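(* Let $T_f$ be a class $P$-homeomorphism of the circle with lift $f$ satisfying the following conditions: (a') the rotation number $\rho_f$ of $T_f$ is irrational of bounded type; (b') $T_f$ has two break points $a_b, c_b$ with disjoint orbits and $\sigma_f(a_b)\,\sigma_f(c_b)=1$; (c) $Df$ is absolutely continuous on every connected interval of $S^1\setminus\{a_b,c_b\}$ and the second derivative $D^2f$ belongs to $L^1$. Then the (unique) $T_f$-invariant probability measure $\mu_f$ is singular with respect to Lebesgue measure on $S^1$.
   Context: $S^1=\mathbb{R}/\mathbb{Z}$ is identified with $[0,1)$. An orientation preserving circle homeomorphism $T_f$ has a lift $f:\mathbb{R}\to\mathbb{R}$, continuous, strictly increasing, with $f(x+1)=f(x)+1$, and $T_f x=f(x) \bmod 1$. Its rotation number is $\rho_f=\lim_{n\to\infty} f^n(x)/n \bmod 1$. If $\rho_f$ is irrational, $T_f$ has a unique invariant probability measure $\mu_f$. The rotation number is of bounded type if the entries of its continued fraction expansion are bounded. The orbit of $x$ is $\{T_f^i x: i\in\mathbb{Z}\}$. Class $P$-homeomorphism: an orientation preserving circle homeomorphism $T_f$ which is differentiable away from countably many points, called break points (set $BP(f)$), at which the left and right derivatives $Df_-$, $Df_+$ exist, such that (i) there are constants $0<c_1<c_2<\infty$ with $c_1<Df(x)<c_2$ for all $x\in S^1\setminus BP(f)$, and $c_1<Df_-(x_b)<c_2$, $c_1<Df_+(x_b)<c_2$ for all $x_b\in BP(f)$; (ii) $\log Df$ has bounded variation. "$T_f$ has two break points $a_b,c_b$" means $BP(f)=\{a_b,c_b\}$,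 $a_b\ne c_b$. The jump ratio at a break point $x_b$ is $\sigma_f(x_b)=Df_-(x_b)/Df_+(x_b)$. Singular means there is a measurable $A\subset S^1$ with $\mu_f(A)=1$ and Lebesgue measure $0$. *)

theory Defs
  imports "HOL-Probability.Probability"
begin

text \<open>The circle is \<open>{0..<1}\<close>.  A circle homeomorphism is given by a lift \<open>f\<close>, and all derivatives
  are those of the lift.\<close>

definition circle_lift :: "(real \<Rightarrow> real) \<Rightarrow> bool" where
  "circle_lift f \<longleftrightarrow>
     continuous_on UNIV f \<and> strict_mono f \<and> (\<forall>x. f (x + 1) = f x + 1)"

definition circle_map :: "(real \<Rightarrow> real) \<Rightarrow> real \<Rightarrow> real" where
  "circle_map f x = frac (f x)"

definition circle_orbit :: "(real \<Rightarrow> real) \<Rightarrow> real \<Rightarrow> real set" where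
  "circle_orbit f x =
     range (\<lambda>n. (circle_map f ^^ n) x) \<union>
     range (\<lambda>n. (inv_into {0..<1} (circle_map f) ^^ n) x)"

definition rotation_number :: "(real \<Rightarrow> real) \<Rightarrow> real" where
  "rotation_number f =
     frac (THE r. \<forall>x. (\<lambda>n. (f ^^ n) x / real n) \<longlonglongrightarrow> r)"

text \<open>The complete quotients \<open>x\<^sub>0 = x\<close>, \<open>x\<^sub>n\<^sub>+\<^sub>1 = 1 / (x\<^sub>n - \<lfloor>x\<^sub>n\<rfloor>)\<close> of an irrational \<open>x\<close>;
  the continued fraction entries are their integer parts.\<close>

primrec complete_quotient :: "real \<Rightarrow> nat \<Rightarrow> real" where
  "complete_quotient x 0 = x"
| "complete_quotient x (Suc n) = 1 / frac (complete_quotient x n)"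

definition cf_entry :: "real \<Rightarrow> nat \<Rightarrow> int" where
  "cf_entry x n = \<lfloor>complete_quotient x n\<rfloor>"

definition bounded_type :: "real \<Rightarrow> bool" where
  "bounded_type x \<longleftrightarrow> x \<notin> \<rat> \<and> (\<exists>M. \<forall>n. \<bar>cf_entry x n\<bar> \<le> M)"

definition bounded_variation_on :: "real set \<Rightarrow> (real \<Rightarrow> real) \<Rightarrow> bool" where
  "bounded_variation_on S g \<longleftrightarrow>
     (\<exists>M. \<forall>(n::nat) x. (\<forall>i\<le>n. x i \<in> S) \<and> (\<forall>i<n. x i \<le> x (Suc i)) \<longrightarrow>
        (\<Sum>i<n. \<bar>g (x (Suc i)) - g (x i)\<bar>) \<le> M)"

definition abs_continuous_on :: "real set \<Rightarrow> (real \<Rightarrow> real) \<Rightarrow> bool" where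
  "abs_continuous_on I g \<longleftrightarrow>
     (\<forall>\<epsilon>>0. \<exists>\<delta>>0. \<forall>(n::nat) u v.
        (\<forall>i<n. u i \<le> v i \<and> {u i..v i} \<subseteq> I) \<and>
        disjoint_family_on (\<lambda>i. {u i<..<v i}) {..<n} \<and>
        (\<Sum>i<n. v i - u i) < \<delta> \<longrightarrow>
        (\<Sum>i<n. \<bar>g (v i) - g (u i)\<bar>) < \<epsilon>)"

definition break_points :: "(real \<Rightarrow> real) \<Rightarrow> real set" where
  "break_points f = {x \<in> {0..<1}. \<not> f differentiable (at x)}"

definition left_deriv :: "(real \<Rightarrow> real) \<Rightarrow> real \<Rightarrow> real" where
  "left_deriv f x = (THE D. (f has_real_derivative D) (at_left x))"

definition right_deriv :: "(real \<Rightarrow> real) \<Rightarrow> real \<Rightarrow> real" where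
  "right_deriv f x = (THE D. (f has_real_derivative D) (at_right x))"

definition jump_ratio :: "(real \<Rightarrow> real) \<Rightarrow> real \<Rightarrow> real" where
  "jump_ratio f x = left_deriv f x / right_deriv f x"

text \<open>\<open>log Df\<close> is defined off the break points only, so its partitions avoid them.  Replacing the
  circle by \<open>{0..<1}\<close> omits only the increment between the last and the first partition point,
  which is bounded by the sum of the others.\<close>

definition class_P :: "(real \<Rightarrow> real) \<Rightarrow> bool" where
  "class_P f \<longleftrightarrow>
     circle_lift f \<and>
     countable (break_points f) \<and>
     (\<forall>b\<in>break_points f. (\<exists>D. (f has_real_derivative D) (at_left b)) \<and>
                          (\<exists>D. (f has_real_derivative D) (at_right b))) \<and>
     (\<exists>c\<^sub>1 c\<^sub>2. 0 < c\<^sub>1 \<and> c\<^sub>1 < c\<^sub>2 \<and>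
        (\<forall>x\<in>{0..<1} - break_points f. c\<^sub>1 < deriv f x \<and> deriv f x < c\<^sub>2) \<and>
        (\<forall>b\<in>break_points f. c\<^sub>1 < left_deriv f b \<and> left_deriv f b < c\<^sub>2 \<and>
                             c\<^sub>1 < right_deriv f b \<and> right_deriv f b < c\<^sub>2)) \<and>
     bounded_variation_on ({0..<1} - break_points f) (\<lambda>x. ln (deriv f x))"

definition invariant_prob :: "(real \<Rightarrow> real) \<Rightarrow> real measure \<Rightarrow> bool" where
  "invariant_prob f \<mu> \<longleftrightarrow>
     sets \<mu> = sets (restrict_space borel {0..<1}) \<and>
     prob_space \<mu> \<and>
     circle_map f \<in> measurable \<mu> \<mu> \<and> distr \<mu> \<mu> (circle_map f) = \<mu>"

definition singular_measure :: "real measure \<Rightarrow> bool" where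
  "singular_measure \<mu> \<longleftrightarrow> (\<exists>A\<in>sets \<mu>. emeasure \<mu> A = 1 \<and> emeasure lborel A = 0)"

end

theory Submission
  imports Defs "HOL-Number_Theory.Cong" "HOL-Real_Asymp.Real_Asymp" "HOL-Library.Nat_Bijection"
begin

text \<open>Suppose the invariant measure is not singular. Denjoy's inequality makes \<open>T\<^sub>f\<close> conjugate, by some
  \<open>\<phi>\<close>, to the rotation by \<open>r\<close>, and makes Lebesgue measure ergodic, so its image under \<open>\<phi>\<close> has a positive
  density \<open>w\<close>, and \<open>w (y + q r) = exp (S\<^sub>q F y) w y\<close> for the Birkhoff sums of \<open>F = log Df \<circ> \<phi>\<inverse>\<close>.
  Translations are continuous in \<open>L\<^sup>1\<close>, hence \<open>S\<^sub>q F\<close> is small in measure when \<open>q r\<close> is close to an integer.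
  As the product of the jump ratios is 1, \<open>F = H - \<kappa> \<zeta>\<close> with \<open>H\<close> the conjugate of an absolutely continuous
  function and \<open>\<zeta>\<close> the integer valued function with opposite unit jumps at the images of the two breaks.
  The oscillation of \<open>S\<^sub>q H\<close> tends to 0, so \<open>S\<^sub>q \<zeta>\<close> is constant off a small set. By bounded type its
  jumps of one sign are spaced by a multiple of \<open>1 / q\<close>, so each must be cancelled by a nearby jump of the
  other sign: \<open>\<bar>\<phi> a - \<phi> c - k r - m\<bar> < \<eta> / q\<close> for some \<open>k\<close>, \<open>m\<close> with \<open>\<bar>k\<bar> \<le> \<eta> q\<close>. Again by bounded
  type, \<open>k\<close> and \<open>m\<close> do not depend on the scale, so \<open>\<phi> a - \<phi> c = k r + m\<close> and the two orbits meet.\<close>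

section \<open>Rotation numbers of bounded type\<close>

text \<open>Non-singularity is used twice. It makes Lebesgue measure and its image equivalent, so
  that \<open>w\<close> exists and is positive; and it makes the inverse of \<phi> absolutely
  continuous with density \<open>w\<close>, so that H, absolutely continuous at first only in the
  original coordinate, stays a primitive of an integrable function in the rotation coordinate.
  Denjoy's inequality bounds the oscillation of S_q H only by a multiple of the variation; it
  becomes small because H is, up to small variation, a combination of explicit functions. The
  obstacle is then that smallness in measure says nothing at a single jump. It is overcome by
  counting: S_q \<zeta> has q upward jumps, each unmatched one spoils a set of measure \<eta> / q,
  so at most \<eta> q are unmatched. The shift k is common to all matched jumps, and the |k| jumps
  at one end of the orbit segment, whose partner would fall outside it, are unmatched; hence |k|
  \<le> \<eta> q. Bounded type enters only as c \<le> |m r - p| |m|: it separates the jumps, makes k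
  unique and puts a good denominator into every dyadic scale.\<close>

lemma complete_quotient_frac_inverse:
  assumes "0 < x" "x < 1"
  shows "complete_quotient (frac (1 / x)) (Suc n) = complete_quotient x (Suc (Suc n))"
proof (induction n)
  case 0
  have "frac x = x" using assms by (simp add: frac_eq)
  then show ?case by simp
qed simp

lemma frac_notin_Rats:
  fixes x :: real
  assumes "x \<notin> \<rat>" shows "frac x \<notin> \<rat>"
proof
  assume "frac x \<in> \<rat>"
  then have "frac x + of_int \<lfloor>x\<rfloor> \<in> \<rat>" by simp
  then show False using assms by (simp add: frac_def)
qed

text \<open>The Gauss map $x \mapsto 1/x - a$ acts on the pair $(m, p)$ by $(p, m - pa)$ and leaves
  $|mx - p|(m + p\beta)/(1 + x\beta)$ invariant when $\beta$ is replaced by $1/(a + \beta)$.\<close>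

lemma cf_bounded_lower_bound_aux:
  fixes m p :: nat and M :: int and x \<beta> :: real
  assumes "m + p = k" "m \<ge> 1" "0 < x" "x < 1" "x \<notin> \<rat>" "\<And>n. cf_entry x n \<le> M" "0 \<le> \<beta>" "\<beta> \<le> 1"
  shows "(1 + x * \<beta>) / (2 * (real_of_int M + 1)) \<le> \<bar>m * x - p\<bar> * (m + p * \<beta>)"
  using assms
proof (induction k arbitrary: m p x \<beta> rule: less_induct)
  case (less k)
  note A = less.prems
  define a where "a = \<lfloor>1/x\<rfloor>"
  have fx: "frac x = x" using A(3,4) by (simp add: frac_eq)
  have "cf_entry x 1 = a" by (simp add: cf_entry_def a_def fx)
  then have aM: "a \<le> M" using A(6)[of 1] by simp
  have a1: "a \<ge> 1" using A(3,4) by (simp add: a_def le_floor_iff)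
  have ax: "real_of_int a * x \<le> 1" 
  proof -
    have "real_of_int a * x \<le> (1/x) * x" unfolding a_def using A(3) by (intro mult_right_mono) auto
    then show ?thesis using A(3) by simp
  qed
  have "1/x < real_of_int a + 1" unfolding a_def by linarith
  also have "\<dots> \<le> real_of_int M + 1" using aM by simp
  finally have xM: "1 / (real_of_int M + 1) < x" using A(3) a1 aM by (simp add: field_simps)
  have M0: "real_of_int M + 1 > 0" using a1 aM by linarith
  have xb: "x * \<beta> \<le> 1" using A(3,4,7,8) by (intro mult_le_one) auto
  \<comment> \<open>1 + x \<beta> is at most 2, and x exceeds 1 / (M + 1) because its first entry a
    is at most M; this is the origin of the 2 in the bound.\<close>
  have start: "(1 + x * \<beta>) / (2 * (real_of_int M + 1)) \<le> x"
  proof -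
    have "(1 + x * \<beta>) / (2 * (real_of_int M + 1)) \<le> 2 / (2 * (real_of_int M + 1))"
      using xb M0 by (intro divide_right_mono) auto
    also have "\<dots> = 1 / (real_of_int M + 1)" using M0 by (simp add: field_simps)
    finally show ?thesis using xM by linarith
  qed
  have big: "?case" if "x \<le> \<bar>m * x - p\<bar>"
  proof -
    have "0 \<le> p * \<beta>" using A(7) by simp
    moreover have "1 \<le> real m" using A(2) by simp
    ultimately have "1 \<le> m + p * \<beta>" by linarith
    then have "x * 1 \<le> \<bar>m * x - p\<bar> * (m + p * \<beta>)" using that A(3) by (intro mult_mono) auto
    then show ?thesis using start by linarith
  qed
  \<comment> \<open>If p = 0 or m < p a, then |m x - p| is at least x, since a x \<le> 1, and the
    descent stops. Otherwise m - p a is a natural number, and the pair (p, m - p a) has a smaller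
    sum because p a \<ge> 1.\<close>
  show ?case
  proof (cases "p = 0 \<or> int m < int p * a")
    case True
    have "x \<le> \<bar>m * x - p\<bar>"
    proof (cases "p = 0")
      case True
      have "1 * x \<le> real m * x" using A(2,3) by (intro mult_right_mono) auto
      then have "x \<le> real m * x - real p" using True by (simp only: of_nat_0 diff_zero mult_1_left)
      then show ?thesis by linarith
    next
      case False
      with True have "int m \<le> int p * a - 1" by simp
      then have "real m \<le> real p * real_of_int a - 1"
        using of_int_le_iff[of "int m" "int p * a - 1", where 'a = real] by simp
      then have "real m * x \<le> (real p * real_of_int a - 1) * x" by (rule mult_right_mono) (use A(3) in simp)
      also have "\<dots> = real p * (real_of_int a * x) - x" by (simp add: algebra_simps)
      also have "\<dots> \<le> real p - x" using ax mult_left_mono[OF ax, of "real p"] by simp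
      finally show ?thesis by linarith
    qed
    then show ?thesis by (rule big)
  next
    case False
    define p' where "p' = nat (int m - int p * a)"
    have p': "real p' = real m - real p * real_of_int a" using False unfolding p'_def
      by (simp add: of_nat_nat)
    have p1: "p \<ge> 1" using False by simp
    have "int p' = int m - int p * a" using False p'_def by simp
    moreover have "int p * a \<ge> 1" 
      using mult_mono[of 1 "int p" 1 a] p1 a1 by simp
    ultimately have lt: "p + p' < k" using A(1) by linarith
    define x' \<beta>' where "x' = frac (1/x)" and "\<beta>' = 1 / (a + \<beta>)"
    have xx: "x = 1 / (a + x')" using A(3) by (simp add: x'_def a_def frac_def)
    have irr: "1/x \<notin> \<rat>"
    proof
      assume "1/x \<in> \<rat>"
      then have "inverse (1/x) \<in> \<rat>" by (rule Rats_inverse)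
      moreover have "inverse (1/x) = x" by (simp only: inverse_divide div_by_1)
      ultimately show False using A(5) by metis
    qed
    have x'Q: "x' \<notin> \<rat>" unfolding x'_def using frac_notin_Rats[OF irr] .
    have "x' \<noteq> 0" using x'Q by auto
    then have x'01: "0 < x'" "x' < 1" using frac_ge_0[of "1/x"] frac_lt_1[of "1/x"] unfolding x'_def by linarith+
    \<comment> \<open>The entries of x' with positive index are entries of x shifted by one; only
      its entry with index 0 differs, being the integer part 0.\<close>
    have "cf_entry x' n \<le> M" for n
    proof (cases n)
      case 0
      have "\<lfloor>x'\<rfloor> = 0" using x'01 by (simp add: floor_eq_iff)
      then show ?thesis using a1 aM 0 by (simp add: cf_entry_def)
    next
      case (Suc n')
      then show ?thesis using A(6)[of "Suc (Suc n')"] complete_quotient_frac_inverse[OF A(3,4), of n']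
        by (simp add: cf_entry_def x'_def del: complete_quotient.simps)
    qed
    moreover have "0 \<le> \<beta>'" "\<beta>' \<le> 1" using a1 A(7) by (auto simp: \<beta>'_def)
    ultimately have IH: "(1 + x' * \<beta>') / (2 * (real_of_int M + 1)) \<le> \<bar>p * x' - p'\<bar> * (p + p' * \<beta>')"
      using less.IH[OF lt refl p1 x'01 x'Q] by blast
    have pos: "real_of_int a + x' > 0" "real_of_int a + \<beta> > 0" using a1 x'01 A(7) by auto
    \<comment> \<open>Both sides of the inequality change by this one factor under the Gauss map,
      which is what the auxiliary \<beta> achieves.\<close>
    define c where "c = (a + \<beta>) / (a + x')"
    have c0: "c > 0" using pos by (simp add: c_def)
    have e1: "1 + x * \<beta> = c * (1 + x' * \<beta>')" 
    proof -
      have "1 + x * \<beta> = (a + x' + \<beta>) / (a + x')" using pos by (subst xx) (simp add: field_simps)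
      moreover have "1 + x' * \<beta>' = (a + \<beta> + x') / (a + \<beta>)" unfolding \<beta>'_def using pos by (simp add: field_simps)
      ultimately show ?thesis unfolding c_def using pos by (simp add: add_ac)
    qed
    have "m * x - p = (m - p * (a + x')) / (a + x')" using pos by (subst xx) (simp add: diff_divide_distrib)
    also have "m - p * (a + x') = - (p * x' - p')" unfolding p' by (simp add: algebra_simps)
    finally have "m * x - p = - (p * x' - p') / (a + x')" .
    then have "\<bar>m * x - p\<bar> = \<bar>p * x' - p'\<bar> / (a + x')" using pos by (simp only: abs_divide abs_minus_cancel abs_of_pos)
    moreover have "m + p * \<beta> = (a + \<beta>) * (p + p' * \<beta>')" 
    proof -
      have "(a + \<beta>) * (p' * \<beta>') = p'" using pos by (simp add: \<beta>'_def)
      then show ?thesis unfolding p' by (simp add: algebra_simps)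
    qed
    ultimately have e2: "\<bar>m * x - p\<bar> * (m + p * \<beta>) = c * (\<bar>p * x' - p'\<bar> * (p + p' * \<beta>'))" by (simp add: c_def)
    show ?thesis unfolding e1 e2 using mult_left_mono[OF IH, of c] c0 by simp
  qed
qed

text \<open>Numbers of bounded type are badly approximable; this is the case \<beta> = 0 of the
  descent, with the integer part of r absorbed into p. Negative p are outside the descent, but then
  |m x - p| \<ge> x, and therefore c is also cut down to x.\<close>

lemma bounded_type_lower_bound:
  assumes "bounded_type (frac r)"
  obtains c where "0 < c" "c < 1" "\<And>m p :: int. m \<noteq> 0 \<Longrightarrow> c \<le> \<bar>real_of_int m * r - p\<bar> * \<bar>real_of_int m\<bar>"
proof -
  define x where "x = frac r"
  have xQ: "x \<notin> \<rat>" using assms by (simp add: bounded_type_def x_def)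
  obtain M where M: "\<And>n. \<bar>cf_entry x n\<bar> \<le> M" using assms by (auto simp: bounded_type_def x_def)
  have M': "\<And>n. cf_entry x n \<le> M" using M by (meson abs_le_D1)
  have "x \<noteq> 0" using xQ by auto
  then have x01: "0 < x" "x < 1" using frac_ge_0[of r] frac_lt_1[of r] unfolding x_def by linarith+
  have M0: "M \<ge> 0" using M[of 0] abs_ge_zero order_trans by blast
  define c where "c = min x (1 / (2 * (real_of_int M + 1)))"
  have c: "c > 0" "c < 1" using x01 M0 by (auto simp: c_def)
  have nat: "c \<le> \<bar>m * x - p\<bar> * m" if m: "m \<ge> 1" for m :: nat and p :: int
  proof (cases "p \<ge> 0")
    case True
    then have p: "real_of_int p = real (nat p)" by simp
    have "(1 + x * 0) / (2 * (real_of_int M + 1)) \<le> \<bar>m * x - nat p\<bar> * (real m + real (nat p) * 0)"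
      by (rule cf_bounded_lower_bound_aux[OF refl m x01 xQ M']) auto
    then have "1 / (2 * (real_of_int M + 1)) \<le> \<bar>m * x - p\<bar> * m" unfolding p by (simp only: mult_zero_right add_0_right)
    then show ?thesis unfolding c_def by (rule min.coboundedI2)
  next
    case False
    have "1 * x \<le> real m * x" using m x01 by (intro mult_right_mono) auto
    moreover have "real_of_int p \<le> 0" using False by simp
    ultimately have "x \<le> \<bar>m * x - p\<bar>" by linarith
    moreover have "\<bar>m * x - p\<bar> * 1 \<le> \<bar>m * x - p\<bar> * m" using m by (intro mult_left_mono) auto
    ultimately have "x \<le> \<bar>m * x - p\<bar> * m" by (simp only: mult_1_right)
    then show ?thesis unfolding c_def by (rule min.coboundedI1)
  qed
  have "c \<le> \<bar>m * r - p\<bar> * \<bar>real_of_int m\<bar>" if m: "m \<noteq> 0" for m p :: int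
  proof -
    have r: "m * r - p = m * x - (p - m * \<lfloor>r\<rfloor>)" by (simp add: x_def frac_def algebra_simps)
    show ?thesis
    proof (cases "m > 0")
      case True
      then have mm: "real (nat m) = m" "1 \<le> nat m" "\<bar>real_of_int m\<bar> = m" by auto
      show ?thesis using nat[OF mm(2), of "p - m * \<lfloor>r\<rfloor>"] unfolding r mm by simp
    next
      case False
      with m have mm: "real (nat (-m)) = - m" "1 \<le> nat (-m)" "\<bar>real_of_int m\<bar> = - m" by auto
      have "\<bar>nat (-m) * x - (- p + m * \<lfloor>r\<rfloor>)\<bar> = \<bar>m * x - (p - m * \<lfloor>r\<rfloor>)\<bar>"
        unfolding mm by (simp add: abs_minus_commute)
      then show ?thesis using nat[OF mm(2), of "- p + m * \<lfloor>r\<rfloor>"] unfolding r mm by simp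
    qed
  qed
  then show ?thesis by (rule that[OF c])
qed

section \<open>Lifts and translation numbers\<close>

text \<open>Iterating the defect gives |a (k n) - k a n| \<le> k, so a n / n and a m / m differ by
  at most 1 / n + 1 / m. The quotients are thus Cauchy, and letting m grow leaves an error of 1 /
  n.\<close>

lemma quasi_additive_limit:
  fixes a :: "nat \<Rightarrow> real"
  assumes qa: "\<And>n m. \<bar>a (n + m) - a n - a m\<bar> \<le> 1"
  obtains r :: real where "\<And>n. \<bar>a n - real n * r\<bar> \<le> 1"
proof -
  have mult: "\<bar>a (k * n) - k * a n\<bar> \<le> k" if "k \<ge> 1" for k n
    using that
  proof (induction k rule: dec_induct)
    case (step k)
    have "a (Suc k * n) - real (Suc k) * a n = (a (n + k * n) - a n - a (k * n)) + (a (k * n) - k * a n)"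
      by (simp add: algebra_simps)
    then show ?case using step.IH qa[of n "k * n"] by linarith
  qed simp
  have cmp: "\<bar>a n / n - a m / m\<bar> \<le> 1/n + 1/m" if "n \<ge> 1" "m \<ge> 1" for n m
  proof -
    have "\<bar>a (m * n) - m * a n\<bar> \<le> m" "\<bar>a (n * m) - n * a m\<bar> \<le> n" using mult that by blast+
    then have "\<bar>m * a n - n * a m\<bar> \<le> real m + n" by (simp add: mult.commute)
    then have "\<bar>m * a n - n * a m\<bar> / (real n * m) \<le> (real m + n) / (real n * m)" by (rule divide_right_mono) simp
    moreover have "(real m + n) / (real n * m) = 1/n + 1/m" using that by (simp add: field_simps)
    moreover have "\<bar>m * a n - n * a m\<bar> / (real n * m) = \<bar>a n / n - a m / m\<bar>"
    proof -
      have "a n / n - a m / m = (m * a n - n * a m) / (real n * m)" using that by (simp add: field_simps)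
      then show ?thesis by (simp add: abs_mult)
    qed
    ultimately show ?thesis by simp
  qed
  have "Cauchy (\<lambda>n. a n / n)"
  proof (rule CauchyI)
    fix e :: real assume e: "e > 0"
    obtain N :: nat where N: "2 / e < N" using reals_Archimedean2 by blast
    have N0: "real N > 0" using less_trans[OF _ N, of 0] e by simp
    show "\<exists>M. \<forall>m\<ge>M. \<forall>n\<ge>M. norm (a m / m - a n / n) < e"
    proof (intro exI allI impI)
      fix m n assume mn: "N \<le> m" "N \<le> n"
      have "1 / m \<le> 1 / N" "1 / n \<le> 1 / N" using mn N0 by (auto intro!: divide_left_mono)
      moreover have "2 / N < e" using N N0 e by (simp add: field_simps)
      moreover have "norm (a m / m - a n / n) \<le> 1/m + 1/n" using cmp[of m n] mn N0 by simp
      ultimately show "norm (a m / m - a n / n) < e" by linarith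
    qed
  qed
  then obtain r where r: "(\<lambda>n. a n / n) \<longlonglongrightarrow> r" by (meson Cauchy_convergent convergent_def)
  have "\<bar>a n - n * r\<bar> \<le> 1" for n
  proof (cases "n = 0")
    case True
    then show ?thesis using qa[of 0 0] by simp
  next
    case False
    have "(\<lambda>m. \<bar>a n / n - a m / m\<bar>) \<longlonglongrightarrow> \<bar>a n / n - r\<bar>" by (intro tendsto_intros r)
    moreover have "(\<lambda>m. 1/n + 1/real m) \<longlonglongrightarrow> 1/n + 0" by (intro tendsto_intros lim_1_over_n)
    ultimately have "\<bar>a n / n - r\<bar> \<le> 1/n + 0"
      by (rule LIMSEQ_le) (use cmp[of n] False in \<open>auto intro!: exI[of _ 1]\<close>)
    then have "\<bar>a n / n - r\<bar> * n \<le> 1/n * n" by (intro mult_right_mono) auto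
    moreover have "\<bar>a n / n - r\<bar> * n = \<bar>(a n / n - r) * n\<bar>" by (simp add: abs_mult)
    moreover have "(a n / n - r) * n = a n - n * r" using False by (simp add: field_simps)
    ultimately show ?thesis using False by simp
  qed
  then show ?thesis by (rule that)
qed

lemma circle_lift_add_int:
  assumes "circle_lift f" shows "f (x + of_int m) = f x + of_int m"
proof -
  have nat: "f (x + of_nat n) = f x + of_nat n" for n x
  proof (induction n)
    case (Suc n)
    have "f (x + of_nat (Suc n)) = f ((x + of_nat n) + 1)" by (simp add: add_ac)
    also have "\<dots> = f x + of_nat (Suc n)" using assms Suc by (simp add: circle_lift_def)
    finally show ?case .
  qed simp
  show ?thesis
  proof (cases "m \<ge> 0")
    case True
    then show ?thesis using nat[of x "nat m"] by simp
  next
    case False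
    then show ?thesis using nat[of "x + of_int m" "nat (-m)"] by simp
  qed
qed

lemma add_int_of_add_one:
  fixes g :: "real \<Rightarrow> real"
  assumes "\<And>x. g (x + 1) = g x + d"
  shows "g (x + of_int m) = g x + of_int m * d"
proof -
  have nat: "g (x + of_nat n) = g x + of_nat n * d" for n x
  proof (induction n)
    case (Suc n)
    have "g (x + of_nat (Suc n)) = g ((x + of_nat n) + 1)" by (simp add: add_ac)
    also have "\<dots> = g x + of_nat (Suc n) * d" unfolding assms Suc by (simp add: algebra_simps)
    finally show ?case .
  qed simp
  show ?thesis
  proof (cases "m \<ge> 0")
    case True
    then show ?thesis using nat[of x "nat m"] by simp
  next
    case False
    then show ?thesis using nat[of "x + of_int m" "nat (-m)"] by simp
  qed
qed

lemma circle_lift_bij: assumes "circle_lift f" shows "bij f"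
proof -
  have "strict_mono f" "continuous_on UNIV f" using assms by (auto simp: circle_lift_def)
  have "\<exists>x. f x = y" for y
  proof -
    define m where "m = \<lfloor>y - f 0\<rfloor>"
    have "f (of_int m) \<le> y" "y \<le> f (of_int (m + 1))"
      using circle_lift_add_int[OF assms, of 0 m] circle_lift_add_int[OF assms, of 0 "m+1"]
      unfolding m_def of_int_add of_int_1 add_0_left by linarith+
    moreover have "real_of_int m \<le> of_int (m + 1)" "continuous_on {of_int m..of_int (m + 1)} f"
      using \<open>continuous_on UNIV f\<close> by (auto intro: continuous_on_subset)
    ultimately show ?thesis using IVT'[of f "of_int m" y "of_int (m+1)"] by blast
  qed
  then have "surj f" unfolding surj_def by metis
  moreover have "inj f" using \<open>strict_mono f\<close> by (rule strict_mono_imp_inj_on)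
  ultimately show ?thesis by (simp add: bij_def)
qed

lemma circle_lift_funpow:
  assumes "circle_lift f" shows "circle_lift (f ^^ n)"
proof (induction n)
  case 0 show ?case by (auto simp: circle_lift_def strict_mono_def)
next
  case (Suc n)
  have c: "continuous_on UNIV f" "continuous_on UNIV (f ^^ n)"
    and m: "strict_mono f" "strict_mono (f ^^ n)" using assms Suc by (simp_all add: circle_lift_def)
  have "continuous_on UNIV (\<lambda>x. f ((f ^^ n) x))" by (rule continuous_on_compose2[OF c]) simp
  moreover have "strict_mono (\<lambda>x. f ((f ^^ n) x))" using m by (simp add: strict_mono_def)
  ultimately show ?case using assms Suc by (simp add: circle_lift_def o_def)
qed

text \<open>x lies between two consecutive integer translates of y, at which the displacement of g
  is the same as at y.\<close>

lemma mono_degree_one_cmp: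
  fixes g :: "real \<Rightarrow> real"
  assumes "mono g" "\<And>x. g (x + 1) = g x + 1"
  shows "\<bar>g x - x - (g y - y)\<bar> \<le> 1"
proof -
  define m where "m = \<lfloor>x - y\<rfloor>"
  have a: "g (y + of_int m) = g y + of_int m" "g (y + of_int (m+1)) = g y + of_int m + 1"
    using add_int_of_add_one[of g 1 y m] add_int_of_add_one[of g 1 y "m+1"] assms(2) by auto
  have b: "y + of_int m \<le> x" "x \<le> y + of_int (m+1)" unfolding m_def by linarith+
  have "g (y + of_int m) \<le> g x" "g x \<le> g (y + of_int (m+1))" using b assms(1) by (auto dest: monoD)
  then show ?thesis using a b unfolding abs_le_iff by linarith
qed

lemma circle_lift_mono: "circle_lift f \<Longrightarrow> mono f"
  by (simp add: circle_lift_def strict_mono_mono)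

text \<open>The translation number r of the lift, rather than its fractional part, is the parameter
  of the whole proof, since the semiconjugacy is written on the line. In the bound 2, one unit is
  the defect along the orbit of 0 and one the change of base point.\<close>

lemma circle_lift_translation_number:
  assumes "circle_lift f"
  obtains r :: real where "\<And>n x. \<bar>(f ^^ n) x - x - real n * r\<bar> \<le> 2" "\<And>x. (\<lambda>n. (f ^^ n) x / real n) \<longlonglongrightarrow> r"
    "rotation_number f = frac r"
proof -
  have cmp: "\<bar>(f ^^ n) x - x - ((f ^^ n) y - y)\<bar> \<le> 1" for n x y
    using mono_degree_one_cmp[of "f ^^ n"] circle_lift_funpow[OF assms, of n] circle_lift_mono
    by (simp add: circle_lift_def)
  have "\<bar>(f ^^ (n + m)) 0 - (f ^^ n) 0 - (f ^^ m) 0\<bar> \<le> 1" for n m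
    using cmp[of n "(f ^^ m) 0" 0] by (simp add: funpow_add)
  then obtain r where r: "\<And>n. \<bar>(f ^^ n) 0 - real n * r\<bar> \<le> 1" using quasi_additive_limit[of "\<lambda>n. (f ^^ n) 0"] by blast
  have b: "\<bar>(f ^^ n) x - x - n * r\<bar> \<le> 2" for n x
    using cmp[of n x 0] r[of n] by linarith
  have lim: "(\<lambda>n. (f ^^ n) x / real n) \<longlonglongrightarrow> r" for x
  proof -
    have "(\<lambda>n. (f ^^ n) x / real n - r) \<longlonglongrightarrow> 0"
    proof (rule Lim_null_comparison)
      show "\<forall>\<^sub>F n in sequentially. norm ((f ^^ n) x / real n - r) \<le> (\<bar>x\<bar> + 2) * (1 / n)"
      proof (intro eventually_sequentiallyI[of 1])
        fix n :: nat assume "n \<ge> 1"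
        then have "(f ^^ n) x / real n - r = ((f ^^ n) x - n * r) / n" by (simp add: field_simps)
        moreover have "\<bar>(f ^^ n) x - n * r\<bar> \<le> \<bar>x\<bar> + 2" using b[of n x] by linarith
        ultimately show "norm ((f ^^ n) x / real n - r) \<le> (\<bar>x\<bar> + 2) * (1 / n)"
          by (simp add: abs_divide divide_right_mono)
      qed
      have "(\<lambda>n. (\<bar>x\<bar> + 2) * (1 / real n)) \<longlonglongrightarrow> (\<bar>x\<bar> + 2) * 0" by (intro tendsto_intros lim_1_over_n)
      then show "(\<lambda>n. (\<bar>x\<bar> + 2) * (1 / real n)) \<longlonglongrightarrow> 0" by simp
    qed
    then show ?thesis by (rule LIM_zero_cancel)
  qed
  have "(THE r. \<forall>x. (\<lambda>n. (f ^^ n) x / real n) \<longlonglongrightarrow> r) = r"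
  proof (rule the_equality)
    show "\<forall>x. (\<lambda>n. (f ^^ n) x / real n) \<longlonglongrightarrow> r" using lim by blast
    show "s = r" if "\<forall>x. (\<lambda>n. (f ^^ n) x / real n) \<longlonglongrightarrow> s" for s
      using that[rule_format, of 0] lim[of 0] by (rule LIMSEQ_unique)
  qed
  then have "rotation_number f = frac r" by (simp add: rotation_number_def)
  then show ?thesis using that b lim by blast
qed

section \<open>The semiconjugacy to the rotation\<close>

lemma cSUP_add_const:
  fixes g :: "nat \<Rightarrow> real"
  assumes "bdd_above (range g)"
  shows "(SUP n. g n + c) = (SUP n. g n) + c"
proof (rule antisym)
  show "(SUP n. g n + c) \<le> (SUP n. g n) + c" by (rule cSUP_least) (auto intro: cSUP_upper assms)
  have bdd: "bdd_above (range (\<lambda>n. g n + c))"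
  proof -
    obtain M where M: "\<And>n. g n \<le> M" using assms by (auto simp: bdd_above_def)
    show ?thesis using M by (auto simp: bdd_above_def intro!: exI[of _ "M + c"])
  qed
  have "(SUP n. g n) \<le> (SUP n. g n + c) - c"
  proof (rule cSUP_least)
    fix n show "g n \<le> (SUP n. g n + c) - c" using cSUP_upper[OF UNIV_I bdd, of n] by linarith
  qed simp
  then show "(SUP n. g n) + c \<le> (SUP n. g n + c)" by linarith
qed

lemma cINF_add_const:
  fixes g :: "nat \<Rightarrow> real"
  assumes "bdd_below (range g)"
  shows "(INF n. g n + c) = (INF n. g n) + c"
proof (rule antisym)
  show "(INF n. g n) + c \<le> (INF n. g n + c)" by (rule cINF_greatest) (auto intro: cINF_lower assms)
  have bdd: "bdd_below (range (\<lambda>n. g n + c))"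
  proof -
    obtain M where M: "\<And>n. M \<le> g n" using assms by (auto simp: bdd_below_def)
    show ?thesis using M by (auto simp: bdd_below_def intro!: exI[of _ "M + c"])
  qed
  have "(INF n. g n + c) - c \<le> (INF n. g n)"
  proof (rule cINF_greatest)
    fix n show "(INF n. g n + c) - c \<le> g n" using cINF_lower[OF bdd UNIV_I, of n] by linarith
  qed simp
  then show "(INF n. g n + c) \<le> (INF n. g n) + c" by linarith
qed

text \<open>Continuity and injectivity are left out on purpose: continuity follows from the
  irrationality of r, injectivity is Denjoy's theorem, and the distribution function of any
  invariant measure, extended to the line, has to qualify.\<close>

definition rotation_semiconj :: "(real \<Rightarrow> real) \<Rightarrow> real \<Rightarrow> (real \<Rightarrow> real) \<Rightarrow> bool" where
  "rotation_semiconj f r \<phi> \<longleftrightarrow> mono \<phi> \<and> (\<forall>x. \<phi> (x + 1) = \<phi> x + 1) \<and> (\<forall>x. \<phi> (f x) = \<phi> x + r)"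

text \<open>The semiconjugacy to the rotation is $\limsup_k (f^k(x) - k r)$.\<close>

lemma rotation_semiconj_exists:
  assumes f: "circle_lift f" and r: "\<And>n x. \<bar>(f ^^ n) x - x - real n * r\<bar> \<le> 2"
  obtains \<phi> where "rotation_semiconj f r \<phi>"
proof -
  define b where "b k x = (f ^^ k) x - real k * r" for k x
  define h where "h n x = (SUP k. b (n + k) x)" for n x
  define \<phi> where "\<phi> x = (INF n. h n x)" for x
  have bb: "x - 2 \<le> b k x" "b k x \<le> x + 2" for k x using r[of k x] by (auto simp: b_def abs_le_iff)
  have bdd: "bdd_above (range (\<lambda>k. b (n + k) x))" for n x
    using bb(2) by (auto simp: bdd_above_def)
  have hb: "x - 2 \<le> h n x" for n x
    using bb(1)[of x n] cSUP_upper[OF UNIV_I bdd[of n x], of 0] by (simp add: h_def)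
  have bddh: "bdd_below (range (\<lambda>n. h n x))" for x using hb by (auto simp: bdd_below_def)
  have hmono: "h n x \<le> h n y" if "x \<le> y" for n x y
    unfolding h_def
  proof (rule cSUP_mono)
    fix k :: nat
    have "(f ^^ (n + k)) x \<le> (f ^^ (n + k)) y"
      using circle_lift_mono[OF circle_lift_funpow[OF f]] that by (rule monoD)
    then show "\<exists>m\<in>UNIV. b (n + k) x \<le> b (n + m) y" by (auto simp: b_def intro!: exI[of _ k])
  qed (use bdd in auto)
  have "mono \<phi>"
  proof (rule monoI)
    fix x y :: real assume xy: "x \<le> y"
    show "\<phi> x \<le> \<phi> y" unfolding \<phi>_def
    proof (rule cINF_mono)
      fix n :: nat show "\<exists>m\<in>UNIV. h m x \<le> h n y" using hmono[OF xy, of n] by blast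
    qed (use bddh in auto)
  qed
  moreover have "\<phi> (x + 1) = \<phi> x + 1" for x
  proof -
    have "b k (x + 1) = b k x + 1" for k
      using circle_lift_funpow[OF f, of k] by (simp add: b_def circle_lift_def)
    then have "h n (x + 1) = h n x + 1" for n using cSUP_add_const[OF bdd, of n x 1] by (simp add: h_def)
    then show ?thesis using cINF_add_const[OF bddh, of x 1] by (simp add: \<phi>_def)
  qed
  moreover have "\<phi> (f x) = \<phi> x + r" for x
  proof -
    have "b k (f x) = b (Suc k) x + r" for k by (simp add: b_def funpow_swap1 algebra_simps)
    then have "h n (f x) = h (Suc n) x + r" for n
      using cSUP_add_const[OF bdd, of "Suc n" x r] by (simp add: h_def)
    moreover have bS: "bdd_below (range (\<lambda>n. h (Suc n) x))" using hb by (auto simp: bdd_below_def)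
    ultimately have "\<phi> (f x) = (INF n. h (Suc n) x) + r"
      using cINF_add_const[OF bS, of r] by (simp add: \<phi>_def)
    \<comment> \<open>f moves the index by one, and the tail suprema decrease in n, so dropping the
      first of them leaves the infimum unchanged.\<close>
    moreover have "(INF n. h (Suc n) x) = (INF n. h n x)"
    proof (rule antisym)
      show "(INF n. h n x) \<le> (INF n. h (Suc n) x)"
        by (rule cINF_greatest) (auto intro: cINF_lower bddh)
      have dec: "h (Suc n) x \<le> h n x" for n
        unfolding h_def
      proof (rule cSUP_mono)
        fix k :: nat
        show "\<exists>m\<in>UNIV. b (Suc n + k) x \<le> b (n + m) x" by (rule bexI[of _ "Suc k"]) auto
      qed (use bdd in auto)
      show "(INF n. h (Suc n) x) \<le> (INF n. h n x)"
      proof (rule cINF_mono)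
        fix n :: nat show "\<exists>m\<in>UNIV. h (Suc m) x \<le> h n x" using dec[of n] by blast
      qed (use bS in auto)
    qed
    ultimately show ?thesis by (simp add: \<phi>_def)
  qed
  ultimately have "rotation_semiconj f r \<phi>" by (simp add: rotation_semiconj_def)
  then show ?thesis by (rule that)
qed

lemma semiconjugacy_orbit:
  assumes "rotation_semiconj f r \<phi>"
  shows "\<phi> ((f ^^ n) x + of_int m) = \<phi> x + real n * r + of_int m"
proof -
  have "\<phi> ((f ^^ n) x) = \<phi> x + real n * r"
    using assms by (induction n) (auto simp: rotation_semiconj_def algebra_simps)
  then show ?thesis using add_int_of_add_one[of \<phi> 1 "(f ^^ n) x" m] assms by (simp add: rotation_semiconj_def)
qed

text \<open>The multiples of r are dense modulo 1, so the orbit of 0 with its integer translates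
  comes close to \<phi> x from both sides. On this orbit every semiconjugacy is known up to a
  constant, and monotonicity carries the information over to x.\<close>

lemma semiconjugacy_sandwich:
  assumes r: "r \<notin> \<rat>" and \<phi>: "rotation_semiconj f r \<phi>" and e: "0 < e"
  obtains n1 m1 n2 m2 where
    "\<phi> x - e < \<phi> ((f ^^ n1) 0 + of_int m1)" "\<phi> ((f ^^ n1) 0 + of_int m1) < \<phi> x" "(f ^^ n1) 0 + of_int m1 < x"
    "\<phi> ((f ^^ n2) 0 + of_int m2) < \<phi> x + e" "\<phi> x < \<phi> ((f ^^ n2) 0 + of_int m2)" "x < (f ^^ n2) 0 + of_int m2"
proof -
  note o = semiconjugacy_orbit[OF \<phi>]
  have mono: "mono \<phi>" using \<phi> by (simp add: rotation_semiconj_def)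
  have less: "u < v" if "\<phi> u < \<phi> v" for u v
    using that mono by (auto simp: mono_def not_le[symmetric])
  \<comment> \<open>Aiming at \<phi> x - e / 2 with tolerance e / 2 puts the value strictly between
    \<phi> x - e and \<phi> x.\<close>
  obtain h k where hk: "k > 0" "\<bar>of_int k * r - of_int h - (\<phi> x - e/2 - \<phi> 0)\<bar> < e/2"
    using sequence_of_fractional_parts_is_dense[OF r half_gt_zero[OF e]] by metis
  obtain h' k' where hk': "k' > 0" "\<bar>of_int k' * r - of_int h' - (\<phi> x + e/2 - \<phi> 0)\<bar> < e/2"
    using sequence_of_fractional_parts_is_dense[OF r half_gt_zero[OF e]] by metis
  have "\<phi> ((f ^^ nat k) 0 + of_int (- h)) = \<phi> 0 + of_int k * r - of_int h"
    "\<phi> ((f ^^ nat k') 0 + of_int (- h')) = \<phi> 0 + of_int k' * r - of_int h'"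
    using o[of "nat k" 0 "-h"] o[of "nat k'" 0 "-h'"] hk(1) hk'(1) by auto
  then have "\<phi> x - e < \<phi> ((f ^^ nat k) 0 + of_int (- h))" "\<phi> ((f ^^ nat k) 0 + of_int (- h)) < \<phi> x"
    "\<phi> ((f ^^ nat k') 0 + of_int (- h')) < \<phi> x + e" "\<phi> x < \<phi> ((f ^^ nat k') 0 + of_int (- h'))"
    using hk(2) hk'(2) unfolding abs_less_iff by linarith+
  then show ?thesis using that less by blast
qed

text \<open>A monotone function cannot jump at x if points on both sides of x have values within e
  of \<phi> x.\<close>

lemma semiconjugacy_continuous:
  assumes "r \<notin> \<rat>" "rotation_semiconj f r \<phi>"
  shows "continuous_on UNIV \<phi>"
  unfolding continuous_on_iff
proof (intro ballI allI impI)
  fix x e :: real assume e: "0 < e"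
  obtain p1 p2 where p: "\<phi> x - e < \<phi> p1" "p1 < x" "\<phi> p2 < \<phi> x + e" "x < p2"
    using semiconjugacy_sandwich[OF assms e, of x] by metis
  show "\<exists>d>0. \<forall>x'\<in>UNIV. dist x' x < d \<longrightarrow> dist (\<phi> x') (\<phi> x) < e"
  proof (intro exI[of _ "min (x - p1) (p2 - x)"] conjI ballI impI)
    fix x' assume "dist x' x < min (x - p1) (p2 - x)"
    then have "p1 \<le> x'" "x' \<le> p2" by (auto simp: dist_real_def abs_less_iff)
    then have "\<phi> p1 \<le> \<phi> x'" "\<phi> x' \<le> \<phi> p2" using assms(2) by (auto simp: rotation_semiconj_def dest: monoD)
    then show "dist (\<phi> x') (\<phi> x) < e" using p unfolding dist_real_def abs_less_iff by linarith
  qed (use p in auto)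
qed

text \<open>At orbit points both functions equal their value at 0 plus n r + m, and the same two
  orbit points enclose x for both. This later identifies the distribution function of every
  invariant measure with \<phi>.\<close>

lemma semiconjugacy_unique:
  assumes r: "r \<notin> \<rat>" and \<phi>: "rotation_semiconj f r \<phi>" and G: "rotation_semiconj f r G"
  shows "G x - G 0 = \<phi> x - \<phi> 0"
proof -
  have "\<bar>(G x - G 0) - (\<phi> x - \<phi> 0)\<bar> \<le> e" if e: "e > 0" for e
  proof -
    obtain n1 m1 n2 m2 where *:
      "\<phi> x - e < \<phi> ((f ^^ n1) 0 + of_int m1)" "\<phi> ((f ^^ n1) 0 + of_int m1) < \<phi> x" "(f ^^ n1) 0 + of_int m1 < x"
      "\<phi> ((f ^^ n2) 0 + of_int m2) < \<phi> x + e" "\<phi> x < \<phi> ((f ^^ n2) 0 + of_int m2)" "x < (f ^^ n2) 0 + of_int m2"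
      using semiconjugacy_sandwich[OF r \<phi> e, of x] by metis
    have "G ((f ^^ n1) 0 + of_int m1) \<le> G x" "G x \<le> G ((f ^^ n2) 0 + of_int m2)"
      using *(3,6) G by (auto simp: rotation_semiconj_def intro: monoD[of G] less_imp_le)
    then show ?thesis
      using * unfolding semiconjugacy_orbit[OF \<phi>] semiconjugacy_orbit[OF G] abs_le_iff by linarith
  qed
  then have "\<bar>(G x - G 0) - (\<phi> x - \<phi> 0)\<bar> \<le> 0" by (rule field_le_epsilon) simp
  then show ?thesis by simp
qed

section \<open>Denjoy's inequality\<close>

text \<open>Denominators of Dirichlet approximations, whether or not they occur in the continued
  fraction. Coprimality makes j p run through all residues modulo q, and the bound keeps j r within
  1 / q of j p / q for all j < q.\<close>

definition good_denom :: "real \<Rightarrow> nat \<Rightarrow> int \<Rightarrow> bool" where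
  "good_denom r q p \<longleftrightarrow> q > 0 \<and> coprime p (int q) \<and> \<bar>real q * r - p\<bar> \<le> 1 / q"

text \<open>\<Theta> plays the role of a variation function on the line and V that of the variation
  over one period. Any monotone majorant of the increments will do, and such majorants can be
  composed with monotone maps of degree one.\<close>

definition variation_bound :: "(real \<Rightarrow> real) \<Rightarrow> (real \<Rightarrow> real) \<Rightarrow> real \<Rightarrow> bool" where
  "variation_bound F \<Theta> V \<longleftrightarrow> mono \<Theta> \<and> (\<forall>y. \<Theta> (y + 1) = \<Theta> y + V) \<and> (\<forall>y. F (y + 1) = F y) \<and>
     (\<forall>u v. u \<le> v \<longrightarrow> \<bar>F u - F v\<bar> \<le> \<Theta> v - \<Theta> u)"

text \<open>The point behind \<xi> j may lie in a plateau of the semiconjugacy, so it is only known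
  to lie between preimages of any v < y + j r and v' > y + j r. Hence the strict inequalities there
  and the weak ones for u.\<close>

definition tracks_orbit :: "real \<Rightarrow> nat \<Rightarrow> (real \<Rightarrow> real) \<Rightarrow> (real \<Rightarrow> real) \<Rightarrow> real \<Rightarrow> (nat \<Rightarrow> real) \<Rightarrow> bool" where
  "tracks_orbit r q F \<Theta> y \<xi> \<longleftrightarrow>
     (\<forall>j<q. \<forall>v v' u. v < y + real j * r \<longrightarrow> y + real j * r < v' \<longrightarrow> v \<le> u \<longrightarrow> u \<le> v' \<longrightarrow> \<bar>\<xi> j - F u\<bar> \<le> \<Theta> v' - \<Theta> v)"

lemma good_denom_exists:
  fixes N :: nat
  assumes "N > 0"
  obtains q p where "good_denom r q p" "q \<le> N" "\<bar>real q * r - p\<bar> < 1 / N"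
proof -
  obtain h k where hk: "coprime h k" "0 < k" "k \<le> int N" "\<bar>of_int k * r - of_int h\<bar> < 1 / N"
    using Dirichlet_approx_coprime[OF assms] by metis
  define q where "q = nat k"
  have q: "int q = k" "real q = of_int k" "q > 0" "q \<le> N" using hk by (auto simp: q_def)
  then have "1 / real N \<le> 1 / real q" by (intro divide_left_mono) auto
  then have "good_denom r q h" unfolding good_denom_def q(1) using q(2,3) hk by simp
  then show ?thesis using that q hk by metis
qed

text \<open>Since p is coprime to q, multiplication by p permutes the residues modulo q.\<close>

lemma sum_coprime_multiples:
  fixes D :: "int \<Rightarrow> real"
  assumes "q > 0" "coprime p (int q)" and per: "\<And>k. D (k + int q) = D k"
  shows "(\<Sum>j<q. D (int j * p)) = (\<Sum>k<q. D (int k))"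
proof -
  have perm: "D (k + int q * m) = D k" for k m
  proof -
    have nat: "D (k + int q * int n) = D k" for n k
    proof (induction n)
      case (Suc n)
      have "D (k + int q * int (Suc n)) = D ((k + int q * int n) + int q)" by (simp add: algebra_simps)
      then show ?case using per Suc by simp
    qed simp
    show ?thesis
    proof (cases "m \<ge> 0")
      case True
      then show ?thesis using nat[of k "nat m"] by simp
    next
      case False
      then show ?thesis using nat[of "k + int q * m" "nat (-m)"] by simp
    qed
  qed
  have Dmod: "D (k mod int q) = D k" for k
    using perm[of "k mod int q" "k div int q"] by simp
  define s where "s j = nat ((int j * p) mod int q)" for j
  have inj: "inj_on s {..<q}"
  proof (rule inj_onI)
    fix i j assume ij: "i \<in> {..<q}" "j \<in> {..<q}" "s i = s j"
    then have "[int i * p = int j * p] (mod int q)"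
      using assms(1) by (simp add: s_def cong_def eq_nat_nat_iff)
    then have "[int i = int j] (mod int q)" using assms(2) cong_mult_rcancel by blast
    then show "i = j" using ij by (simp add: cong_def flip: of_nat_mod)
  qed
  have "s ` {..<q} \<subseteq> {..<q}" using assms(1) by (auto simp: s_def nat_less_iff)
  then have bij: "bij_betw s {..<q} {..<q}"
    using inj endo_inj_surj[of "{..<q}" s] by (simp add: bij_betw_def)
  have "(\<Sum>k<q. D (int k)) = (\<Sum>j<q. D (int (s j)))"
    by (rule sum.reindex_bij_betw[OF bij, symmetric])
  also have "\<dots> = (\<Sum>j<q. D (int j * p))"
    using assms(1) by (intro sum.cong) (auto simp: s_def Dmod)
  finally show ?thesis by simp
qed

text \<open>Moving the summation range by one replaces a single value E b by E (b + q), which adds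
  V.\<close>

lemma sum_shift_quasiperiodic:
  fixes E :: "int \<Rightarrow> real"
  assumes "\<And>k. E (k + int q) = E k + V"
  shows "(\<Sum>k<q. E (int k + a + int n)) - (\<Sum>k<q. E (int k + a)) = real n * V"
proof (induction n)
  case (Suc n)
  have "(\<Sum>k<q. E (int k + a + int (Suc n))) - (\<Sum>k<q. E (int k + a + int n))
      = (\<Sum>k<q. E (int (Suc k) + (a + int n)) - E (int k + (a + int n)))"
    by (simp add: sum_subtractf algebra_simps)
  also have "\<dots> = E (int q + (a + int n)) - E (a + int n)"
    by (subst sum_lessThan_telescope) simp
  also have "\<dots> = V" using assms[of "a + int n"] by (simp add: add_ac)
  finally show ?case using Suc by (simp add: algebra_simps)
qed simp

lemma good_denom_multiple:
  assumes "good_denom r q p" "j < q"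
  shows "\<bar>real j * r - of_int (int j * p) / q\<bar> < 1 / q"
proof -
  have q: "q > 0" "\<bar>real q * r - p\<bar> \<le> 1 / q" using assms by (auto simp: good_denom_def)
  have "real j * r - of_int (int j * p) / q = (real j / q) * (real q * r - p)" using q by (simp add: field_simps)
  then have "\<bar>real j * r - of_int (int j * p) / q\<bar> = (real j / q) * \<bar>real q * r - p\<bar>" by (simp add: abs_mult)
  also have "\<dots> \<le> (real j / q) * (1 / q)" using q by (intro mult_left_mono) auto
  also have "\<dots> < 1 * (1 / q)" using assms(2) by (intro mult_strict_right_mono) auto
  finally show ?thesis by simp
qed

text \<open>Replacing j r by j p / q costs one grid cell at either end of each window. The permuted
  windows are n1 + n2 + 2 cells wide and together cover every cell of the circle that many
  times.\<close>

lemma good_denom_sum_increments: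
  fixes \<Theta> :: "real \<Rightarrow> real"
  assumes g: "good_denom r q p" and mono: "mono \<Theta>" and per: "\<And>y. \<Theta> (y + 1) = \<Theta> y + V"
  shows "(\<Sum>j<q. \<Theta> (y + real j * r + real n2 / q) - \<Theta> (y + real j * r - real n1 / q)) \<le> real (n1 + n2 + 2) * V"
proof -
  have q: "q > 0" "coprime p (int q)" using g by (auto simp: good_denom_def)
  define E where "E k = \<Theta> (y + of_int k / q)" for k
  have Eper: "E (k + int q) = E k + V" for k
  proof -
    have "y + of_int (k + int q) / q = y + of_int k / q + 1" using q by (simp add: field_simps)
    then show ?thesis unfolding E_def by (simp only: per)
  qed
  define D where "D k = E (k + (- int n1 - 1) + int (n1 + n2 + 2)) - E (k + (- int n1 - 1))" for k
  have "D (k + int q) = D k" for k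
    using Eper[of "k + (- int n1 - 1) + int (n1 + n2 + 2)"] Eper[of "k + (- int n1 - 1)"]
    by (simp add: D_def algebra_simps)
  then have sumD: "(\<Sum>j<q. D (int j * p)) = (\<Sum>k<q. D (int k))" by (rule sum_coprime_multiples[OF q])
  have "(\<Sum>j<q. \<Theta> (y + real j * r + real n2 / q) - \<Theta> (y + real j * r - real n1 / q)) \<le> (\<Sum>j<q. D (int j * p))"
  proof (rule sum_mono)
    fix j assume "j \<in> {..<q}"
    then have j: "\<bar>real j * r - of_int (int j * p) / q\<bar> < 1 / q" using good_denom_multiple[OF g] by simp
    have k1: "int j * p + (- int n1 - 1) + int (n1 + n2 + 2) = int j * p + int n2 + 1" by simp
    have "of_int (int j * p + int n2 + 1) / real q = of_int (int j * p) / q + n2 / q + 1 / q"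
      "of_int (int j * p + (- int n1 - 1)) / real q = of_int (int j * p) / q - n1 / q - 1 / q"
      by (simp_all add: add_divide_distrib diff_divide_distrib)
    then have "y + real j * r + real n2 / q \<le> y + of_int (int j * p + int n2 + 1) / real q"
      "y + of_int (int j * p + (- int n1 - 1)) / real q \<le> y + real j * r - real n1 / q"
      using j by (simp_all only: abs_less_iff) linarith+
    then show "\<Theta> (y + real j * r + real n2 / q) - \<Theta> (y + real j * r - real n1 / q) \<le> D (int j * p)"
      unfolding D_def E_def k1 by (intro diff_mono monoD[OF mono])
  qed
  also have "\<dots> = (\<Sum>k<q. E (int k + (- int n1 - 1) + int (n1 + n2 + 2))) - (\<Sum>k<q. E (int k + (- int n1 - 1)))"
    unfolding sumD by (simp only: D_def sum_subtractf)
  also have "\<dots> = real (n1 + n2 + 2) * V" by (rule sum_shift_quasiperiodic[of E, OF Eper])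
  finally show ?thesis .
qed

text \<open>Denjoy's inequality, in a form that does not need the conjugacy to be injective: $\xi_j$ is the
  value at a point whose image on the line is $y + jr$.\<close>

lemma denjoy_compare_grid:
  assumes g: "good_denom r q p" and var: "variation_bound F \<Theta> V" and \<xi>: "tracks_orbit r q F \<Theta> y \<xi>"
  shows "\<bar>(\<Sum>j<q. \<xi> j) - (\<Sum>k<q. F (y + real k / q))\<bar> \<le> 2 * V"
proof -
  have per\<Theta>: "\<And>y. \<Theta> (y + 1) = \<Theta> y + V" and perF: "\<And>y. F (y + 1) = F y"
    using var by (auto simp: variation_bound_def)
  have q: "q > 0" "coprime p (int q)" using g by (auto simp: good_denom_def)
  define E where "E k = \<Theta> (y + of_int k / q)" for k
  have step: "y + of_int (k + int q) / q = y + of_int k / q + 1" for k using q by (simp add: field_simps)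
  have Eper: "E (k + int q) = E k + V" for k unfolding E_def step by (rule per\<Theta>)
  define FF where "FF k = F (y + of_int k / q)" for k
  have FFper: "FF (k + int q) = FF k" for k unfolding FF_def step by (rule perF)
  \<comment> \<open>The window of two grid cells around the k-th grid point; for k = j p it contains
    y + j r as well as the grid point, which is the source of the constant 2.\<close>
  define D where "D k = E (k + (- 1) + int 2) - E (k + (- 1))" for k
  have "D (k + int q) = D k" for k
    using Eper[of "k + (- 1) + int 2"] Eper[of "k + (- 1)"] by (simp add: D_def algebra_simps)
  then have sumD: "(\<Sum>j<q. D (int j * p)) = (\<Sum>k<q. D (int k))" by (rule sum_coprime_multiples[OF q])
  have sumF: "(\<Sum>j<q. FF (int j * p)) = (\<Sum>k<q. FF (int k))" by (rule sum_coprime_multiples[where D=FF, OF q FFper])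
  have "\<bar>(\<Sum>j<q. \<xi> j) - (\<Sum>j<q. FF (int j * p))\<bar> = \<bar>\<Sum>j<q. \<xi> j - FF (int j * p)\<bar>" by (simp add: sum_subtractf)
  also have "\<dots> \<le> (\<Sum>j<q. \<bar>\<xi> j - FF (int j * p)\<bar>)" by (rule sum_abs)
  also have "\<dots> \<le> (\<Sum>j<q. D (int j * p))"
  proof (rule sum_mono)
    fix j assume jq: "j \<in> {..<q}"
    then have j: "\<bar>real j * r - of_int (int j * p) / q\<bar> < 1 / q" using good_denom_multiple[OF g] by simp
    have "of_int (int j * p + - 1 + int 2) / real q = of_int (int j * p) / q + 1 / q"
      "of_int (int j * p + - 1) / real q = of_int (int j * p) / q - 1 / q"
      by (simp_all add: add_divide_distrib diff_divide_distrib)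
    then show "\<bar>\<xi> j - FF (int j * p)\<bar> \<le> D (int j * p)"
      unfolding D_def E_def FF_def 
      using j jq \<xi> unfolding abs_less_iff tracks_orbit_def by auto
  qed
  also have "\<dots> = (\<Sum>k<q. E (int k + - 1 + int 2)) - (\<Sum>k<q. E (int k + - 1))"
    unfolding sumD by (simp only: D_def sum_subtractf)
  also have "\<dots> = real 2 * V" by (rule sum_shift_quasiperiodic[of E, OF Eper])
  finally show ?thesis unfolding sumF by (simp add: FF_def)
qed

text \<open>Moving the grid by whole cells does not change a periodic sum, so y' may be assumed in
  the cell to the right of y. Then every cell contributes its variation once.\<close>

lemma grid_sum_oscillation:
  assumes q: "q > 0" and var: "variation_bound F \<Theta> V"
  shows "\<bar>(\<Sum>k<q. F (y + real k / q)) - (\<Sum>k<q. F (y' + real k / q))\<bar> \<le> V"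
proof -
  have mono: "mono \<Theta>" and per\<Theta>: "\<And>y. \<Theta> (y + 1) = \<Theta> y + V" and perF: "\<And>y. F (y + 1) = F y"
    and F: "\<And>u v. u \<le> v \<Longrightarrow> \<bar>F u - F v\<bar> \<le> \<Theta> v - \<Theta> u"
    using var by (auto simp: variation_bound_def)
  define m where "m = \<lfloor>(y' - y) * q\<rfloor>"
  have "of_int m \<le> (y' - y) * q" "(y' - y) * q < of_int m + 1" unfolding m_def by linarith+
  then have m: "y + of_int m / q \<le> y'" "y' \<le> y + (of_int m + 1) / q" using q by (auto simp: field_simps)
  define E where "E k = \<Theta> (y + of_int k / q)" for k
  have step: "y + of_int (k + int q) / q = y + of_int k / q + 1" for k using q by (simp add: field_simps)
  have Eper: "E (k + int q) = E k + V" for k unfolding E_def step by (rule per\<Theta>)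
  define FF where "FF k = F (y + of_int k / q)" for k
  have FFper: "FF (k + int q) = FF k + 0" for k unfolding FF_def step by (simp add: perF)
  have FFnat: "(\<Sum>k<q. FF (int k + a + int n)) = (\<Sum>k<q. FF (int k + a))" for a n
    using sum_shift_quasiperiodic[of FF q 0 a n] FFper by simp
  have FFm: "(\<Sum>k<q. FF (int k + m)) = (\<Sum>k<q. FF (int k))"
  proof (cases "m \<ge> 0")
    case True
    then show ?thesis using FFnat[of 0 "nat m"] by simp
  next
    case False
    then show ?thesis using FFnat[of m "nat (-m)"] by simp
  qed
  have "\<bar>(\<Sum>k<q. FF (int k + m)) - (\<Sum>k<q. F (y' + real k / q))\<bar> = \<bar>\<Sum>k<q. FF (int k + m) - F (y' + real k / q)\<bar>"
    by (simp add: sum_subtractf)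
  also have "\<dots> \<le> (\<Sum>k<q. \<bar>FF (int k + m) - F (y' + real k / q)\<bar>)" by (rule sum_abs)
  also have "\<dots> \<le> (\<Sum>k<q. E (int k + m + int 1) - E (int k + m))"
  proof (rule sum_mono)
    fix k
    have e: "of_int (int k + m) / real q = real k / q + of_int m / q"
      "of_int (int k + m + int 1) / real q = real k / q + (of_int m + 1) / q"
      by (simp_all add: add_divide_distrib)
    have "y + of_int (int k + m) / real q \<le> y' + real k / q" unfolding e using m by linarith
    then have "\<bar>FF (int k + m) - F (y' + real k / q)\<bar> \<le> \<Theta> (y' + real k / q) - \<Theta> (y + of_int (int k + m) / q)"
      unfolding FF_def by (rule F)
    also have "\<dots> \<le> E (int k + m + int 1) - E (int k + m)"
      unfolding E_def e using m by (intro diff_right_mono monoD[OF mono]) linarith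
    finally show "\<bar>FF (int k + m) - F (y' + real k / q)\<bar> \<le> E (int k + m + int 1) - E (int k + m)" .
  qed
  also have "\<dots> = real 1 * V" unfolding sum_subtractf by (rule sum_shift_quasiperiodic[of E, OF Eper])
  finally show ?thesis unfolding FFm by (simp add: FF_def)
qed

text \<open>Passing to the equidistant grid costs 2 V for each of the two orbits, and moving the
  grid costs V.\<close>

lemma denjoy_inequality:
  assumes g: "good_denom r q p" and var: "variation_bound F \<Theta> V"
    and \<xi>: "tracks_orbit r q F \<Theta> y \<xi>" and \<eta>: "tracks_orbit r q F \<Theta> y' \<eta>"
  shows "\<bar>(\<Sum>j<q. \<xi> j) - (\<Sum>j<q. \<eta> j)\<bar> \<le> 5 * V"
proof -
  have "q > 0" using g by (simp add: good_denom_def)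
  from grid_sum_oscillation[OF this var, of y y'] denjoy_compare_grid[OF g var \<xi>] denjoy_compare_grid[OF g var \<eta>]
  show ?thesis unfolding abs_le_iff by linarith
qed

lemma birkhoff_sum_oscillation:
  assumes g: "good_denom r q p" and var: "variation_bound F \<Theta> V"
  shows "\<bar>(\<Sum>j<q. F (y + real j * r)) - (\<Sum>j<q. F (y' + real j * r))\<bar> \<le> 5 * V"
proof -
  have mono: "mono \<Theta>" and F: "\<And>u v. u \<le> v \<Longrightarrow> \<bar>F u - F v\<bar> \<le> \<Theta> v - \<Theta> u"
    using var by (auto simp: variation_bound_def)
  have *: "\<bar>F w - F u\<bar> \<le> \<Theta> v' - \<Theta> v" if "v < w" "w < v'" "v \<le> u" "u \<le> v'" for v v' u w
  proof -
    have m: "\<Theta> v \<le> \<Theta> w" "\<Theta> v \<le> \<Theta> u" "\<Theta> w \<le> \<Theta> v'" "\<Theta> u \<le> \<Theta> v'"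
      using that by (auto intro: monoD[OF mono])
    show ?thesis
    proof (cases "u \<le> w")
      case True
      then show ?thesis using F[OF True] m unfolding abs_le_iff by linarith
    next
      case False
      then show ?thesis using F[of w u] m by linarith
    qed
  qed
  then have "tracks_orbit r q F \<Theta> y (\<lambda>j. F (y + real j * r))" for y
    unfolding tracks_orbit_def by blast
  then show ?thesis using denjoy_inequality[OF g var] by blast
qed

section \<open>Absolutely continuous functions as integrals\<close>

definition disjoint_intervals :: "'i set \<Rightarrow> ('i \<Rightarrow> real) \<Rightarrow> ('i \<Rightarrow> real) \<Rightarrow> bool" where
  "disjoint_intervals I u v \<longleftrightarrow> finite I \<and> (\<forall>i\<in>I. u i \<le> v i) \<and> disjoint_family_on (\<lambda>i. {u i<..<v i}) I"

text \<open>Uniform on the whole line. The conclusion has \<le> instead of < so that it passes to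
  limits; the index sets are initial segments of the naturals, and \<open>ac_funD\<close> frees them
  for systems indexed by pairs or by intervals.\<close>

definition ac_fun :: "(real \<Rightarrow> real) \<Rightarrow> bool" where
  "ac_fun D \<longleftrightarrow> (\<forall>e>0. \<exists>d>0. \<forall>(n::nat) u v. disjoint_intervals {..<n} u v \<longrightarrow> (\<Sum>i<n. v i - u i) < d \<longrightarrow>
     (\<Sum>i<n. \<bar>D (v i) - D (u i)\<bar>) \<le> e)"

lemma disjoint_intervals_reindex:
  assumes "disjoint_intervals I u v"
  obtains n :: nat and h where "disjoint_intervals {..<n} (u \<circ> h) (v \<circ> h)" "bij_betw h {..<n} I"
    "\<And>g :: real \<Rightarrow> real \<Rightarrow> real. (\<Sum>i<n. g ((u \<circ> h) i) ((v \<circ> h) i)) = (\<Sum>i\<in>I. g (u i) (v i))"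
proof -
  have fin: "finite I" using assms by (simp add: disjoint_intervals_def)
  obtain h where h: "bij_betw h {..<card I} I" using ex_bij_betw_nat_finite[OF fin] by (auto simp: atLeast0LessThan)
  have hI: "h i \<in> I" if "i < card I" for i using h that by (auto simp: bij_betw_def)
  have hinj: "h i \<noteq> h j" if "i < card I" "j < card I" "i \<noteq> j" for i j
    using h that by (auto simp: bij_betw_def inj_on_def)
  have "disjoint_intervals {..<card I} (u \<circ> h) (v \<circ> h)"
    using assms hI hinj by (auto simp: disjoint_intervals_def disjoint_family_on_def)
  moreover have "(\<Sum>i<card I. g ((u \<circ> h) i) ((v \<circ> h) i)) = (\<Sum>i\<in>I. g (u i) (v i))" for g :: "real \<Rightarrow> real \<Rightarrow> real"
    using sum.reindex_bij_betw[OF h, of "\<lambda>i. g (u i) (v i)"] by simp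
  ultimately show ?thesis using that h by blast
qed

lemma ac_funD:
  assumes "ac_fun D" "0 < e"
  obtains d where "0 < d"
    "\<And>I u v. disjoint_intervals I u v \<Longrightarrow> (\<Sum>i\<in>I. v i - u i) < d \<Longrightarrow> (\<Sum>i\<in>I. \<bar>D (v i) - D (u i)\<bar>) \<le> e"
proof -
  obtain d where d: "0 < d" "\<And>(n::nat) u v. disjoint_intervals {..<n} u v \<Longrightarrow> (\<Sum>i<n. v i - u i) < d \<Longrightarrow>
     (\<Sum>i<n. \<bar>D (v i) - D (u i)\<bar>) \<le> e" using assms unfolding ac_fun_def by meson
  have "(\<Sum>i\<in>I. \<bar>D (v i) - D (u i)\<bar>) \<le> e" if di: "disjoint_intervals I u v" and s: "(\<Sum>i\<in>I. v i - u i) < d"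
    for I and u v :: "'a \<Rightarrow> real"
  proof -
    obtain n h where h: "disjoint_intervals {..<n} (u \<circ> h) (v \<circ> h)"
      "\<And>g :: real \<Rightarrow> real \<Rightarrow> real. (\<Sum>i<n::nat. g ((u \<circ> h) i) ((v \<circ> h) i)) = (\<Sum>i\<in>I. g (u i) (v i))"
      using disjoint_intervals_reindex[OF di] by metis
    show ?thesis using d(2)[OF h(1)] s h(2)[of "\<lambda>a b. b - a"] h(2)[of "\<lambda>a b. \<bar>D b - D a\<bar>"] by simp
  qed
  then show ?thesis using that d(1) by blast
qed

lemma disjoint_intervals_length:
  assumes "disjoint_intervals I u v" "\<And>i. i \<in> I \<Longrightarrow> {u i<..<v i} \<subseteq> A" "A \<in> sets borel"
  shows "ennreal (\<Sum>i\<in>I. v i - u i) \<le> emeasure lborel A"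
proof -
  have "ennreal (\<Sum>i\<in>I. v i - u i) = (\<Sum>i\<in>I. emeasure lborel {u i<..<v i})"
    using assms(1) by (subst sum_ennreal[symmetric]) (auto simp: disjoint_intervals_def)
  also have "\<dots> = emeasure lborel (\<Union>i\<in>I. {u i<..<v i})"
    using assms(1) by (intro sum_emeasure) (auto simp: disjoint_intervals_def)
  also have "\<dots> \<le> emeasure lborel A" using assms by (intro emeasure_mono) auto
  finally show ?thesis .
qed

lemma disjoint_intervals_length_le:
  assumes "disjoint_intervals I u v" "\<And>i. i \<in> I \<Longrightarrow> a \<le> u i \<and> v i \<le> b" "a \<le> b"
  shows "(\<Sum>i\<in>I. v i - u i) \<le> b - a"
proof -
  have "ennreal (\<Sum>i\<in>I. v i - u i) \<le> emeasure lborel {a..b}"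
    by (rule disjoint_intervals_length[OF assms(1)]) (use assms(2) in force)+
  then show ?thesis using assms(3) by (simp add: ennreal_le_iff)
qed

text \<open>The last assumption makes c the identity strictly inside its range, so that the open
  interval from c a to c b lies in the one from a to b. Truncations by \<open>min\<close> and
  \<open>max\<close> are of this kind.\<close>

lemma disjoint_intervals_clamp:
  fixes c :: "real \<Rightarrow> real"
  assumes "disjoint_intervals I u v" "mono c" "\<And>x y. x \<le> y \<Longrightarrow> c y - c x \<le> y - x"
    "\<forall>x y z. c x < z \<longrightarrow> z < c y \<longrightarrow> c z = z"
  shows "disjoint_intervals I (c \<circ> u) (c \<circ> v)" "(\<Sum>i\<in>I. (c \<circ> v) i - (c \<circ> u) i) \<le> (\<Sum>i\<in>I. v i - u i)"
proof -
  have sub: "{c a<..<c b} \<subseteq> {a<..<b}" for a b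
  proof
    fix z assume "z \<in> {c a<..<c b}"
    then have "c a < z" "z < c b" by simp_all
    moreover from this have "c z = z" using assms(4) by blast
    ultimately have z: "c a < c z" "c z < c b" by simp_all
    have "a < z" using z(1) monoD[OF assms(2), of z a] by (meson not_le)
    moreover have "z < b" using z(2) monoD[OF assms(2), of b z] by (meson not_le)
    ultimately show "z \<in> {a<..<b}" by simp
  qed
  have "disjoint_family_on (\<lambda>i. {c (u i)<..<c (v i)}) I"
    using assms(1) sub unfolding disjoint_intervals_def disjoint_family_on_def by blast
  then show "disjoint_intervals I (c \<circ> u) (c \<circ> v)"
    using assms(1,2) by (auto simp: disjoint_intervals_def dest: monoD)
  show "(\<Sum>i\<in>I. (c \<circ> v) i - (c \<circ> u) i) \<le> (\<Sum>i\<in>I. v i - u i)"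
    using assms(1,3) by (intro sum_mono) (auto simp: disjoint_intervals_def)
qed

lemma ac_fun_continuous: assumes "ac_fun D" shows "continuous_on UNIV D"
  unfolding continuous_on_iff
proof (intro ballI allI impI)
  fix x e :: real assume e: "0 < e"
  then have e2: "0 < e/2" by simp
  obtain d where d: "0 < d" "\<And>(I::nat set) u v. disjoint_intervals I u v \<Longrightarrow> (\<Sum>i\<in>I. v i - u i) < d \<Longrightarrow> (\<Sum>i\<in>I. \<bar>D (v i) - D (u i)\<bar>) \<le> e/2"
    using ac_funD[OF assms e2] by metis
  have *: "\<bar>D b - D a\<bar> \<le> e/2" if "a \<le> b" "b - a < d" for a b
    using d(2)[of "{0}" "\<lambda>_. a" "\<lambda>_. b"] that by (simp add: disjoint_intervals_def disjoint_family_on_def)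
  show "\<exists>d>0. \<forall>x'\<in>UNIV. dist x' x < d \<longrightarrow> dist (D x') (D x) < e"
  proof (intro exI[of _ d] conjI ballI impI d(1))
    fix x' assume x': "dist x' x < d"
    have "\<bar>D x' - D x\<bar> \<le> e/2"
    proof (cases "x \<le> x'")
      case True
      then show ?thesis using *[of x x'] x' by (simp add: dist_real_def)
    next
      case False
      then show ?thesis using *[of x' x] x' by (simp add: dist_real_def abs_minus_commute)
    qed
    then show "dist (D x') (D x) < e" using e by (simp add: dist_real_def)
  qed
qed

text \<open>Absolute continuity is given on an open arc only. Uniform continuity extends D to the
  closed arc, and beyond the end points it is continued as a constant. Absolute continuity is
  inherited by moving all interval ends into the open arc and letting their margin to its ends tend
  to 0.\<close>

lemma ac_extension:
  assumes ab: "\<alpha> < \<beta>" and ac: "abs_continuous_on {\<alpha><..<\<beta>} D"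
  obtains D' where "ac_fun D'" "\<And>x. \<alpha> < x \<Longrightarrow> x < \<beta> \<Longrightarrow> D' x = D x"
    "\<And>x. x \<le> \<alpha> \<Longrightarrow> D' x = D' \<alpha>" "\<And>x. \<beta> \<le> x \<Longrightarrow> D' x = D' \<beta>"
proof -
  have AC: "\<exists>d>0. \<forall>(n::nat) u v. disjoint_intervals {..<n} u v \<longrightarrow> (\<forall>i<n. \<alpha> < u i \<and> v i < \<beta>) \<longrightarrow>
      (\<Sum>i<n. v i - u i) < d \<longrightarrow> (\<Sum>i<n. \<bar>D (v i) - D (u i)\<bar>) < e" if "e > 0" for e
  proof -
    obtain d where d: "d > 0" "\<And>(n::nat) u v. (\<forall>i<n. u i \<le> v i \<and> {u i..v i} \<subseteq> {\<alpha><..<\<beta>}) \<and>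
        disjoint_family_on (\<lambda>i. {u i<..<v i}) {..<n} \<and> (\<Sum>i<n. v i - u i) < d \<Longrightarrow> (\<Sum>i<n. \<bar>D (v i) - D (u i)\<bar>) < e"
      using ac \<open>e > 0\<close> unfolding abs_continuous_on_def by meson
    have "(\<Sum>i<n. \<bar>D (v i) - D (u i)\<bar>) < e"
      if "disjoint_intervals {..<n} u v" "\<forall>i<n. \<alpha> < u i \<and> v i < \<beta>" "(\<Sum>i<n. v i - u i) < d" for n :: nat and u v
      using that by (intro d(2)) (auto simp: disjoint_intervals_def)
    then show ?thesis using d(1) by blast
  qed
  have "uniformly_continuous_on {\<alpha><..<\<beta>} D"
    unfolding uniformly_continuous_on_def
  proof (intro allI impI)
    fix e :: real assume "e > 0"
    then obtain d where d: "d > 0" "\<And>(n::nat) u v. disjoint_intervals {..<n} u v \<longrightarrow> (\<forall>i<n. \<alpha> < u i \<and> v i < \<beta>) \<longrightarrow>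
      (\<Sum>i<n. v i - u i) < d \<longrightarrow> (\<Sum>i<n. \<bar>D (v i) - D (u i)\<bar>) < e" using AC by meson
    have *: "\<bar>D b - D a\<bar> < e" if "\<alpha> < a" "a \<le> b" "b < \<beta>" "b - a < d" for a b
      using d(2)[of 1 "\<lambda>_. a" "\<lambda>_. b"] that by (simp add: disjoint_intervals_def disjoint_family_on_def)
    show "\<exists>d>0. \<forall>x\<in>{\<alpha><..<\<beta>}. \<forall>x'\<in>{\<alpha><..<\<beta>}. dist x' x < d \<longrightarrow> dist (D x') (D x) < e"
    proof (intro exI[of _ d] conjI ballI impI d(1))
      fix x x' assume "x \<in> {\<alpha><..<\<beta>}" "x' \<in> {\<alpha><..<\<beta>}" "dist x' x < d"
      then show "dist (D x') (D x) < e"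
        using *[of x x'] *[of x' x] by (cases "x \<le> x'") (auto simp: dist_real_def abs_minus_commute)
    qed
  qed
  then obtain g where g: "uniformly_continuous_on (closure {\<alpha><..<\<beta>}) g" "\<And>x. x \<in> {\<alpha><..<\<beta>} \<Longrightarrow> D x = g x"
    by (rule uniformly_continuous_on_extension_on_closure) blast
  have gc: "continuous_on {\<alpha>..\<beta>} g" using uniformly_continuous_imp_continuous[OF g(1)] ab by simp
  define D' where "D' x = g (max \<alpha> (min x \<beta>))" for x
  \<comment> \<open>With \<open>real k + 3\<close> in the denominator twice the margin stays below
    \<beta> - \<alpha>, so the truncated arc is never empty.\<close>
  define \<eta> where "\<eta> k = (\<beta> - \<alpha>) / (real k + 3)" for k :: nat
  define c where "c k x = max (\<alpha> + \<eta> k) (min x (\<beta> - \<eta> k))" for k x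
  have k3: "\<eta> k > 0" "2 * \<eta> k < \<beta> - \<alpha>" for k
  proof -
    show "\<eta> k > 0" using ab by (simp add: \<eta>_def)
    have "2 * (\<beta> - \<alpha>) < (real k + 3) * (\<beta> - \<alpha>)" using ab by (intro mult_strict_right_mono) auto
    then show "2 * \<eta> k < \<beta> - \<alpha>" by (simp add: \<eta>_def pos_divide_less_eq mult.commute)
  qed
  have cin: "\<alpha> < c k x" "c k x < \<beta>" for k x using k3[of k] by (auto simp: c_def)
  have clim: "(\<lambda>k. D (c k x)) \<longlonglongrightarrow> D' x" for x
  proof -
    have t: "\<eta> \<longlonglongrightarrow> 0" unfolding \<eta>_def by real_asymp
    have "(\<lambda>k. c k x) \<longlonglongrightarrow> max (\<alpha> + 0) (min x (\<beta> - 0))"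
      unfolding c_def by (intro tendsto_intros t)
    then have l: "(\<lambda>k. c k x) \<longlonglongrightarrow> max \<alpha> (min x \<beta>)" by simp
    have "(\<lambda>k. g (c k x)) \<longlonglongrightarrow> g (max \<alpha> (min x \<beta>))"
      using cin ab by (intro continuous_on_tendsto_compose[OF gc l]) (auto intro!: always_eventually less_imp_le)
    then show ?thesis using g(2) cin by (simp add: D'_def)
  qed
  have "ac_fun D'" unfolding ac_fun_def
  proof (intro allI impI)
    fix e :: real assume "e > 0"
    then obtain d where d: "d > 0" "\<And>(n::nat) u v. disjoint_intervals {..<n} u v \<longrightarrow> (\<forall>i<n. \<alpha> < u i \<and> v i < \<beta>) \<longrightarrow>
      (\<Sum>i<n. v i - u i) < d \<longrightarrow> (\<Sum>i<n. \<bar>D (v i) - D (u i)\<bar>) < e" using AC by meson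
    show "\<exists>d>0. \<forall>(n::nat) u v. disjoint_intervals {..<n} u v \<longrightarrow> (\<Sum>i<n. v i - u i) < d \<longrightarrow> (\<Sum>i<n. \<bar>D' (v i) - D' (u i)\<bar>) \<le> e"
    proof (intro exI[of _ d] conjI allI impI d(1))
      fix n :: nat and u v assume uv: "disjoint_intervals {..<n} u v" "(\<Sum>i<n. v i - u i) < d"
      have cm: "mono (c k)" for k by (auto simp: mono_def c_def)
      have c1: "c k y - c k x \<le> y - x" if "x \<le> y" for k x y using that k3[of k] by (auto simp: c_def max_def min_def)
      have cid: "\<forall>x y z. c k x < z \<longrightarrow> z < c k y \<longrightarrow> c k z = z" for k by (auto simp: c_def max_def min_def split: if_splits)
      have "(\<Sum>i<n. \<bar>D (c k (v i)) - D (c k (u i))\<bar>) \<le> e" for k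
        using disjoint_intervals_clamp[OF uv(1) cm c1 cid, of k] d(2)[of n "c k \<circ> u" "c k \<circ> v"] uv(2) cin
        by (simp add: less_imp_le)
      moreover have "(\<lambda>k. \<Sum>i<n. \<bar>D (c k (v i)) - D (c k (u i))\<bar>) \<longlonglongrightarrow> (\<Sum>i<n. \<bar>D' (v i) - D' (u i)\<bar>)"
        by (intro tendsto_intros clim)
      ultimately show "(\<Sum>i<n. \<bar>D' (v i) - D' (u i)\<bar>) \<le> e" by (meson LIMSEQ_le_const2)
    qed
  qed
  moreover have "D' x = D x" if "\<alpha> < x" "x < \<beta>" for x using that g(2)[of x] by (simp add: D'_def max_def min_def)
  moreover have "D' x = D' \<alpha>" if "x \<le> \<alpha>" for x using that ab by (simp add: D'_def max_def min_def)
  moreover have "D' x = D' \<beta>" if "\<beta> \<le> x" for x using that ab by (simp add: D'_def max_def min_def)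
  ultimately show ?thesis by (rule that)
qed

section \<open>Variation functions and monotone decomposition\<close>

definition var_sums :: "(real \<Rightarrow> real) \<Rightarrow> real \<Rightarrow> real set" where
  "var_sums D x = {s. \<exists>(n::nat) u v. disjoint_intervals {..<n} u v \<and> (\<forall>i<n. v i \<le> x) \<and> s = (\<Sum>i<n. \<bar>D (v i) - D (u i)\<bar>)}"

lemma abs_diff_split:
  fixes D :: "real \<Rightarrow> real"
  assumes "a \<le> b"
  shows "\<bar>D b - D a\<bar> \<le> \<bar>D (min b t) - D (min a t)\<bar> + \<bar>D (max b t) - D (max a t)\<bar>"
  using assms by (cases "a \<le> t"; cases "b \<le> t") (auto simp: min_def max_def)

lemma disjoint_intervals_min_max:
  fixes t :: real
  assumes "disjoint_intervals I u v"
  shows "disjoint_intervals I (\<lambda>i. min (u i) t) (\<lambda>i. min (v i) t)"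
    "disjoint_intervals I (\<lambda>i. max (u i) t) (\<lambda>i. max (v i) t)"
    "(\<Sum>i\<in>I. max (v i) t - max (u i) t) \<le> (\<Sum>i\<in>I. v i - u i)"
proof -
  have m: "mono (\<lambda>x. min x t)" "mono (\<lambda>x. max x t)" by (auto simp: mono_def)
  have c: "min y t - min x t \<le> y - x" "max y t - max x t \<le> y - x" if "x \<le> y" for x y
    using that unfolding min_def max_def by auto
  have i: "\<forall>x y z. min x t < z \<longrightarrow> z < min y t \<longrightarrow> min z t = z" "\<forall>x y z. max x t < z \<longrightarrow> z < max y t \<longrightarrow> max z t = z"
    by auto
  show "disjoint_intervals I (\<lambda>i. min (u i) t) (\<lambda>i. min (v i) t)"
    using disjoint_intervals_clamp(1)[OF assms m(1) c(1) i(1)] by (simp add: o_def)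
  show "disjoint_intervals I (\<lambda>i. max (u i) t) (\<lambda>i. max (v i) t)"
    "(\<Sum>i\<in>I. max (v i) t - max (u i) t) \<le> (\<Sum>i\<in>I. v i - u i)"
    using disjoint_intervals_clamp[OF assms m(2) c(2) i(2)] by (simp_all add: o_def)
qed

text \<open>Nothing is contributed outside the interval from \<alpha> to \<beta>, and each step of
  length d / 2 inside it adds at most 1, where d belongs to the tolerance 1. Half of d turns the
  bound on the length into a strict one.\<close>

lemma var_sums_bounded:
  assumes ac: "ac_fun D" and const: "\<And>x. x \<le> \<alpha> \<Longrightarrow> D x = D \<alpha>" "\<And>x. \<beta> \<le> x \<Longrightarrow> D x = D \<beta>"
  obtains K where "\<And>x s. s \<in> var_sums D x \<Longrightarrow> s \<le> K"
proof -
  obtain d where d: "0 < d" "\<And>(I::nat set) u v. disjoint_intervals I u v \<Longrightarrow> (\<Sum>i\<in>I. v i - u i) < d \<Longrightarrow> (\<Sum>i\<in>I. \<bar>D (v i) - D (u i)\<bar>) \<le> 1"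
    using ac_funD[OF ac, of 1] by (metis zero_less_one)
  have split: "\<exists>s1\<in>var_sums D t. s \<le> s1 + s2" if "disjoint_intervals {..<n} u v" "s = (\<Sum>i<n. \<bar>D (v i) - D (u i)\<bar>)"
      "s2 = (\<Sum>i<n. \<bar>D (max (v i) t) - D (max (u i) t)\<bar>)" for n :: nat and u v t s s2
  proof (rule bexI)
    show "(\<Sum>i<n. \<bar>D (min (v i) t) - D (min (u i) t)\<bar>) \<in> var_sums D t"
      unfolding var_sums_def using disjoint_intervals_min_max(1)[OF that(1), of t] by fastforce
    show "s \<le> (\<Sum>i<n. \<bar>D (min (v i) t) - D (min (u i) t)\<bar>) + s2"
      unfolding that(2,3) sum.distrib[symmetric]
      using that(1) by (intro sum_mono abs_diff_split) (auto simp: disjoint_intervals_def)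
  qed
  have step: "\<forall>s\<in>var_sums D (\<alpha> + real m * (d/2)). s \<le> real m" for m
  proof (induction m)
    case 0
    show ?case
    proof
      fix s assume "s \<in> var_sums D (\<alpha> + real 0 * (d/2))"
      then obtain n u v where s: "disjoint_intervals {..<n::nat} u v" "\<forall>i<n. v i \<le> \<alpha>" "s = (\<Sum>i<n. \<bar>D (v i) - D (u i)\<bar>)"
        by (auto simp: var_sums_def)
      have "D (v i) = D (u i)" if "i < n" for i
        using const(1)[of "v i"] const(1)[of "u i"] s(1,2) that by (force simp: disjoint_intervals_def)
      then show "s \<le> real 0" by (simp add: s(3))
    qed
  next
    case (Suc m)
    show ?case
    proof
      define t where "t = \<alpha> + real m * (d/2)"
      have t2: "\<alpha> + real (Suc m) * (d/2) = t + d/2" by (simp add: t_def algebra_simps)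
      fix s assume "s \<in> var_sums D (\<alpha> + real (Suc m) * (d/2))"
      then obtain n u v where s: "disjoint_intervals {..<n::nat} u v" "\<forall>i<n. v i \<le> t + d/2" "s = (\<Sum>i<n. \<bar>D (v i) - D (u i)\<bar>)"
        unfolding t2 by (auto simp: var_sums_def)
      note mm = disjoint_intervals_min_max[OF s(1), of t]
      have "(\<Sum>i<n. max (v i) t - max (u i) t) \<le> (t + d/2) - t"
        by (rule disjoint_intervals_length_le[OF mm(2)]) (use s(2) d(1) in auto)
      then have "(\<Sum>i<n. \<bar>D (max (v i) t) - D (max (u i) t)\<bar>) \<le> 1" using d(1) by (intro d(2)[OF mm(2)]) linarith
      moreover obtain s1 where "s1 \<in> var_sums D t" "s \<le> s1 + (\<Sum>i<n. \<bar>D (max (v i) t) - D (max (u i) t)\<bar>)"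
        using split[OF s(1,3) refl] by blast
      moreover have "s1 \<le> real m" using Suc calculation(2) by (auto simp: t_def)
      ultimately show "s \<le> real (Suc m)" by simp
    qed
  qed
  obtain m :: nat where m: "(\<beta> - \<alpha>) / (d/2) < m" using reals_Archimedean2 by blast
  define t where "t = \<alpha> + real m * (d/2)"
  have t: "\<beta> \<le> t" using m d(1) by (simp add: t_def field_simps)
  have "s \<le> real m" if "s \<in> var_sums D x" for x s
  proof -
    from that obtain n u v where s: "disjoint_intervals {..<n::nat} u v" "s = (\<Sum>i<n. \<bar>D (v i) - D (u i)\<bar>)"
      by (auto simp: var_sums_def)
    have "D (max (v i) t) = D (max (u i) t)" for i
      using const(2)[of "max (v i) t"] const(2)[of "max (u i) t"] t by simp
    then have "(\<Sum>i<n. \<bar>D (max (v i) t) - D (max (u i) t)\<bar>) = 0" by simp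
    then obtain s1 where "s1 \<in> var_sums D t" "s \<le> s1" using split[OF s refl, of t] by force
    then show ?thesis using step[of m] by (force simp: t_def)
  qed
  then show ?thesis by (rule that)
qed

text \<open>W is the total variation from minus infinity. It makes D the difference of the monotone
  absolutely continuous functions W and W - D, which reduces the existence of a density to the
  monotone case.\<close>

lemma ac_variation_function:
  assumes ac: "ac_fun D" and const: "\<And>x. x \<le> \<alpha> \<Longrightarrow> D x = D \<alpha>" "\<And>x. \<beta> \<le> x \<Longrightarrow> D x = D \<beta>"
  obtains W where "ac_fun W" "\<And>x y. x \<le> y \<Longrightarrow> \<bar>D y - D x\<bar> \<le> W y - W x"
proof -
  obtain K where K: "\<And>x s. s \<in> var_sums D x \<Longrightarrow> s \<le> K" using var_sums_bounded[OF ac const] by blast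
  define W where "W x = Sup (var_sums D x)" for x
  have bdd: "bdd_above (var_sums D x)" for x using K by (auto simp: bdd_above_def)
  have ne: "var_sums D x \<noteq> {}" for x
    unfolding var_sums_def by (auto simp: disjoint_intervals_def disjoint_family_on_def intro!: exI[of _ "0::nat"])
  have W: "\<bar>D y - D x\<bar> \<le> W y - W x" if xy: "x \<le> y" for x y
  proof -
    have "W x \<le> W y - \<bar>D y - D x\<bar>" unfolding W_def
    proof (rule cSup_least[OF ne])
      fix s assume "s \<in> var_sums D x"
      then obtain n u v where s: "disjoint_intervals {..<n::nat} u v" "\<forall>i<n. v i \<le> x" "s = (\<Sum>i<n. \<bar>D (v i) - D (u i)\<bar>)"
        by (auto simp: var_sums_def)
      \<comment> \<open>The interval from x to y is appended to a system that ends left of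
        x.\<close>
      define u' v' where "u' = u(n := x)" and "v' = v(n := y)"
      have "{u i<..<v i} \<inter> {x<..<y} = {}" "{x<..<y} \<inter> {u i<..<v i} = {}" if "i < n" for i using s(2) that by auto
      then have dj: "{u' i<..<v' i} \<inter> {u' j<..<v' j} = {}" if "i < Suc n" "j < Suc n" "i \<noteq> j" for i j
        using that s(1) unfolding disjoint_intervals_def disjoint_family_on_def u'_def v'_def less_Suc_eq
        by (elim disjE) (simp_all del: Int_greaterThanLessThan)
      have "disjoint_intervals {..<Suc n} u' v'"
        unfolding disjoint_intervals_def disjoint_family_on_def
      proof (intro conjI ballI impI)
        fix i assume "i \<in> {..<Suc n}"
        then show "u' i \<le> v' i" using s(1) xy by (auto simp: disjoint_intervals_def u'_def v'_def less_Suc_eq)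
      next
        fix i j assume "i \<in> {..<Suc n}" "j \<in> {..<Suc n}" "i \<noteq> j"
        then show "{u' i<..<v' i} \<inter> {u' j<..<v' j} = {}" by (intro dj) simp_all
      qed simp
      moreover have "\<forall>i<Suc n. v' i \<le> y" using s(2) xy by (auto simp: v'_def less_Suc_eq intro: order_trans)
      moreover have "s + \<bar>D y - D x\<bar> = (\<Sum>i<Suc n. \<bar>D (v' i) - D (u' i)\<bar>)" by (simp add: s(3) u'_def v'_def)
      ultimately have "s + \<bar>D y - D x\<bar> \<in> var_sums D y" unfolding var_sums_def by blast
      then show "s \<le> Sup (var_sums D y) - \<bar>D y - D x\<bar>" using cSup_upper[OF _ bdd] by fastforce
    qed
    then show ?thesis by simp
  qed
  have "ac_fun W" unfolding ac_fun_def
  proof (intro allI impI)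
    fix e :: real assume e: "e > 0"
    obtain d where d: "0 < d" "\<And>(I::(nat \<times> nat) set) u v. disjoint_intervals I u v \<Longrightarrow> (\<Sum>i\<in>I. v i - u i) < d \<Longrightarrow> (\<Sum>i\<in>I. \<bar>D (v i) - D (u i)\<bar>) \<le> e"
      using ac_funD[OF ac e] by metis
    show "\<exists>d>0. \<forall>(n::nat) u v. disjoint_intervals {..<n} u v \<longrightarrow> (\<Sum>i<n. v i - u i) < d \<longrightarrow> (\<Sum>i<n. \<bar>W (v i) - W (u i)\<bar>) \<le> e"
    proof (intro exI[of _ d] conjI allI impI d(1))
      fix m :: nat and x y assume xy: "disjoint_intervals {..<m} x y" "(\<Sum>k<m. y k - x k) < d"
      have xley: "x k \<le> y k" if "k < m" for k using xy(1) that by (simp add: disjoint_intervals_def)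
      have "(\<Sum>k<m. W (y k) - W (x k)) \<le> e + \<epsilon>" if \<epsilon>: "\<epsilon> > 0" for \<epsilon>
      proof -
        \<comment> \<open>In each of the m intervals a system is chosen whose sum misses the
          increment of W by at most \<eta>. Together these systems, indexed by pairs, are no longer
          than the given intervals and lose at most \<epsilon>.\<close>
        define \<eta> where "\<eta> = \<epsilon> / (real m + 1)"
        have \<eta>: "\<eta> > 0" "real m * \<eta> \<le> \<epsilon>" using \<epsilon> by (auto simp: \<eta>_def field_simps)
        have "\<exists>n u v. disjoint_intervals {..<n::nat} u v \<and> (\<forall>i<n. x k \<le> u i \<and> v i \<le> y k) \<and>
            W (y k) - W (x k) - \<eta> \<le> (\<Sum>i<n. \<bar>D (v i) - D (u i)\<bar>)" if k: "k < m" for k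
        proof -
          have "W (y k) - \<eta> < Sup (var_sums D (y k))" using \<eta> by (simp add: W_def)
          then obtain s where "s \<in> var_sums D (y k)" "W (y k) - \<eta> < s" using less_cSupE[OF _ ne] by blast
          then obtain n u v where s: "disjoint_intervals {..<n::nat} u v" "\<forall>i<n. v i \<le> y k"
            "W (y k) - \<eta> < (\<Sum>i<n. \<bar>D (v i) - D (u i)\<bar>)" by (auto simp: var_sums_def)
          \<comment> \<open>Cutting at x k: the parts to the left contribute at most W (x k), and
            the parts to the right form the wanted system.\<close>
          note mm = disjoint_intervals_min_max[OF s(1), of "x k"]
          have "(\<Sum>i<n. \<bar>D (min (v i) (x k)) - D (min (u i) (x k))\<bar>) \<in> var_sums D (x k)"
            unfolding var_sums_def using mm(1) by fastforce
          then have "(\<Sum>i<n. \<bar>D (min (v i) (x k)) - D (min (u i) (x k))\<bar>) \<le> W (x k)"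
            unfolding W_def by (rule cSup_upper[OF _ bdd])
          moreover have "(\<Sum>i<n. \<bar>D (v i) - D (u i)\<bar>) \<le> (\<Sum>i<n. \<bar>D (min (v i) (x k)) - D (min (u i) (x k))\<bar>)
              + (\<Sum>i<n. \<bar>D (max (v i) (x k)) - D (max (u i) (x k))\<bar>)"
            unfolding sum.distrib[symmetric]
            using s(1) by (intro sum_mono abs_diff_split) (auto simp: disjoint_intervals_def)
          ultimately have "W (y k) - W (x k) - \<eta> \<le> (\<Sum>i<n. \<bar>D (max (v i) (x k)) - D (max (u i) (x k))\<bar>)"
            using s(3) by linarith
          moreover have "\<forall>i<n. x k \<le> max (u i) (x k) \<and> max (v i) (x k) \<le> y k" using s(2) xley[OF k] by auto
          ultimately show ?thesis using mm(2) by blast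
        qed
        then have "\<forall>k\<in>{..<m}. \<exists>p. case p of (n, u, v) \<Rightarrow> disjoint_intervals {..<n::nat} u v \<and>
            (\<forall>i<n. x k \<le> u i \<and> v i \<le> y k) \<and> W (y k) - W (x k) - \<eta> \<le> (\<Sum>i<n. \<bar>D (v i) - D (u i)\<bar>)"
          by (simp add: split_paired_Ex)
        from bchoice[OF this] obtain P where P: "\<forall>k\<in>{..<m}. case P k of (n, u, v) \<Rightarrow> disjoint_intervals {..<n::nat} u v \<and>
            (\<forall>i<n. x k \<le> u i \<and> v i \<le> y k) \<and> W (y k) - W (x k) - \<eta> \<le> (\<Sum>i<n. \<bar>D (v i) - D (u i)\<bar>)" ..
        define N U V where "N k = fst (P k)" and "U k = fst (snd (P k))" and "V k = snd (snd (P k))" for k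
        have NUV: "disjoint_intervals {..<N k} (U k) (V k)"
          "i < N k \<Longrightarrow> x k \<le> U k i \<and> V k i \<le> y k"
          "W (y k) - W (x k) - \<eta> \<le> (\<Sum>i<N k. \<bar>D (V k i) - D (U k i)\<bar>)" if "k < m" for k i
          using P that by (auto simp: N_def U_def V_def split_def)
        define I where "I = Sigma {..<m} (\<lambda>k. {..<N k})"
        define u v where "u = (\<lambda>(k, i). U k i)" and "v = (\<lambda>(k, i). V k i)"
        have "disjoint_family_on (\<lambda>i. {u i<..<v i}) I" unfolding disjoint_family_on_def
        proof (intro ballI impI)
          fix a b assume ab: "a \<in> I" "b \<in> I" "a \<noteq> b"
          obtain k i l j where kl: "a = (k, i)" "b = (l, j)" "k < m" "l < m" "i < N k" "j < N l"
            using ab by (auto simp: I_def)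
          show "{u a<..<v a} \<inter> {u b<..<v b} = {}"
          proof (cases "k = l")
            case True
            then have "i \<noteq> j" using ab kl by auto
            then show ?thesis using NUV(1)[of k] kl True
              by (auto simp: u_def v_def disjoint_intervals_def disjoint_family_on_def)
          next
            case False
            then have "{x k<..<y k} \<inter> {x l<..<y l} = {}" using xy(1) kl
              by (auto simp: disjoint_intervals_def disjoint_family_on_def)
            moreover have "{u a<..<v a} \<subseteq> {x k<..<y k}" "{u b<..<v b} \<subseteq> {x l<..<y l}"
              using NUV(2)[of k i] NUV(2)[of l j] kl by (auto simp: u_def v_def)
            ultimately show ?thesis by blast
          qed
        qed
        moreover have "\<forall>i\<in>I. u i \<le> v i" using NUV(1) by (auto simp: I_def u_def v_def disjoint_intervals_def)
        moreover have "finite I" by (simp add: I_def)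
        ultimately have di: "disjoint_intervals I u v" by (simp add: disjoint_intervals_def)
        have "(\<Sum>i\<in>I. v i - u i) = (\<Sum>k<m. \<Sum>i<N k. V k i - U k i)"
          unfolding I_def by (subst sum.Sigma) (auto simp: u_def v_def split_def)
        also have "\<dots> \<le> (\<Sum>k<m. y k - x k)"
        proof (rule sum_mono)
          fix k assume "k \<in> {..<m}"
          then show "(\<Sum>i<N k. V k i - U k i) \<le> y k - x k"
            using NUV(2)[of k] xley[of k] by (intro disjoint_intervals_length_le[OF NUV(1)]) auto
        qed
        finally have "(\<Sum>i\<in>I. \<bar>D (v i) - D (u i)\<bar>) \<le> e" using xy(2) by (intro d(2)[OF di]) linarith
        moreover have "(\<Sum>i\<in>I. \<bar>D (v i) - D (u i)\<bar>) = (\<Sum>k<m. \<Sum>i<N k. \<bar>D (V k i) - D (U k i)\<bar>)"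
          unfolding I_def by (subst sum.Sigma) (auto simp: u_def v_def split_def)
        moreover have "(\<Sum>k<m. W (y k) - W (x k) - \<eta>) \<le> (\<Sum>k<m. \<Sum>i<N k. \<bar>D (V k i) - D (U k i)\<bar>)"
          using NUV(3) by (intro sum_mono) auto
        moreover have "(\<Sum>k<m. W (y k) - W (x k) - \<eta>) = (\<Sum>k<m. W (y k) - W (x k)) - real m * \<eta>"
          by (simp add: sum_subtractf)
        ultimately show ?thesis using \<eta> by linarith
      qed
      then have "(\<Sum>k<m. W (y k) - W (x k)) \<le> e" by (rule field_le_epsilon)
      moreover have "(\<Sum>k<m. \<bar>W (y k) - W (x k)\<bar>) = (\<Sum>k<m. W (y k) - W (x k))"
      proof (intro sum.cong refl)
        fix k assume "k \<in> {..<m}"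
        then have "0 \<le> W (y k) - W (x k)" using W[OF xley[of k]] by (meson abs_ge_zero lessThan_iff order_trans)
        then show "\<bar>W (y k) - W (x k)\<bar> = W (y k) - W (x k)" by simp
      qed
      ultimately show "(\<Sum>k<m. \<bar>W (y k) - W (x k)\<bar>) \<le> e" by simp
    qed
  qed
  then show ?thesis using W by (rule that)
qed

section \<open>Densities of absolutely continuous functions\<close>

definition indefinite_integral :: "(real \<Rightarrow> real) \<Rightarrow> (real \<Rightarrow> real) \<Rightarrow> bool" where
  "indefinite_integral D g \<longleftrightarrow> g \<in> borel_measurable borel \<and>
     (\<forall>x y. x \<le> y \<longrightarrow> set_integrable lborel {x..y} g \<and> (LINT t:{x..y}|lborel. g t) = D y - D x)"

text \<open>Lusin's property N. An open set T of small measure around N is used to cover N by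
  non-overlapping intervals inside T, and absolute continuity bounds the total increment of M over
  any finite number of them.\<close>

lemma ac_mono_null_bounded:
  assumes ac: "ac_fun M" and mono: "mono M" and N: "N \<in> null_sets lborel" "N \<subseteq> {-k..k}" and k: "0 < k" and e: "0 < e"
  shows "emeasure (interval_measure M) N \<le> ennreal e"
proof -
  define m where "m = interval_measure M"
  have cont: "continuous_on UNIV M" by (rule ac_fun_continuous[OF ac])
  have sm: "sets m = sets borel" by (simp add: m_def)
  have mIcc: "emeasure m {a..b} = ennreal (M b - M a)" if "a \<le> b" for a b
    unfolding m_def by (rule emeasure_interval_measure_Icc[OF that _ cont]) (use mono in \<open>auto dest: monoD\<close>)
  obtain d where d: "0 < d" "\<And>(I::real set set) u v. disjoint_intervals I u v \<Longrightarrow> (\<Sum>i\<in>I. v i - u i) < d \<Longrightarrow> (\<Sum>i\<in>I. \<bar>M (v i) - M (u i)\<bar>) \<le> e"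
    using ac_funD[OF ac e] by metis
  have NL: "N \<in> sets lebesgue" "emeasure lebesgue N = 0" using N(1)
    by (auto simp: null_sets_def intro: null_sets_completionI)
  obtain T where T: "open T" "N \<subseteq> T" "emeasure lebesgue (T - N) < ennreal d"
    using sets_lebesgue_outer_open[OF NL(1) d(1)] by metis
  have Tb: "T \<in> sets borel" using T(1) by simp
  have "emeasure lborel T \<le> emeasure lebesgue (T - N) + emeasure lebesgue N"
  proof -
    have "emeasure lborel T = emeasure lebesgue T" using Tb by (simp add: emeasure_completion)
    also have "\<dots> \<le> emeasure lebesgue ((T - N) \<union> N)" using NL(1) Tb by (intro emeasure_mono) auto
    also have "\<dots> \<le> emeasure lebesgue (T - N) + emeasure lebesgue N"
      using NL(1) Tb by (intro emeasure_subadditive) auto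
    finally show ?thesis .
  qed
  then have Td: "emeasure lborel T < ennreal d" using T(3) NL(2) by simp
  \<comment> \<open>Every interval of the covering has a tag in N, and the gauge then forces it into
    T.\<close>
  define g where "g x = (if x \<in> T then T else UNIV)" for x :: real
  have "gauge g" using T(1) by (auto simp: gauge_def g_def)
  moreover have "N \<subseteq> cbox (-k) k" "box (-k) k \<noteq> {}" using N(2) k by (auto simp: box_real)
  ultimately obtain DD where DD: "countable DD" "\<And>K. K \<in> DD \<Longrightarrow> interior K \<noteq> {} \<and> (\<exists>c d. K = cbox c d)"
    "pairwise (\<lambda>A B. interior A \<inter> interior B = {}) DD" "\<And>K. K \<in> DD \<Longrightarrow> \<exists>x\<in>N \<inter> K. K \<subseteq> g x" "N \<subseteq> \<Union>DD"
    by (metis covering_lemma)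
  have "\<forall>K\<in>DD. \<exists>c d. K = {c..d} \<and> c < d"
  proof
    fix K assume "K \<in> DD"
    then obtain c d where K: "K = cbox c d" "interior K \<noteq> {}" using DD(2) by metis
    then have "c < d" by (auto simp: interior_cbox box_real)
    then show "\<exists>c d. K = {c..d} \<and> c < d" using K by auto
  qed
  then obtain c b where cb: "\<And>K. K \<in> DD \<Longrightarrow> K = {c K..b K} \<and> c K < b K" by metis
  have int: "interior K = {c K<..<b K}" if "K \<in> DD" for K using cb[OF that] by (metis interior_atLeastAtMost_real)
  have KT: "K \<subseteq> T" if K: "K \<in> DD" for K
  proof -
    obtain x where x: "x \<in> N" "K \<subseteq> g x" using DD(4)[OF K] by blast
    then have "x \<in> T" using T(2) by blast
    then show ?thesis using x(2) by (simp add: g_def)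
  qed
  have fin: "(\<Sum>K\<in>F. emeasure m K) \<le> ennreal e" if F: "F \<subseteq> DD" "finite F" for F
  proof -
    have di: "disjoint_intervals F c b"
      unfolding disjoint_intervals_def disjoint_family_on_def
    proof (intro conjI ballI impI F(2))
      fix K assume "K \<in> F" then show "c K \<le> b K" using cb F by (meson less_imp_le subsetD)
    next
      fix K L assume "K \<in> F" "L \<in> F" "K \<noteq> L"
      then show "{c K<..<b K} \<inter> {c L<..<b L} = {}" using DD(3) int F(1) unfolding pairwise_def by (metis subsetD)
    qed
    have "ennreal (\<Sum>K\<in>F. b K - c K) \<le> emeasure lborel T"
      by (rule disjoint_intervals_length[OF di _ Tb]) (use int KT F(1) interior_subset in blast)
    then have "ennreal (\<Sum>K\<in>F. b K - c K) < ennreal d" using Td by (rule le_less_trans)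
    moreover have "0 \<le> (\<Sum>K\<in>F. b K - c K)" using di by (intro sum_nonneg) (simp add: disjoint_intervals_def)
    ultimately have "(\<Sum>K\<in>F. b K - c K) < d" by (simp only: ennreal_less_iff)
    then have "(\<Sum>K\<in>F. \<bar>M (b K) - M (c K)\<bar>) \<le> e" by (rule d(2)[OF di])
    moreover have "(\<Sum>K\<in>F. emeasure m K) = (\<Sum>K\<in>F. ennreal (\<bar>M (b K) - M (c K)\<bar>))"
    proof (rule sum.cong[OF refl])
      fix K assume "K \<in> F"
      then have K: "K = {c K..b K}" "c K < b K" using cb F by blast+
      have "emeasure m {c K..b K} = ennreal (M (b K) - M (c K))" using K(2) by (intro mIcc) simp
      moreover have "M (c K) \<le> M (b K)" using K(2) mono by (simp add: monoD)
      ultimately show "emeasure m K = ennreal (\<bar>M (b K) - M (c K)\<bar>)" using K(1) by simp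
    qed
    moreover have "(\<Sum>K\<in>F. ennreal (\<bar>M (b K) - M (c K)\<bar>)) = ennreal (\<Sum>K\<in>F. \<bar>M (b K) - M (c K)\<bar>)"
      by (rule sum_ennreal) simp
    ultimately show ?thesis by (simp add: ennreal_leI)
  qed
  have meas: "K \<in> sets m" if "K \<in> DD" for K using cb[OF that] sm by (metis atLeastAtMost_borel)
  show ?thesis
  proof (cases "DD = {}")
    case True
    then have "N = {}" using DD(5) by auto
    then show ?thesis by simp
  next
    case False
    \<comment> \<open>Absolute continuity speaks of finite systems, so the bound reaches the whole
      cover along an increasing sequence of finite unions.\<close>
    define h where "h = from_nat_into DD"
    have h: "h n \<in> DD" "range h = DD" for n
      using False DD(1) by (auto simp: h_def from_nat_into range_from_nat_into)
    define A where "A n = (\<Union>i<n. h i)" for n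
    have "incseq A" unfolding A_def by (intro incseq_SucI UN_mono) auto
    moreover have Am: "range A \<subseteq> sets m" using h(1) meas by (auto simp: A_def intro!: sets.finite_UN)
    ultimately have "(SUP n. emeasure m (A n)) = emeasure m (\<Union>n. A n)" by (intro SUP_emeasure_incseq)
    moreover have "emeasure m (A n) \<le> ennreal e" for n
    proof -
      have "A n = (\<Union>K\<in>h ` {..<n}. K)" by (simp add: A_def)
      moreover have "emeasure m (\<Union>K\<in>h ` {..<n}. K) \<le> (\<Sum>K\<in>h ` {..<n}. emeasure m K)"
        using h(1) meas by (intro emeasure_subadditive_finite) auto
      ultimately have "emeasure m (A n) \<le> (\<Sum>K\<in>h ` {..<n}. emeasure m K)" by (simp only:)
      also have "\<dots> \<le> ennreal e" using h(1) by (intro fin) auto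
      finally show ?thesis .
    qed
    ultimately have "emeasure m (\<Union>n. A n) \<le> ennreal e" by (metis SUP_least)
    moreover have "N \<subseteq> (\<Union>n. A n)"
    proof -
      have "\<Union>DD = (\<Union>n. A n)" using h(2) by (fastforce simp: A_def)
      then show ?thesis using DD(5) by simp
    qed
    moreover have "(\<Union>n. A n) \<in> sets m" using Am by blast
    ultimately show ?thesis unfolding m_def[symmetric] by (meson emeasure_mono order_trans)
  qed
qed

text \<open>Lebesgue null sets are null for the interval measure of M, so the density is supplied by
  Radon-Nikodym.\<close>

lemma ac_mono_density:
  assumes ac: "ac_fun M" and mono: "mono M"
  obtains g where "indefinite_integral M g" "\<And>x. 0 \<le> g x"
proof -
  define m where "m = interval_measure M"
  have cont: "continuous_on UNIV M" by (rule ac_fun_continuous[OF ac])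
  have sm: "sets m = sets lborel" by (simp add: m_def)
  have mIcc: "emeasure m {a..b} = ennreal (M b - M a)" if "a \<le> b" for a b
    unfolding m_def by (rule emeasure_interval_measure_Icc[OF that _ cont]) (use mono in \<open>auto dest: monoD\<close>)
  have "absolutely_continuous lborel m"
    unfolding absolutely_continuous_def
  proof
    fix N :: "real set" assume N: "N \<in> null_sets lborel"
    have Nb: "N \<in> sets borel" using N by auto
    \<comment> \<open>Bounded pieces, because the covering takes place inside a box.\<close>
    have bd: "emeasure m (N \<inter> {- real (Suc k)..real (Suc k)}) = 0" for k
    proof -
      have nk: "N \<inter> {- real (Suc k)..real (Suc k)} \<in> null_sets lborel"
        using N by (intro null_set_Int2) auto
      have "emeasure m (N \<inter> {- real (Suc k)..real (Suc k)}) \<le> 0 + ennreal e" if "0 < e" for e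
        using ac_mono_null_bounded[OF ac mono nk Int_lower2 _ that] unfolding m_def by simp
      then have "emeasure m (N \<inter> {- real (Suc k)..real (Suc k)}) \<le> 0"
        by (rule ennreal_le_epsilon)
      then show ?thesis by simp
    qed
    have "N \<subseteq> (\<Union>k. N \<inter> {- real (Suc k)..real (Suc k)})"
    proof
      fix x assume "x \<in> N"
      obtain k :: nat where "\<bar>x\<bar> < k" using reals_Archimedean2 by blast
      then show "x \<in> (\<Union>k. N \<inter> {- real (Suc k)..real (Suc k)})" using \<open>x \<in> N\<close> by (auto intro!: exI[of _ k])
    qed
    moreover have "(\<Union>k. N \<inter> {- real (Suc k)..real (Suc k)}) \<in> null_sets m"
      using bd Nb sm by (intro null_sets_UN) (auto simp: null_sets_def)
    ultimately show "N \<in> null_sets m" using Nb sm by (metis null_sets_subset sets_lborel)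
  qed
  then obtain f where f: "f \<in> borel_measurable lborel" "density lborel f = m"
    using sigma_finite_measure.Radon_Nikodym[OF sigma_finite_lborel _ sm] by blast
  define g where "g x = enn2real (f x)" for x
  have g[measurable]: "g \<in> borel_measurable borel" unfolding g_def using f(1) by measurable
  have "set_integrable lborel {x..y} g \<and> (LINT t:{x..y}|lborel. g t) = M y - M x" if xy: "x \<le> y" for x y
  proof -
    have M: "M x \<le> M y" using mono xy by (rule monoD)
    have fI: "(\<integral>\<^sup>+t. f t * indicator {x..y} t \<partial>lborel) = ennreal (M y - M x)"
    proof -
      have "emeasure (density lborel f) {x..y} = ennreal (M y - M x)" unfolding f(2) by (rule mIcc[OF xy])
      then show ?thesis using f(1) by (simp add: emeasure_density)
    qed
    then have "AE t in lborel. f t * indicator {x..y} t \<noteq> \<infinity>"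
      using f(1) by (intro nn_integral_PInf_AE) auto
    then have "(\<integral>\<^sup>+t. f t * indicator {x..y} t \<partial>lborel) = (\<integral>\<^sup>+t. ennreal (indicator {x..y} t *\<^sub>R g t) \<partial>lborel)"
      by (intro nn_integral_cong_AE) (auto simp: g_def indicator_def top.not_eq_extremum split: if_splits)
    then have I: "(\<integral>\<^sup>+t. ennreal (indicator {x..y} t *\<^sub>R g t) \<partial>lborel) = ennreal (M y - M x)" using fI by simp
    have nn: "AE t in lborel. 0 \<le> indicator {x..y} t *\<^sub>R g t" by (auto simp: g_def)
    have "integrable lborel (\<lambda>t. indicator {x..y} t *\<^sub>R g t)"
      by (rule integrableI_nn_integral_finite[OF _ nn I]) (use M in auto)
    moreover have "integral\<^sup>L lborel (\<lambda>t. indicator {x..y} t *\<^sub>R g t) = M y - M x"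
    proof (subst integral_eq_nn_integral[OF _ nn])
      show "enn2real (\<integral>\<^sup>+t. ennreal (indicator {x..y} t *\<^sub>R g t) \<partial>lborel) = M y - M x"
        unfolding I using M by simp
    qed simp
    ultimately show ?thesis by (simp add: set_integrable_def set_lebesgue_integral_def)
  qed
  then have "indefinite_integral M g" unfolding indefinite_integral_def by simp
  then show ?thesis by (rule that) (simp add: g_def)
qed

lemma ac_fun_diff:
  assumes "ac_fun D" "ac_fun E" shows "ac_fun (\<lambda>x. D x - E x)"
  unfolding ac_fun_def
proof (intro allI impI)
  fix e :: real assume "e > 0"
  then have e2: "e/2 > 0" by simp
  obtain d1 where d1: "0 < d1" "\<And>(I::nat set) u v. disjoint_intervals I u v \<Longrightarrow> (\<Sum>i\<in>I. v i - u i) < d1 \<Longrightarrow> (\<Sum>i\<in>I. \<bar>D (v i) - D (u i)\<bar>) \<le> e/2"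
    using ac_funD[OF assms(1) e2] by metis
  obtain d2 where d2: "0 < d2" "\<And>(I::nat set) u v. disjoint_intervals I u v \<Longrightarrow> (\<Sum>i\<in>I. v i - u i) < d2 \<Longrightarrow> (\<Sum>i\<in>I. \<bar>E (v i) - E (u i)\<bar>) \<le> e/2"
    using ac_funD[OF assms(2) e2] by metis
  show "\<exists>d>0. \<forall>(n::nat) u v. disjoint_intervals {..<n} u v \<longrightarrow> (\<Sum>i<n. v i - u i) < d \<longrightarrow>
      (\<Sum>i<n. \<bar>D (v i) - E (v i) - (D (u i) - E (u i))\<bar>) \<le> e"
  proof (intro exI[of _ "min d1 d2"] conjI allI impI)
    fix n :: nat and u v assume uv: "disjoint_intervals {..<n} u v" "(\<Sum>i<n. v i - u i) < min d1 d2"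
    have "(\<Sum>i<n. \<bar>D (v i) - E (v i) - (D (u i) - E (u i))\<bar>) \<le> (\<Sum>i<n. \<bar>D (v i) - D (u i)\<bar> + \<bar>E (v i) - E (u i)\<bar>)"
      by (intro sum_mono) linarith
    also have "\<dots> \<le> e" using d1(2)[OF uv(1)] d2(2)[OF uv(1)] uv(2) by (simp add: sum.distrib)
    finally show "(\<Sum>i<n. \<bar>D (v i) - E (v i) - (D (u i) - E (u i))\<bar>) \<le> e" .
  qed (use d1 d2 in auto)
qed

lemma indefinite_integral_diff:
  assumes "indefinite_integral D g" "indefinite_integral E h"
  shows "indefinite_integral (\<lambda>x. D x - E x) (\<lambda>x. g x - h x)"
  using assms unfolding indefinite_integral_def by (auto simp: set_integral_diff)

lemma abs_continuous_density:
  assumes "\<alpha> < \<beta>" "abs_continuous_on {\<alpha><..<\<beta>} D"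
  obtains D' g where "indefinite_integral D' g" "continuous_on UNIV D'" "\<And>x. \<alpha> < x \<Longrightarrow> x < \<beta> \<Longrightarrow> D' x = D x"
proof -
  obtain D' where D': "ac_fun D'" "\<And>x. \<alpha> < x \<Longrightarrow> x < \<beta> \<Longrightarrow> D' x = D x"
    "\<And>x. x \<le> \<alpha> \<Longrightarrow> D' x = D' \<alpha>" "\<And>x. \<beta> \<le> x \<Longrightarrow> D' x = D' \<beta>" using ac_extension[OF assms] by metis
  obtain W where W: "ac_fun W" "\<And>x y. x \<le> y \<Longrightarrow> \<bar>D' y - D' x\<bar> \<le> W y - W x"
    using ac_variation_function[OF D'(1,3,4)] by metis
  have m1: "mono W"
  proof (rule monoI)
    fix x y :: real assume "x \<le> y" then show "W x \<le> W y" using W(2)[of x y] by linarith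
  qed
  have m2: "mono (\<lambda>x. W x - D' x)"
  proof (rule monoI)
    fix x y :: real assume "x \<le> y" then show "W x - D' x \<le> W y - D' y" using W(2)[of x y] by linarith
  qed
  have a2: "ac_fun (\<lambda>x. W x - D' x)" by (rule ac_fun_diff[OF W(1) D'(1)])
  obtain g where g: "indefinite_integral W g" by (rule ac_mono_density[OF W(1) m1])
  obtain h where h: "indefinite_integral (\<lambda>x. W x - D' x) h" by (rule ac_mono_density[OF a2 m2])
  have "indefinite_integral D' (\<lambda>x. g x - h x)" using indefinite_integral_diff[OF g h] by simp
  then show ?thesis using ac_fun_continuous[OF D'(1)] D'(2) by (rule that)
qed

section \<open>Primitives and the derivative of the lift\<close>

lemma set_integral_combine:
  fixes g :: "real \<Rightarrow> real"
  assumes "x \<le> y" "y \<le> z" "set_integrable lborel {x..y} g" "set_integrable lborel {y..z} g"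
  shows "set_integrable lborel {x..z} g"
    "(LINT t:{x..z}|lborel. g t) = (LINT t:{x..y}|lborel. g t) + (LINT t:{y..z}|lborel. g t)"
proof -
  have "{x..y} \<union> {y..z} = {x..z}" using assms(1,2) by (rule ivl_disj_un_two_touch(4))
  then show i: "set_integrable lborel {x..z} g" using set_integrable_Un[OF assms(3,4)] by simp
  show "(LINT t:{x..z}|lborel. g t) = (LINT t:{x..y}|lborel. g t) + (LINT t:{y..z}|lborel. g t)"
    unfolding set_borel_integral_eq_integral(2)[OF i] set_borel_integral_eq_integral(2)[OF assms(3)]
      set_borel_integral_eq_integral(2)[OF assms(4)]
    using Henstock_Kurzweil_Integration.integral_combine[OF assms(1,2) set_borel_integral_eq_integral(1)[OF i]] by simp
qed

lemma primitive_exists: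
  fixes g :: "real \<Rightarrow> real"
  assumes "g \<in> borel_measurable borel" "\<And>x y. set_integrable lborel {x..y} g"
  obtains G where "indefinite_integral G g"
proof -
  define G where "G x = (if 0 \<le> x then LINT t:{0..x}|lborel. g t else - (LINT t:{x..0}|lborel. g t))" for x
  have "(LINT t:{x..y}|lborel. g t) = G y - G x" if xy: "x \<le> y" for x y
  proof -
    consider "0 \<le> x" | "x < 0" "0 \<le> y" | "y < 0" by linarith
    then show ?thesis
    proof cases
      case 1
      then show ?thesis using set_integral_combine(2)[of 0 x y g] assms(2) xy by (simp add: G_def)
    next
      case 2
      then show ?thesis using set_integral_combine(2)[of x 0 y g] assms(2) xy by (simp add: G_def)
    next
      case 3
      then show ?thesis using set_integral_combine(2)[of x y 0 g] assms(2) xy by (simp add: G_def)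
    qed
  qed
  then have "indefinite_integral G g" using assms by (simp add: indefinite_integral_def)
  then show ?thesis by (rule that)
qed

lemma set_integral_shift:
  fixes g :: "real \<Rightarrow> real"
  shows "(LINT t:{x + s..y + s}|lborel. g t) = (LINT t:{x..y}|lborel. g (t + s))"
    "set_integrable lborel {x + s..y + s} g \<longleftrightarrow> set_integrable lborel {x..y} (\<lambda>t. g (t + s))"
proof -
  have e: "indicator {x + s..y + s} (s + 1 * t) *\<^sub>R g (s + 1 * t) = indicator {x..y} t *\<^sub>R g (t + s)" for t
    by (simp add: indicator_def add.commute)
  show "(LINT t:{x + s..y + s}|lborel. g t) = (LINT t:{x..y}|lborel. g (t + s))"
    unfolding set_lebesgue_integral_def
    using lborel_integral_real_affine[of 1 "\<lambda>t. indicator {x + s..y + s} t *\<^sub>R g t" s] unfolding e by simp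
  show "set_integrable lborel {x + s..y + s} g \<longleftrightarrow> set_integrable lborel {x..y} (\<lambda>t. g (t + s))"
    unfolding set_integrable_def
    using lborel_integrable_real_affine_iff[of 1 "\<lambda>t. indicator {x + s..y + s} t *\<^sub>R g t" s] unfolding e by simp
qed

lemma indefinite_integral_quasiperiodic:
  assumes G: "indefinite_integral G g" and per: "\<And>x. g (x + 1) = g x"
  shows "G (x + 1) - G x = G 1 - G 0"
proof -
  have *: "G (y + 1) - G (x + 1) = G y - G x" if "x \<le> y" for x y
  proof -
    have i: "(LINT t:{u..v}|lborel. g t) = G v - G u" if "u \<le> v" for u v
      using G that by (simp add: indefinite_integral_def)
    have "(LINT t:{x + 1..y + 1}|lborel. g t) = (LINT t:{x..y}|lborel. g t)"
      by (simp only: set_integral_shift(1) per)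
    then show ?thesis using i[of x y] i[of "x + 1" "y + 1"] that by simp
  qed
  show ?thesis using *[of 0 x] *[of x 0] by (cases "0 \<le> x") auto
qed

text \<open>Glues statements about intervals within single cells, for functions that are defined
  cell by cell. The interval is cut at the first cell boundary to the right of x, with induction on
  the number of boundaries crossed.\<close>

lemma periodic_cells_induct:
  fixes P :: "real \<Rightarrow> real \<Rightarrow> bool"
  assumes trans: "\<And>x y z. x \<le> y \<Longrightarrow> y \<le> z \<Longrightarrow> P x y \<Longrightarrow> P y z \<Longrightarrow> P x z"
    and cell: "\<And>n x y. a + of_int n \<le> x \<Longrightarrow> x \<le> y \<Longrightarrow> y \<le> a + of_int n + 1 \<Longrightarrow> P x y"
    and xy: "x \<le> y"
  shows "P x y"
proof -
  have "P x y" if "x \<le> y" "nat (\<lfloor>y - a\<rfloor> - \<lfloor>x - a\<rfloor>) = k" for k x y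
    using that
  proof (induction k arbitrary: x)
    case 0
    then have "\<lfloor>y - a\<rfloor> = \<lfloor>x - a\<rfloor>" using floor_mono[of "x - a" "y - a"] by linarith
    then show ?case using 0 by (intro cell[of "\<lfloor>x - a\<rfloor>"]) linarith+
  next
    case (Suc k)
    define z where "z = a + of_int \<lfloor>x - a\<rfloor> + 1"
    have fz: "\<lfloor>z - a\<rfloor> = \<lfloor>x - a\<rfloor> + 1" by (simp add: z_def)
    have "of_int (\<lfloor>x - a\<rfloor> + 1) \<le> y - a" using Suc.prems(2) by linarith
    then have "z \<le> y" by (simp add: z_def)
    moreover have "x \<le> z" unfolding z_def by linarith
    moreover have "P z y" using Suc \<open>z \<le> y\<close> fz by (intro Suc.IH) auto
    moreover have "P x z" using \<open>x \<le> z\<close> by (intro cell[of "\<lfloor>x - a\<rfloor>"]) (auto simp: z_def, linarith)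
    ultimately show ?case using trans by blast
  qed
  then show ?thesis using xy by blast
qed

section \<open>Boundary values and jumps of log Df\<close>

lemma abs_continuous_ln:
  assumes "abs_continuous_on I D" "0 < k" "\<And>x. x \<in> I \<Longrightarrow> k < D x"
  shows "abs_continuous_on I (\<lambda>x. ln (D x))"
  unfolding abs_continuous_on_def
proof (intro allI impI)
  fix e :: real assume "e > 0"
  then have "e * k > 0" using assms(2) by simp
  then obtain d where d: "d > 0" "\<And>(n::nat) u v. (\<forall>i<n. u i \<le> v i \<and> {u i..v i} \<subseteq> I) \<and>
      disjoint_family_on (\<lambda>i. {u i<..<v i}) {..<n} \<and> (\<Sum>i<n. v i - u i) < d \<Longrightarrow> (\<Sum>i<n. \<bar>D (v i) - D (u i)\<bar>) < e * k"
    using assms(1) unfolding abs_continuous_on_def by meson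
  \<comment> \<open>On values above k the logarithm has Lipschitz constant 1 / k.\<close>
  have ln: "\<bar>ln s - ln t\<bar> \<le> \<bar>s - t\<bar> / k" if st: "k < s" "k < t" for s t
  proof -
    have *: "ln s - ln t \<le> \<bar>s - t\<bar> / k" if "k < s" "k < t" for s t
    proof -
      have "ln s - ln t \<le> (s - t) / t" using that assms(2) by (intro ln_diff_le) auto
      also have "\<dots> \<le> \<bar>s - t\<bar> / t" using that assms(2) by (intro divide_right_mono) auto
      also have "\<dots> \<le> \<bar>s - t\<bar> / k" using that assms(2) by (intro divide_left_mono) auto
      finally show ?thesis .
    qed
    show ?thesis using *[OF st] *[OF st(2,1)] by (simp add: abs_le_iff abs_minus_commute)
  qed
  show "\<exists>d>0. \<forall>(n::nat) u v. (\<forall>i<n. u i \<le> v i \<and> {u i..v i} \<subseteq> I) \<and> disjoint_family_on (\<lambda>i. {u i<..<v i}) {..<n} \<and>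
      (\<Sum>i<n. v i - u i) < d \<longrightarrow> (\<Sum>i<n. \<bar>ln (D (v i)) - ln (D (u i))\<bar>) < e"
  proof (intro exI[of _ d] conjI allI impI d(1))
    fix n :: nat and u v assume uv: "(\<forall>i<n. u i \<le> v i \<and> {u i..v i} \<subseteq> I) \<and>
      disjoint_family_on (\<lambda>i. {u i<..<v i}) {..<n} \<and> (\<Sum>i<n. v i - u i) < d"
    have "(\<Sum>i<n. \<bar>ln (D (v i)) - ln (D (u i))\<bar>) \<le> (\<Sum>i<n. \<bar>D (v i) - D (u i)\<bar> / k)"
    proof (intro sum_mono ln)
      fix i assume "i \<in> {..<n}"
      then have "u i \<le> v i" "{u i..v i} \<subseteq> I" using uv by auto
      then have "u i \<in> I" "v i \<in> I" by (auto simp: subset_iff)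
      then show "k < D (v i)" "k < D (u i)" using assms(3) by auto
    qed
    also have "\<dots> = (\<Sum>i<n. \<bar>D (v i) - D (u i)\<bar>) / k" by (simp add: sum_divide_distrib)
    also have "\<dots> < e" using d(2)[OF uv] assms(2) by (simp add: pos_divide_less_eq)
    finally show "(\<Sum>i<n. \<bar>ln (D (v i)) - ln (D (u i))\<bar>) < e" .
  qed
qed

lemma left_deriv_eq: "(f has_real_derivative D) (at_left x) \<Longrightarrow> left_deriv f x = D"
  unfolding left_deriv_def has_field_derivative_iff
  by (rule the_equality, assumption) (rule tendsto_unique[OF trivial_limit_at_left_real])

lemma right_deriv_eq: "(f has_real_derivative D) (at_right x) \<Longrightarrow> right_deriv f x = D"
  unfolding right_deriv_def has_field_derivative_iff
  by (rule the_equality, assumption) (rule tendsto_unique[OF trivial_limit_at_right_real])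

text \<open>If the derivative extends continuously to the end points, f is the integral of the
  extension on the closed interval, which yields the one-sided derivatives at the ends. In this way
  the jump ratios become exponentials of differences of boundary values of log Df.\<close>

lemma derivative_within_closed:
  assumes "\<alpha> < \<beta>" "continuous_on UNIV f" "continuous_on UNIV E"
    and der: "\<And>x. \<alpha> < x \<Longrightarrow> x < \<beta> \<Longrightarrow> (f has_real_derivative E x) (at x)" and x: "x \<in> {\<alpha>..\<beta>}"
  shows "(f has_real_derivative E x) (at x within {\<alpha>..\<beta>})"
proof -
  have F: "f t = f \<alpha> + integral {\<alpha>..t} E" if "t \<in> {\<alpha>..\<beta>}" for t
  proof -
    have "(E has_integral f t - f \<alpha>) {\<alpha>..t}"
    proof (rule fundamental_theorem_of_calculus_interior)
      show "\<alpha> \<le> t" using that by simp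
      show "continuous_on {\<alpha>..t} f" using assms(2) by (rule continuous_on_subset) simp
      show "(f has_vector_derivative E s) (at s)" if "s \<in> {\<alpha><..<t}" for s
        using der[of s] that \<open>t \<in> {\<alpha>..\<beta>}\<close> by (simp add: has_real_derivative_iff_has_vector_derivative)
    qed
    then show ?thesis by (simp add: integral_unique)
  qed
  have "((\<lambda>t. f \<alpha> + integral {\<alpha>..t} E) has_real_derivative E x) (at x within {\<alpha>..\<beta>})"
    by (rule derivative_eq_intros integral_has_real_derivative[OF continuous_on_subset[OF assms(3)] x] | simp)+
  then show ?thesis by (rule has_field_derivative_transform_within[OF _ zero_less_one x]) (erule F[symmetric])
qed

lemma circle_lift_deriv_add_int:
  assumes f: "circle_lift f" and D: "(f has_real_derivative D) (at x)"
  shows "(f has_real_derivative D) (at (x + of_int n))"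
proof -
  have "((\<lambda>t. f (t + of_int (- n)) + of_int n) has_real_derivative D) (at (x + of_int n))"
    using D by (auto intro!: derivative_eq_intros DERIV_chain'[where g = f] simp: )
  moreover have "(\<lambda>t. f (t + of_int (- n)) + of_int n) = f"
    using circle_lift_add_int[OF f, of _ "-n"] by auto
  ultimately show ?thesis by simp
qed

lemma class_P_deriv:
  assumes P: "class_P f"
  obtains c1 where "0 < c1"
    "\<And>x. frac x \<notin> break_points f \<Longrightarrow> (f has_real_derivative deriv f x) (at x) \<and> c1 < deriv f x"
proof -
  obtain c1 c2 where c: "0 < c1" "\<And>x. x \<in> {0..<1} - break_points f \<Longrightarrow> c1 < deriv f x"
    using P unfolding class_P_def by blast
  have f: "circle_lift f" using P by (simp add: class_P_def)
  have "(f has_real_derivative deriv f x) (at x) \<and> c1 < deriv f x" if x: "frac x \<notin> break_points f" for x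
  proof -
    have "frac x \<in> {0..<1}" by (simp add: frac_lt_1)
    then have "f differentiable at (frac x)" "c1 < deriv f (frac x)" using x c(2) by (auto simp: break_points_def)
    then have "(f has_real_derivative deriv f (frac x)) (at (frac x))"
      by (simp add: DERIV_deriv_iff_real_differentiable)
    then have "(f has_real_derivative deriv f (frac x)) (at (frac x + of_int \<lfloor>x\<rfloor>))"
      by (rule circle_lift_deriv_add_int[OF f])
    then have *: "(f has_real_derivative deriv f (frac x)) (at x)" by (simp add: frac_def)
    then have "deriv f x = deriv f (frac x)" by (rule DERIV_imp_deriv)
    then show ?thesis using * \<open>c1 < deriv f (frac x)\<close> by simp
  qed
  then show ?thesis using that c(1) by blast
qed

text \<open>log Df extends continuously to D1 on the arc from a to c and to D2 on the arc from c to
  a + 1. As the product of the jump ratios is 1, its jumps at a and c are opposite, and adding the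
  constant \<kappa> on the first arc closes both gaps. The difference of the two floors is 1 on the
  first arc and 0 on the second.\<close>

lemma two_break_structure:
  assumes P: "class_P f" and bp: "break_points f = {a, c}" and ac: "a < c"
    and jump: "jump_ratio f a * jump_ratio f c = 1"
    and AC: "\<And>I. connected I \<Longrightarrow> frac ` I \<inter> {a, c} = {} \<Longrightarrow> abs_continuous_on I (deriv f)"
  obtains G g \<kappa> where "indefinite_integral G g" "\<And>x. g (x + 1) = g x" "\<And>x. G (x + 1) = G x" "\<kappa> \<noteq> 0"
    "\<And>x y. x \<le> y \<Longrightarrow> ((\<lambda>t. exp (G t - \<kappa> * (of_int \<lfloor>t - a\<rfloor> - of_int \<lfloor>t - c\<rfloor>))) has_integral (f y - f x)) {x..y}"
proof -
  have f: "circle_lift f" and fc: "continuous_on UNIV f" and f1: "\<And>x. f (x + 1) = f x + 1"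
    using P by (auto simp: class_P_def circle_lift_def)
  have a01: "0 \<le> a" "a < 1" "0 \<le> c" "c < 1" using bp by (auto simp: break_points_def)
  obtain c1 where c1: "0 < c1" "\<And>x. frac x \<notin> {a, c} \<Longrightarrow> (f has_real_derivative deriv f x) (at x) \<and> c1 < deriv f x"
    using class_P_deriv[OF P] unfolding bp by metis
  have nb: "frac t \<notin> {a, c}" if "a < t" "t < c \<or> c < t" "t < a + 1" for t
  proof (cases "t < 1")
    case True
    then have "frac t = t" using that a01 by (simp add: frac_eq)
    then show ?thesis using that by auto
  next
    case False
    then have "frac t = t - 1" using that a01 by (simp add: frac_unique_iff)
    then show ?thesis using that ac by auto
  qed
  have logAC: "abs_continuous_on {\<alpha><..<\<beta>} (\<lambda>x. ln (deriv f x))"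
    if "\<And>t. \<alpha> < t \<Longrightarrow> t < \<beta> \<Longrightarrow> frac t \<notin> {a, c}" for \<alpha> \<beta>
  proof -
    have "abs_continuous_on {\<alpha><..<\<beta>} (deriv f)"
    proof (rule AC)
      show "frac ` {\<alpha><..<\<beta>} \<inter> {a, c} = {}" using that by fastforce
    qed simp
    then show ?thesis by (rule abs_continuous_ln[OF _ c1(1)]) (use c1(2) that in auto)
  qed
  obtain D1 g1 where D1: "indefinite_integral D1 g1" "continuous_on UNIV D1" "\<And>x. a < x \<Longrightarrow> x < c \<Longrightarrow> D1 x = ln (deriv f x)"
    by (rule abs_continuous_density[OF ac logAC]) (use nb a01 in auto)
  have ca: "c < a + 1" using a01 by simp
  obtain D2 g2 where D2: "indefinite_integral D2 g2" "continuous_on UNIV D2" "\<And>x. c < x \<Longrightarrow> x < a + 1 \<Longrightarrow> D2 x = ln (deriv f x)"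
    by (rule abs_continuous_density[OF ca logAC]) (use nb ac in auto)
  have e1: "exp (D1 x) = deriv f x" "(f has_real_derivative exp (D1 x)) (at x)" if "a < x" "x < c" for x
  proof -
    have "frac x \<notin> {a, c}" using nb[of x] that ca by auto
    then show "exp (D1 x) = deriv f x" using D1(3)[OF that] c1 by (metis exp_ln less_trans)
    then show "(f has_real_derivative exp (D1 x)) (at x)" using c1(2)[OF \<open>frac x \<notin> {a, c}\<close>] by simp
  qed
  have e2: "exp (D2 x) = deriv f x" "(f has_real_derivative exp (D2 x)) (at x)" if "c < x" "x < a + 1" for x
  proof -
    have "frac x \<notin> {a, c}" using nb[of x] that ac by auto
    then show "exp (D2 x) = deriv f x" using D2(3)[OF that] c1 by (metis exp_ln less_trans)
    then show "(f has_real_derivative exp (D2 x)) (at x)" using c1(2)[OF \<open>frac x \<notin> {a, c}\<close>] by simp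
  qed
  have w1: "(f has_real_derivative exp (D1 x)) (at x within {a..c})" if "x \<in> {a..c}" for x
    by (rule derivative_within_closed[OF ac fc _ e1(2) that]) (intro continuous_intros D1(2), simp_all)
  have w2: "(f has_real_derivative exp (D2 x)) (at x within {c..a + 1})" if "x \<in> {c..a + 1}" for x
    by (rule derivative_within_closed[OF ca fc _ e2(2) that]) (intro continuous_intros D2(2), simp_all)
  have ra: "(f has_real_derivative exp (D1 a)) (at_right a)" using w1[of a] ac by (simp add: at_within_Icc_at_right)
  have lc: "(f has_real_derivative exp (D1 c)) (at_left c)" using w1[of c] ac by (simp add: at_within_Icc_at_left)
  have rc: "(f has_real_derivative exp (D2 c)) (at_right c)" using w2[of c] ca by (simp add: at_within_Icc_at_right)
  have la: "(f has_real_derivative exp (D2 (a + 1))) (at_left a)"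
  proof -
    have im: "(+) 1 ` {c - 1..a} = {c..a + 1}" by (simp add: image_add_atLeastAtMost add.commute)
    have "(f has_real_derivative exp (D2 (a + 1))) (at (1 + a) within (+) 1 ` {c - 1..a})"
      unfolding im using w2[of "a + 1"] ca by (simp add: add.commute)
    then have "((\<lambda>x. f (1 + x)) has_real_derivative exp (D2 (a + 1))) (at a within {c - 1..a})"
      by (simp only: DERIV_at_within_shift)
    then have "((\<lambda>x. f (1 + x) - 1) has_real_derivative exp (D2 (a + 1)) - 0) (at a within {c - 1..a})"
      by (intro derivative_intros)
    moreover have "(\<lambda>x. f (1 + x) - 1) = f" using f1 by (auto simp: add.commute)
    ultimately show ?thesis using ca by (simp add: at_within_Icc_at_left)
  qed
  have "D2 (a + 1) - D1 a + (D1 c - D2 c) = 0"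
  proof -
    have "exp (D2 (a + 1)) / exp (D1 a) * (exp (D1 c) / exp (D2 c)) = 1"
      using jump unfolding jump_ratio_def left_deriv_eq[OF la] right_deriv_eq[OF ra] left_deriv_eq[OF lc] right_deriv_eq[OF rc] .
    then have "exp (D2 (a + 1) - D1 a + (D1 c - D2 c)) = 1" by (simp add: exp_add exp_diff)
    then show ?thesis by simp
  qed
  \<comment> \<open>The left limit minus the right limit of log Df at a, the point a + 1 standing
    for the left side of a.\<close>
  define \<kappa> where "\<kappa> = D2 (a + 1) - D1 a"
  have \<kappa>c: "D1 c + \<kappa> = D2 c" using \<open>D2 (a + 1) - D1 a + (D1 c - D2 c) = 0\<close> by (simp add: \<kappa>_def)
  have \<kappa>a: "D1 a + \<kappa> = D2 (a + 1)" by (simp add: \<kappa>_def)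
  \<comment> \<open>Without a jump the one-sided derivatives at a would agree, and a would not be a
    break.\<close>
  have \<kappa>0: "\<kappa> \<noteq> 0"
  proof
    assume "\<kappa> = 0"
    then have "(f has_real_derivative exp (D1 a)) (at_left a)" using la by (simp add: \<kappa>_def)
    then have "(f has_real_derivative exp (D1 a)) (at a)"
      using ra unfolding has_field_derivative_iff by (rule filterlim_split_at)
    then have "f differentiable (at a)" by (auto simp: real_differentiable_def)
    moreover have "a \<in> break_points f" using bp by simp
    ultimately show False by (simp add: break_points_def)
  qed
  \<comment> \<open>The representative of x in the cell that begins at a, in which both arcs are
    intervals.\<close>
  define \<tau> where "\<tau> x = a + frac (x - a)" for x
  define G where "G x = (if \<tau> x < c then D1 (\<tau> x) + \<kappa> else D2 (\<tau> x))" for x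
  define g where "g x = (if \<tau> x < c then g1 (\<tau> x) else g2 (\<tau> x))" for x
  have \<tau>1: "\<tau> (x + 1) = \<tau> x" for x using frac_1_eq[of "x - a"] by (simp add: \<tau>_def algebra_simps)
  have \<tau>n: "\<tau> x = x - of_int n" if "a + of_int n \<le> x" "x < a + of_int n + 1" for x n
  proof -
    have "\<lfloor>x - a\<rfloor> = n" using that by (simp add: floor_eq_iff)
    then show ?thesis by (simp add: \<tau>_def frac_def)
  qed
  have Gp: "G (x + 1) = G x" and gp: "g (x + 1) = g x" for x by (simp_all add: G_def g_def \<tau>1)
  have G1: "G x = D1 (x - of_int n) + \<kappa>" if "a + of_int n \<le> x" "x \<le> c + of_int n" for x n
  proof (cases "x < c + of_int n")
    case True
    then show ?thesis using \<tau>n[of n x] that ca by (auto simp: G_def)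
  next
    case False
    then have "x = c + of_int n" using that by simp
    then show ?thesis using \<tau>n[of n x] ac ca \<kappa>c by (auto simp: G_def)
  qed
  have G2: "G x = D2 (x - of_int n)" if "c + of_int n \<le> x" "x \<le> a + of_int n + 1" for x n
  proof (cases "x < a + of_int n + 1")
    case True
    then show ?thesis using \<tau>n[of n x] that ac by (auto simp: G_def)
  next
    case False
    then have "x = a + of_int n + 1" using that by simp
    then show ?thesis using G1[of "n + 1" x] ac \<kappa>a by (simp add: add.commute)
  qed
  have gm: "g \<in> borel_measurable borel"
  proof -
    have "g1 \<in> borel_measurable borel" "g2 \<in> borel_measurable borel" using D1(1) D2(1) by (auto simp: indefinite_integral_def)
    moreover have "\<tau> \<in> borel_measurable borel" unfolding \<tau>_def frac_def by measurable
    ultimately show ?thesis unfolding g_def by measurable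
  qed
  have L: "exp (G t - \<kappa> * (of_int \<lfloor>t - a\<rfloor> - of_int \<lfloor>t - c\<rfloor>)) = deriv f t" if t: "frac t \<notin> {a, c}" for t
  proof -
    define n where "n = \<lfloor>t - a\<rfloor>"
    have n: "a + of_int n \<le> t" "t < a + of_int n + 1" unfolding n_def by linarith+
    have ne: "t \<noteq> a + of_int n" "t \<noteq> c + of_int n"
      using t a01 by (auto simp: frac_eq frac_add)
    have dn: "deriv f t = deriv f (t - of_int n)"
    proof -
      have "(f has_real_derivative deriv f t) (at (t + of_int (- n)))"
        using c1(2)[OF t] by (intro circle_lift_deriv_add_int[OF f]) simp
      then show ?thesis by (simp add: DERIV_imp_deriv)
    qed
    show ?thesis
    proof (cases "t < c + of_int n")
      case True
      then have "\<lfloor>t - c\<rfloor> = n - 1" using n ca by (simp add: floor_eq_iff)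
      then show ?thesis using G1[of n t] e1(1)[of "t - of_int n"] True n ne dn by (simp add: n_def[symmetric])
    next
      case False
      then have "\<lfloor>t - c\<rfloor> = n" using n ac by (simp add: floor_eq_iff)
      then show ?thesis using G2[of n t] e2(1)[of "t - of_int n"] False n ne dn by (simp add: n_def[symmetric])
    qed
  qed
  have hi: "((\<lambda>t. exp (G t - \<kappa> * (of_int \<lfloor>t - a\<rfloor> - of_int \<lfloor>t - c\<rfloor>))) has_integral (f y - f x)) {x..y}" if xy: "x \<le> y" for x y
  proof (rule fundamental_theorem_of_calculus_interior_strong)
    \<comment> \<open>Only finitely many translates of the breaks lie between x and y. Since f is
      continuous, the fundamental theorem steps over them and yields integrability at the same
      time.\<close>
    define S where "S = (\<lambda>(b, n). b + real_of_int n) ` ({a, c} \<times> {\<lfloor>x\<rfloor>..\<lfloor>y\<rfloor>})"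
    show "finite S" by (simp add: S_def)
    show "x \<le> y" by fact
    show "continuous_on {x..y} f" using fc by (rule continuous_on_subset) simp
    show "(f has_vector_derivative exp (G t - \<kappa> * (of_int \<lfloor>t - a\<rfloor> - of_int \<lfloor>t - c\<rfloor>))) (at t)" if t: "t \<in> {x<..<y} - S" for t
    proof -
      have "frac t \<notin> {a, c}"
      proof
        assume "frac t \<in> {a, c}"
        moreover have "\<lfloor>t\<rfloor> \<in> {\<lfloor>x\<rfloor>..\<lfloor>y\<rfloor>}" using t by (auto intro!: floor_mono)
        moreover have "t = frac t + of_int \<lfloor>t\<rfloor>" by (simp add: frac_def)
        ultimately have "t \<in> S" unfolding S_def by (intro image_eqI[of _ _ "(frac t, \<lfloor>t\<rfloor>)"]) auto
        then show False using t by simp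
      qed
      then show ?thesis using L c1(2) by (simp add: has_real_derivative_iff_has_vector_derivative)
    qed
  qed
  define PP where "PP x y \<longleftrightarrow> set_integrable lborel {x..y} g \<and> (LINT t:{x..y}|lborel. g t) = G y - G x" for x y
  have PPtrans: "PP x z" if "x \<le> y" "y \<le> z" "PP x y" "PP y z" for x y z
    using set_integral_combine[OF that(1,2), of g] that(3,4) by (simp add: PP_def)
  \<comment> \<open>Moves the integral formula for D1 or D2 into the n-th cell. The constant k is
    \<kappa> on the first arc and 0 on the second; the end point y, where g already belongs to the
    next piece, is a null set.\<close>
  have shift: "PP x y" if x: "x \<le> y" and ii: "indefinite_integral D h" and gh: "\<And>t. x \<le> t \<Longrightarrow> t < y \<Longrightarrow> g t = h (t - of_int n)"
    and GD: "G x = D (x - of_int n) + k" "G y = D (y - of_int n) + k" for x y D h n k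
  proof -
    have hm: "h \<in> borel_measurable borel" using ii by (simp add: indefinite_integral_def)
    have 1: "set_integrable lborel {x - of_int n..y - of_int n} h"
      "(LINT t:{x - of_int n..y - of_int n}|lborel. h t) = D (y - of_int n) - D (x - of_int n)"
      using ii x by (auto simp: indefinite_integral_def)
    have 2: "set_integrable lborel {x..y} (\<lambda>t. h (t - of_int n))"
      "(LINT t:{x..y}|lborel. h (t - of_int n)) = D (y - of_int n) - D (x - of_int n)"
      using 1 set_integral_shift[of x "- of_int n" y h] by simp_all
    have "AE t in lborel. t \<noteq> y" by (rule AE_lborel_singleton)
    then have ae: "AE t\<in>{x..y} in lborel. g t = h (t - of_int n)" by eventually_elim (auto intro: gh)
    have "set_integrable lborel {x..y} g \<longleftrightarrow> set_integrable lborel {x..y} (\<lambda>t. h (t - of_int n))"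
      using gm hm ae by (intro set_integrable_cong_AE) auto
    moreover have "(LINT t:{x..y}|lborel. g t) = (LINT t:{x..y}|lborel. h (t - of_int n))"
      using gm hm ae by (intro set_lebesgue_integral_cong_AE) auto
    ultimately show ?thesis using 2 GD by (simp add: PP_def)
  qed
  have "PP x y" if "x \<le> y" for x y
  proof (rule periodic_cells_induct[where a = a, OF PPtrans _ that])
    fix n x y assume xy: "a + of_int n \<le> x" "x \<le> y" "y \<le> a + of_int n + 1"
    have left: "PP x y" if "a + of_int n \<le> x" "x \<le> y" "y \<le> c + of_int n" for x y
    proof (rule shift[OF that(2) D1(1)])
      fix t assume "x \<le> t" "t < y"
      then have "\<tau> t = t - of_int n" "t - of_int n < c" using \<tau>n[of n t] that ca by auto
      then show "g t = g1 (t - of_int n)" by (simp add: g_def)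
    qed (use G1 that in auto)
    have right: "PP x y" if "c + of_int n \<le> x" "x \<le> y" "y \<le> a + of_int n + 1" for x y
    proof (rule shift[OF that(2) D2(1), of n 0])
      fix t assume "x \<le> t" "t < y"
      then have "\<tau> t = t - of_int n" "\<not> t - of_int n < c" using \<tau>n[of n t] that ac by auto
      then show "g t = g2 (t - of_int n)" by (simp add: g_def)
    qed (use G2 that in auto)
    consider "y \<le> c + of_int n" | "c + of_int n \<le> x" | "x \<le> c + of_int n" "c + of_int n \<le> y" by linarith
    then show "PP x y"
    proof cases
      case 3
      show ?thesis by (rule PPtrans[OF 3 left right]) (use xy 3 ca ac in auto)
    qed (use left right xy in auto)
  qed
  then have "indefinite_integral G g" using gm by (simp add: indefinite_integral_def PP_def)
  then show ?thesis using gp Gp \<kappa>0 hi by (rule that)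
qed

section \<open>Change of variables and injectivity of the semiconjugacy\<close>

text \<open>The statement Df = exp L in integrated form. It mentions no pointwise derivative, and it
  iterates by mere substitution.\<close>

definition change_of_variables :: "(real \<Rightarrow> real) \<Rightarrow> (real \<Rightarrow> real) \<Rightarrow> bool" where
  "change_of_variables f L \<longleftrightarrow> f \<in> borel_measurable borel \<and> L \<in> borel_measurable borel \<and>
     (\<forall>u :: real \<Rightarrow> ennreal. u \<in> borel_measurable borel \<longrightarrow>
        (\<integral>\<^sup>+x. u (f x) * ennreal (exp (L x)) \<partial>lborel) = (\<integral>\<^sup>+x. u x \<partial>lborel))"

text \<open>The chain rule: the log derivative of an iterate is the Birkhoff sum of L. The formula
  for f is applied to the integrand of the formula for n iterates.\<close>

lemma change_of_variables_funpow:
  assumes "change_of_variables f L"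
  shows "change_of_variables (f ^^ n) (\<lambda>x. \<Sum>i<n. L ((f ^^ i) x))"
proof -
  have [measurable]: "f \<in> borel_measurable borel" "L \<in> borel_measurable borel"
    using assms by (auto simp: change_of_variables_def)
  have fn[measurable]: "(f ^^ i) \<in> borel_measurable borel" for i by (induction i) (auto simp: o_def)
  have I: "(\<integral>\<^sup>+x. u (f x) * ennreal (exp (L x)) \<partial>lborel) = (\<integral>\<^sup>+x. u x \<partial>lborel)"
    if "u \<in> borel_measurable borel" for u :: "real \<Rightarrow> ennreal"
    using assms that by (simp add: change_of_variables_def)
  have "(\<integral>\<^sup>+x. u ((f ^^ n) x) * ennreal (exp (\<Sum>i<n. L ((f ^^ i) x))) \<partial>lborel) = (\<integral>\<^sup>+x. u x \<partial>lborel)"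
    if u: "u \<in> borel_measurable borel" for u :: "real \<Rightarrow> ennreal"
  proof (induction n)
    case (Suc n)
    define k where "k z = u ((f ^^ n) z) * ennreal (exp (\<Sum>i<n. L ((f ^^ i) z)))" for z
    have km: "k \<in> borel_measurable borel" unfolding k_def using u by measurable
    have "u ((f ^^ Suc n) x) * ennreal (exp (\<Sum>i<Suc n. L ((f ^^ i) x))) = k (f x) * ennreal (exp (L x))" for x
      unfolding sum.lessThan_Suc_shift k_def
      by (simp add: funpow_swap1 exp_add ennreal_mult mult_ac)
    then show ?case using I[OF km] Suc by (simp add: k_def)
  qed simp
  then show ?thesis unfolding change_of_variables_def by simp
qed

lemma circle_lift_inv:
  assumes f: "circle_lift f"
  shows "circle_lift (inv f)"
proof -
  have b: "bij f" by (rule circle_lift_bij[OF f])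
  have sm: "strict_mono f" using f by (simp add: circle_lift_def)
  have fi: "f (inv f y) = y" for y using b by (simp add: bij_is_surj surj_f_inv_f)
  have "strict_mono (inv f)"
  proof (rule strict_monoI)
    fix x y :: real assume "x < y"
    then have "f (inv f x) < f (inv f y)" by (simp add: fi)
    then show "inv f x < inv f y" using sm by (simp add: strict_mono_less)
  qed
  moreover have "continuous_on UNIV (inv f)"
    using bij_imp_bij_inv[OF b] \<open>strict_mono (inv f)\<close>
    by (intro continuous_onI_mono) (auto simp: bij_is_surj strict_mono_mono dest: monoD strict_mono_mono)
  moreover have "inv f (y + 1) = inv f y + 1" for y
  proof -
    have "f (inv f y + 1) = y + 1" using f fi by (simp add: circle_lift_def)
    then show ?thesis using b by (metis bij_inv_eq_iff)
  qed
  ultimately show ?thesis by (simp add: circle_lift_def)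
qed

text \<open>The image under f of the measure with density exp L agrees with Lebesgue measure on
  intervals, hence on all Borel sets.\<close>

lemma change_of_variables_circle_lift:
  assumes f: "circle_lift f" and L: "L \<in> borel_measurable borel"
    and I: "\<And>x y. x \<le> y \<Longrightarrow> ((\<lambda>t. exp (L t)) has_integral (f y - f x)) {x..y}"
  shows "change_of_variables f L"
proof -
  have b: "bij f" by (rule circle_lift_bij[OF f])
  have fi: "f (inv f y) = y" for y using b by (simp add: bij_is_surj surj_f_inv_f)
  have sm: "strict_mono f" using f by (simp add: circle_lift_def)
  have fm[measurable]: "f \<in> borel_measurable borel"
    using f by (intro borel_measurable_continuous_onI) (simp add: circle_lift_def)
  note L[measurable]
  have nn: "(\<integral>\<^sup>+t. ennreal (exp (L t)) * indicator {x..y} t \<partial>lborel) = ennreal (f y - f x)" if "x \<le> y" for x y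
    by (rule nn_integral_has_integral_lebesgue'[OF _ I[OF that]]) simp
  define M where "M = distr (density lborel (\<lambda>x. ennreal (exp (L x)))) borel f"
  have "lborel = M"
  proof (rule lborel_eqI)
    fix l u :: real assume "\<And>b. b \<in> Basis \<Longrightarrow> l \<bullet> b \<le> u \<bullet> b"
    then have lu: "l \<le> u" by simp
    define x y where "x = inv f l" and "y = inv f u"
    have xy: "f x = l" "f y = u" by (simp_all add: x_def y_def fi)
    then have "x \<le> y" using lu sm by (metis strict_mono_less_eq)
    have "f -` {l<..<u} = {x<..<y}" using sm xy by (auto simp flip: xy simp: strict_mono_less)
    then have "emeasure M {l<..<u} = (\<integral>\<^sup>+t. ennreal (exp (L t)) * indicator {x<..<y} t \<partial>lborel)"
      unfolding M_def by (simp add: emeasure_distr emeasure_density)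
    also have "\<dots> = (\<integral>\<^sup>+t. ennreal (exp (L t)) * indicator {x..y} t \<partial>lborel)"
    proof (rule nn_integral_cong_AE)
      have "AE t in lborel. t \<noteq> x" "AE t in lborel. t \<noteq> y" by (rule AE_lborel_singleton)+
      then show "AE t in lborel. ennreal (exp (L t)) * indicator {x<..<y} t = ennreal (exp (L t)) * indicator {x..y} t"
        by eventually_elim (auto simp: indicator_def)
    qed
    also have "\<dots> = ennreal (u - l)" using nn[OF \<open>x \<le> y\<close>] xy by simp
    finally show "emeasure M (box l u) = (\<Prod>b\<in>Basis. (u - l) \<bullet> b)" using lu by (simp add: box_real)
  qed (simp add: M_def)
  then have "(\<integral>\<^sup>+x. v (f x) * ennreal (exp (L x)) \<partial>lborel) = (\<integral>\<^sup>+x. v x \<partial>lborel)"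
    if [measurable]: "v \<in> borel_measurable borel" for v :: "real \<Rightarrow> ennreal"
  proof -
    have "(\<integral>\<^sup>+x. v x \<partial>lborel) = (\<integral>\<^sup>+x. v x \<partial>M)" using \<open>lborel = M\<close> by simp
    also have "\<dots> = (\<integral>\<^sup>+x. v (f x) \<partial>density lborel (\<lambda>x. ennreal (exp (L x))))"
      unfolding M_def by (rule nn_integral_distr) auto
    also have "\<dots> = (\<integral>\<^sup>+x. ennreal (exp (L x)) * v (f x) \<partial>lborel)"
      by (rule nn_integral_density) auto
    finally show ?thesis by (simp add: mult.commute)
  qed
  then show ?thesis unfolding change_of_variables_def using fm L by blast
qed

lemma circle_lift_increment:
  assumes f: "circle_lift f" and cov: "change_of_variables f L" and xy: "x \<le> y"
  shows "(\<integral>\<^sup>+t. ennreal (exp (L t)) * indicator {x..y} t \<partial>lborel) = ennreal (f y - f x)"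
proof -
  have sm: "strict_mono f" using f by (simp add: circle_lift_def)
  have "(\<integral>\<^sup>+t. indicator {f x..f y} (f t) * ennreal (exp (L t)) \<partial>lborel) = (\<integral>\<^sup>+t. indicator {f x..f y} t \<partial>lborel)"
    using cov unfolding change_of_variables_def by simp
  moreover have "indicator {f x..f y} (f t) * ennreal (exp (L t)) = ennreal (exp (L t)) * indicator {x..y} t" for t
    using sm by (auto simp: indicator_def strict_mono_less_eq)
  moreover have "f x \<le> f y" using sm xy by (simp add: strict_mono_less_eq)
  ultimately show ?thesis by simp
qed

section \<open>Denjoy's theorem: the semiconjugacy has no plateau\<close>

lemma good_denom_unbounded:
  assumes c: "0 < c" "\<And>m p :: int. m \<noteq> 0 \<Longrightarrow> c \<le> \<bar>real_of_int m * r - p\<bar> * \<bar>real_of_int m\<bar>"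
  shows "\<exists>q p. good_denom r q p \<and> n \<le> q"
proof -
  obtain N :: nat where N: "real n / c < N" using reals_Archimedean2 by blast
  then have "real N > 0" using c(1) by (metis divide_nonneg_pos le_less_trans of_nat_0_le_iff)
  then obtain q p where q: "good_denom r q p" "\<bar>real q * r - p\<bar> < 1 / N" using good_denom_exists[of N r] by (metis of_nat_0_less_iff)
  have "q > 0" using q by (simp add: good_denom_def)
  then have "c \<le> \<bar>real q * r - p\<bar> * real q" using c(2)[of "int q" p] by simp
  also have "\<dots> \<le> 1 / N * real q" using q(2) by (intro mult_right_mono) auto
  finally have "c * N \<le> real q" using \<open>real N > 0\<close> by (simp add: field_simps)
  moreover have "real n < c * N" using N c(1) by (simp add: field_simps)
  ultimately have "n \<le> q" by linarith
  then show ?thesis using q(1) by blast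
qed

text \<open>By Denjoy's inequality S_q oscillates by at most 5 V, and exp (S_q) has mean 1 over a
  period, so S_q \<ge> - 5 V. Hence f^q shrinks no interval by more than the factor exp (- 5 V), for
  every good q. A plateau of \<phi> would have infinitely many images of at least that relative
  length, while its images up to any good time Q have total length at most 4.\<close>

lemma denjoy_injective:
  assumes f: "circle_lift f" and \<phi>: "rotation_semiconj f r \<phi>" and rQ: "r \<notin> \<rat>"
    and cov: "change_of_variables f L"
    and var: "variation_bound L W V"
    and unb: "\<And>n. \<exists>q p. good_denom r q p \<and> n \<le> q"
  shows "strict_mono \<phi>"
proof -
  have mono: "mono \<phi>" and \<phi>1: "\<And>x. \<phi> (x + 1) = \<phi> x + 1" and \<phi>f: "\<And>x. \<phi> (f x) = \<phi> x + r"
    using \<phi> by (auto simp: rotation_semiconj_def)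
  have \<phi>c: "continuous_on UNIV \<phi>" by (rule semiconjugacy_continuous[OF rQ \<phi>])
  have "\<exists>x. \<phi> x = y" for y
  proof -
    define m where "m = \<lfloor>y - \<phi> 0\<rfloor>"
    have "\<phi> (of_int m) = \<phi> 0 + of_int m" "\<phi> (of_int (m + 1)) = \<phi> 0 + of_int (m + 1)"
      using add_int_of_add_one[of \<phi> 1 0] \<phi>1 by auto
    then have "\<phi> (of_int m) \<le> y" "y \<le> \<phi> (of_int (m + 1))"
      unfolding m_def of_int_add of_int_1 by linarith+
    moreover have "real_of_int m \<le> of_int (m + 1)" "continuous_on {of_int m..of_int (m + 1)} \<phi>"
      using \<phi>c by (auto intro: continuous_on_subset)
    ultimately show ?thesis using IVT'[of \<phi> "of_int m" y "of_int (m+1)"] by blast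
  qed
  then obtain s where s: "\<And>y. \<phi> (s y) = y" by metis
  \<comment> \<open>A right inverse of \<phi>, chosen on the unit interval and continued by integer
    translation, so that it has degree one even where \<phi> is not injective.\<close>
  define \<psi> where "\<psi> y = s (frac y) + of_int \<lfloor>y\<rfloor>" for y
  have \<phi>\<psi>: "\<phi> (\<psi> y) = y" for y
    using add_int_of_add_one[of \<phi> 1 "s (frac y)" "\<lfloor>y\<rfloor>"] \<phi>1 s by (simp add: \<psi>_def frac_def)
  have \<psi>1: "\<psi> (y + 1) = \<psi> y + 1" for y by (simp add: \<psi>_def frac_1_eq)
  have less: "u < v" if "\<phi> u < \<phi> v" for u v using that mono by (auto simp: mono_def not_le[symmetric])
  have \<psi>m: "mono \<psi>"
  proof (rule monoI)
    fix u v :: real assume "u \<le> v"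
    then show "\<psi> u \<le> \<psi> v" using less[of "\<psi> u" "\<psi> v"] \<phi>\<psi> by (cases "u = v") auto
  qed
  have W: "mono W" "\<And>y. W (y + 1) = W y + V" "\<And>y. L (y + 1) = L y" "\<And>u v. u \<le> v \<Longrightarrow> \<bar>L u - L v\<bar> \<le> W v - W u"
    using var by (auto simp: variation_bound_def)
  have Wle: "\<bar>L u - L v\<bar> \<le> W b - W a" if "a \<le> u" "u \<le> b" "a \<le> v" "v \<le> b" for u v a b
  proof -
    have m: "W a \<le> W u" "W u \<le> W b" "W a \<le> W v" "W v \<le> W b" using that by (auto intro: monoD[OF W(1)])
    show ?thesis
    proof (cases "u \<le> v")
      case True
      then show ?thesis using W(4)[OF True] m by linarith
    next
      case False
      then show ?thesis using W(4)[of v u] m by linarith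
    qed
  qed
  have vb: "variation_bound (\<lambda>y. L (\<psi> y)) (\<lambda>y. W (\<psi> y)) V"
    unfolding variation_bound_def
  proof (intro conjI allI impI)
    show "mono (\<lambda>y. W (\<psi> y))" using W(1) \<psi>m by (auto simp: mono_def)
    show "\<bar>L (\<psi> u) - L (\<psi> v)\<bar> \<le> W (\<psi> v) - W (\<psi> u)" if "u \<le> v" for u v using W(4) \<psi>m that by (auto dest: monoD)
  qed (simp_all add: \<psi>1 W)
  have orb: "\<phi> ((f ^^ j) x) = \<phi> x + real j * r" for j x using semiconjugacy_orbit[OF \<phi>, of j x 0] by simp
  have btw: "\<psi> v \<le> (f ^^ j) x" "(f ^^ j) x \<le> \<psi> v'" if "v < \<phi> x + real j * r" "\<phi> x + real j * r < v'" for v v' j x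
    using less[of "\<psi> v" "(f ^^ j) x"] less[of "(f ^^ j) x" "\<psi> v'"] that by (auto simp: \<phi>\<psi> orb)
  have trk: "tracks_orbit r q (\<lambda>y. L (\<psi> y)) (\<lambda>y. W (\<psi> y)) (\<phi> x) (\<lambda>j. L ((f ^^ j) x))" for q x
    unfolding tracks_orbit_def
  proof (intro allI impI)
    fix j v v' u assume "v < \<phi> x + real j * r" "\<phi> x + real j * r < v'" "v \<le> u" "u \<le> v'"
    then show "\<bar>L ((f ^^ j) x) - L (\<psi> u)\<bar> \<le> W (\<psi> v') - W (\<psi> v)"
      using btw[of v x j v'] \<psi>m by (intro Wle) (auto dest: monoD)
  qed
  define S where "S q x = (\<Sum>i<q. L ((f ^^ i) x))" for q x
  have osc: "\<bar>S q x - S q x'\<bar> \<le> 5 * V" if "good_denom r q p" for q p x x'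
    unfolding S_def by (rule denjoy_inequality[OF that vb trk trk])
  have covq: "change_of_variables (f ^^ q) (S q)" for q
    using change_of_variables_funpow[OF cov, of q] by (simp add: S_def[abs_def])
  have low: "- (5 * V) \<le> S q x" if g: "good_denom r q p" for q p x
  proof -
    have "ennreal ((f ^^ q) 1 - (f ^^ q) 0) = (\<integral>\<^sup>+t. ennreal (exp (S q t)) * indicator {0..1} t \<partial>lborel)"
      using circle_lift_increment[OF circle_lift_funpow[OF f] covq, of 0 1 q] by simp
    also have "\<dots> \<le> (\<integral>\<^sup>+t. ennreal (exp (S q x + 5 * V)) * indicator {0..1::real} t \<partial>lborel)"
    proof (intro nn_integral_mono mult_right_mono ennreal_leI)
      fix t show "exp (S q t) \<le> exp (S q x + 5 * V)" using osc[OF g, of t x] by simp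
    qed simp
    also have "\<dots> = ennreal (exp (S q x + 5 * V))" by (simp add: nn_integral_cmult_indicator)
    finally have "1 \<le> exp (S q x + 5 * V)"
      using circle_lift_funpow[OF f, of q] unfolding circle_lift_def by (metis add_0 add_diff_cancel_left' ennreal_le_iff exp_ge_zero)
    then show ?thesis by (simp add: one_le_exp_iff)
  qed
  have grow: "exp (- (5 * V)) * (b - a) \<le> (f ^^ q) b - (f ^^ q) a" if g: "good_denom r q p" and ab: "a \<le> b" for q p a b
  proof -
    have "ennreal (exp (- (5 * V)) * (b - a)) = (\<integral>\<^sup>+t. ennreal (exp (- (5 * V))) * indicator {a..b} t \<partial>lborel)"
      using ab by (simp add: nn_integral_cmult_indicator ennreal_mult)
    also have "\<dots> \<le> (\<integral>\<^sup>+t. ennreal (exp (S q t)) * indicator {a..b} t \<partial>lborel)"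
      using low[OF g] by (intro nn_integral_mono mult_right_mono ennreal_leI) auto
    also have "\<dots> = ennreal ((f ^^ q) b - (f ^^ q) a)"
      by (rule circle_lift_increment[OF circle_lift_funpow[OF f] covq ab])
    finally show ?thesis using ab circle_lift_mono[OF circle_lift_funpow[OF f]]
      by (subst (asm) ennreal_le_iff) (auto dest: monoD)
  qed
  show ?thesis
  proof (rule ccontr)
    assume "\<not> strict_mono \<phi>"
    then obtain a b where ab: "a < b" "\<phi> b \<le> \<phi> a" by (auto simp: strict_mono_def not_less)
    then have eq: "\<phi> a = \<phi> b" using mono by (meson antisym less_imp_le monoD)
    define \<delta> where "\<delta> = exp (- (5 * V)) * (b - a)"
    have \<delta>: "\<delta> > 0" using ab by (simp add: \<delta>_def)
    \<comment> \<open>\<delta> bounds the image of the plateau from below at each good time, and 4 =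
      1 + 1 + 2 is the multiplicity with which windows of half-width 1 / Q around an orbit cover the
      circle.\<close>
    obtain K :: nat where K: "4 / \<delta> < K" using reals_Archimedean2 by blast
    define A where "A = {q. \<exists>p. good_denom r q p}"
    have "infinite A"
    proof
      assume "finite A"
      obtain q p where "good_denom r q p" "Suc (Max A) \<le> q" using unb by blast
      then have "q \<in> A" by (auto simp: A_def)
      then have "q \<le> Max A" using \<open>finite A\<close> by simp
      then show False using \<open>Suc (Max A) \<le> q\<close> by simp
    qed
    then obtain B where B: "B \<subseteq> A" "card B = K" "finite B" using infinite_arbitrarily_large by metis
    obtain Q p where Q: "good_denom r Q p" "Suc (Max (insert 0 B)) \<le> Q" using unb by blast
    have BQ: "B \<subseteq> {..<Q}"
    proof
      fix q assume "q \<in> B"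
      then have "q \<le> Max (insert 0 B)" using B(3) by simp
      then show "q \<in> {..<Q}" using Q(2) by simp
    qed
    have "real K * \<delta> = (\<Sum>q\<in>B. \<delta>)" using B by simp
    also have "\<dots> \<le> (\<Sum>q\<in>B. (f ^^ q) b - (f ^^ q) a)"
    proof (rule sum_mono)
      fix q assume "q \<in> B"
      then obtain p where "good_denom r q p" using B(1) by (auto simp: A_def)
      then show "\<delta> \<le> (f ^^ q) b - (f ^^ q) a" using grow[of q p a b] ab by (simp add: \<delta>_def)
    qed
    also have "\<dots> \<le> (\<Sum>q<Q. (f ^^ q) b - (f ^^ q) a)"
      using BQ ab by (intro sum_mono2) (auto intro!: monoD[OF circle_lift_mono[OF circle_lift_funpow[OF f]]])
    \<comment> \<open>\<phi> is constant on the j-th image of the plateau, so this image fits into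
      the window of half-width 1 / Q around that value.\<close>
    also have "\<dots> \<le> (\<Sum>j<Q. \<psi> (\<phi> a + real j * r + real 1 / Q) - \<psi> (\<phi> a + real j * r - real 1 / Q))"
    proof (rule sum_mono)
      fix j assume "j \<in> {..<Q}"
      then have "0 < real 1 / Q" by simp
      then show "(f ^^ j) b - (f ^^ j) a \<le> \<psi> (\<phi> a + real j * r + real 1 / Q) - \<psi> (\<phi> a + real j * r - real 1 / Q)"
        using btw(2)[of "\<phi> b + real j * r - 1" b j "\<phi> b + real j * r + 1 / Q"]
          btw(1)[of "\<phi> a + real j * r - 1 / Q" a j "\<phi> a + real j * r + 1"] eq by simp
    qed
    also have "\<dots> \<le> real (1 + 1 + 2) * 1" by (rule good_denom_sum_increments[OF Q(1) \<psi>m \<psi>1])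
    finally have "real K * \<delta> \<le> 4" by simp
    then show False using K \<delta> by (simp add: pos_divide_less_eq)
  qed
qed

section \<open>Ergodicity with respect to Lebesgue measure\<close>

lemma emeasure_unit_cells:
  fixes A :: "real set"
  assumes A: "A \<in> sets borel"
  shows "emeasure lborel A = (\<Sum>n. emeasure lborel (A \<inter> {real_of_int (int_decode n)..<real_of_int (int_decode n) + 1}))"
proof -
  define C where "C n = A \<inter> {real_of_int (int_decode n)..<real_of_int (int_decode n) + 1}" for n
  have "disjoint_family C"
    unfolding disjoint_family_on_def
  proof (intro ballI impI)
    fix m n :: nat assume "m \<noteq> n"
    then have ne: "int_decode m \<noteq> int_decode n" using inj_int_decode by (auto dest: injD)
    show "C m \<inter> C n = {}"
    proof (rule ccontr)
      assume "C m \<inter> C n \<noteq> {}"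
      then obtain x where "x \<in> C m" "x \<in> C n" by blast
      then have "\<lfloor>x\<rfloor> = int_decode m" "\<lfloor>x\<rfloor> = int_decode n" by (auto simp: C_def floor_eq_iff)
      then show False using ne by simp
    qed
  qed
  moreover have "range C \<subseteq> sets lborel" using A by (auto simp: C_def)
  ultimately have "(\<Sum>n. emeasure lborel (C n)) = emeasure lborel (\<Union>n. C n)" by (intro suminf_emeasure)
  moreover have "(\<Union>n. C n) = A"
  proof
    show "A \<subseteq> (\<Union>n. C n)"
    proof
      fix x assume "x \<in> A"
      then have "x \<in> C (int_encode \<lfloor>x\<rfloor>)" by (simp add: C_def)
      then show "x \<in> (\<Union>n. C n)" by blast
    qed
  qed (auto simp: C_def)
  ultimately show ?thesis by (simp add: C_def)
qed

lemma emeasure_lborel_translate: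
  fixes A :: "real set"
  assumes "A \<in> sets borel"
  shows "emeasure lborel {x. x + s \<in> A} = emeasure lborel A"
proof -
  have "emeasure lborel A = emeasure (distr lborel borel ((+) s)) A" by (simp add: lborel_distr_plus)
  also have "\<dots> = emeasure lborel ((+) s -` A \<inter> space lborel)" using assms by (intro emeasure_distr) auto
  finally show ?thesis by (simp add: vimage_def add.commute)
qed

text \<open>Each unit cell of A is translated back to the unit interval; the translates cover
  B.\<close>

lemma emeasure_mod1_image_le:
  fixes A B :: "real set"
  assumes A: "A \<in> sets borel" and B: "B \<subseteq> {0..<1}" "\<And>x. x \<in> B \<Longrightarrow> \<exists>m::int. x + of_int m \<in> A" and Bm: "B \<in> sets borel"
  shows "emeasure lborel B \<le> emeasure lborel A"
proof -
  define C where "C n = {x. x + real_of_int (int_decode n) \<in> A \<inter> {real_of_int (int_decode n)..<real_of_int (int_decode n) + 1}}" for n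
  have Cm: "C n \<in> sets lborel" for n unfolding C_def using A by measurable
  have "B \<subseteq> (\<Union>n. C n)"
  proof
    fix x assume x: "x \<in> B"
    then obtain m :: int where "x + of_int m \<in> A" using B(2) by blast
    then have "x \<in> C (int_encode m)" using x B(1) by (auto simp: C_def)
    then show "x \<in> (\<Union>n. C n)" by blast
  qed
  then have "emeasure lborel B \<le> emeasure lborel (\<Union>n. C n)" using Cm by (intro emeasure_mono) auto
  also have "\<dots> \<le> (\<Sum>n. emeasure lborel (C n))" using Cm by (intro emeasure_subadditive_countably) auto
  also have "\<dots> = (\<Sum>n. emeasure lborel (A \<inter> {real_of_int (int_decode n)..<real_of_int (int_decode n) + 1}))"
    unfolding C_def using A by (intro suminf_cong emeasure_lborel_translate) auto
  finally show ?thesis by (simp only: emeasure_unit_cells[OF A, symmetric])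
qed

lemma periodic_null:
  fixes Z :: "real set"
  assumes Z: "Z \<in> sets borel" and per: "\<And>x. x + 1 \<in> Z \<longleftrightarrow> x \<in> Z" and null: "emeasure lborel (Z \<inter> {0..<1}) = 0"
  shows "emeasure lborel Z = 0"
proof -
  have peri: "x + of_int m \<in> Z \<longleftrightarrow> x \<in> Z" for x m
    using add_int_of_add_one[of "indicator Z" 0 x m] per by (simp add: indicator_def of_bool_eq_iff)
  have "emeasure lborel (Z \<inter> {real_of_int m..<real_of_int m + 1}) = 0" for m
  proof -
    have "emeasure lborel {x. x + of_int m \<in> Z \<inter> {real_of_int m..<real_of_int m + 1}} = emeasure lborel (Z \<inter> {real_of_int m..<real_of_int m + 1})"
      using Z by (intro emeasure_lborel_translate) auto
    moreover have "{x. x + of_int m \<in> Z \<inter> {real_of_int m..<real_of_int m + 1}} = Z \<inter> {0..<1}"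
      using peri by auto
    ultimately show ?thesis using null by simp
  qed
  then show ?thesis by (subst emeasure_unit_cells[OF Z]) simp
qed

lemma lipschitz_ac_fun:
  assumes "\<And>x y. x \<le> y \<Longrightarrow> \<bar>M y - M x\<bar> \<le> K * (y - x)" "0 < K"
  shows "ac_fun M"
  unfolding ac_fun_def
proof (intro allI impI)
  fix e :: real assume "e > 0"
  show "\<exists>d>0. \<forall>(n::nat) u v. disjoint_intervals {..<n} u v \<longrightarrow> (\<Sum>i<n. v i - u i) < d \<longrightarrow> (\<Sum>i<n. \<bar>M (v i) - M (u i)\<bar>) \<le> e"
  proof (intro exI[of _ "e / K"] conjI allI impI)
    fix n :: nat and u v assume uv: "disjoint_intervals {..<n} u v" "(\<Sum>i<n. v i - u i) < e / K"
    have "(\<Sum>i<n. \<bar>M (v i) - M (u i)\<bar>) \<le> (\<Sum>i<n. K * (v i - u i))"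
      using uv(1) assms(1) by (intro sum_mono) (simp add: disjoint_intervals_def)
    also have "\<dots> = K * (\<Sum>i<n. v i - u i)" by (simp add: sum_distrib_left)
    also have "\<dots> \<le> e" using uv(2) assms(2) by (simp add: field_simps)
    finally show "(\<Sum>i<n. \<bar>M (v i) - M (u i)\<bar>) \<le> e" .
  qed (use \<open>e > 0\<close> assms(2) in simp)
qed

text \<open>Half-open intervals are stable under intersection and generate the Borel sets, so equal
  increments force equal measures and hence equal densities.\<close>

lemma interval_integrals_eq_AE:
  assumes D: "indefinite_integral D g" "indefinite_integral D h" and nn: "\<And>x. 0 \<le> g x" "\<And>x. 0 \<le> h x"
  shows "AE x in lborel. g x = h x"
proof -
  have [measurable]: "g \<in> borel_measurable borel" "h \<in> borel_measurable borel"
    using D by (auto simp: indefinite_integral_def)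
  have nI: "(\<integral>\<^sup>+t. ennreal (k t) * indicator {x<..y} t \<partial>lborel) = ennreal (D y - D x)"
    if D: "indefinite_integral D k" "\<And>x. 0 \<le> k x" and xy: "x \<le> y" for k x y
  proof -
    have i: "integrable lborel (\<lambda>t. indicator {x..y} t *\<^sub>R k t)" "(\<integral>t. indicator {x..y} t *\<^sub>R k t \<partial>lborel) = D y - D x"
      using D xy by (auto simp: indefinite_integral_def set_integrable_def set_lebesgue_integral_def)
    have "(\<integral>\<^sup>+t. ennreal (k t) * indicator {x<..y} t \<partial>lborel) = (\<integral>\<^sup>+t. ennreal (indicator {x..y} t *\<^sub>R k t) \<partial>lborel)"
    proof (rule nn_integral_cong_AE)
      have "AE t in lborel. t \<noteq> x" by (rule AE_lborel_singleton)
      then show "AE t in lborel. ennreal (k t) * indicator {x<..y} t = ennreal (indicator {x..y} t *\<^sub>R k t)"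
        by eventually_elim (auto simp: indicator_def)
    qed
    also have "\<dots> = ennreal (D y - D x)"
      using i D(2) by (subst nn_integral_eq_integral) auto
    finally show ?thesis .
  qed
  have "density lborel (\<lambda>x. ennreal (g x)) = density lborel (\<lambda>x. ennreal (h x))"
  proof (rule measure_eqI_generator_eq[where E = "range (\<lambda>(a, b). {a<..b})" and A = "\<lambda>n. {- real n<..real n}" and \<Omega> = UNIV])
    show "Int_stable (range (\<lambda>(a, b). {a<..b::real}))"
      by (auto simp: Int_stable_def)
    show "emeasure (density lborel (\<lambda>x. ennreal (g x))) X = emeasure (density lborel (\<lambda>x. ennreal (h x))) X"
      if "X \<in> range (\<lambda>(a, b). {a<..b})" for X
    proof -
      from that obtain ab where 1: "X = (\<lambda>(a, b). {a<..b}) ab" by (rule rangeE)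
      define a b where "a = fst ab" and "b = snd ab"
      have X: "X = {a<..b}" unfolding 1 a_def b_def by (simp add: split_def)
      show ?thesis
      proof (cases "a \<le> b")
        case True
        then show ?thesis unfolding X using nI[OF D(1) nn(1) True] nI[OF D(2) nn(2) True]
          by (simp add: emeasure_density)
      qed (simp add: X)
    qed
    show "(\<Union>n. {- real n<..real n}) = UNIV"
    proof (safe intro!: UNIV_I)
      fix x :: real
      obtain n :: nat where "\<bar>x\<bar> < n" using reals_Archimedean2 by blast
      then show "x \<in> (\<Union>n. {- real n<..real n})" by (auto intro!: exI[of _ n])
    qed
    show "emeasure (density lborel (\<lambda>x. ennreal (g x))) {- real n<..real n} \<noteq> \<infinity>" for n
      using nI[OF D(1) nn(1), of "- real n" "real n"] by (simp add: emeasure_density)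
  qed (auto simp: borel_sigma_sets_Ioc)
  then have "AE x in lborel. ennreal (g x) = ennreal (h x)"
    by (subst (asm) sigma_finite_measure.density_unique_iff[OF sigma_finite_lborel]) auto
  then show ?thesis by eventually_elim (use nn in auto)
qed

text \<open>The assumptions are also met by the rotation itself, conjugated by the identity, so that
  ergodicity is proved once for both maps.\<close>

locale circle_conjugacy =
  fixes f \<phi> \<psi> L W :: "real \<Rightarrow> real" and V r :: real
  assumes f: "circle_lift f" and semi: "rotation_semiconj f r \<phi>"
    and \<phi>: "circle_lift \<phi>" and \<psi>: "circle_lift \<psi>" and \<phi>\<psi>: "\<And>y. \<phi> (\<psi> y) = y" and \<psi>\<phi>: "\<And>x. \<psi> (\<phi> x) = x"
    and cov: "change_of_variables f L" and var: "variation_bound L W V"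
    and unb: "\<And>n. \<exists>q p. good_denom r q p \<and> n \<le> q"
begin

definition S :: "nat \<Rightarrow> real \<Rightarrow> real" where "S q x = (\<Sum>i<q. L ((f ^^ i) x))"

lemma \<phi>_less: "\<phi> x < \<phi> y \<longleftrightarrow> x < y" and \<phi>_le: "\<phi> x \<le> \<phi> y \<longleftrightarrow> x \<le> y"
  using \<phi> by (auto simp: circle_lift_def strict_mono_less strict_mono_less_eq)

lemma \<psi>_less: "\<psi> x < \<psi> y \<longleftrightarrow> x < y" and \<psi>_le: "\<psi> x \<le> \<psi> y \<longleftrightarrow> x \<le> y"
  using \<psi> by (auto simp: circle_lift_def strict_mono_less strict_mono_less_eq)

lemma \<phi>_orbit: "\<phi> ((f ^^ j) x) = \<phi> x + real j * r"
  using semiconjugacy_orbit[OF semi, of j x 0] by simp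

lemma f_orbit: "(f ^^ j) x = \<psi> (\<phi> x + real j * r)"
  using \<psi>\<phi>[of "(f ^^ j) x"] by (simp add: \<phi>_orbit)

lemma cov_S: "change_of_variables (f ^^ q) (S q)"
  using change_of_variables_funpow[OF cov, of q] by (simp add: S_def[abs_def])

lemma W_mono: "mono W" and W_per: "W (y + 1) = W y + V" and L_per: "L (y + 1) = L y"
  and W_bound: "u \<le> v \<Longrightarrow> \<bar>L u - L v\<bar> \<le> W v - W u"
  using var by (auto simp: variation_bound_def)

lemma variation_bound_conj: "variation_bound (\<lambda>y. L (\<psi> y)) (\<lambda>y. W (\<psi> y)) V"
  unfolding variation_bound_def
proof (intro conjI allI impI)
  show "mono (\<lambda>y. W (\<psi> y))" using W_mono by (auto simp: mono_def \<psi>_le)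
  show "\<bar>L (\<psi> u) - L (\<psi> v)\<bar> \<le> W (\<psi> v) - W (\<psi> u)" if "u \<le> v" for u v using that by (auto simp: \<psi>_le intro: W_bound)
  show "W (\<psi> (y + 1)) = W (\<psi> y) + V" "L (\<psi> (y + 1)) = L (\<psi> y)" for y
    using \<psi> by (auto simp: circle_lift_def W_per L_per)
qed

text \<open>The images of an interval of \<phi>-length 3 / q at times below q overlap at most 5 = 0
  + 3 + 2 times, hence the variation of L over them adds up to at most 5 V.\<close>

lemma distortion:
  assumes g: "good_denom r q p" and J: "\<phi> x1 = \<phi> x0 + 3 / q" and uv: "x0 \<le> u" "u \<le> x1" "x0 \<le> v" "v \<le> x1" and j: "j \<le> q"
  shows "\<bar>S j u - S j v\<bar> \<le> 5 * V"
proof -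
  have fm: "mono (f ^^ i)" for i by (rule circle_lift_mono[OF circle_lift_funpow[OF f]])
  have "x0 \<le> x1" using uv by simp
  have "\<bar>S j u - S j v\<bar> = \<bar>\<Sum>i<j. L ((f ^^ i) u) - L ((f ^^ i) v)\<bar>" by (simp add: S_def sum_subtractf)
  also have "\<dots> \<le> (\<Sum>i<j. \<bar>L ((f ^^ i) u) - L ((f ^^ i) v)\<bar>)" by (rule sum_abs)
  also have "\<dots> \<le> (\<Sum>i<j. W ((f ^^ i) x1) - W ((f ^^ i) x0))"
  proof (rule sum_mono)
    fix i
    define a b where "a = (f ^^ i) (min u v)" and "b = (f ^^ i) (max u v)"
    have ab: "a \<le> b" unfolding a_def b_def by (intro monoD[OF fm]) auto
    have "\<bar>L ((f ^^ i) u) - L ((f ^^ i) v)\<bar> = \<bar>L a - L b\<bar>"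
      by (cases "u \<le> v") (auto simp: a_def b_def min_def max_def)
    also have "\<dots> \<le> W b - W a" by (rule W_bound[OF ab])
    also have "\<dots> \<le> W ((f ^^ i) x1) - W ((f ^^ i) x0)"
      unfolding a_def b_def using uv by (intro diff_mono monoD[OF W_mono] monoD[OF fm]) auto
    finally show "\<bar>L ((f ^^ i) u) - L ((f ^^ i) v)\<bar> \<le> W ((f ^^ i) x1) - W ((f ^^ i) x0)" .
  qed
  also have "\<dots> \<le> (\<Sum>i<q. W ((f ^^ i) x1) - W ((f ^^ i) x0))"
    using j \<open>x0 \<le> x1\<close> by (intro sum_mono2) (auto intro!: monoD[OF W_mono] monoD[OF fm])
  also have "\<dots> = (\<Sum>i<q. W (\<psi> (\<phi> x0 + real i * r + real 3 / q)) - W (\<psi> (\<phi> x0 + real i * r - real 0 / q)))"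
    by (simp add: f_orbit J algebra_simps)
  also have "\<dots> \<le> real (0 + 3 + 2) * V"
    using variation_bound_conj g unfolding variation_bound_def
    by (intro good_denom_sum_increments[where \<Theta> = "\<lambda>y. W (\<psi> y)"]) auto
  finally show ?thesis by simp
qed

text \<open>Let x lie in the k-th cell of width 1 / q, counted from x0. The time j < q is chosen
  with j p congruent to k - 1 modulo q, so that the image of x0 lies within one cell of position k -
  1: not to the right of x, and less than three cells to its left.\<close>

lemma orbit_cover:
  assumes g: "good_denom r q p" and J: "\<phi> x1 = \<phi> x0 + 3 / q"
  shows "\<exists>j<q. \<exists>m::int. x + of_int m \<in> {(f ^^ j) x0..(f ^^ j) x1}"
proof -
  have q: "q > 0" "coprime p (int q)" using g by (auto simp: good_denom_def)
  obtain s where s: "[p * s = 1] (mod int q)" using cong_solve_coprime_int[OF q(2)] by blast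
  define k where "k = \<lfloor>(\<phi> x - \<phi> x0) * q\<rfloor>"
  have "of_int k \<le> (\<phi> x - \<phi> x0) * q" "(\<phi> x - \<phi> x0) * q < of_int k + 1" unfolding k_def by linarith+
  then have k: "of_int k / q \<le> \<phi> x - \<phi> x0" "\<phi> x - \<phi> x0 < (of_int k + 1) / q" using q by (auto simp: field_simps)
  define j where "j = nat (((k - 1) * s) mod int q)"
  have jq: "j < q" "int j = ((k - 1) * s) mod int q" using q(1) by (auto simp: j_def nat_less_iff)
  have "[int j * p = ((k - 1) * s) * p] (mod int q)" unfolding jq(2) by (intro cong_mult cong_refl) (simp add: cong_def)
  also have "[((k - 1) * s) * p = (k - 1) * 1] (mod int q)"
    using cong_mult[OF cong_refl s, of "k - 1"] by (simp add: mult_ac)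
  finally have "[int j * p = k - 1] (mod int q)" by simp
  then obtain m where m: "int j * p = k - 1 + int q * m" by (metis cong_iff_lin cong_sym)
  have jr: "\<bar>real j * r - of_int (int j * p) / q\<bar> < 1 / q" by (rule good_denom_multiple[OF g jq(1)])
  have e: "of_int (int j * p) / real q = of_int k / q - 1 / q + of_int m"
    unfolding m using q by (simp add: field_simps)
  have k': "(of_int k + 1) / real q = of_int k / q + 1 / q" by (simp add: add_divide_distrib)
  have "\<phi> x0 + real j * r \<le> \<phi> x + of_int m"
    using jr k unfolding e k' abs_less_iff by linarith
  moreover have "\<phi> x + of_int m \<le> \<phi> x0 + 3 / q + real j * r"
  proof -
    have "3 / real q = 3 * (1 / real q)" by simp
    then show ?thesis using jr k unfolding e k' abs_less_iff by linarith
  qed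
  moreover have "\<phi> (x + of_int m) = \<phi> x + of_int m" by (rule circle_lift_add_int[OF \<phi>])
  ultimately have "\<phi> ((f ^^ j) x0) \<le> \<phi> (x + of_int m)" "\<phi> (x + of_int m) \<le> \<phi> ((f ^^ j) x1)"
    by (simp_all add: \<phi>_orbit J)
  then show ?thesis using jq(1) unfolding \<phi>_le by auto
qed

text \<open>By bounded distortion the share of Z in the image of [x0, x1] at time j exceeds its
  share in [x0, x1] at most by the factor exp (10 V), with 5 V from the upper and 5 V from the lower
  estimate. The images cover the circle and have total length at most 5.\<close>

lemma invariant_set_uniform_density:
  assumes Z: "Z \<in> sets borel" and per: "\<And>x. x + 1 \<in> Z \<longleftrightarrow> x \<in> Z" and inv: "\<And>x. f x \<in> Z \<longleftrightarrow> x \<in> Z"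
    and g: "good_denom r q p" and J: "\<phi> x1 = \<phi> x0 + 3 / q"
  shows "measure lborel (Z \<inter> {0..<1}) * (x1 - x0) \<le> 5 * exp (10 * V) * measure lborel (Z \<inter> {x0..x1})"
proof -
  have q: "q > 0" using g by (simp add: good_denom_def)
  have "\<phi> x0 \<le> \<phi> x1" using J q by simp
  then have x01: "x0 \<le> x1" by (simp add: \<phi>_le)
  have fsm: "(f ^^ i) u \<le> (f ^^ i) v \<longleftrightarrow> u \<le> v" for i u v
    using circle_lift_funpow[OF f, of i] by (simp add: circle_lift_def strict_mono_less_eq)
  have invj: "(f ^^ j) x \<in> Z \<longleftrightarrow> x \<in> Z" for j x by (induction j) (auto simp: inv)
  define I where "I j = {(f ^^ j) x0..(f ^^ j) x1}" for j
  have fin: "emeasure lborel (Z \<inter> {u..v}) < \<infinity>" for u v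
    by (rule le_less_trans[OF emeasure_mono[of _ "{u..v}"]]) (auto simp: emeasure_lborel_Icc_eq)
  have em: "emeasure lborel (Z \<inter> {u..v}) = ennreal (measure lborel (Z \<inter> {u..v}))" for u v
    using fin[of u v] by (simp add: emeasure_eq_ennreal_measure)
  have "emeasure lborel (Z \<inter> {0..<1}) < \<infinity>"
    by (rule le_less_trans[OF emeasure_mono[of _ "{0..<1}"]]) auto
  then have emz: "emeasure lborel (Z \<inter> {0..<1}) = ennreal (measure lborel (Z \<inter> {0..<1}))"
    by (simp add: emeasure_eq_ennreal_measure)
  have bound: "measure lborel (Z \<inter> I j) * (x1 - x0) \<le> exp (10 * V) * ((f ^^ j) x1 - (f ^^ j) x0) * measure lborel (Z \<inter> {x0..x1})"
    if j: "j < q" for j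
  proof -
    have dist: "\<bar>S j t - S j x0\<bar> \<le> 5 * V" if "t \<in> {x0..x1}" for t
      using that j x01 by (intro distortion[OF g J]) auto
    have zm: "(\<lambda>t. indicator (Z \<inter> I j) t :: ennreal) \<in> borel_measurable borel" using Z by (simp add: I_def)
    have "emeasure lborel (Z \<inter> I j) = (\<integral>\<^sup>+t. indicator (Z \<inter> I j) t \<partial>lborel)"
      using Z by (simp add: I_def)
    also have "\<dots> = (\<integral>\<^sup>+t. indicator (Z \<inter> I j) ((f ^^ j) t) * ennreal (exp (S j t)) \<partial>lborel)"
      using cov_S[of j] zm unfolding change_of_variables_def by simp
    also have "\<dots> \<le> (\<integral>\<^sup>+t. ennreal (exp (S j x0 + 5 * V)) * indicator (Z \<inter> {x0..x1}) t \<partial>lborel)"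
    proof (rule nn_integral_mono)
      fix t
      show "indicator (Z \<inter> I j) ((f ^^ j) t) * ennreal (exp (S j t)) \<le> ennreal (exp (S j x0 + 5 * V)) * indicator (Z \<inter> {x0..x1}) t"
      proof (cases "t \<in> Z \<inter> {x0..x1}")
        case True
        then have "S j t \<le> S j x0 + 5 * V" using dist[of t] by auto
        then show ?thesis using True by (simp add: indicator_def ennreal_leI)
      next
        case False
        then have "(f ^^ j) t \<notin> Z \<inter> I j" using invj[of j t] by (auto simp: I_def fsm)
        then show ?thesis by simp
      qed
    qed
    also have "\<dots> = ennreal (exp (S j x0 + 5 * V)) * emeasure lborel (Z \<inter> {x0..x1})"
      using Z by (simp add: nn_integral_cmult_indicator)
    finally have 1: "measure lborel (Z \<inter> I j) \<le> exp (S j x0 + 5 * V) * measure lborel (Z \<inter> {x0..x1})"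
      unfolding I_def em by (simp add: ennreal_mult[symmetric] ennreal_le_iff)
    have "ennreal (exp (S j x0 - 5 * V) * (x1 - x0)) = (\<integral>\<^sup>+t. ennreal (exp (S j x0 - 5 * V)) * indicator {x0..x1} t \<partial>lborel)"
      using x01 by (simp add: nn_integral_cmult_indicator ennreal_mult)
    also have "\<dots> \<le> (\<integral>\<^sup>+t. ennreal (exp (S j t)) * indicator {x0..x1} t \<partial>lborel)"
    proof (rule nn_integral_mono)
      fix t
      show "ennreal (exp (S j x0 - 5 * V)) * indicator {x0..x1} t \<le> ennreal (exp (S j t)) * indicator {x0..x1} t"
      proof (cases "t \<in> {x0..x1}")
        case True
        then have "S j x0 - 5 * V \<le> S j t" using dist[of t] by auto
        then show ?thesis using True by (simp add: ennreal_leI)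
      qed simp
    qed
    also have "\<dots> = ennreal ((f ^^ j) x1 - (f ^^ j) x0)"
      by (rule circle_lift_increment[OF circle_lift_funpow[OF f] cov_S x01])
    finally have 2: "exp (S j x0 - 5 * V) * (x1 - x0) \<le> (f ^^ j) x1 - (f ^^ j) x0"
      using x01 fsm[of j x0 x1] by (simp add: ennreal_le_iff)
    have e: "exp (S j x0 + 5 * V) = exp (10 * V) * exp (S j x0 - 5 * V)" by (simp flip: exp_add)
    have "measure lborel (Z \<inter> I j) * (x1 - x0) \<le> (exp (S j x0 + 5 * V) * measure lborel (Z \<inter> {x0..x1})) * (x1 - x0)"
      using 1 x01 by (intro mult_right_mono) auto
    also have "\<dots> = (exp (10 * V) * measure lborel (Z \<inter> {x0..x1})) * (exp (S j x0 - 5 * V) * (x1 - x0))"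
      unfolding e by (simp add: mult_ac)
    also have "\<dots> \<le> (exp (10 * V) * measure lborel (Z \<inter> {x0..x1})) * ((f ^^ j) x1 - (f ^^ j) x0)"
      using 2 by (intro mult_left_mono) auto
    finally show ?thesis by (simp add: mult_ac)
  qed
  have "emeasure lborel (Z \<inter> {0..<1}) \<le> emeasure lborel (\<Union>j<q. Z \<inter> I j)"
  proof (rule emeasure_mod1_image_le)
    have peri: "x + of_int m \<in> Z \<longleftrightarrow> x \<in> Z" for x m
      using add_int_of_add_one[of "indicator Z" 0 x m] per by (simp add: indicator_def of_bool_eq_iff)
    fix x assume "x \<in> Z \<inter> {0..<1}"
    then show "\<exists>m::int. x + of_int m \<in> (\<Union>j<q. Z \<inter> I j)"
      using orbit_cover[OF g J, of x] by (auto simp: I_def peri)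
  qed (use Z in \<open>auto simp: I_def\<close>)
  also have "\<dots> \<le> (\<Sum>j<q. emeasure lborel (Z \<inter> I j))"
    using Z by (intro emeasure_subadditive_finite) (auto simp: I_def)
  also have "\<dots> = ennreal (\<Sum>j<q. measure lborel (Z \<inter> I j))"
    by (simp add: I_def em sum_ennreal)
  finally have "measure lborel (Z \<inter> {0..<1}) \<le> (\<Sum>j<q. measure lborel (Z \<inter> I j))"
    unfolding emz by (simp add: ennreal_le_iff sum_nonneg)
  then have "measure lborel (Z \<inter> {0..<1}) * (x1 - x0) \<le> (\<Sum>j<q. measure lborel (Z \<inter> I j)) * (x1 - x0)"
    using x01 by (intro mult_right_mono) auto
  also have "\<dots> \<le> (\<Sum>j<q. exp (10 * V) * ((f ^^ j) x1 - (f ^^ j) x0) * measure lborel (Z \<inter> {x0..x1}))"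
    unfolding sum_distrib_right using bound by (intro sum_mono) auto
  also have "\<dots> = (\<Sum>j<q. (f ^^ j) x1 - (f ^^ j) x0) * (exp (10 * V) * measure lborel (Z \<inter> {x0..x1}))"
    unfolding sum_distrib_right by (intro sum.cong) (simp_all add: mult_ac)
  also have "\<dots> \<le> 5 * (exp (10 * V) * measure lborel (Z \<inter> {x0..x1}))"
  proof (rule mult_right_mono)
    have "(\<Sum>j<q. (f ^^ j) x1 - (f ^^ j) x0) = (\<Sum>i<q. \<psi> (\<phi> x0 + real i * r + real 3 / q) - \<psi> (\<phi> x0 + real i * r - real 0 / q))"
      by (simp add: f_orbit J algebra_simps)
    also have "\<dots> \<le> real (0 + 3 + 2) * 1"
      using \<psi> by (intro good_denom_sum_increments[OF g]) (auto simp: circle_lift_mono circle_lift_def)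
    finally show "(\<Sum>j<q. (f ^^ j) x1 - (f ^^ j) x0) \<le> 5" by simp
  qed simp
  finally show ?thesis by simp
qed

text \<open>An arbitrary interval is tiled by intervals of \<phi>-length 3 / q. For large q the
  uncovered rest is shorter than any given e, because \<phi> is strictly increasing.\<close>

lemma invariant_set_density_interval:
  assumes Z: "Z \<in> sets borel" and per: "\<And>x. x + 1 \<in> Z \<longleftrightarrow> x \<in> Z" and inv: "\<And>x. f x \<in> Z \<longleftrightarrow> x \<in> Z"
    and H: "indefinite_integral H (indicator Z)"
  shows "x \<le> y \<Longrightarrow> measure lborel (Z \<inter> {0..<1}) / (5 * exp (10 * V)) * (y - x) \<le> H y - H x"
proof -
  define \<kappa> where "\<kappa> = measure lborel (Z \<inter> {0..<1}) / (5 * exp (10 * V))"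
  have \<kappa>0: "\<kappa> \<ge> 0" by (simp add: \<kappa>_def)
  have Hm: "H y - H x = measure lborel (Z \<inter> {x..y})" if "x \<le> y" for x y
  proof -
    have "H y - H x = (\<integral>t. indicator {x..y} t *\<^sub>R indicator Z t \<partial>lborel)"
      using H that by (simp add: indefinite_integral_def set_lebesgue_integral_def)
    also have "\<dots> = (\<integral>t. indicator (Z \<inter> {x..y}) t \<partial>lborel)"
      by (intro Bochner_Integration.integral_cong) (auto simp: indicator_def)
    also have "\<dots> = measure lborel (Z \<inter> {x..y})" using Z by simp
    finally show ?thesis .
  qed
  have tile: "\<kappa> * (x1 - x0) \<le> H x1 - H x0" if g: "good_denom r q p" and J: "\<phi> x1 = \<phi> x0 + 3 / q" for q p x0 x1
  proof -
    have "\<phi> x0 \<le> \<phi> x1" using J by simp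
    then have "x0 \<le> x1" by (simp add: \<phi>_le)
    then show ?thesis using invariant_set_uniform_density[OF Z per inv g J]
      by (simp add: Hm \<kappa>_def field_simps)
  qed
  have "\<kappa> * (y - x) \<le> H y - H x + \<kappa> * e" if xy: "x \<le> y" and e: "e > 0" for x y e
  proof -
    have "\<phi> (y - e) < \<phi> y" using e by (simp add: \<phi>_less)
    then obtain n :: nat where n: "3 / (\<phi> y - \<phi> (y - e)) < n" using reals_Archimedean2 by blast
    obtain q p where q: "good_denom r q p" "n \<le> q" using unb by blast
    have "q > 0" using q by (simp add: good_denom_def)
    have "3 / (\<phi> y - \<phi> (y - e)) < q" using n q(2) by linarith
    then have q3: "3 / real q < \<phi> y - \<phi> (y - e)"
      using \<open>\<phi> (y - e) < \<phi> y\<close> \<open>q > 0\<close> by (simp add: field_simps)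
    define z where "z i = \<psi> (\<phi> x + real i * (3 / q))" for i
    have z0: "z 0 = x" by (simp add: z_def \<psi>\<phi>)
    have zs: "\<kappa> * (z i - x) \<le> H (z i) - H x" for i
    proof (induction i)
      case (Suc i)
      have "\<phi> (z (Suc i)) = \<phi> (z i) + 3 / q" by (simp add: z_def \<phi>\<psi> algebra_simps add_divide_distrib)
      then have "\<kappa> * (z (Suc i) - z i) \<le> H (z (Suc i)) - H (z i)" by (rule tile[OF q(1)])
      then show ?case using Suc by (simp add: algebra_simps)
    qed (simp add: z0)
    define N where "N = nat \<lfloor>(\<phi> y - \<phi> x) * q / 3\<rfloor>"
    have "\<phi> x \<le> \<phi> y" using xy by (simp add: \<phi>_le)
    then have "real N \<le> (\<phi> y - \<phi> x) * q / 3" "(\<phi> y - \<phi> x) * q / 3 < real N + 1"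
      unfolding N_def by (simp_all add: of_nat_nat, linarith)
    then have N: "\<phi> x + real N * (3 / q) \<le> \<phi> y" "\<phi> y < \<phi> x + real N * (3 / q) + 3 / q"
      using \<open>q > 0\<close> by (auto simp: field_simps)
    have "z N \<le> y" using N(1) by (metis z_def \<psi>_le \<psi>\<phi>)
    moreover have "\<phi> (y - e) \<le> \<phi> (z N)" using N(2) q3 by (simp add: z_def \<phi>\<psi>)
    then have "y - e \<le> z N" by (simp add: \<phi>_le)
    moreover have "H (z N) \<le> H y" using Hm[OF \<open>z N \<le> y\<close>] by (metis diff_ge_0_iff_ge measure_nonneg)
    moreover have "\<kappa> * (y - e - x) \<le> \<kappa> * (z N - x)" using \<open>y - e \<le> z N\<close> \<kappa>0 by (intro mult_left_mono) auto
    moreover have "\<kappa> * (y - x) = \<kappa> * (y - e - x) + \<kappa> * e" by (simp add: algebra_simps)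
    ultimately show ?thesis using zs[of N] by linarith
  qed note * = this
  show "measure lborel (Z \<inter> {0..<1}) / (5 * exp (10 * V)) * (y - x) \<le> H y - H x" if "x \<le> y"
  proof -
    have "\<kappa> * (y - x) \<le> H y - H x"
    proof (rule field_le_epsilon)
      fix d :: real assume "d > 0"
      then have "d / (\<kappa> + 1) > 0" using \<kappa>0 by simp
      moreover have "\<kappa> * (d / (\<kappa> + 1)) \<le> d" using \<kappa>0 \<open>d > 0\<close> by (simp add: field_simps)
      ultimately show "\<kappa> * (y - x) \<le> H y - H x + d" using *[OF that, of "d / (\<kappa> + 1)"] by linarith
    qed
    then show ?thesis by (simp add: \<kappa>_def)
  qed
qed

text \<open>Ergodicity without density points: the indicator of Z has integral at least \<kappa> (y
  - x) over every interval, so subtracting \<kappa> x from its primitive leaves a monotone function,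
  which has a nonnegative density. By uniqueness of densities the indicator is almost everywhere at
  least \<kappa> > 0, that is, equal to 1.\<close>

lemma invariant_set_conull:
  assumes Z: "Z \<in> sets borel" and per: "\<And>x. x + 1 \<in> Z \<longleftrightarrow> x \<in> Z" and inv: "\<And>x. f x \<in> Z \<longleftrightarrow> x \<in> Z"
    and pos: "emeasure lborel Z \<noteq> 0"
  shows "emeasure lborel (- Z) = 0"
proof -
  define \<kappa> where "\<kappa> = measure lborel (Z \<inter> {0..<1}) / (5 * exp (10 * V))"
  have ii: "integrable lborel (indicator {x..y} :: real \<Rightarrow> real)" for x y
    by (rule integrable_real_indicator) (auto simp: emeasure_lborel_Icc_eq)
  have "emeasure lborel (Z \<inter> {0..<1}) \<noteq> 0" using periodic_null[OF Z per] pos by blast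
  moreover have "emeasure lborel (Z \<inter> {0..<1}) < \<infinity>"
    by (rule le_less_trans[OF emeasure_mono[of _ "{0..<1}"]]) auto
  ultimately have "measure lborel (Z \<inter> {0..<1}) \<noteq> 0" by (simp add: emeasure_eq_ennreal_measure)
  then have "measure lborel (Z \<inter> {0..<1}) > 0" using measure_nonneg[of lborel "Z \<inter> {0..<1}"] by linarith
  then have \<kappa>: "\<kappa> > 0" by (simp add: \<kappa>_def)
  obtain H where H: "indefinite_integral H (indicator Z)"
  proof (rule primitive_exists)
    show "(indicator Z :: real \<Rightarrow> real) \<in> borel_measurable borel" using Z by simp
    show "set_integrable lborel {x..y} (indicator Z :: real \<Rightarrow> real)" for x y
      unfolding set_integrable_def
      by (rule Bochner_Integration.integrable_bound[OF ii[of x y]]) (use Z in \<open>auto simp: indicator_def\<close>)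
  qed
  have low: "\<kappa> * (y - x) \<le> H y - H x" if "x \<le> y" for x y
    using invariant_set_density_interval[OF Z per inv H that] by (simp add: \<kappa>_def)
  have up: "H y - H x \<le> y - x" if "x \<le> y" for x y
  proof -
    have "H y - H x = (LINT t:{x..y}|lborel. indicator Z t)" using H that by (simp add: indefinite_integral_def)
    also have "\<dots> \<le> (LINT t:{x..y}|lborel. 1)"
    proof (rule set_integral_mono)
      show "set_integrable lborel {x..y} (indicator Z :: real \<Rightarrow> real)" using H that by (simp add: indefinite_integral_def)
      show "set_integrable lborel {x..y} (\<lambda>_. 1 :: real)" using ii[of x y] by (simp add: set_integrable_def)
    qed (simp add: indicator_def)
    also have "\<dots> = y - x" using that by (simp add: set_lebesgue_integral_def)
    finally show ?thesis .
  qed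
  define M where "M x = H x - \<kappa> * x" for x
  have "mono M"
  proof (rule monoI)
    fix x y :: real assume "x \<le> y"
    then show "M x \<le> M y" using low[of x y] by (simp add: M_def algebra_simps)
  qed
  have "ac_fun M"
  proof (rule lipschitz_ac_fun)
    fix x y :: real assume xy: "x \<le> y"
    have "0 \<le> \<kappa> * (y - x)" using \<kappa> xy by simp
    then show "\<bar>M y - M x\<bar> \<le> 1 * (y - x)" using up[OF xy] low[OF xy] by (simp add: M_def algebra_simps)
  qed simp
  obtain g where g: "indefinite_integral M g" "\<And>x. 0 \<le> g x" by (rule ac_mono_density[OF \<open>ac_fun M\<close> \<open>mono M\<close>]) blast
  have "indefinite_integral H (\<lambda>x. g x - - \<kappa>)"
  proof -
    have "indefinite_integral (\<lambda>x. - (\<kappa> * x)) (\<lambda>_. - \<kappa>)"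
      by (auto simp: indefinite_integral_def set_lebesgue_integral_def set_integrable_def algebra_simps)
    from indefinite_integral_diff[OF g(1) this] show ?thesis by (simp add: M_def)
  qed
  then have "AE x in lborel. indicator Z x = g x - - \<kappa>"
    by (rule interval_integrals_eq_AE[OF H]) (use g \<kappa> in \<open>auto intro: add_nonneg_nonneg less_imp_le\<close>)
  then have "AE x in lborel. x \<in> Z"
  proof eventually_elim
    fix x assume "indicator Z x = g x - - \<kappa>"
    then show "x \<in> Z" using g(2)[of x] \<kappa> by (cases "x \<in> Z") auto
  qed
  then show ?thesis using Z by (subst (asm) AE_iff_measurable[of "- Z"]) auto
qed

end

section \<open>The invariant measure\<close>

definition unit_lborel :: "real measure" where
  "unit_lborel = restrict_space lborel {0..<1}"

lemma sets_unit_lborel[simp, measurable_cong]: "sets unit_lborel = sets (restrict_space borel {0..<1})"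
  unfolding unit_lborel_def by (rule sets_restrict_space_cong) simp

lemma space_unit_lborel[simp]: "space unit_lborel = {0..<1}"
  by (simp add: unit_lborel_def space_restrict_space)

lemma sets_unit_lborel_iff: "A \<in> sets unit_lborel \<longleftrightarrow> A \<in> sets borel \<and> A \<subseteq> {0..<1}"
  by (subst sets_unit_lborel) (subst sets_restrict_space_iff, auto)

lemma emeasure_unit_lborel: "A \<subseteq> {0..<1} \<Longrightarrow> emeasure unit_lborel A = emeasure lborel A"
  unfolding unit_lborel_def by (rule emeasure_restrict_space) auto

lemma nn_integral_unit_lborel:
  "(\<integral>\<^sup>+x. u x \<partial>unit_lborel) = (\<integral>\<^sup>+x. u x * indicator {0..<1} x \<partial>lborel)"
  unfolding unit_lborel_def by (rule nn_integral_restrict_space) auto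

text \<open>One inequality comes from translating B modulo 1, the other from doing so with the
  inverse rotation.\<close>

lemma emeasure_rotation:
  fixes B :: "real set"
  assumes B: "B \<in> sets borel" "B \<subseteq> {0..<1}"
  shows "emeasure lborel {y \<in> {0..<1}. frac (y + t) \<in> B} = emeasure lborel B"
proof (rule antisym)
  have fm: "frac \<in> borel_measurable (borel :: real measure)" unfolding frac_def by measurable
  then have "(\<lambda>y. frac (y + t)) \<in> borel_measurable borel" by measurable
  then have "(\<lambda>y. frac (y + t)) -` B \<inter> space borel \<in> sets borel" by (rule measurable_sets[OF _ B(1)])
  moreover have "{y \<in> {0..<1}. frac (y + t) \<in> B} = ((\<lambda>y. frac (y + t)) -` B \<inter> space borel) \<inter> {0..<1}" by auto
  ultimately have Am: "{y \<in> {0..<1}. frac (y + t) \<in> B} \<in> sets borel" by simp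
  have "emeasure lborel {y \<in> {0..<1}. frac (y + t) \<in> B} \<le> emeasure lborel {z. z + t \<in> B}"
  proof (rule emeasure_mod1_image_le[OF _ _ _ Am])
    show "{z. z + t \<in> B} \<in> sets borel" using B(1) by measurable
    fix y assume "y \<in> {y \<in> {0..<1}. frac (y + t) \<in> B}"
    then have "y + of_int (- \<lfloor>y + t\<rfloor>) \<in> {z. z + t \<in> B}" by (simp add: frac_def algebra_simps)
    then show "\<exists>m::int. y + of_int m \<in> {z. z + t \<in> B}" by blast
  qed auto
  then show "emeasure lborel {y \<in> {0..<1}. frac (y + t) \<in> B} \<le> emeasure lborel B"
    using emeasure_lborel_translate[OF B(1), of t] by simp
  define A where "A = {y \<in> {0..<1}. frac (y + t) \<in> B}"
  have "emeasure lborel B \<le> emeasure lborel {z. z + (- t) \<in> A}"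
  proof (rule emeasure_mod1_image_le[OF _ B(2) _ B(1)])
    show "{z. z + (- t) \<in> A} \<in> sets borel" using Am unfolding A_def[symmetric] by measurable
    fix x assume x: "x \<in> B"
    have e: "x + of_int (- \<lfloor>x - t\<rfloor>) + (- t) = frac (x - t)" by (simp add: frac_def)
    have "frac (frac (x - t) + t) = frac x"
    proof -
      have "frac (x - t) + t = x - of_int \<lfloor>x - t\<rfloor>" by (simp add: frac_def)
      then show ?thesis by (simp only:) (simp add: frac_def)
    qed
    also have "frac x = x" using x B(2) by (auto simp: frac_eq)
    finally have "x + of_int (- \<lfloor>x - t\<rfloor>) \<in> {z. z + (- t) \<in> A}"
      using x by (simp only: mem_Collect_eq e) (simp add: A_def frac_lt_1)
    then show "\<exists>m::int. x + of_int m \<in> {z. z + (- t) \<in> A}" by blast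
  qed
  also have "\<dots> = emeasure lborel A" using Am by (intro emeasure_lborel_translate) (simp add: A_def)
  finally show "emeasure lborel B \<le> emeasure lborel {y \<in> {0..<1}. frac (y + t) \<in> B}" by (simp add: A_def)
qed

lemma rotation_measurable: "(\<lambda>y. frac (y + t)) \<in> measurable unit_lborel unit_lborel"
proof -
  have "frac \<in> borel_measurable (borel :: real measure)" unfolding frac_def by measurable
  then have "(\<lambda>y. frac (y + t)) \<in> borel_measurable borel" by measurable
  then have "(\<lambda>y. frac (y + t)) \<in> measurable (restrict_space borel {0..<1}) (restrict_space borel {0..<1})"
    by (intro measurable_restrict_space3) (auto simp: frac_lt_1)
  then show ?thesis by (simp cong: measurable_cong_sets)
qed

lemma distr_rotation: "distr unit_lborel unit_lborel (\<lambda>y. frac (y + t)) = unit_lborel"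
proof (rule measure_eqI)
  fix A assume "A \<in> sets (distr unit_lborel unit_lborel (\<lambda>y. frac (y + t)))"
  then have A: "A \<in> sets unit_lborel" "A \<in> sets borel" "A \<subseteq> {0..<1}" by (simp_all add: sets_unit_lborel_iff del: sets_unit_lborel)
  have v: "(\<lambda>y. frac (y + t)) -` A \<inter> space unit_lborel = {y \<in> {0..<1}. frac (y + t) \<in> A}" by auto
  have "emeasure (distr unit_lborel unit_lborel (\<lambda>y. frac (y + t))) A = emeasure unit_lborel {y \<in> {0..<1}. frac (y + t) \<in> A}"
    unfolding v[symmetric] by (rule emeasure_distr[OF rotation_measurable A(1)])
  also have "\<dots> = emeasure lborel {y \<in> {0..<1}. frac (y + t) \<in> A}" by (rule emeasure_unit_lborel) auto
  also have "\<dots> = emeasure unit_lborel A" by (simp only: emeasure_rotation[OF A(2,3)] emeasure_unit_lborel[OF A(3)])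
  finally show "emeasure (distr unit_lborel unit_lborel (\<lambda>y. frac (y + t))) A = emeasure unit_lborel A" .
qed simp

lemma nn_integral_rotation:
  fixes u :: "real \<Rightarrow> ennreal"
  assumes u: "u \<in> borel_measurable borel" and per: "\<And>x. u (x + 1) = u x"
  shows "(\<integral>\<^sup>+y. u (y + t) \<partial>unit_lborel) = (\<integral>\<^sup>+y. u y \<partial>unit_lborel)"
proof -
  have ufrac: "u (frac y) = u y" for y
  proof -
    have nat: "u (x + of_nat n) = u x" for x n
    proof (induction n)
      case (Suc n)
      have "u (x + of_nat (Suc n)) = u ((x + of_nat n) + 1)" by (simp add: add_ac)
      then show ?case using per Suc by simp
    qed simp
    have "u (x + of_int m) = u x" for x m
    proof (cases "m \<ge> 0")
      case True
      then show ?thesis using nat[of x "nat m"] by simp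
    next
      case False
      then show ?thesis using nat[of "x + of_int m" "nat (- m)"] by simp
    qed
    from this[of "frac y" "\<lfloor>y\<rfloor>"] show ?thesis by (simp add: frac_def)
  qed
  have um: "u \<in> borel_measurable unit_lborel"
    using u by (simp add: measurable_restrict_space1 cong: measurable_cong_sets)
  have "(\<integral>\<^sup>+y. u y \<partial>unit_lborel) = (\<integral>\<^sup>+y. u y \<partial>distr unit_lborel unit_lborel (\<lambda>y. frac (y + t)))"
    by (simp add: distr_rotation)
  also have "\<dots> = (\<integral>\<^sup>+y. u (frac (y + t)) \<partial>unit_lborel)"
    by (rule nn_integral_distr[OF rotation_measurable]) (use um in simp)
  finally show ?thesis by (simp add: ufrac)
qed

text \<open>The distribution function, continued to the line as G with G (x + 1) = G x + 1, is a
  semiconjugacy to the translation by G (f 0). Its growth along an orbit gives G (f 0) = r, and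
  semiconjugacies are unique. In particular all invariant measures have the same distribution
  function.\<close>

lemma invariant_prob_cdf:
  assumes f: "circle_lift f" and trans: "\<And>n x. \<bar>(f ^^ n) x - x - real n * r\<bar> \<le> 2" and rQ: "r \<notin> \<rat>"
    and \<phi>: "rotation_semiconj f r \<phi>" "\<phi> 0 = 0" and \<mu>: "invariant_prob f \<mu>" and x: "0 \<le> x" "x \<le> 1"
  shows "measure \<mu> {0..<x} = \<phi> x"
proof -
  interpret prob_space \<mu> using \<mu> by (simp add: invariant_prob_def)
  have s\<mu>: "sets \<mu> = sets (restrict_space borel {0..<1})" and Tm: "circle_map f \<in> measurable \<mu> \<mu>"
    and Td: "distr \<mu> \<mu> (circle_map f) = \<mu>" using \<mu> by (auto simp: invariant_prob_def)
  have sp: "space \<mu> = {0..<1}" using sets_eq_imp_space_eq[OF s\<mu>] by (simp add: space_restrict_space)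
  have ms: "{a..<b} \<in> sets \<mu>" if "0 \<le> a" "b \<le> 1" for a b
    unfolding s\<mu> using that by (subst sets_restrict_space_iff) auto
  define m where "m b = measure \<mu> {0..<b}" for b
  have fsm: "f u < f v \<longleftrightarrow> u < v" and fle: "f u \<le> f v \<longleftrightarrow> u \<le> v" for u v
    using f by (auto simp: circle_lift_def strict_mono_less strict_mono_less_eq)
  have f1: "f (u + 1) = f u + 1" for u using f by (simp add: circle_lift_def)
  have m01: "m 0 = 0" "m 1 = 1" using prob_space by (auto simp: m_def sp)
  have mint: "measure \<mu> {a..<b} = m b - m a" if "0 \<le> a" "a \<le> b" "b \<le> 1" for a b
  proof -
    have "{a..<b} = {0..<b} - {0..<a}" using that by auto
    then have "measure \<mu> {a..<b} = measure \<mu> ({0..<b} - {0..<a})" by (rule arg_cong)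
    also have "\<dots> = m b - m a" unfolding m_def using that ms by (intro finite_measure_Diff) auto
    finally show ?thesis .
  qed
  have inv: "measure \<mu> (circle_map f -` A \<inter> {0..<1}) = measure \<mu> A" if "A \<in> sets \<mu>" for A
    using measure_distr[OF Tm that] Td sp by simp
  define G where "G x = of_int \<lfloor>x\<rfloor> + m (frac x)" for x
  have Gk: "G x = of_int k + m (x - of_int k)" if "of_int k \<le> x" "x \<le> of_int k + 1" for x k
  proof (cases "x < of_int k + 1")
    case True
    then have "\<lfloor>x\<rfloor> = k" using that by (simp add: floor_eq_iff)
    then show ?thesis by (simp add: G_def frac_def)
  next
    case False
    then have "x = of_int (k + 1)" using that by simp
    then show ?thesis using m01 by (simp add: G_def)
  qed
  have mmono: "m a \<le> m b" if "a \<le> b" "b \<le> 1" for a b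
    unfolding m_def using that ms by (intro finite_measure_mono) auto
  have m0: "0 \<le> m b" "m b \<le> 1" for b unfolding m_def by (auto simp: measure_nonneg)
  have "mono G"
  proof (rule monoI)
    fix a b :: real assume ab: "a \<le> b"
    show "G a \<le> G b"
    proof (cases "\<lfloor>a\<rfloor> = \<lfloor>b\<rfloor>")
      case True
      then show ?thesis using ab by (simp add: G_def frac_def) (rule mmono; linarith)
    next
      case False
      then have "\<lfloor>a\<rfloor> + 1 \<le> \<lfloor>b\<rfloor>" using floor_mono[OF ab] by simp
      then have "real_of_int \<lfloor>a\<rfloor> + 1 \<le> of_int \<lfloor>b\<rfloor>" by linarith
      then show ?thesis using m0[of "frac a"] m0[of "frac b"] by (simp add: G_def)
    qed
  qed
  moreover have G1: "G (a + 1) = G a + 1" for a by (simp add: G_def frac_1_eq)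
  moreover have Gf: "G (f a) = G a + G (f 0)" for a
  proof -
    have base: "G (f a) = m a + G (f 0)" if a: "0 \<le> a" "a < 1" for a
    proof -
      define k where "k = \<lfloor>f 0\<rfloor>"
      have k: "of_int k \<le> f 0" "f 0 < of_int k + 1" unfolding k_def by linarith+
      have fa: "f 0 \<le> f a" "f a < f 0 + 1" using a f1[of 0] by (auto simp: fle fsm simp flip: f1)
      have fz: "f 0 \<le> f z" "f z < f 0 + 1" if "z \<in> {0..<1}" for z
        using that f1[of 0] by (auto simp: fle fsm simp flip: f1)
      have fr: "frac (f z) = (if f z < of_int k + 1 then f z - of_int k else f z - of_int k - 1)" if "z \<in> {0..<1}" for z
        using fz[OF that] k by (auto intro!: frac_unique_iff[THEN iffD2])
      have G0: "G (f 0) = of_int k + m (f 0 - of_int k)" using k by (intro Gk) auto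
      \<comment> \<open>The arc from f 0 to f a is the image of the segment from 0 to a. If it
        passes an integer, the complementary arc, the image of the segment from a to 1, is measured
        instead.\<close>
      show ?thesis
      proof (cases "f a \<le> of_int k + 1")
        case True
        have "circle_map f -` {f 0 - of_int k..<f a - of_int k} \<inter> {0..<1} = {0..<a}"
        proof (intro set_eqI iffI)
          fix z assume z: "z \<in> circle_map f -` {f 0 - of_int k..<f a - of_int k} \<inter> {0..<1}"
          then have "f z < f a" using fr[of z] fz[of z] k True by (auto simp: circle_map_def split: if_splits)
          then show "z \<in> {0..<a}" using z by (simp add: fsm)
        next
          fix z assume z: "z \<in> {0..<a}"
          then have z1: "z \<in> {0..<1}" "f z < f a" using a by (auto simp: fsm)
          then show "z \<in> circle_map f -` {f 0 - of_int k..<f a - of_int k} \<inter> {0..<1}"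
            using fr[of z] fz[of z] True by (auto simp: circle_map_def)
        qed
        then have "m a = measure \<mu> {f 0 - of_int k..<f a - of_int k}"
          using inv[OF ms[of "f 0 - of_int k" "f a - of_int k"]] k True by (simp add: m_def)
        also have "\<dots> = m (f a - of_int k) - m (f 0 - of_int k)" using k fa True by (intro mint) auto
        finally show ?thesis using Gk[of k "f a"] k fa True G0 by simp
      next
        case False
        have "circle_map f -` {f a - of_int k - 1..<f 0 - of_int k} \<inter> {0..<1} = {a..<1}"
        proof (intro set_eqI iffI)
          fix z assume z: "z \<in> circle_map f -` {f a - of_int k - 1..<f 0 - of_int k} \<inter> {0..<1}"
          then have "f a \<le> f z" using fr[of z] fz[of z] k False by (auto simp: circle_map_def split: if_splits)
          then show "z \<in> {a..<1}" using z by (simp add: fle)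
        next
          fix z assume z: "z \<in> {a..<1}"
          then have z1: "z \<in> {0..<1}" "f a \<le> f z" using a by (auto simp: fle)
          then show "z \<in> circle_map f -` {f a - of_int k - 1..<f 0 - of_int k} \<inter> {0..<1}"
            using fr[of z] fz[of z] False by (auto simp: circle_map_def)
        qed
        then have "measure \<mu> {a..<1} = measure \<mu> {f a - of_int k - 1..<f 0 - of_int k}"
          using inv[OF ms[of "f a - of_int k - 1" "f 0 - of_int k"]] k False by simp
        moreover have "measure \<mu> {a..<1} = 1 - m a" using mint[of a 1] a m01 by simp
        moreover have "measure \<mu> {f a - of_int k - 1..<f 0 - of_int k} = m (f 0 - of_int k) - m (f a - of_int k - 1)"
          using k fa False by (intro mint) auto
        moreover have "G (f a) = of_int k + 1 + m (f a - of_int k - 1)"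
          using Gk[of "k + 1" "f a"] k fa False by (simp add: algebra_simps)
        ultimately show ?thesis using G0 by simp
      qed
    qed
    have "G (f a) = G (f (frac a)) + of_int \<lfloor>a\<rfloor>"
    proof -
      have "f a = f (frac a) + of_int \<lfloor>a\<rfloor>" using circle_lift_add_int[OF f, of "frac a" "\<lfloor>a\<rfloor>"] by (simp add: frac_def)
      then show ?thesis using add_int_of_add_one[of G 1 "f (frac a)" "\<lfloor>a\<rfloor>"] G1 by simp
    qed
    also have "\<dots> = G a + G (f 0)" using base[of "frac a"] by (simp add: frac_lt_1 G_def)
    finally show ?thesis .
  qed
  \<comment> \<open>G differs from the identity by at most 1 and the orbit of 0 from n r by at most
    2, so n |G (f 0) - r| \<le> 3 for all n.\<close>
  moreover have "G (f 0) = r"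
  proof (rule ccontr)
    assume ne: "G (f 0) \<noteq> r"
    have Gn: "G ((f ^^ n) 0) = real n * G (f 0)" for n
    proof (induction n)
      case 0
      show ?case by (simp add: G_def m01)
    next
      case (Suc n)
      have "G ((f ^^ Suc n) 0) = G ((f ^^ n) 0) + G (f 0)" using Gf[of "(f ^^ n) 0"] by simp
      then show ?case unfolding Suc by (simp add: algebra_simps)
    qed
    have Gx: "\<bar>G y - y\<bar> \<le> 1" for y
    proof -
      have "y = of_int \<lfloor>y\<rfloor> + frac y" by (simp add: frac_def)
      then show ?thesis using m0[of "frac y"] frac_ge_0[of y] frac_lt_1[of y] unfolding G_def abs_le_iff by linarith
    qed
    have b: "real n * \<bar>G (f 0) - r\<bar> \<le> 3" for n
    proof -
      have "\<bar>real n * G (f 0) - real n * r\<bar> \<le> 3" using Gx[of "(f ^^ n) 0"] trans[of n 0] unfolding Gn by linarith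
      then show ?thesis by (simp flip: right_diff_distrib add: abs_mult)
    qed
    obtain n :: nat where "3 / \<bar>G (f 0) - r\<bar> < n" using reals_Archimedean2 by blast
    then have "3 < real n * \<bar>G (f 0) - r\<bar>" using ne by (simp add: field_simps)
    then show False using b[of n] by simp
  qed
  ultimately have "rotation_semiconj f r G" by (simp add: rotation_semiconj_def)
  from semiconjugacy_unique[OF rQ \<phi>(1) this, of x] have "G x = \<phi> x" using \<phi>(2) m01 by (simp add: G_def)
  moreover have "G x = m x" using Gk[of 0 x] x by simp
  ultimately show ?thesis by (simp add: m_def)
qed

lemma sets_unit_generated: "sets (restrict_space borel {0..<1}) = sigma_sets {0..<1::real} ((\<lambda>x. {0..<x}) ` {0..1})"
  (is "_ = sigma_sets _ ?E")
proof
  show "sigma_sets {0..<1} ?E \<subseteq> sets (restrict_space borel {0..<1::real})"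
  proof (rule sets.sigma_sets_subset[of _ "restrict_space borel {0..<1::real}", simplified space_restrict_space, simplified])
    show "?E \<subseteq> sets (restrict_space borel {0..<1})" by (auto simp: sets_restrict_space_iff)
  qed
  have bs: "sets borel = sigma_sets UNIV (range (\<lambda>x::real. {..<x}))"
    by (subst borel_Iio) (rule sets_measure_of, simp)
  have "sets (restrict_space borel {0..<1}) = (\<inter>) {0..<1} ` sigma_sets UNIV (range (\<lambda>x::real. {..<x}))"
    by (simp add: sets_restrict_space bs)
  also have "\<dots> = sigma_sets {0..<1} ((\<inter>) {0..<1} ` range (\<lambda>x::real. {..<x}))"
  proof (rule restricted_sigma)
    show "{0..<1::real} \<in> sigma_sets UNIV (range lessThan)" unfolding bs[symmetric] by simp
  qed simp
  also have "\<dots> \<subseteq> sigma_sets {0..<1} ?E"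
  proof (rule sigma_sets_mono')
    show "(\<inter>) {0..<1} ` range (\<lambda>x::real. {..<x}) \<subseteq> ?E"
    proof safe
      fix x :: real
      have "{0..<1} \<inter> {..<x} = {0..<max 0 (min x 1)}" by auto
      then show "{0..<1} \<inter> {..<x} \<in> ?E" by (rule image_eqI) auto
    qed
  qed
  finally show "sets (restrict_space borel {0..<1}) \<subseteq> sigma_sets {0..<1} ?E" .
qed

lemma Int_stable_initial_segments: "Int_stable ((\<lambda>x::real. {0..<x}) ` {0..1})"
  unfolding Int_stable_def
proof safe
  fix a b :: real assume ab: "a \<in> {0..1}" "b \<in> {0..1}"
  have "{0..<a} \<inter> {0..<b} = {0..<min a b}" by (simp add: min_def)
  moreover have "min a b \<in> {0..1}" using ab by (simp add: min_def)
  ultimately show "{0..<a} \<inter> {0..<b} \<in> (\<lambda>x. {0..<x}) ` {0..1}" by (rule image_eqI)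
qed

lemma invariant_prob_unique:
  assumes f: "circle_lift f" and trans: "\<And>n x. \<bar>(f ^^ n) x - x - real n * r\<bar> \<le> 2" and rQ: "r \<notin> \<rat>"
    and \<phi>: "rotation_semiconj f r \<phi>" "\<phi> 0 = 0" and \<mu>: "invariant_prob f \<mu>" and \<nu>: "invariant_prob f \<nu>"
  shows "\<mu> = \<nu>"
proof -
  interpret M: prob_space \<mu> using \<mu> by (simp add: invariant_prob_def)
  interpret N: prob_space \<nu> using \<nu> by (simp add: invariant_prob_def)
  have s\<mu>: "sets \<mu> = sets (restrict_space borel {0..<1})" "sets \<nu> = sets (restrict_space borel {0..<1})"
    using \<mu> \<nu> by (auto simp: invariant_prob_def)
  define E where "E = (\<lambda>x::real. {0..<x}) ` {0..1}"
  show ?thesis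
  proof (rule measure_eqI_generator_eq[where E = E and A = "\<lambda>_. {0..<1}" and \<Omega> = "{0..<1}"])
    show "Int_stable E" unfolding E_def by (rule Int_stable_initial_segments)
    show "emeasure \<mu> X = emeasure \<nu> X" if XE: "X \<in> E" for X
    proof -
      obtain x where "x \<in> {0..1}" "X = {0..<x}" using XE unfolding E_def by (rule imageE)
      then have "0 \<le> x" "x \<le> 1" "X = {0..<x}" by simp_all
      then have "measure \<mu> X = measure \<nu> X"
        using invariant_prob_cdf[OF f trans rQ \<phi> \<mu>, of x] invariant_prob_cdf[OF f trans rQ \<phi> \<nu>, of x] by simp
      then show ?thesis by (simp add: M.emeasure_eq_measure N.emeasure_eq_measure)
    qed
    have "{0..<1} \<in> E" unfolding E_def by (rule image_eqI[of _ _ 1]) simp_all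
    then show "range (\<lambda>_. {0..<1}) \<subseteq> E" by (rule image_subsetI)
    show "E \<subseteq> Pow {0..<1}"
    proof
      fix X assume "X \<in> E"
      then obtain x where "x \<in> {0..1}" "X = {0..<x}" unfolding E_def by (rule imageE)
      then show "X \<in> Pow {0..<1}" by simp
    qed
    show "sets \<mu> = sigma_sets {0..<1} E" "sets \<nu> = sigma_sets {0..<1} E" unfolding s\<mu> E_def by (rule sets_unit_generated)+
    show "(\<Union>i. {0..<1}) = {0..<1::real}" by simp
    show "emeasure \<mu> {0..<1} \<noteq> \<infinity>" using M.emeasure_finite by simp
  qed
qed

section \<open>The invariant measure as an image of Lebesgue measure\<close>

context circle_conjugacy
begin

lemma f_\<psi>: "f (\<psi> y) = \<psi> (y + r)"
proof -
  have "\<phi> (f (\<psi> y)) = y + r" using semi by (simp add: rotation_semiconj_def \<phi>\<psi>)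
  then show ?thesis by (metis \<psi>\<phi>)
qed

lemma borel_maps: "\<phi> \<in> borel_measurable borel" "\<psi> \<in> borel_measurable borel" "f \<in> borel_measurable borel"
  using f \<phi> \<psi> by (auto intro!: borel_measurable_continuous_onI simp: circle_lift_def)

definition \<mu>0 :: "real measure" where "\<mu>0 = distr unit_lborel unit_lborel \<psi>"

lemma \<psi>_unit:
  assumes "\<phi> 0 = 0"
  shows "\<psi> y \<in> {0..<1} \<longleftrightarrow> y \<in> {0..<1}" "\<psi> (frac y) = frac (\<psi> y)" "\<psi> \<in> measurable unit_lborel unit_lborel"
proof -
  have \<psi>0: "\<psi> 0 = 0" using \<psi>\<phi>[of 0] assms by simp
  have \<psi>1: "\<psi> 1 = 1" using \<psi> \<psi>0 unfolding circle_lift_def by (metis add_0)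
  show iff: "\<psi> y \<in> {0..<1} \<longleftrightarrow> y \<in> {0..<1}" for y
    using \<psi>_le[of 0 y] \<psi>_less[of y 1] \<psi>0 \<psi>1 by simp
  have "\<psi> (frac y) = \<psi> y - of_int \<lfloor>y\<rfloor>"
    using circle_lift_add_int[OF \<psi>, of y "- \<lfloor>y\<rfloor>"] by (simp add: frac_def)
  moreover have "\<psi> (frac y) \<in> {0..<1}" unfolding iff by (simp add: frac_lt_1)
  ultimately show "\<psi> (frac y) = frac (\<psi> y)" by (metis atLeastLessThan_iff frac_unique_iff Ints_of_int diff_diff_eq2 add_diff_cancel_left')
  have "\<psi> \<in> measurable (restrict_space borel {0..<1}) (restrict_space borel {0..<1})"
    using iff by (intro measurable_restrict_space3[OF borel_maps(2)]) auto
  then show "\<psi> \<in> measurable unit_lborel unit_lborel" by (simp cong: measurable_cong_sets)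
qed

lemma invariant_prob_exists:
  assumes "\<phi> 0 = 0"
  shows "invariant_prob f \<mu>0"
proof -
  note u = \<psi>_unit[OF assms]
  have s\<mu>: "sets \<mu>0 = sets unit_lborel" by (simp add: \<mu>0_def)
  have "prob_space unit_lborel"
    by (rule prob_spaceI) (simp add: emeasure_unit_lborel)
  then have P: "prob_space \<mu>0" unfolding \<mu>0_def by (rule prob_space.prob_space_distr[OF _ u(3)])
  have "frac \<in> borel_measurable (borel :: real measure)" unfolding frac_def by measurable
  then have "circle_map f \<in> borel_measurable borel"
    unfolding circle_map_def using borel_maps(3) by measurable
  then have "circle_map f \<in> measurable (restrict_space borel {0..<1}) (restrict_space borel {0..<1})"
    by (intro measurable_restrict_space3) (auto simp: circle_map_def frac_lt_1)
  then have T: "circle_map f \<in> measurable unit_lborel unit_lborel" by (simp cong: measurable_cong_sets)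
  have T\<psi>: "circle_map f (\<psi> y) = \<psi> (frac (y + r))" for y
    by (simp add: circle_map_def f_\<psi> u(2))
  have "distr \<mu>0 \<mu>0 (circle_map f) = distr \<mu>0 unit_lborel (circle_map f)"
    by (rule distr_cong) (simp_all add: s\<mu>)
  also have "\<dots> = distr unit_lborel unit_lborel (circle_map f \<circ> \<psi>)"
    unfolding \<mu>0_def by (rule distr_distr[OF T u(3)])
  also have "circle_map f \<circ> \<psi> = \<psi> \<circ> (\<lambda>y. frac (y + r))" by (auto simp: T\<psi>)
  also have "distr unit_lborel unit_lborel (\<psi> \<circ> (\<lambda>y. frac (y + r))) = distr (distr unit_lborel unit_lborel (\<lambda>y. frac (y + r))) unit_lborel \<psi>"
    by (rule distr_distr[OF u(3) rotation_measurable, symmetric])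
  also have "\<dots> = \<mu>0" by (simp only: distr_rotation \<mu>0_def)
  finally have D: "distr \<mu>0 \<mu>0 (circle_map f) = \<mu>0" .
  have "circle_map f \<in> measurable \<mu>0 \<mu>0" using T by (simp add: s\<mu> cong: measurable_cong_sets)
  then show ?thesis using P D s\<mu> by (simp add: invariant_prob_def)
qed

lemma singular_\<mu>0I:
  assumes "\<phi> 0 = 0" "A \<in> sets borel" "A \<subseteq> {0..<1}" "emeasure lborel A = 0" "emeasure lborel {y \<in> {0..<1}. \<psi> y \<in> A} = 1"
  shows "singular_measure \<mu>0"
proof -
  have A: "A \<in> sets unit_lborel" using assms by (simp only: sets_unit_lborel_iff)
  have "emeasure \<mu>0 A = emeasure unit_lborel (\<psi> -` A \<inter> space unit_lborel)"
    unfolding \<mu>0_def by (rule emeasure_distr[OF \<psi>_unit(3)[OF assms(1)] A])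
  also have "\<psi> -` A \<inter> space unit_lborel = {y \<in> {0..<1}. \<psi> y \<in> A}" by auto
  also have "emeasure unit_lborel {y \<in> {0..<1}. \<psi> y \<in> A} = 1"
    using assms(5) by (subst emeasure_unit_lborel) auto
  finally have "emeasure \<mu>0 A = 1" .
  moreover have "A \<in> sets \<mu>0" using A by (simp add: \<mu>0_def)
  ultimately show ?thesis using assms(4) unfolding singular_measure_def by blast
qed

text \<open>Both signs of n occur, which makes the set invariant under the rotation in both
  directions; the union is countable, which preserves Borel sets and null sets.\<close>

definition saturation :: "real set \<Rightarrow> real set" where
  "saturation B = {y. \<exists>n m::int. y + of_int n * r + of_int m \<in> B}"

lemma saturation_shift: "y + 1 \<in> saturation B \<longleftrightarrow> y \<in> saturation B" "y + r \<in> saturation B \<longleftrightarrow> y \<in> saturation B"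
proof -
  have 1: "y + 1 + of_int n * r + of_int m = y + of_int n * r + of_int (m + 1)"
    "y + of_int n * r + of_int m = y + 1 + of_int n * r + of_int (m - 1)"
    "y + r + of_int n * r + of_int m = y + of_int (n + 1) * r + of_int m"
    "y + of_int n * r + of_int m = y + r + of_int (n - 1) * r + of_int m" for n m
    by (simp_all add: algebra_simps)
  show "y + 1 \<in> saturation B \<longleftrightarrow> y \<in> saturation B" "y + r \<in> saturation B \<longleftrightarrow> y \<in> saturation B"
    unfolding saturation_def mem_Collect_eq by (metis 1(1,2)) (metis 1(3,4))
qed

lemma saturation_UN: "saturation B = (\<Union>n::int. \<Union>m::int. {y. y + (of_int n * r + of_int m) \<in> B})"
  by (auto simp: saturation_def add_ac)

lemma saturation_supset: "B \<subseteq> saturation B"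
proof
  fix y assume "y \<in> B"
  then have "y + of_int 0 * r + of_int 0 \<in> B" by simp
  then show "y \<in> saturation B" unfolding saturation_def by blast
qed

lemma saturation_borel:
  assumes "B \<in> sets borel" shows "saturation B \<in> sets borel"
  unfolding saturation_UN using assms by (intro sets.countable_UN) (auto intro!: borel_comp)

lemma saturation_null:
  assumes B: "B \<in> sets borel" "emeasure lborel B = 0" shows "emeasure lborel (saturation B) = 0"
proof -
  have "{y. y + s \<in> B} \<in> null_sets lborel" for s
  proof (rule null_setsI)
    show "{y. y + s \<in> B} \<in> sets lborel" using B(1) by measurable
    show "emeasure lborel {y. y + s \<in> B} = 0" using emeasure_lborel_translate[OF B(1), of s] B(2) by simp
  qed
  then have "saturation B \<in> null_sets lborel" unfolding saturation_UN by (intro null_sets_UN)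
  then show ?thesis by auto
qed

text \<open>The weight exp (S_n) in the substitution formula is positive, so null sets correspond in
  both directions.\<close>

lemma null_orbit:
  assumes X: "X \<in> sets borel" shows "emeasure lborel {x. (f ^^ n) x \<in> X} = 0 \<longleftrightarrow> emeasure lborel X = 0"
proof -
  have fn: "(f ^^ n) \<in> borel_measurable borel" "S n \<in> borel_measurable borel"
    using cov_S[of n] by (auto simp: change_of_variables_def)
  have m: "{x. (f ^^ n) x \<in> X} \<in> sets borel" using measurable_sets_borel[OF fn(1) X] by (simp add: vimage_def)
  have "emeasure lborel X = (\<integral>\<^sup>+x. indicator X x \<partial>lborel)" using X by simp
  also have "\<dots> = (\<integral>\<^sup>+x. indicator X ((f ^^ n) x) * ennreal (exp (S n x)) \<partial>lborel)"
    using cov_S[of n] X unfolding change_of_variables_def by simp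
  also have "\<dots> = (\<integral>\<^sup>+x. ennreal (exp (S n x)) * indicator {x. (f ^^ n) x \<in> X} x \<partial>lborel)"
    by (intro nn_integral_cong) (auto simp: indicator_def)
  finally have "emeasure lborel X = 0 \<longleftrightarrow> (AE x in lborel. ennreal (exp (S n x)) * indicator {x. (f ^^ n) x \<in> X} x = 0)"
    using fn m by (simp add: nn_integral_0_iff_AE)
  also have "\<dots> \<longleftrightarrow> (AE x in lborel. x \<notin> {x. (f ^^ n) x \<in> X})"
    by (intro AE_cong) (auto simp: indicator_def)
  also have "\<dots> \<longleftrightarrow> emeasure lborel {x. (f ^^ n) x \<in> X} = 0"
    using m by (subst AE_iff_measurable[of "{x. (f ^^ n) x \<in> X}"]) auto
  finally show ?thesis by simp
qed

lemma saturation_preimage_null: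
  assumes B: "B \<in> sets borel" "emeasure lborel {x. \<phi> x \<in> B} = 0"
  shows "emeasure lborel {x. \<phi> x \<in> saturation B} = 0"
proof -
  have bp: "{x. \<phi> x + s \<in> B} \<in> sets borel" for s
  proof -
    have "(\<lambda>x. \<phi> x + s) \<in> borel_measurable borel" using borel_maps(1) by measurable
    then show ?thesis using measurable_sets_borel[OF _ B(1)] by (simp add: vimage_def)
  qed
  have base: "emeasure lborel {x. \<phi> x + of_int m \<in> B} = 0" for m
  proof -
    have "{x. \<phi> x + of_int m \<in> B} = {x. x + of_int m \<in> {x. \<phi> x \<in> B}}" by (simp add: circle_lift_add_int[OF \<phi>])
    then show ?thesis using emeasure_lborel_translate[of "{x. \<phi> x \<in> B}" "of_int m"] B bp[of 0] by simp
  qed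
  \<comment> \<open>Only forward iterates of f are available. For negative n it is the set itself
    that is pulled back, by the iterate of order - n.\<close>
  have "emeasure lborel {x. \<phi> x + (of_int n * r + of_int m) \<in> B} = 0" for n m
  proof (cases "n \<ge> 0")
    case True
    have "{x. \<phi> x + (of_int n * r + of_int m) \<in> B} = {x. (f ^^ nat n) x \<in> {x. \<phi> x + of_int m \<in> B}}"
      using True by (simp add: \<phi>_orbit add_ac)
    then show ?thesis using null_orbit[OF bp[of "of_int m"], of "nat n"] base[of m] by simp
  next
    case False
    have "{x. (f ^^ nat (- n)) x \<in> {x. \<phi> x + (of_int n * r + of_int m) \<in> B}} = {x. \<phi> x + of_int m \<in> B}"
      using False by (simp add: \<phi>_orbit algebra_simps)
    then show ?thesis using null_orbit[OF bp[of "of_int n * r + of_int m"], of "nat (- n)"] base[of m] by simp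
  qed
  then have "{x. \<phi> x + (of_int n * r + of_int m) \<in> B} \<in> null_sets lborel" for n m using bp by (intro null_setsI) auto
  then have "(\<Union>n::int. \<Union>m::int. {x. \<phi> x + (of_int n * r + of_int m) \<in> B}) \<in> null_sets lborel" by (intro null_sets_UN)
  moreover have "{x. \<phi> x \<in> saturation B} = (\<Union>n::int. \<Union>m::int. {x. \<phi> x + (of_int n * r + of_int m) \<in> B})"
    unfolding saturation_UN by auto
  ultimately show ?thesis by auto
qed

text \<open>Makes ergodicity of the rotation an instance of the general result, with L = 0.\<close>

lemma rotation_conjugacy: "circle_conjugacy (\<lambda>x. x + r) (\<lambda>x. x) (\<lambda>x. x) (\<lambda>_. 0) (\<lambda>_. 0) 0 r"
proof (unfold_locales)
  show "change_of_variables (\<lambda>x. x + r) (\<lambda>_. 0)"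
    unfolding change_of_variables_def
  proof (intro conjI allI impI)
    fix u :: "real \<Rightarrow> ennreal" assume u: "u \<in> borel_measurable borel"
    show "(\<integral>\<^sup>+x. u (x + r) * ennreal (exp 0) \<partial>lborel) = (\<integral>\<^sup>+x. u x \<partial>lborel)"
      using nn_integral_real_affine[OF u, of 1 r] by (simp add: add.commute)
  qed auto
  show "\<exists>q p. good_denom r q p \<and> n \<le> q" for n by (rule unb)
qed (auto simp: circle_lift_def rotation_semiconj_def variation_bound_def strict_mono_def mono_def
      intro!: continuous_intros)

lemma unit_complement:
  fixes Y :: "real set"
  assumes "Y \<in> sets borel" "emeasure lborel (- Y) = 0"
  shows "emeasure lborel {y \<in> {0..<1}. y \<in> Y} = 1"
proof -
  have "AE y in lborel. y \<in> Y" using assms by (subst AE_iff_measurable[of "- Y"]) auto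
  then have ae: "AE y in lborel. y \<in> {0..<1} \<inter> Y \<longleftrightarrow> y \<in> {0..<1}" by eventually_elim auto
  have "{y \<in> {0..<1}. y \<in> Y} = {0..<1} \<inter> Y" by auto
  moreover have "emeasure lborel ({0..<1} \<inter> Y) = emeasure lborel {0..<1::real}"
    by (rule emeasure_eq_AE[OF ae]) (use assms(1) in auto)
  ultimately show ?thesis by simp
qed

text \<open>If B is null in one coordinate but not in the other, ergodicity makes its saturation
  null in the one and of full measure in the other. This set or its complement then carries \<mu>0
  and has Lebesgue measure 0.\<close>

lemma nonsingular_equivalent:
  assumes \<phi>0: "\<phi> 0 = 0" and ns: "\<not> singular_measure \<mu>0" and B: "B \<in> sets borel"
  shows "emeasure lborel {x. \<phi> x \<in> B} = 0 \<longleftrightarrow> emeasure lborel B = 0"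
proof -
  define Y where "Y = saturation B"
  have Y: "Y \<in> sets borel" unfolding Y_def by (rule saturation_borel[OF B])
  define Z where "Z = {x. \<phi> x \<in> Y}"
  have Z: "Z \<in> sets borel" using measurable_sets_borel[OF borel_maps(1) Y] by (simp add: Z_def vimage_def)
  have "\<phi> (x + 1) = \<phi> x + 1" "\<phi> (f x) = \<phi> x + r" for x using semi by (auto simp: rotation_semiconj_def)
  then have Zi: "x + 1 \<in> Z \<longleftrightarrow> x \<in> Z" "f x \<in> Z \<longleftrightarrow> x \<in> Z" for x by (simp_all add: Z_def Y_def saturation_shift)
  have \<psi>Z: "\<psi> y \<in> Z \<longleftrightarrow> y \<in> Y" for y by (simp add: Z_def \<phi>\<psi>)
  note u = \<psi>_unit(1)[OF \<phi>0]
  show ?thesis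
  proof (rule ccontr)
    assume "\<not> ?thesis"
    then consider "emeasure lborel B = 0" "emeasure lborel {x. \<phi> x \<in> B} \<noteq> 0"
      | "emeasure lborel {x. \<phi> x \<in> B} = 0" "emeasure lborel B \<noteq> 0" by blast
    then show False
    proof cases
      \<comment> \<open>Z has full measure while Y is null, so \<mu>0 lives on the complement of
        Z.\<close>
      case 1
      have Y0: "emeasure lborel Y = 0" unfolding Y_def by (rule saturation_null[OF B 1(1)])
      have "emeasure lborel {x. \<phi> x \<in> B} \<le> emeasure lborel Z"
        using Z saturation_supset[of B] by (intro emeasure_mono) (auto simp: Z_def Y_def)
      then have "emeasure lborel Z \<noteq> 0" using 1(2) by auto
      then have Zc: "emeasure lborel (- Z) = 0" by (rule invariant_set_conull[OF Z Zi])
      have "singular_measure \<mu>0"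
      proof (rule singular_\<mu>0I[OF \<phi>0, of "{0..<1} - Z"])
        have "emeasure lborel ({0..<1} - Z) \<le> emeasure lborel (- Z)" using Z by (intro emeasure_mono) auto
        then show "emeasure lborel ({0..<1} - Z) = 0" using Zc by simp
        have "{y \<in> {0..<1}. \<psi> y \<in> {0..<1} - Z} = {y \<in> {0..<1}. y \<in> - Y}" using u \<psi>Z by auto
        then show "emeasure lborel {y \<in> {0..<1}. \<psi> y \<in> {0..<1} - Z} = 1"
          using unit_complement[of "- Y"] Y Y0 by (simp only:) simp
      qed (use Z in auto)
      then show False using ns by simp
    next
      \<comment> \<open>Here it is the rotation whose ergodicity is used: Y has full measure while Z
        is null, so \<mu>0 lives on Z.\<close>
      case 2
      have Z0: "emeasure lborel Z = 0" unfolding Z_def Y_def by (rule saturation_preimage_null[OF B 2(1)])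
      have "emeasure lborel B \<le> emeasure lborel Y"
        using Y saturation_supset[of B] by (intro emeasure_mono) (auto simp: Y_def)
      then have "emeasure lborel Y \<noteq> 0" using 2(2) by auto
      then have Yc: "emeasure lborel (- Y) = 0"
        by (intro circle_conjugacy.invariant_set_conull[OF rotation_conjugacy Y]) (auto simp: Y_def saturation_shift)
      have "singular_measure \<mu>0"
      proof (rule singular_\<mu>0I[OF \<phi>0, of "{0..<1} \<inter> Z"])
        have "emeasure lborel ({0..<1} \<inter> Z) \<le> emeasure lborel Z" using Z by (intro emeasure_mono) auto
        then show "emeasure lborel ({0..<1} \<inter> Z) = 0" using Z0 by simp
        have "{y \<in> {0..<1}. \<psi> y \<in> {0..<1} \<inter> Z} = {y \<in> {0..<1}. y \<in> Y}" using u \<psi>Z by auto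
        then show "emeasure lborel {y \<in> {0..<1}. \<psi> y \<in> {0..<1} \<inter> Z} = 1"
          using unit_complement[OF Y Yc] by (simp only:)
      qed (use Z in auto)
      then show False using ns by simp
    qed
  qed
qed

end

section \<open>Oscillation of Birkhoff sums of primitives\<close>

text \<open>For 0 \<le> a \<le> b \<le> 1 the difference of the floors is the periodic indicator of
  the interval from a to b. In this form it lives on the whole line, and its deviation from the mean
  has an explicit periodic primitive.\<close>

inductive_set steps :: "(real \<Rightarrow> real) set" where
  zero: "(\<lambda>_. 0) \<in> steps"
| add: "v \<in> steps \<Longrightarrow> 0 \<le> a \<Longrightarrow> a \<le> b \<Longrightarrow> b \<le> 1 \<Longrightarrow> (\<lambda>y. v y + c * (of_int \<lfloor>y - a\<rfloor> - of_int \<lfloor>y - b\<rfloor>)) \<in> steps"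

lemma steps_borel: "v \<in> steps \<Longrightarrow> v \<in> borel_measurable borel"
proof (induction rule: steps.induct)
  case (add v a b c)
  note [measurable] = add.IH
  show ?case by measurable
qed simp

lemma steps_periodic: "v \<in> steps \<Longrightarrow> v (y + 1) = v y"
proof (induction rule: steps.induct)
  case (add v a b c)
  have "\<lfloor>y + 1 - s\<rfloor> = \<lfloor>y - s\<rfloor> + 1" for s by (simp add: diff_add_eq[symmetric])
  then show ?case using add.IH by simp
qed simp

lemma steps_bounded: "v \<in> steps \<Longrightarrow> \<exists>K. \<forall>y. \<bar>v y\<bar> \<le> K"
proof (induction rule: steps.induct)
  case (add v a b c)
  then obtain K where K: "\<And>y. \<bar>v y\<bar> \<le> K" by blast
  have "\<bar>real_of_int \<lfloor>y - a\<rfloor> - of_int \<lfloor>y - b\<rfloor>\<bar> \<le> 2" for y using add.hyps by linarith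
  then have "\<bar>c * (of_int \<lfloor>y - a\<rfloor> - of_int \<lfloor>y - b\<rfloor>)\<bar> \<le> \<bar>c\<bar> * 2" for y
    unfolding abs_mult by (intro mult_left_mono) auto
  then have "\<bar>v y + c * (of_int \<lfloor>y - a\<rfloor> - of_int \<lfloor>y - b\<rfloor>)\<bar> \<le> K + \<bar>c\<bar> * 2" for y
    using K[of y] abs_triangle_ineq[of "v y" "c * (of_int \<lfloor>y - a\<rfloor> - of_int \<lfloor>y - b\<rfloor>)"] by (smt (verit, best))
  then show ?case by blast
qed (auto intro: exI[of _ 0])

lemma steps_sum: "w \<in> steps \<Longrightarrow> v \<in> steps \<Longrightarrow> (\<lambda>y. v y + w y) \<in> steps"
proof (induction rule: steps.induct)
  case (add w a b c)
  have "(\<lambda>y. (v y + w y) + c * (of_int \<lfloor>y - a\<rfloor> - of_int \<lfloor>y - b\<rfloor>)) \<in> steps"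
    using add by (intro steps.add) auto
  then show ?case by (simp add: add.assoc)
qed simp

lemma steps_scale: "v \<in> steps \<Longrightarrow> (\<lambda>y. k * v y) \<in> steps"
proof (induction rule: steps.induct)
  case (add v a b c)
  have "(\<lambda>y. k * v y + (k * c) * (of_int \<lfloor>y - a\<rfloor> - of_int \<lfloor>y - b\<rfloor>)) \<in> steps"
    using add by (intro steps.add) auto
  then show ?case by (simp add: distrib_left mult.assoc)
qed (simp add: steps.zero)

section \<open>Approximation of integrable functions by steps\<close>

lemma finite_measure_unit: "finite_measure unit_lborel"
  by (rule finite_measureI) (simp add: emeasure_unit_lborel)

lemma borel_unit: "u \<in> borel_measurable borel \<Longrightarrow> u \<in> borel_measurable unit_lborel"
  by (simp add: measurable_restrict_space1 cong: measurable_cong_sets)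

lemma steps_integrable: "v \<in> steps \<Longrightarrow> integrable unit_lborel v"
  using steps_bounded[of v] finite_measure.integrable_const_bound[OF finite_measure_unit, of v] borel_unit[OF steps_borel]
  by (auto simp: real_norm_def)

definition step_approximable :: "(real \<Rightarrow> real) \<Rightarrow> bool" where
  "step_approximable u \<longleftrightarrow> (\<forall>e>0. \<exists>v\<in>steps. (\<integral>y. \<bar>u y - v y\<bar> \<partial>unit_lborel) < e)"

lemma step_approximable_limit:
  assumes u: "integrable unit_lborel u"
    and s: "\<And>n. integrable unit_lborel (s n)" "\<And>n. step_approximable (s n)"
    and lim: "(\<lambda>n. \<integral>y. \<bar>u y - s n y\<bar> \<partial>unit_lborel) \<longlonglongrightarrow> 0"
  shows "step_approximable u"
  unfolding step_approximable_def
proof (intro allI impI)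
  fix e :: real assume e: "e > 0"
  then have "\<forall>\<^sub>F n in sequentially. (\<integral>y. \<bar>u y - s n y\<bar> \<partial>unit_lborel) < e / 2"
    using lim by (intro order_tendstoD(2)) auto
  then obtain n where n: "(\<integral>y. \<bar>u y - s n y\<bar> \<partial>unit_lborel) < e / 2" by (auto simp: eventually_sequentially)
  obtain v where v: "v \<in> steps" "(\<integral>y. \<bar>s n y - v y\<bar> \<partial>unit_lborel) < e / 2"
    using s(2)[of n] e unfolding step_approximable_def by (meson half_gt_zero)
  note iv = steps_integrable[OF v(1)]
  have "(\<integral>y. \<bar>u y - v y\<bar> \<partial>unit_lborel) \<le> (\<integral>y. \<bar>u y - s n y\<bar> + \<bar>s n y - v y\<bar> \<partial>unit_lborel)"
    using u s(1) iv by (intro integral_mono) auto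
  also have "\<dots> = (\<integral>y. \<bar>u y - s n y\<bar> \<partial>unit_lborel) + (\<integral>y. \<bar>s n y - v y\<bar> \<partial>unit_lborel)"
    using u s(1) iv by (intro Bochner_Integration.integral_add) auto
  also have "\<dots> < e" using n v(2) by simp
  finally show "\<exists>v\<in>steps. (\<integral>y. \<bar>u y - v y\<bar> \<partial>unit_lborel) < e" using v(1) by blast
qed

lemma step_approximable_add:
  assumes "integrable unit_lborel u" "integrable unit_lborel w" "step_approximable u" "step_approximable w"
  shows "step_approximable (\<lambda>y. u y + w y)"
  unfolding step_approximable_def
proof (intro allI impI)
  fix e :: real assume "e > 0"
  then have e2: "e / 2 > 0" by simp
  obtain v where v: "v \<in> steps" "(\<integral>y. \<bar>u y - v y\<bar> \<partial>unit_lborel) < e / 2"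
    using assms(3) e2 unfolding step_approximable_def by meson
  obtain v' where v': "v' \<in> steps" "(\<integral>y. \<bar>w y - v' y\<bar> \<partial>unit_lborel) < e / 2"
    using assms(4) e2 unfolding step_approximable_def by meson
  note iv = steps_integrable[OF v(1)] steps_integrable[OF v'(1)]
  have "(\<integral>y. \<bar>u y + w y - (v y + v' y)\<bar> \<partial>unit_lborel) \<le> (\<integral>y. \<bar>u y - v y\<bar> + \<bar>w y - v' y\<bar> \<partial>unit_lborel)"
    using assms(1,2) iv by (intro integral_mono) auto
  also have "\<dots> = (\<integral>y. \<bar>u y - v y\<bar> \<partial>unit_lborel) + (\<integral>y. \<bar>w y - v' y\<bar> \<partial>unit_lborel)"
    using assms(1,2) iv by (intro Bochner_Integration.integral_add) auto
  also have "\<dots> < e" using v(2) v'(2) by simp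
  finally show "\<exists>v\<in>steps. (\<integral>y. \<bar>u y + w y - v y\<bar> \<partial>unit_lborel) < e" using steps_sum[OF v'(1) v(1)] by (intro bexI)
qed

lemma step_approximable_scale:
  assumes "step_approximable u"
  shows "step_approximable (\<lambda>y. k * u y)"
  unfolding step_approximable_def
proof (intro allI impI)
  fix e :: real assume e: "e > 0"
  then have "e / (\<bar>k\<bar> + 1) > 0" by simp
  then obtain v where v: "v \<in> steps" "(\<integral>y. \<bar>u y - v y\<bar> \<partial>unit_lborel) < e / (\<bar>k\<bar> + 1)"
    using assms unfolding step_approximable_def by meson
  have "(\<integral>y. \<bar>k * u y - k * v y\<bar> \<partial>unit_lborel) = \<bar>k\<bar> * (\<integral>y. \<bar>u y - v y\<bar> \<partial>unit_lborel)"
    by (simp add: abs_mult flip: right_diff_distrib)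
  also have "\<dots> \<le> (\<bar>k\<bar> + 1) * (\<integral>y. \<bar>u y - v y\<bar> \<partial>unit_lborel)" by (intro mult_right_mono) auto
  also have "\<dots> < e" using v(2) by (simp add: pos_less_divide_eq mult.commute)
  finally show "\<exists>v\<in>steps. (\<integral>y. \<bar>k * u y - v y\<bar> \<partial>unit_lborel) < e" using steps_scale[OF v(1)] by (intro bexI)
qed

lemma step_approximable_steps: "v \<in> steps \<Longrightarrow> step_approximable v"
  unfolding step_approximable_def by (intro allI impI bexI[of _ v]) auto

lemma integrable_indicator_unit: "A \<in> sets unit_lborel \<Longrightarrow> integrable unit_lborel (indicator A :: real \<Rightarrow> real)"
  using finite_measure.emeasure_finite[OF finite_measure_unit, of A] by (intro integrable_real_indicator) (auto simp: less_top)

lemma step_approximable_cong: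
  assumes "\<And>y. y \<in> {0..<1} \<Longrightarrow> u y = w y" "step_approximable u" shows "step_approximable w"
proof -
  have "(\<integral>y. \<bar>w y - v y\<bar> \<partial>unit_lborel) = (\<integral>y. \<bar>u y - v y\<bar> \<partial>unit_lborel)" for v
    using assms(1) by (intro Bochner_Integration.integral_cong) auto
  then show ?thesis using assms(2) by (simp add: step_approximable_def)
qed

text \<open>The sets with approximable indicator form a Dynkin system that contains the initial
  segments, which are stable under intersection.\<close>

lemma step_approximable_indicator:
  assumes "A \<in> sets unit_lborel"
  shows "step_approximable (indicator A)"
proof -
  interpret finite_measure unit_lborel by (rule finite_measure_unit)
  have A: "A \<in> sigma_sets {0..<1} ((\<lambda>x::real. {0..<x}) ` {0..1})"
    using assms unfolding sets_unit_lborel by (simp only: sets_unit_generated)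
  have sub: "(\<lambda>x::real. {0..<x}) ` {0..1} \<subseteq> Pow {0..<1}" by auto
  have mem: "sigma_sets {0..<1} ((\<lambda>x::real. {0..<x}) ` {0..1}) = sets unit_lborel"
    unfolding sets_unit_lborel by (rule sets_unit_generated[symmetric])
  from Int_stable_initial_segments sub A show ?thesis
  proof (induction rule: sigma_sets_induct_disjoint)
    case (basic B)
    then obtain x where x: "0 \<le> x" "x \<le> 1" "B = {0..<x}" by auto
    have "(\<lambda>y. 0 + 1 * (of_int \<lfloor>y - 0\<rfloor> - of_int \<lfloor>y - x\<rfloor>)) \<in> steps" using x by (intro steps.add steps.zero) auto
    then have "step_approximable (\<lambda>y. 0 + 1 * (of_int \<lfloor>y - 0\<rfloor> - of_int \<lfloor>y - x\<rfloor>))" by (rule step_approximable_steps)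
    then show ?case
    proof (rule step_approximable_cong[rotated])
      fix y :: real assume y: "y \<in> {0..<1}"
      then have "\<lfloor>y\<rfloor> = 0" "\<lfloor>y - x\<rfloor> = (if y < x then - 1 else 0)" using x by (auto simp: floor_eq_iff)
      then show "0 + 1 * (of_int \<lfloor>y - 0\<rfloor> - of_int \<lfloor>y - x\<rfloor>) = indicator B y" using x(3) y by simp
    qed
  next
    case empty
    then show ?case using step_approximable_steps[OF steps.zero] by (simp add: indicator_def[abs_def])
  next
    case (compl B)
    \<comment> \<open>The constant 1 as a step, with a = 0 and b = 1.\<close>
    have "(\<lambda>y. 0 + 1 * (of_int \<lfloor>y - 0\<rfloor> - of_int \<lfloor>y - 1\<rfloor>)) \<in> steps" by (intro steps.add steps.zero) auto
    note s = step_approximable_steps[OF this] steps_integrable[OF this]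
    have "integrable unit_lborel (\<lambda>y. - 1 * indicator B y :: real)"
      using integrable_indicator_unit[of B] compl.hyps mem by (intro integrable_mult_right) simp
    from step_approximable_add[OF s(2) this s(1) step_approximable_scale[OF compl.IH]] show ?case
    proof (rule step_approximable_cong[rotated])
      fix y :: real assume y: "y \<in> {0..<1}"
      then show "0 + 1 * (of_int \<lfloor>y - 0\<rfloor> - of_int \<lfloor>y - 1\<rfloor>) + - 1 * indicator B y = indicator ({0..<1} - B) y"
        by (simp add: indicator_def)
    qed
  next
    case (union B)
    have Bm: "B i \<in> sets unit_lborel" for i using union.hyps(2) mem by auto
    have UB: "(\<Union>i. B i) \<in> sets unit_lborel" using Bm by blast
    define s where "s n y = (\<Sum>i<n. indicator (B i) y :: real)" for n y
    have si: "integrable unit_lborel (s n)" for n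
      unfolding s_def using integrable_indicator_unit[OF Bm] by (intro Bochner_Integration.integrable_sum)
    have sa: "step_approximable (s n)" for n
    proof (induction n)
      case 0
      then show ?case using step_approximable_steps[OF steps.zero] by (simp add: s_def[abs_def])
    next
      case (Suc n)
      have "s (Suc n) = (\<lambda>y. s n y + indicator (B n) y)" by (simp add: s_def[abs_def])
      then show ?case using step_approximable_add[OF si[of n] integrable_indicator_unit[OF Bm] Suc union.IH] by simp
    qed
    have se: "s n y = indicator (\<Union>i<n. B i) y" for n y
      unfolding s_def using union.hyps(1) by (intro indicator_UN_disjoint[symmetric]) (auto simp: disjoint_family_on_def)
    show ?case
    proof (rule step_approximable_limit[OF integrable_indicator_unit[OF UB] si sa])
      have "(\<integral>y. \<bar>indicator (\<Union>i. B i) y - s n y\<bar> \<partial>unit_lborel) = measure unit_lborel (\<Union>i. B i) - (\<Sum>i<n. measure unit_lborel (B i))" for n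
      proof -
        have "\<bar>indicator (\<Union>i. B i) y - s n y\<bar> = indicator (\<Union>i. B i) y - s n y" for y :: real
          by (auto simp: se indicator_def)
        then have "(\<integral>y. \<bar>indicator (\<Union>i. B i) y - s n y\<bar> \<partial>unit_lborel) = (\<integral>y. indicator (\<Union>i. B i) y \<partial>unit_lborel) - (\<integral>y. s n y \<partial>unit_lborel)"
          using integrable_indicator_unit[OF UB] si by simp
        moreover have "(\<integral>y. s n y \<partial>unit_lborel) = (\<Sum>i<n. measure unit_lborel (B i))"
          unfolding s_def using integrable_indicator_unit[OF Bm] sets.sets_into_space[OF Bm]
          by (subst Bochner_Integration.integral_sum) (auto simp: Int_absorb2)
        moreover have "(\<integral>y. indicator (\<Union>i. B i) y \<partial>unit_lborel) = measure unit_lborel (\<Union>i. B i)"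
          using sets.sets_into_space[OF UB] by (simp add: Int_absorb2)
        ultimately show ?thesis by simp
      qed
      moreover have "(\<lambda>i. measure unit_lborel (B i)) sums measure unit_lborel (\<Union>i. B i)"
        using Bm union.hyps(1) by (intro finite_measure_UNION) auto
      ultimately show "(\<lambda>n. \<integral>y. \<bar>indicator (\<Union>i. B i) y - s n y\<bar> \<partial>unit_lborel) \<longlonglongrightarrow> 0"
        unfolding sums_def by (auto intro!: tendsto_eq_intros)
    qed
  qed
qed

lemma integrable_step_approximable:
  assumes "integrable unit_lborel u"
  shows "step_approximable u"
  using assms
proof (induction rule: integrable_induct)
  case (base A c)
  show ?case using step_approximable_scale[OF step_approximable_indicator[OF base(1)], of c] by (simp add: mult.commute)
next
  case (add f g)
  then show ?case by (intro step_approximable_add)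
next
  case (lim f s)
  show ?case
  proof (rule step_approximable_limit[OF lim.hyps(4) lim.hyps(1) lim.IH])
    have "(\<lambda>n. \<integral>y. \<bar>f y - s n y\<bar> \<partial>unit_lborel) \<longlonglongrightarrow> (\<integral>y. 0 \<partial>unit_lborel)"
    proof (rule integral_dominated_convergence[where w = "\<lambda>y. 3 * norm (f y)"])
      show "AE y in unit_lborel. (\<lambda>n. \<bar>f y - s n y\<bar>) \<longlonglongrightarrow> 0"
      proof (rule AE_I2)
        fix y assume "y \<in> space unit_lborel"
        then have "(\<lambda>n. s n y) \<longlonglongrightarrow> f y" by (rule lim.hyps(2))
        then have "(\<lambda>n. f y - s n y) \<longlonglongrightarrow> 0" by (auto intro!: tendsto_eq_intros)
        then show "(\<lambda>n. \<bar>f y - s n y\<bar>) \<longlonglongrightarrow> 0" by (rule tendsto_rabs_zero)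
      qed
      show "AE y in unit_lborel. norm \<bar>f y - s n y\<bar> \<le> 3 * norm (f y)" for n
      proof (rule AE_I2)
        fix y assume "y \<in> space unit_lborel"
        then have "norm (s n y) \<le> 2 * norm (f y)" by (rule lim.hyps(3))
        then show "norm \<bar>f y - s n y\<bar> \<le> 3 * norm (f y)" unfolding real_norm_def by linarith
      qed
    qed (use lim.hyps in auto)
    then show "(\<lambda>n. \<integral>y. \<bar>f y - s n y\<bar> \<partial>unit_lborel) \<longlonglongrightarrow> 0" by simp
  qed
qed

section \<open>Calculus of indefinite integrals\<close>

lemma indefinite_integral_shift:
  assumes "indefinite_integral H g"
  shows "indefinite_integral (\<lambda>y. H (y + s)) (\<lambda>y. g (y + s))"
proof -
  have gm[measurable]: "g \<in> borel_measurable borel" using assms by (simp add: indefinite_integral_def)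
  have "(\<lambda>y. g (y + s)) \<in> borel_measurable borel" by measurable
  moreover have "set_integrable lborel {x..y} (\<lambda>t. g (t + s)) \<and> (LINT t:{x..y}|lborel. g (t + s)) = H (y + s) - H (x + s)"
    if "x \<le> y" for x y
    using assms that set_integral_shift[of x s y g] by (simp add: indefinite_integral_def)
  ultimately show ?thesis by (simp add: indefinite_integral_def)
qed

lemma indefinite_integral_add:
  assumes "indefinite_integral D g" "indefinite_integral E h"
  shows "indefinite_integral (\<lambda>x. D x + E x) (\<lambda>x. g x + h x)"
  using assms unfolding indefinite_integral_def by (auto simp: set_integral_add)

lemma indefinite_integral_scale:
  assumes "indefinite_integral D g"
  shows "indefinite_integral (\<lambda>x. c * D x) (\<lambda>x. c * g x)"
  using assms unfolding indefinite_integral_def by (auto simp: set_integrable_mult_right right_diff_distrib)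

lemma indefinite_integral_zero: "indefinite_integral (\<lambda>_. 0) (\<lambda>_. 0)"
  by (simp add: indefinite_integral_def set_integrable_def set_lebesgue_integral_def)

lemma indefinite_integral_sum:
  assumes "\<And>i. i < n \<Longrightarrow> indefinite_integral (D i) (g i)"
  shows "indefinite_integral (\<lambda>x. \<Sum>i<(n::nat). D i x) (\<lambda>x. \<Sum>i<n. g i x)"
  using assms
proof (induction n)
  case (Suc n)
  then show ?case using indefinite_integral_add[of "\<lambda>x. \<Sum>i<n. D i x" "\<lambda>x. \<Sum>i<n. g i x" "D n" "g n"] by simp
qed (simp add: indefinite_integral_zero)

lemma set_integrable_Icc_const: "set_integrable lborel {x..y::real} (\<lambda>_. c :: real)"
  unfolding set_integrable_def
  by (intro integrable_scaleR_left integrable_real_indicator) (auto simp: emeasure_lborel_Icc_eq)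

lemma set_integral_Icc_const: "x \<le> y \<Longrightarrow> (LINT t:{x..y::real}|lborel. c) = c * (y - x :: real)"
  by (simp add: set_lebesgue_integral_def)

lemma indefinite_integral_le:
  assumes D: "indefinite_integral D g" and g: "\<And>t. g t \<le> C" and xy: "x \<le> y"
  shows "D y - D x \<le> C * (y - x)"
proof -
  have "(LINT t:{x..y}|lborel. g t) \<le> (LINT t:{x..y}|lborel. C)"
    using D g xy by (intro set_integral_mono set_integrable_Icc_const) (auto simp: indefinite_integral_def)
  then show ?thesis using D xy by (simp add: indefinite_integral_def set_integral_Icc_const)
qed

lemma indefinite_integral_lipschitz:
  assumes D: "indefinite_integral D g" and g: "\<And>t. \<bar>g t\<bar> \<le> C" and xy: "x \<le> y"
  shows "\<bar>D y - D x\<bar> \<le> C * (y - x)"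
proof -
  have "D y - D x \<le> C * (y - x)" using g by (intro indefinite_integral_le[OF D _ xy]) (simp add: abs_le_iff)
  moreover have "- 1 * D y - - 1 * D x \<le> C * (y - x)"
    using g by (intro indefinite_integral_le[OF indefinite_integral_scale[OF D] _ xy]) (simp add: abs_le_iff)
  ultimately show ?thesis by (simp add: abs_le_iff)
qed

section \<open>Birkhoff sums of vanishing oscillation\<close>

definition birkhoff :: "real \<Rightarrow> (real \<Rightarrow> real) \<Rightarrow> nat \<Rightarrow> real \<Rightarrow> real" where
  "birkhoff r H q y = (\<Sum>j<q. H (y + real j * r))"

text \<open>Oscillation instead of size, so that additive constants, and with them the growth of S_q
  due to a nonzero mean, drop out.\<close>

definition osc_vanishes :: "real \<Rightarrow> (real \<Rightarrow> real) \<Rightarrow> bool" where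
  "osc_vanishes r H \<longleftrightarrow> (\<forall>e>0. \<exists>N. \<forall>q\<ge>N. \<forall>p. good_denom r q p \<longrightarrow>
     (\<forall>y y'. \<bar>birkhoff r H q y - birkhoff r H q y'\<bar> \<le> e))"

lemma osc_vanishes_shift:
  assumes "osc_vanishes r H" shows "osc_vanishes r (\<lambda>y. H (y + s))"
proof -
  have "birkhoff r (\<lambda>y. H (y + s)) q y = birkhoff r H q (y + s)" for q y
    by (simp add: birkhoff_def add_ac)
  then show ?thesis using assms unfolding osc_vanishes_def by metis
qed

lemma osc_vanishes_scale:
  assumes "osc_vanishes r H" shows "osc_vanishes r (\<lambda>y. c * H y)"
  unfolding osc_vanishes_def
proof (intro allI impI)
  fix e :: real assume e: "e > 0"
  then have "e / (\<bar>c\<bar> + 1) > 0" by simp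
  then obtain N where N: "\<And>q p y y'. N \<le> q \<Longrightarrow> good_denom r q p \<Longrightarrow> \<bar>birkhoff r H q y - birkhoff r H q y'\<bar> \<le> e / (\<bar>c\<bar> + 1)"
    using assms unfolding osc_vanishes_def by meson
  have "\<bar>birkhoff r (\<lambda>y. c * H y) q y - birkhoff r (\<lambda>y. c * H y) q y'\<bar> \<le> e" if "N \<le> q" "good_denom r q p" for q p y y'
  proof -
    have "\<bar>birkhoff r (\<lambda>y. c * H y) q y - birkhoff r (\<lambda>y. c * H y) q y'\<bar> = \<bar>c\<bar> * \<bar>birkhoff r H q y - birkhoff r H q y'\<bar>"
      by (simp add: birkhoff_def abs_mult flip: sum_distrib_left right_diff_distrib)
    also have "\<dots> \<le> (\<bar>c\<bar> + 1) * (e / (\<bar>c\<bar> + 1))" using N[OF that] by (intro mult_mono) auto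
    also have "\<dots> = e" by (simp add: add_nonneg_eq_0_iff)
    finally show ?thesis .
  qed
  then show "\<exists>N. \<forall>q\<ge>N. \<forall>p. good_denom r q p \<longrightarrow> (\<forall>y y'. \<bar>birkhoff r (\<lambda>y. c * H y) q y - birkhoff r (\<lambda>y. c * H y) q y'\<bar> \<le> e)"
    by blast
qed

lemma osc_vanishes_add:
  assumes "osc_vanishes r H" "osc_vanishes r G" shows "osc_vanishes r (\<lambda>y. H y + G y)"
  unfolding osc_vanishes_def
proof (intro allI impI)
  fix e :: real assume "e > 0"
  then have e2: "e / 2 > 0" by simp
  obtain N where N: "\<And>q p y y'. N \<le> q \<Longrightarrow> good_denom r q p \<Longrightarrow> \<bar>birkhoff r H q y - birkhoff r H q y'\<bar> \<le> e / 2"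
    using assms(1) e2 unfolding osc_vanishes_def by meson
  obtain N' where N': "\<And>q p y y'. N' \<le> q \<Longrightarrow> good_denom r q p \<Longrightarrow> \<bar>birkhoff r G q y - birkhoff r G q y'\<bar> \<le> e / 2"
    using assms(2) e2 unfolding osc_vanishes_def by meson
  have b: "birkhoff r (\<lambda>y. H y + G y) q y = birkhoff r H q y + birkhoff r G q y" for q y
    by (simp add: birkhoff_def sum.distrib)
  have "\<bar>birkhoff r (\<lambda>y. H y + G y) q y - birkhoff r (\<lambda>y. H y + G y) q y'\<bar> \<le> e" if "max N N' \<le> q" "good_denom r q p" for q p y y'
  proof -
    have "\<bar>birkhoff r H q y - birkhoff r H q y'\<bar> \<le> e / 2" using that by (intro N) auto
    moreover have "\<bar>birkhoff r G q y - birkhoff r G q y'\<bar> \<le> e / 2" using that by (intro N') auto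
    ultimately show ?thesis unfolding b by linarith
  qed
  then show "\<exists>N. \<forall>q\<ge>N. \<forall>p. good_denom r q p \<longrightarrow> (\<forall>y y'. \<bar>birkhoff r (\<lambda>y. H y + G y) q y - birkhoff r (\<lambda>y. H y + G y) q y'\<bar> \<le> e)"
    by blast
qed

text \<open>The first periodic Bernoulli function; \<open>parabola\<close> is half the second one up
  to an additive constant. Differences of translates of \<open>sawtooth\<close> are steps minus
  their means, so differences of translates of \<open>parabola\<close> are primitives of
  these.\<close>

definition sawtooth :: "real \<Rightarrow> real" where "sawtooth y = frac y - 1 / 2"
definition parabola :: "real \<Rightarrow> real" where "parabola y = ((frac y)\<^sup>2 - frac y) / 2"

lemma parabola_periodic: "parabola (y + 1) = parabola y"
  by (simp add: parabola_def frac_1_eq)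

lemma parabola_integral: "indefinite_integral parabola sawtooth"
proof -
  have sm: "sawtooth \<in> borel_measurable borel" unfolding sawtooth_def frac_def by measurable
  define PP where "PP x y \<longleftrightarrow> set_integrable lborel {x..y} sawtooth \<and> (LINT t:{x..y}|lborel. sawtooth t) = parabola y - parabola x" for x y
  have PPtrans: "PP x z" if "x \<le> y" "y \<le> z" "PP x y" "PP y z" for x y z
    using set_integral_combine[OF that(1,2), of sawtooth] that(3,4) by (simp add: PP_def)
  have "PP x y" if "x \<le> y" for x y
  proof (rule periodic_cells_induct[where a = 0, OF PPtrans _ that])
    fix n :: int and x y :: real assume xy: "0 + of_int n \<le> x" "x \<le> y" "y \<le> 0 + of_int n + 1"
    define h where "h t = t - of_int n - 1 / 2" for t :: real
    define P where "P t = ((t - of_int n)\<^sup>2 - (t - of_int n)) / 2" for t :: real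
    have hP: "(P has_vector_derivative h t) (at t within {x..y})" for t
      unfolding P_def h_def has_real_derivative_iff_has_vector_derivative[symmetric]
      by (auto intro!: derivative_eq_intros simp: field_simps)
    have hc: "continuous_on {x..y} h" unfolding h_def by (intro continuous_intros)
    have hi: "set_integrable lborel {x..y} h"
      unfolding set_integrable_def by (rule borel_integrable_compact[OF compact_Icc hc])
    have hI: "(LINT t:{x..y}|lborel. h t) = P y - P x"
      unfolding set_lebesgue_integral_def by (rule integral_FTC_atLeastAtMost[OF xy(2) hP hc])
    have hm: "h \<in> borel_measurable borel" unfolding h_def by measurable
    have ft: "frac t = t - of_int n" if "of_int n \<le> t" "t < of_int n + 1" for t :: real
    proof -
      have "\<lfloor>t\<rfloor> = n" using that by (simp add: floor_eq_iff)
      then show ?thesis by (simp add: frac_def)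
    qed
    have PE: "parabola t = P t" if t: "of_int n \<le> t" "t \<le> of_int n + 1" for t
    proof (cases "t < of_int n + 1")
      case True
      then show ?thesis using ft[OF t(1)] by (simp add: parabola_def P_def)
    next
      case False
      then have "t = of_int (n + 1)" using t by simp
      then show ?thesis by (simp add: parabola_def P_def)
    qed
    have "AE t in lborel. t \<noteq> of_int n + 1" by (rule AE_lborel_singleton)
    then have ae: "AE t\<in>{x..y} in lborel. sawtooth t = h t"
      by eventually_elim (use xy ft in \<open>auto simp: sawtooth_def h_def\<close>)
    have "set_integrable lborel {x..y} sawtooth \<longleftrightarrow> set_integrable lborel {x..y} h"
      using sm hm ae by (intro set_integrable_cong_AE) auto
    moreover have "(LINT t:{x..y}|lborel. sawtooth t) = (LINT t:{x..y}|lborel. h t)"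
      using sm hm ae by (intro set_lebesgue_integral_cong_AE) auto
    ultimately show "PP x y" using hi hI PE[of x] PE[of y] xy by (simp add: PP_def)
  qed
  then show ?thesis using sm by (simp add: indefinite_integral_def PP_def)
qed

lemma sawtooth_variation: "variation_bound sawtooth (\<lambda>y. y + of_int \<lfloor>y\<rfloor>) 2"
  unfolding variation_bound_def
proof (intro conjI allI impI)
  show "mono (\<lambda>y. y + real_of_int \<lfloor>y\<rfloor>)" by (auto simp: mono_def intro!: add_mono floor_mono)
  fix u v :: real assume "u \<le> v"
  then have "real_of_int \<lfloor>u\<rfloor> \<le> of_int \<lfloor>v\<rfloor>" by (simp add: floor_mono)
  then show "\<bar>sawtooth u - sawtooth v\<bar> \<le> v + of_int \<lfloor>v\<rfloor> - (u + of_int \<lfloor>u\<rfloor>)"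
    using \<open>u \<le> v\<close> by (simp add: sawtooth_def frac_def)
qed (simp_all add: sawtooth_def frac_1_eq)

text \<open>\<open>sawtooth\<close> has variation 2 per period, one from the slope and one from the
  jump, so Denjoy bounds the oscillation by 10. As the density of a periodic function the sum has
  mean 0, hence it cannot stay away from 0 by more than its oscillation.\<close>

lemma birkhoff_sawtooth_bound:
  assumes g: "good_denom r q p"
  shows "\<bar>birkhoff r sawtooth q y\<bar> \<le> 10"
proof -
  have osc: "\<bar>birkhoff r sawtooth q y - birkhoff r sawtooth q y'\<bar> \<le> 10" for y y'
    unfolding birkhoff_def using birkhoff_sum_oscillation[OF g sawtooth_variation] by simp
  have I: "indefinite_integral (\<lambda>y. \<Sum>j<q. parabola (y + real j * r)) (birkhoff r sawtooth q)"
    unfolding birkhoff_def[abs_def] by (intro indefinite_integral_sum indefinite_integral_shift parabola_integral)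
  have per: "(\<Sum>j<q. parabola (1 + real j * r)) = (\<Sum>j<q. parabola (0 + real j * r))"
  proof -
    have "parabola (1 + s) = parabola (0 + s)" for s using parabola_periodic[of s] by (simp add: add.commute)
    then show ?thesis by (simp only:)
  qed
  have "birkhoff r sawtooth q y \<le> 10"
  proof (rule ccontr)
    assume a: "\<not> birkhoff r sawtooth q y \<le> 10"
    have "- 1 * birkhoff r sawtooth q t \<le> - (birkhoff r sawtooth q y - 10)" for t
      using osc[of y t] by linarith
    from indefinite_integral_le[OF indefinite_integral_scale[OF I] this, of 0 1]
    show False using a per by simp
  qed
  moreover have "- 10 \<le> birkhoff r sawtooth q y"
  proof (rule ccontr)
    assume a: "\<not> - 10 \<le> birkhoff r sawtooth q y"
    have "birkhoff r sawtooth q t \<le> birkhoff r sawtooth q y + 10" for t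
      using osc[of t y] by linarith
    from indefinite_integral_le[OF I this, of 0 1]
    show False using a per by simp
  qed
  ultimately show ?thesis by (simp add: abs_le_iff)
qed

lemma periodic_int_shift:
  fixes H :: "real \<Rightarrow> real"
  assumes "\<And>y. H (y + 1) = H y" shows "H (y + of_int m) = H y"
  using add_int_of_add_one[of H 0 y m] assms by simp

text \<open>Averaging over a good number $K$ of rotations makes the function Lipschitz with constant
  $O(1/K)$, while $S_q$ of the average differs little from $S_q$, since $S_q Q(y + r) - S_q Q(y) =
  Q(y + qr) - Q(y)$ is small.\<close>

lemma osc_vanishes_parabola:
  assumes unb: "\<And>n. \<exists>q p. good_denom r q p \<and> n \<le> q"
  shows "osc_vanishes r parabola"
  unfolding osc_vanishes_def
proof (intro allI impI)
  fix e :: real assume e: "e > 0"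
  \<comment> \<open>The average over K rotations has Lipschitz constant 10 / K, so by Denjoy its
    sums oscillate by at most 50 / K \<le> e / 2. The other half of e pays twice for the averaging
    error K / q \<le> e / 4.\<close>
  obtain n0 :: nat where n0: "100 / e < n0" using reals_Archimedean2 by blast
  obtain K P where K: "good_denom r K P" "Suc n0 \<le> K" using unb by blast
  have K0: "real K > 0" and Ke: "50 / K \<le> e / 2"
  proof -
    show "real K > 0" using K(2) by simp
    have "100 / e < K" using n0 K(2) by linarith
    then show "50 / K \<le> e / 2" using e \<open>real K > 0\<close> by (simp add: field_simps)
  qed
  define T where "T y = (1 / real K) * birkhoff r parabola K y" for y
  have I: "indefinite_integral T (\<lambda>y. (1 / real K) * birkhoff r sawtooth K y)"
    unfolding T_def birkhoff_def[abs_def]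
    by (intro indefinite_integral_scale indefinite_integral_sum indefinite_integral_shift parabola_integral)
  have lipT: "\<bar>T v - T u\<bar> \<le> (10 / K) * (v - u)" if "u \<le> v" for u v
  proof (rule indefinite_integral_lipschitz[OF I _ that])
    fix t
    have "\<bar>birkhoff r sawtooth K t\<bar> / K \<le> 10 / K"
      using birkhoff_sawtooth_bound[OF K(1), of t] K0 by (intro divide_right_mono) auto
    then show "\<bar>1 / real K * birkhoff r sawtooth K t\<bar> \<le> 10 / real K" by (simp add: abs_mult)
  qed
  have perT: "T (y + 1) = T y" for y
  proof -
    have "parabola (y + 1 + s) = parabola (y + s)" for s using parabola_periodic[of "y + s"] by (simp add: add_ac)
    then show ?thesis by (simp add: T_def birkhoff_def)
  qed
  have varT: "variation_bound T (\<lambda>y. (10 / K) * y) (10 / K)"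
    unfolding variation_bound_def
  proof (intro conjI allI impI)
    show "mono (\<lambda>y. 10 / real K * y)" using K0 by (auto simp: mono_def intro!: divide_right_mono)
    show "\<bar>T u - T v\<bar> \<le> 10 / real K * v - 10 / real K * u" if "u \<le> v" for u v
      using lipT[OF that] by (simp add: abs_minus_commute right_diff_distrib)
  qed (simp_all add: perT algebra_simps add_divide_distrib)
  have lipQ: "\<bar>parabola v - parabola u\<bar> \<le> \<bar>v - u\<bar>" for u v
  proof -
    have s: "\<bar>sawtooth t\<bar> \<le> 1" for t using frac_ge_0[of t] frac_lt_1[of t] unfolding sawtooth_def abs_le_iff by linarith
    show ?thesis
      using indefinite_integral_lipschitz[OF parabola_integral s, of u v] indefinite_integral_lipschitz[OF parabola_integral s, of v u]
      by (cases "u \<le> v") (auto simp: abs_minus_commute)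
  qed
  obtain N :: nat where N: "4 * K / e < N" using reals_Archimedean2 by blast
  show "\<exists>N. \<forall>q\<ge>N. \<forall>p. good_denom r q p \<longrightarrow> (\<forall>y y'. \<bar>birkhoff r parabola q y - birkhoff r parabola q y'\<bar> \<le> e)"
  proof (intro exI[of _ N] allI impI)
    fix q p y y' assume q: "N \<le> q" "good_denom r q p"
    have q0: "real q > 0" using q(2) by (simp add: good_denom_def)
    have Kq: "real K / q \<le> e / 4"
    proof -
      have "4 * K / e < real q" using N q(1) by linarith
      then show ?thesis using e q0 by (simp add: field_simps)
    qed
    have one: "\<bar>birkhoff r parabola q (z + r) - birkhoff r parabola q z\<bar> \<le> 1 / q" for z
    proof -
      have "birkhoff r parabola q (z + r) - birkhoff r parabola q z = (\<Sum>j<q. parabola (z + real (Suc j) * r) - parabola (z + real j * r))"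
        by (simp add: birkhoff_def sum_subtractf algebra_simps)
      also have "\<dots> = parabola (z + real q * r) - parabola (z + real 0 * r)" by (rule sum_lessThan_telescope)
      also have "\<dots> = parabola (z + real q * r + of_int (- p)) - parabola z"
        by (simp only: periodic_int_shift[of parabola, OF parabola_periodic]) simp
      finally have "\<bar>birkhoff r parabola q (z + r) - birkhoff r parabola q z\<bar> \<le> \<bar>z + real q * r + of_int (- p) - z\<bar>"
        using lipQ[of "z + real q * r + of_int (- p)" z] by simp
      also have "\<dots> \<le> 1 / q" using q(2) by (simp add: good_denom_def)
      finally show ?thesis .
    qed
    have multi: "\<bar>birkhoff r parabola q (z + real k * r) - birkhoff r parabola q z\<bar> \<le> real k / q" for k z
    proof (induction k)
      case (Suc k)
      have e1: "z + real (Suc k) * r = (z + real k * r) + r" by (simp add: algebra_simps)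
      have e2: "real (Suc k) / q = real k / q + 1 / q" by (simp add: add_divide_distrib)
      show ?case unfolding e1 e2 using Suc one[of "z + real k * r"] by linarith
    qed simp
    have close: "\<bar>birkhoff r T q z - birkhoff r parabola q z\<bar> \<le> real K / q" for z
    proof -
      have "birkhoff r T q z = (1 / real K) * (\<Sum>k<K. birkhoff r parabola q (z + real k * r))"
      proof -
        have "birkhoff r T q z = (1 / real K) * (\<Sum>j<q. \<Sum>k<K. parabola (z + real j * r + real k * r))"
          by (simp add: birkhoff_def T_def sum_distrib_left)
        also have "(\<Sum>j<q. \<Sum>k<K. parabola (z + real j * r + real k * r)) = (\<Sum>k<K. \<Sum>j<q. parabola (z + real j * r + real k * r))"
          by (rule sum.swap)
        finally show ?thesis by (simp add: birkhoff_def add_ac)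
      qed
      also have "\<dots> - birkhoff r parabola q z = (1 / real K) * (\<Sum>k<K. birkhoff r parabola q (z + real k * r) - birkhoff r parabola q z)"
        using K0 by (simp add: sum_subtractf right_diff_distrib)
      finally have "\<bar>birkhoff r T q z - birkhoff r parabola q z\<bar> = (1 / real K) * \<bar>\<Sum>k<K. birkhoff r parabola q (z + real k * r) - birkhoff r parabola q z\<bar>"
        by (simp add: abs_mult)
      also have "\<dots> \<le> (1 / real K) * (\<Sum>k<K. real K / q)"
      proof (rule mult_left_mono)
        have "\<bar>\<Sum>k<K. birkhoff r parabola q (z + real k * r) - birkhoff r parabola q z\<bar> \<le> (\<Sum>k<K. \<bar>birkhoff r parabola q (z + real k * r) - birkhoff r parabola q z\<bar>)"
          by (rule sum_abs)
        also have "\<dots> \<le> (\<Sum>k<K. real K / q)"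
        proof (rule sum_mono)
          fix k assume "k \<in> {..<K}"
          then have "real k / q \<le> real K / q" using q0 by (intro divide_right_mono) auto
          then show "\<bar>birkhoff r parabola q (z + real k * r) - birkhoff r parabola q z\<bar> \<le> real K / q"
            using multi[of z k] by linarith
        qed
        finally show "\<bar>\<Sum>k<K. birkhoff r parabola q (z + real k * r) - birkhoff r parabola q z\<bar> \<le> (\<Sum>k<K. real K / q)" .
      qed simp
      also have "\<dots> = real K / q" using K0 by simp
      finally show ?thesis .
    qed
    have "\<bar>birkhoff r T q y - birkhoff r T q y'\<bar> \<le> 5 * (10 / K)"
      unfolding birkhoff_def by (rule birkhoff_sum_oscillation[OF q(2) varT])
    then show "\<bar>birkhoff r parabola q y - birkhoff r parabola q y'\<bar> \<le> e"
      using close[of y] close[of y'] Kq Ke by linarith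
  qed
qed

lemma integral_unit_lborel_eq:
  fixes g :: "real \<Rightarrow> real"
  assumes "g \<in> borel_measurable borel" "set_integrable lborel {0..1} g"
  shows "(\<integral>y. g y \<partial>unit_lborel) = (LINT t:{0..1}|lborel. g t)" "integrable unit_lborel g"
proof -
  have ae: "AE t in lborel. indicator {0..<1} t *\<^sub>R g t = indicator {0..1} t *\<^sub>R g t"
  proof -
    have "AE t in lborel. t \<noteq> (1 :: real)" by (rule AE_lborel_singleton)
    then show ?thesis by eventually_elim (auto simp: indicator_def)
  qed
  have m: "(\<lambda>t. indicator {0..<1} t *\<^sub>R g t) \<in> borel_measurable lborel" "(\<lambda>t. indicator {0..1} t *\<^sub>R g t) \<in> borel_measurable lborel"
    using assms(1) by auto
  have "(\<integral>y. g y \<partial>unit_lborel) = (\<integral>t. indicator {0..<1} t *\<^sub>R g t \<partial>lborel)"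
    unfolding unit_lborel_def by (subst integral_restrict_space) auto
  also have "\<dots> = (LINT t:{0..1}|lborel. g t)"
    unfolding set_lebesgue_integral_def by (rule integral_cong_AE[OF m ae])
  finally show "(\<integral>y. g y \<partial>unit_lborel) = (LINT t:{0..1}|lborel. g t)" .
  have "integrable lborel (\<lambda>t. indicator {0..<1} t *\<^sub>R g t)"
    using assms(2) integrable_cong_AE[OF m ae] by (simp add: set_integrable_def)
  then show "integrable unit_lborel g"
    unfolding unit_lborel_def by (subst integrable_restrict_space) auto
qed

text \<open>The new summand minus its mean c (b - a) is c times the difference of
  \<open>sawtooth\<close> at y - b and at y - a. The number m is the mean of v.\<close>

lemma steps_primitive:
  assumes unb: "\<And>n. \<exists>q p. good_denom r q p \<and> n \<le> q" and "v \<in> steps"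
  shows "\<exists>G m. osc_vanishes r G \<and> (\<forall>y. G (y + 1) = G y) \<and> indefinite_integral G (\<lambda>y. v y - m)"
  using assms(2)
proof (induction rule: steps.induct)
  case zero
  have "osc_vanishes r (\<lambda>_. 0)" by (simp add: osc_vanishes_def birkhoff_def)
  then show ?case using indefinite_integral_zero by (intro exI[of _ "\<lambda>_. 0"] exI[of _ 0]) simp
next
  case (add v a b c)
  then obtain G m where G: "osc_vanishes r G" "\<And>y. G (y + 1) = G y" "indefinite_integral G (\<lambda>y. v y - m)" by blast
  define J where "J y = c * (parabola (y + (- b)) + - 1 * parabola (y + (- a)))" for y
  have "osc_vanishes r J" unfolding J_def
    by (intro osc_vanishes_scale osc_vanishes_add osc_vanishes_shift osc_vanishes_parabola unb)
  then have "osc_vanishes r (\<lambda>y. G y + J y)" using G(1) by (rule osc_vanishes_add[rotated])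
  moreover have "J (y + 1) = J y" for y
    using parabola_periodic[of "y - a"] parabola_periodic[of "y - b"] by (simp add: J_def algebra_simps)
  moreover have "indefinite_integral (\<lambda>y. G y + J y) (\<lambda>y. v y + c * (of_int \<lfloor>y - a\<rfloor> - of_int \<lfloor>y - b\<rfloor>) - (m + c * (b - a)))"
  proof -
    have "indefinite_integral J (\<lambda>y. c * (sawtooth (y + (- b)) + - 1 * sawtooth (y + (- a))))" unfolding J_def
      by (intro indefinite_integral_scale indefinite_integral_add indefinite_integral_shift parabola_integral)
    from indefinite_integral_add[OF G(3) this]
    show ?thesis by (simp add: sawtooth_def frac_def algebra_simps)
  qed
  ultimately show ?case using G(2) by (intro exI[of _ "\<lambda>y. G y + J y"] exI[of _ "m + c * (b - a)"]) simp
qed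

text \<open>l is approximated in the mean by a step v. The primitive of v - m is covered by the case
  of steps, and what remains of H has variation V \<le> e / 10, so that Denjoy's inequality bounds
  its contribution by 5 V \<le> e / 2.\<close>

lemma osc_vanishes_primitive:
  assumes unb: "\<And>n. \<exists>q p. good_denom r q p \<and> n \<le> q"
    and H: "indefinite_integral H l" and perH: "\<And>y. H (y + 1) = H y" and perl: "\<And>y. l (y + 1) = l y"
  shows "osc_vanishes r H"
  unfolding osc_vanishes_def
proof (intro allI impI)
  fix e :: real assume e: "e > 0"
  have lm: "l \<in> borel_measurable borel" using H by (simp add: indefinite_integral_def)
  have lI: "set_integrable lborel {0..1} l" "(LINT t:{0..1}|lborel. l t) = 0"
    using H perH[of 0] by (auto simp: indefinite_integral_def)
  note lU = integral_unit_lborel_eq[OF lm lI(1)]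
  obtain v where v: "v \<in> steps" "(\<integral>y. \<bar>l y - v y\<bar> \<partial>unit_lborel) < e / 20"
    using integrable_step_approximable[OF lU(2)] e unfolding step_approximable_def
    by (metis divide_pos_pos zero_less_numeral)
  obtain G m where G: "osc_vanishes r G" "\<And>y. G (y + 1) = G y" "indefinite_integral G (\<lambda>y. v y - m)"
    using steps_primitive[OF unb v(1)] by blast
  define R k where "R y = H y - G y" and "k y = l y - (v y - m)" for y
  have R: "indefinite_integral R k" unfolding R_def k_def by (rule indefinite_integral_diff[OF H G(3)])
  have perR: "R (y + 1) = R y" for y by (simp add: R_def perH G(2))
  have perk: "k (y + 1) = k y" for y by (simp add: k_def perl steps_periodic[OF v(1)])
  have km: "k \<in> borel_measurable borel" using R by (simp add: indefinite_integral_def)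
  have ki: "set_integrable lborel {x..y} k" for x y
    using R by (cases "x \<le> y") (auto simp: indefinite_integral_def set_integrable_def)
  have vI: "integrable unit_lborel v" by (rule steps_integrable[OF v(1)])
  have vm: "(\<integral>y. v y \<partial>unit_lborel) = m"
  proof -
    have "(\<integral>y. v y - m \<partial>unit_lborel) = 0"
      using integral_unit_lborel_eq(1)[of "\<lambda>y. v y - m"] G(3) G(2)[of 0] by (simp add: indefinite_integral_def)
    moreover have "(\<integral>y. v y - m \<partial>unit_lborel) = (\<integral>y. v y \<partial>unit_lborel) - m"
      using vI finite_measure.integrable_const[OF finite_measure_unit, of m]
      by (subst Bochner_Integration.integral_diff) (auto simp: measure_def emeasure_unit_lborel)
    ultimately show ?thesis by simp
  qed
  \<comment> \<open>As H is periodic, l has mean 0, and the mean m of v is at most the distance of v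
    from l. The distance thus enters V twice, whence the tolerance e / 20.\<close>
  have "\<bar>m\<bar> \<le> (\<integral>y. \<bar>l y - v y\<bar> \<partial>unit_lborel)"
  proof -
    have "- m = (\<integral>y. l y - v y \<partial>unit_lborel)" using lU lI(2) vI vm by simp
    then have "\<bar>m\<bar> = \<bar>\<integral>y. l y - v y \<partial>unit_lborel\<bar>" by (metis abs_minus_cancel)
    also have "\<dots> \<le> (\<integral>y. \<bar>l y - v y\<bar> \<partial>unit_lborel)" by (rule integral_abs_bound)
    finally show ?thesis .
  qed
  then have m: "\<bar>m\<bar> < e / 20" using v(2) by simp
  have ka: "set_integrable lborel {x..y} (\<lambda>t. \<bar>k t\<bar>)" for x y using ki[of x y] by (rule set_integrable_abs)
  have "(\<lambda>t. \<bar>k t\<bar>) \<in> borel_measurable borel" using km by measurable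
  then obtain \<Theta> where \<Theta>: "indefinite_integral \<Theta> (\<lambda>t. \<bar>k t\<bar>)" using primitive_exists ka by metis
  define V where "V = \<Theta> 1 - \<Theta> 0"
  have \<Theta>per: "\<Theta> (y + 1) = \<Theta> y + V" for y
    using indefinite_integral_quasiperiodic[OF \<Theta>, of y] perk by (simp add: V_def algebra_simps)
  have "V = (\<integral>y. \<bar>k y\<bar> \<partial>unit_lborel)"
    using \<Theta> integral_unit_lborel_eq(1)[OF _ ka] km by (simp add: V_def indefinite_integral_def)
  also have "\<dots> \<le> (\<integral>y. \<bar>l y - v y\<bar> + \<bar>m\<bar> \<partial>unit_lborel)"
  proof (rule integral_mono)
    show "integrable unit_lborel (\<lambda>y. \<bar>k y\<bar>)" using integral_unit_lborel_eq(2)[OF km ki] by (rule integrable_abs)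
    show "integrable unit_lborel (\<lambda>y. \<bar>l y - v y\<bar> + \<bar>m\<bar>)"
      using lU(2) vI finite_measure.integrable_const[OF finite_measure_unit, of m]
      by (intro Bochner_Integration.integrable_add integrable_abs Bochner_Integration.integrable_diff) auto
  qed (simp add: k_def)
  also have "\<dots> = (\<integral>y. \<bar>l y - v y\<bar> \<partial>unit_lborel) + \<bar>m\<bar>"
    using lU(2) vI finite_measure.integrable_const[OF finite_measure_unit, of "\<bar>m\<bar>"]
    by (subst Bochner_Integration.integral_add) (auto simp: measure_def emeasure_unit_lborel)
  finally have V: "V \<le> e / 10" using v(2) m by simp
  have var: "variation_bound R \<Theta> V"
    unfolding variation_bound_def
  proof (intro conjI allI impI perR \<Theta>per)
    have inc: "\<bar>R x - R y\<bar> \<le> \<Theta> y - \<Theta> x" if "x \<le> y" for x y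
    proof -
      have "\<bar>LINT t:{x..y}|lborel. k t\<bar> \<le> (LINT t:{x..y}|lborel. \<bar>k t\<bar>)"
        using integral_abs_bound[of lborel "\<lambda>t. indicator {x..y} t *\<^sub>R k t"]
        by (simp add: set_lebesgue_integral_def abs_mult)
      then show ?thesis using R \<Theta> that by (simp add: indefinite_integral_def abs_minus_commute)
    qed
    then show "\<bar>R x - R y\<bar> \<le> \<Theta> y - \<Theta> x" if "x \<le> y" for x y using that by blast
    show "mono \<Theta>"
    proof (rule monoI)
      fix x y :: real assume "x \<le> y" then show "\<Theta> x \<le> \<Theta> y" using inc[of x y] by linarith
    qed
  qed
  obtain N where N: "\<And>q p y y'. N \<le> q \<Longrightarrow> good_denom r q p \<Longrightarrow> \<bar>birkhoff r G q y - birkhoff r G q y'\<bar> \<le> e / 2"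
    using G(1) e unfolding osc_vanishes_def by (meson half_gt_zero)
  have "\<bar>birkhoff r H q y - birkhoff r H q y'\<bar> \<le> e" if "N \<le> q" "good_denom r q p" for q p y y'
  proof -
    have b: "birkhoff r H q z = birkhoff r R q z + birkhoff r G q z" for z
      by (simp add: birkhoff_def R_def flip: sum.distrib)
    moreover have "\<bar>birkhoff r R q y - birkhoff r R q y'\<bar> \<le> 5 * V"
      unfolding birkhoff_def by (rule birkhoff_sum_oscillation[OF that(2) var])
    ultimately show ?thesis using N[OF that, of y y'] V b[of y] b[of y'] by linarith
  qed
  then show "\<exists>N. \<forall>q\<ge>N. \<forall>p. good_denom r q p \<longrightarrow> (\<forall>y y'. \<bar>birkhoff r H q y - birkhoff r H q y'\<bar> \<le> e)" by blast
qed

section \<open>Coincidence of break orbits at all scales\<close>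

lemma floor_add_small:
  fixes z h :: real
  assumes "0 \<le> h" "h < 1"
  shows "\<lfloor>z + h\<rfloor> - \<lfloor>z\<rfloor> = (if 1 - h \<le> frac z then 1 else 0)"
proof (cases "1 - h \<le> frac z")
  case True
  then have "\<lfloor>z + h\<rfloor> = \<lfloor>z\<rfloor> + 1" using assms frac_lt_1[of z] by (simp add: floor_eq_iff frac_def)
  then show ?thesis using True by simp
next
  case False
  then have "\<lfloor>z + h\<rfloor> = \<lfloor>z\<rfloor>" using assms of_int_floor_le[of z] by (simp add: floor_eq_iff frac_def del: of_int_floor_le)
  then show ?thesis using False by simp
qed

lemma frac_near_one:
  fixes z h :: real
  assumes "1 - h \<le> frac z"
  obtains n :: int where "of_int n - h \<le> z" "z < of_int n"
proof -
  have "of_int (\<lfloor>z\<rfloor> + 1) - h \<le> z" "z < of_int (\<lfloor>z\<rfloor> + 1)" using assms frac_lt_1[of z] by (auto simp: frac_def)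
  then show ?thesis by (rule that)
qed

lemma measure_periodic_translate:
  assumes U: "U \<in> sets borel" "\<And>y. y + 1 \<in> U \<longleftrightarrow> y \<in> U"
  shows "emeasure unit_lborel {y \<in> {0..<1}. y + t \<in> U} = emeasure unit_lborel (U \<inter> {0..<1})"
proof -
  have per: "y + of_int m \<in> U \<longleftrightarrow> y \<in> U" for y m
    using add_int_of_add_one[of "indicator U" 0 y m] U(2) by (simp add: indicator_def of_bool_eq_iff)
  have "{y \<in> {0..<1}. y + t \<in> U} = {y \<in> {0..<1}. frac (y + t) \<in> U \<inter> {0..<1}}"
    using per[of "frac (y + t)" "\<lfloor>y + t\<rfloor>" for y] by (auto simp: frac_def) (auto simp: frac_def[symmetric] frac_lt_1)
  moreover have "emeasure unit_lborel {y \<in> {0..<1}. frac (y + t) \<in> U \<inter> {0..<1}} = emeasure lborel {y \<in> {0..<1}. frac (y + t) \<in> U \<inter> {0..<1}}"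
    by (rule emeasure_unit_lborel) auto
  moreover have "emeasure unit_lborel (U \<inter> {0..<1}) = emeasure lborel (U \<inter> {0..<1})" by (rule emeasure_unit_lborel) auto
  ultimately show ?thesis
    using emeasure_rotation[of "U \<inter> {0..<1}" t] U(1) by (simp only: sets.Int atLeastLessThan_borel Int_lower2)
qed

text \<open>The sum jumps up where some y + i r - A is an integer and down where some y + j r - C
  is. An index i is bad if no downward jump lies within h = \<eta> / q of its upward jump. Moving by
  h across a bad jump raises the sum by exactly 1, so one of the two points lies in U. Counting by
  measure leaves an index that is not bad, and the same count bounds k.\<close>

lemma coincidence_single_scale:
  fixes A C r \<eta> \<kappa> c0 :: real
  assumes g: "good_denom r q p"
    and c0: "\<And>m p :: int. m \<noteq> 0 \<Longrightarrow> c0 \<le> \<bar>real_of_int m * r - p\<bar> * \<bar>real_of_int m\<bar>"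
    and \<eta>: "0 < \<eta>" "\<eta> < c0 / 4" "\<eta> < 1"
    and \<zeta>: "\<zeta> = (\<lambda>y. real_of_int \<lfloor>y - A\<rfloor> - of_int \<lfloor>y - C\<rfloor>)"
    and U: "U \<in> sets borel" "\<And>y. y + 1 \<in> U \<longleftrightarrow> y \<in> U" "emeasure unit_lborel (U \<inter> {0..<1}) \<le> ennreal (\<eta>\<^sup>2 / 2)"
    and const: "\<And>y y'. y \<notin> U \<Longrightarrow> y' \<notin> U \<Longrightarrow> birkhoff r \<zeta> q y = birkhoff r \<zeta> q y'"
  shows "\<exists>k m :: int. \<bar>real_of_int k\<bar> \<le> \<eta> * q \<and> \<bar>A - C - of_int k * r - of_int m\<bar> < \<eta> / q"
proof -
  have q0: "q > 0" using g by (simp add: good_denom_def)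
  define h where "h = \<eta> / q"
  have h: "0 < h" "h < 1" using \<eta> q0 by (auto simp: h_def pos_divide_less_eq intro: less_le_trans)
  have hq: "h * q = \<eta>" using q0 by (simp add: h_def)
  \<comment> \<open>Two orbit points closer than 2 h would violate bounded type, since 2 h q = 2
    \<eta> < c0.\<close>
  have sep: "i = j" if "i < q" "j < q" "\<bar>(real i - real j) * r - of_int m\<bar> < 2 * h" for i j and m :: int
  proof (rule ccontr)
    assume "i \<noteq> j"
    then have "int i - int j \<noteq> 0" by simp
    from c0[OF this, of m] have "c0 \<le> \<bar>(real i - real j) * r - of_int m\<bar> * \<bar>real i - real j\<bar>" by simp
    also have "\<dots> \<le> (2 * h) * q" using that by (intro mult_mono) auto
    also have "\<dots> = 2 * \<eta>" using hq by simp
    finally show False using \<eta> by simp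
  qed
  \<comment> \<open>The points, of measure h, from which a move by h to the right crosses the upward
    jump with index i.\<close>
  define B where "B i = {y \<in> {0..<1}. 1 - h \<le> frac (y + (real i * r - A))}" for i
  have fm: "frac \<in> borel_measurable (borel :: real measure)" unfolding frac_def by measurable
  have Bset: "B i = {y \<in> {0..<1}. frac (y + (real i * r - A)) \<in> {1 - h..<1}}" for i
    by (auto simp: B_def frac_lt_1)
  have Bm: "B i \<in> sets borel" for i
  proof -
    have "(\<lambda>y. frac (y + (real i * r - A))) \<in> borel_measurable borel" using fm by measurable
    then have "(\<lambda>y. frac (y + (real i * r - A))) -` {1 - h..} \<in> sets borel" by (rule measurable_sets_borel) simp
    moreover have "B i = (\<lambda>y. frac (y + (real i * r - A))) -` {1 - h..} \<inter> {0..<1}" by (auto simp: B_def)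
    ultimately show ?thesis by simp
  qed
  have Bmeas: "emeasure lborel (B i) = ennreal h" for i
    unfolding Bset using h by (subst emeasure_rotation) auto
  have Bnear: "\<bar>(real i - real j) * r - of_int m - s\<bar> < h"
    if "of_int n - h \<le> y + (real i * r - A)" "y + (real i * r - A) < of_int n"
      "of_int n' - h \<le> y + (real j * r - D)" "y + (real j * r - D) < of_int n'" "m = n - n'" "s = A - D" for i j m n n' y D s
    using that by (simp add: abs_less_iff algebra_simps)
  have disj: "i = j" if ij: "i < q" "j < q" "y \<in> B i" "y \<in> B j" for i j y
  proof -
    obtain n where n: "of_int n - h \<le> y + (real i * r - A)" "y + (real i * r - A) < of_int n"
      using ij(3) frac_near_one[of h "y + (real i * r - A)"] by (auto simp: B_def)
    obtain n' where n': "of_int n' - h \<le> y + (real j * r - A)" "y + (real j * r - A) < of_int n'"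
      using ij(4) frac_near_one[of h "y + (real j * r - A)"] by (auto simp: B_def)
    have "\<bar>(real i - real j) * r - of_int (n - n') - 0\<bar> < h" using Bnear[OF n n'] by simp
    then show ?thesis using h by (intro sep[OF ij(1,2), of "n - n'"]) simp
  qed
  define bad where "bad = {i. i < q \<and> (\<forall>j<q. \<forall>m::int. h \<le> \<bar>A - C - (real i - real j) * r - of_int m\<bar>)}"
  have badq: "bad \<subseteq> {..<q}" "finite bad" by (auto simp: bad_def)
  have jump: "birkhoff r \<zeta> q (y + h) = birkhoff r \<zeta> q y + 1" if i: "i \<in> bad" and y: "y \<in> B i" for i y
  proof -
    have "birkhoff r \<zeta> q (y + h) - birkhoff r \<zeta> q y
        = (\<Sum>j<q. of_int (\<lfloor>y + (real j * r - A) + h\<rfloor> - \<lfloor>y + (real j * r - A)\<rfloor>) - of_int (\<lfloor>y + (real j * r - C) + h\<rfloor> - \<lfloor>y + (real j * r - C)\<rfloor>))"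
      by (simp add: birkhoff_def \<zeta> sum_subtractf[symmetric] algebra_simps)
    also have "\<dots> = (\<Sum>j<q. if j = i then 1 else 0)"
    proof (rule sum.cong[OF refl])
      fix j assume j: "j \<in> {..<q}"
      have iq: "i < q" using i by (simp add: bad_def)
      have "y \<in> B j \<longleftrightarrow> j = i" using disj[of i j y] iq j y by auto
      then have 1: "1 - h \<le> frac (y + (real j * r - A)) \<longleftrightarrow> j = i" using y by (auto simp: B_def)
      have 2: "\<not> 1 - h \<le> frac (y + (real j * r - C))"
      proof
        assume "1 - h \<le> frac (y + (real j * r - C))"
        then obtain n' where n': "of_int n' - h \<le> y + (real j * r - C)" "y + (real j * r - C) < of_int n'"
          by (rule frac_near_one)
        obtain n where n: "of_int n - h \<le> y + (real i * r - A)" "y + (real i * r - A) < of_int n"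
          using y frac_near_one[of h "y + (real i * r - A)"] by (auto simp: B_def)
        have "\<bar>(real i - real j) * r - of_int (n - n') - (A - C)\<bar> < h" by (rule Bnear[OF n n']) auto
        then have "\<bar>A - C - (real i - real j) * r - of_int (n' - n)\<bar> < h" by (simp add: abs_less_iff algebra_simps)
        moreover have "\<forall>j<q. \<forall>m::int. h \<le> \<bar>A - C - (real i - real j) * r - of_int m\<bar>" using i by (simp add: bad_def)
        then have "h \<le> \<bar>A - C - (real i - real j) * r - of_int (n' - n)\<bar>" using j by blast
        ultimately show False by linarith
      qed
      show "of_int (\<lfloor>y + (real j * r - A) + h\<rfloor> - \<lfloor>y + (real j * r - A)\<rfloor>) - of_int (\<lfloor>y + (real j * r - C) + h\<rfloor> - \<lfloor>y + (real j * r - C)\<rfloor>) = (if j = i then 1 else 0 :: real)"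
        using floor_add_small[of h "y + (real j * r - A)"] floor_add_small[of h "y + (real j * r - C)"] h 1 2 by simp
    qed
    also have "\<dots> = 1" using i by (simp add: bad_def)
    finally show ?thesis by simp
  qed
  have cover: "(\<Union>i\<in>bad. B i) \<subseteq> (U \<inter> {0..<1}) \<union> {y \<in> {0..<1}. y + h \<in> U}"
  proof
    fix y assume "y \<in> (\<Union>i\<in>bad. B i)"
    then obtain i where i: "i \<in> bad" "y \<in> B i" by blast
    have "y \<in> U \<or> y + h \<in> U" using const[of "y + h" y] jump[OF i] by auto
    then show "y \<in> (U \<inter> {0..<1}) \<union> {y \<in> {0..<1}. y + h \<in> U}" using i(2) by (auto simp: B_def)
  qed
  have shm: "{y \<in> {0..<1}. y + h \<in> U} \<in> sets borel"
  proof -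
    have "{y \<in> {0..<1}. y + h \<in> U} = (\<lambda>y. y + h) -` U \<inter> {0..<1}" by auto
    moreover have "(\<lambda>y. y + h) -` U \<in> sets borel" by (rule measurable_sets_borel[OF _ U(1)]) simp
    ultimately show ?thesis by simp
  qed
  \<comment> \<open>The windows of the bad indices are disjoint and lie in U or in U moved by - h,
    so their number times h is at most \<eta>^2. Division by h = \<eta> / q leaves \<eta> q.\<close>
  have "ennreal (real (card bad) * h) = (\<Sum>i\<in>bad. emeasure lborel (B i))"
    using h by (simp add: Bmeas ennreal_of_nat_eq_real_of_nat ennreal_mult)
  also have "\<dots> = emeasure lborel (\<Union>i\<in>bad. B i)"
  proof (rule sum_emeasure)
    show "disjoint_family_on B bad" using disj badq by (auto simp: disjoint_family_on_def)
  qed (use Bm badq in auto)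
  also have "\<dots> \<le> emeasure lborel ((U \<inter> {0..<1}) \<union> {y \<in> {0..<1}. y + h \<in> U})"
    using cover U(1) shm by (intro emeasure_mono) auto
  also have "\<dots> \<le> emeasure lborel (U \<inter> {0..<1}) + emeasure lborel {y \<in> {0..<1}. y + h \<in> U}"
    using U(1) shm by (intro emeasure_subadditive) auto
  also have "emeasure lborel (U \<inter> {0..<1}) = emeasure unit_lborel (U \<inter> {0..<1})" by (rule emeasure_unit_lborel[symmetric]) auto
  also have "emeasure lborel {y \<in> {0..<1}. y + h \<in> U} = emeasure unit_lborel {y \<in> {0..<1}. y + h \<in> U}" by (rule emeasure_unit_lborel[symmetric]) auto
  also have "emeasure unit_lborel {y \<in> {0..<1}. y + h \<in> U} = emeasure unit_lborel (U \<inter> {0..<1})"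
    by (rule measure_periodic_translate[OF U(1,2)])
  also have "emeasure unit_lborel (U \<inter> {0..<1}) + emeasure unit_lborel (U \<inter> {0..<1}) \<le> ennreal (\<eta>\<^sup>2 / 2) + ennreal (\<eta>\<^sup>2 / 2)"
    using U(3) by (intro add_mono)
  also have "\<dots> = ennreal (\<eta>\<^sup>2)" by (simp flip: ennreal_plus)
  finally have "real (card bad) * h \<le> \<eta>\<^sup>2" by (simp add: ennreal_le_iff)
  then have "real (card bad) * h * q \<le> \<eta>\<^sup>2 * q" by (intro mult_right_mono) auto
  moreover have "real (card bad) * h * q = real (card bad) * \<eta>" by (simp only: mult.assoc hq)
  moreover have "\<eta>\<^sup>2 * q = (\<eta> * q) * \<eta>" by (simp add: power2_eq_square)
  ultimately have "real (card bad) * \<eta> \<le> (\<eta> * q) * \<eta>" by linarith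
  then have cb: "real (card bad) \<le> \<eta> * q" using \<eta>(1) by (rule mult_right_le_imp_le)
  have "\<eta> * real q < 1 * real q" using \<eta>(3) q0 by (intro mult_strict_right_mono) auto
  then have "card bad < q" using cb by simp
  then have "bad \<noteq> {..<q}" by auto
  then obtain i0 where i0: "i0 < q" "i0 \<notin> bad" using badq by auto
  then obtain j0 m where j0: "j0 < q" "\<bar>A - C - (real i0 - real j0) * r - of_int m\<bar> < h" by (auto simp: bad_def not_le)
  define k where "k = int i0 - int j0"
  \<comment> \<open>Two different shifts would give a nonzero integer of size at most 2 q whose
    multiple of r is within 2 h of an integer, contrary to 4 \<eta> < c0.\<close>
  have uniq: "int i - int j = k" if i: "i < q" "j < q" "\<bar>A - C - (real i - real j) * r - of_int m'\<bar> < h" for i j and m' :: int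
  proof (rule ccontr)
    assume "int i - int j \<noteq> k"
    then have "int i - int j - k \<noteq> 0" by simp
    from c0[OF this, of "m - m'"] have "c0 \<le> \<bar>(real i - real j - real i0 + real j0) * r - of_int (m - m')\<bar> * \<bar>real i - real j - real i0 + real j0\<bar>"
      by (simp add: k_def algebra_simps)
    also have "\<dots> \<le> (2 * h) * (2 * q)"
      using i j0 i0 by (intro mult_mono) (simp_all add: abs_less_iff abs_le_iff algebra_simps)
    also have "\<dots> = 4 * \<eta>" using hq by simp
    finally show False using \<eta> by simp
  qed
  have gk: "0 \<le> int i - k \<and> int i - k < int q" if ib: "i < q" "i \<notin> bad" for i
  proof -
    obtain j m' where "j < q" "\<bar>A - C - (real i - real j) * r - of_int m'\<bar> < h" using ib by (auto simp: bad_def not_le)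
    then have "int i - int j = k" using uniq ib(1) by blast
    then show ?thesis using \<open>j < q\<close> by linarith
  qed
  \<comment> \<open>For the |k| indices at one end of the range the partner i - k falls outside 0,
    ..., q - 1, so they are bad.\<close>
  have "nat \<bar>k\<bar> \<le> card bad"
  proof (cases "k \<ge> 0")
    case True
    have "{..<nat k} \<subseteq> bad"
    proof
      fix i assume i: "i \<in> {..<nat k}"
      then have "i < q" using i0(1) by (simp add: k_def)
      then show "i \<in> bad" using gk[of i] i by (cases "i \<in> bad") auto
    qed
    then have "card {..<nat k} \<le> card bad" using badq(2) by (intro card_mono)
    then show ?thesis using True by simp
  next
    case False
    have "{q - nat (- k)..<q} \<subseteq> bad"
    proof
      fix i assume i: "i \<in> {q - nat (- k)..<q}"
      then show "i \<in> bad" using gk[of i] False by (cases "i \<in> bad") auto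
    qed
    then have "card {q - nat (- k)..<q} \<le> card bad" using badq(2) by (intro card_mono)
    moreover have "nat (- k) \<le> q" using j0(1) by (simp add: k_def)
    ultimately show ?thesis using False by simp
  qed
  then have "\<bar>real_of_int k\<bar> \<le> \<eta> * q" using cb by linarith
  moreover have "\<bar>A - C - of_int k * r - of_int m\<bar> < \<eta> / q" using j0(2) by (simp add: k_def h_def)
  ultimately show ?thesis by blast
qed

text \<open>For every n a good denominator lies between c0 2^n and 2^n. The integers k of
  consecutive scales differ by at most 3 \<eta> 2^n, while the difference times r is within (3 / 2)
  \<eta> / (c0 2^n) of an integer. The product (9 / 2) \<eta>^2 / c0 is below c0, so by bounded type
  the two integers agree.\<close>

lemma coincidence_all_scales:
  fixes A C r \<eta> c0 :: real
  assumes c0: "0 < c0" "\<And>m p :: int. m \<noteq> 0 \<Longrightarrow> c0 \<le> \<bar>real_of_int m * r - p\<bar> * \<bar>real_of_int m\<bar>"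
    and \<eta>: "0 < \<eta>" "\<eta> < c0 / 4"
    and sc: "\<And>q p. N \<le> q \<Longrightarrow> good_denom r q p \<Longrightarrow> \<exists>k m :: int. \<bar>real_of_int k\<bar> \<le> \<eta> * q \<and> \<bar>A - C - of_int k * r - of_int m\<bar> < \<eta> / q"
  shows "\<exists>k m :: int. A - C = of_int k * r + of_int m"
proof -
  have ex: "\<exists>q p. good_denom r q p \<and> real q \<le> 2 ^ n \<and> c0 * 2 ^ n \<le> real q" for n
  proof -
    obtain q p where q: "good_denom r q p" "q \<le> 2 ^ n" "\<bar>real q * r - p\<bar> < 1 / real (2 ^ n)"
      using good_denom_exists[of "2 ^ n" r] by (metis zero_less_numeral zero_less_power)
    have "q > 0" using q by (simp add: good_denom_def)
    then have "c0 \<le> \<bar>real q * r - p\<bar> * real q" using c0(2)[of "int q" p] by simp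
    also have "\<dots> \<le> 1 / 2 ^ n * real q" using q(3) by (intro mult_right_mono) auto
    finally have "c0 * 2 ^ n \<le> real q" by (simp add: field_simps)
    moreover have "real q \<le> 2 ^ n" using q(2) by (metis of_nat_le_iff of_nat_numeral of_nat_power)
    ultimately show ?thesis using q(1) by blast
  qed
  obtain n0 :: nat where n0: "real N / c0 < 2 ^ n0" using real_arch_pow[of 2 "real N / c0"] by auto
  have "\<exists>k m :: int. \<bar>real_of_int k\<bar> \<le> \<eta> * 2 ^ n \<and> \<bar>A - C - of_int k * r - of_int m\<bar> < \<eta> / (c0 * 2 ^ n)" if n: "n0 \<le> n" for n
  proof -
    obtain q p where q: "good_denom r q p" "real q \<le> 2 ^ n" "c0 * 2 ^ n \<le> real q" using ex by blast
    have "(2::real) ^ n0 \<le> 2 ^ n" using n by simp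
    then have "c0 * 2 ^ n0 \<le> c0 * 2 ^ n" using c0(1) by (intro mult_left_mono) auto
    moreover have "real N < c0 * 2 ^ n0" using n0 c0(1) by (simp add: pos_divide_less_eq mult.commute)
    ultimately have "real N < c0 * 2 ^ n" by linarith
    then have "N \<le> q" using q(3) by linarith
    then obtain k m :: int where km: "\<bar>real_of_int k\<bar> \<le> \<eta> * q" "\<bar>A - C - of_int k * r - of_int m\<bar> < \<eta> / q" using sc q(1) by blast
    have "\<eta> * q \<le> \<eta> * 2 ^ n" using q(2) \<eta>(1) by (intro mult_left_mono) auto
    moreover have "\<eta> / q \<le> \<eta> / (c0 * 2 ^ n)"
    proof (rule divide_left_mono[OF q(3)])
      have c: "0 < c0 * 2 ^ n" using c0(1) by simp
      then have "0 < real q" using q(3) by linarith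
      then show "0 < real q * (c0 * 2 ^ n)" using c by (rule mult_pos_pos)
    qed (use \<eta>(1) in simp)
    ultimately have "\<bar>real_of_int k\<bar> \<le> \<eta> * 2 ^ n \<and> \<bar>A - C - of_int k * r - of_int m\<bar> < \<eta> / (c0 * 2 ^ n)" using km by linarith
    then show ?thesis by blast
  qed
  then have "\<forall>n. \<exists>km. n0 \<le> n \<longrightarrow> \<bar>real_of_int (fst km)\<bar> \<le> \<eta> * 2 ^ n \<and> \<bar>A - C - of_int (fst km) * r - of_int (snd km)\<bar> < \<eta> / (c0 * 2 ^ n)"
    by (metis fst_conv snd_conv)
  from choice[OF this] obtain km :: "nat \<Rightarrow> int \<times> int" where km: "\<And>n. n0 \<le> n \<Longrightarrow> \<bar>real_of_int (fst (km n))\<bar> \<le> \<eta> * 2 ^ n"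
    "\<And>n. n0 \<le> n \<Longrightarrow> \<bar>A - C - of_int (fst (km n)) * r - of_int (snd (km n))\<bar> < \<eta> / (c0 * 2 ^ n)" by blast
  define k where "k n = fst (km n)" for n
  define m where "m n = snd (km n)" for n
  have step: "k (Suc n) = k n" if n: "n0 \<le> n" for n
  proof (rule ccontr)
    assume "k (Suc n) \<noteq> k n"
    then have "k (Suc n) - k n \<noteq> 0" by simp
    from c0(2)[OF this, of "m n - m (Suc n)"]
    have "c0 \<le> \<bar>(real_of_int (k (Suc n)) - of_int (k n)) * r - (of_int (m n) - of_int (m (Suc n)))\<bar> * \<bar>real_of_int (k (Suc n)) - of_int (k n)\<bar>"
      by simp
    also have "\<dots> \<le> (\<eta> / (c0 * 2 ^ n) + \<eta> / (c0 * 2 ^ Suc n)) * (\<eta> * 2 ^ n + \<eta> * 2 ^ Suc n)"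
    proof (rule mult_mono)
      have "(real_of_int (k (Suc n)) - of_int (k n)) * r - (of_int (m n) - of_int (m (Suc n)))
          = (A - C - of_int (k n) * r - of_int (m n)) - (A - C - of_int (k (Suc n)) * r - of_int (m (Suc n)))"
        by (simp add: algebra_simps)
      then show "\<bar>(real_of_int (k (Suc n)) - of_int (k n)) * r - (of_int (m n) - of_int (m (Suc n)))\<bar> \<le> \<eta> / (c0 * 2 ^ n) + \<eta> / (c0 * 2 ^ Suc n)"
        using km(2)[of n] km(2)[of "Suc n"] n unfolding k_def m_def by linarith
      show "\<bar>real_of_int (k (Suc n)) - of_int (k n)\<bar> \<le> \<eta> * 2 ^ n + \<eta> * 2 ^ Suc n"
        using km(1)[of n] km(1)[of "Suc n"] n unfolding k_def by linarith
    qed (use \<eta> c0 in auto)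
    also have "\<dots> = (9 / 2) * \<eta> * \<eta> / c0" using c0(1) by (simp add: field_simps)
    finally have "c0 * c0 \<le> (9 / 2) * (\<eta> * \<eta>)" using c0(1) by (simp add: pos_le_divide_eq mult_ac)
    moreover have "\<eta> * \<eta> < (c0 / 4) * (c0 / 4)" using \<eta> by (intro mult_strict_mono) auto
    moreover have "0 < c0 * c0" using c0(1) by simp
    ultimately show False by simp
  qed
  have kc: "k n = k n0" if "n0 \<le> n" for n using that by (induction n rule: dec_induct) (auto simp: step)
  define d where "d = A - C - of_int (k n0) * r"
  \<comment> \<open>m might still vary with n; the nearest integer to d does not, and it is at least
    as close.\<close>
  have small: "\<bar>of_int (round d) - d\<bar> \<le> (\<eta> / c0) * (1 / 2) ^ n" if "n0 \<le> n" for n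
  proof -
    have "\<bar>of_int (round d) - d\<bar> \<le> \<bar>of_int (m n) - d\<bar>" using round_diff_minimal[of d "m n"] by (simp add: abs_minus_commute)
    also have "\<dots> \<le> \<eta> / (c0 * 2 ^ n)"
      using km(2)[OF that] kc[OF that] unfolding d_def k_def m_def by (simp add: abs_minus_commute)
    also have "\<dots> = (\<eta> / c0) * (1 / 2) ^ n" by (simp add: power_one_over)
    finally show ?thesis .
  qed
  have "(\<lambda>n. (\<eta> / c0) * (1 / 2) ^ n) \<longlonglongrightarrow> (\<eta> / c0) * 0" by (intro tendsto_intros) auto
  then have "\<bar>of_int (round d) - d\<bar> \<le> (\<eta> / c0) * 0" using small by (intro LIMSEQ_le_const) auto
  then have "d = of_int (round d)" by simp
  then have "A - C = of_int (k n0) * r + of_int (round d)" by (simp add: d_def)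
  then show ?thesis by blast
qed

section \<open>The density in the conjugated coordinate\<close>

lemma borel_unit': "(u :: real \<Rightarrow> ennreal) \<in> borel_measurable borel \<Longrightarrow> u \<in> borel_measurable unit_lborel"
  by (simp add: measurable_restrict_space1 cong: measurable_cong_sets)

context circle_conjugacy
begin

definition F :: "real \<Rightarrow> real" where "F y = L (\<psi> y)"

lemma S_\<psi>: "S q (\<psi> y) = birkhoff r F q y"
  by (simp add: S_def birkhoff_def F_def f_orbit \<phi>\<psi>)

lemma F_borel: "F \<in> borel_measurable borel"
proof -
  have "L \<in> borel_measurable borel" using cov by (simp add: change_of_variables_def)
  then show ?thesis unfolding F_def using borel_maps(2) by measurable
qed

lemma birkhoff_borel:
  assumes [measurable]: "G \<in> borel_measurable borel"
  shows "birkhoff r G q \<in> borel_measurable borel"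
  unfolding birkhoff_def[abs_def] by measurable

text \<open>The image of Lebesgue measure on the whole line, not on one period, so that translations
  by q r + p act on it.\<close>

definition \<nu> :: "real measure" where "\<nu> = distr lborel borel \<phi>"

lemma nn_integral_\<nu>: "u \<in> borel_measurable borel \<Longrightarrow> (\<integral>\<^sup>+y. u y \<partial>\<nu>) = (\<integral>\<^sup>+x. u (\<phi> x) \<partial>lborel)"
  unfolding \<nu>_def using borel_maps(1) by (intro nn_integral_distr) auto

lemma nn_integral_translate:
  fixes u :: "real \<Rightarrow> ennreal"
  assumes "u \<in> borel_measurable borel" shows "(\<integral>\<^sup>+x. u (x + s) \<partial>lborel) = (\<integral>\<^sup>+x. u x \<partial>lborel)"
  using nn_integral_real_affine[OF assms, of 1 s] by (simp add: add.commute)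

text \<open>The substitution formula for f^q carried over by \<phi>, together with the invariance of
  Lebesgue measure under integer translations. The integer p allows q r to be replaced by the small
  number q r - p.\<close>

lemma \<nu>_quasi_invariant:
  assumes u[measurable]: "u \<in> borel_measurable borel"
  shows "(\<integral>\<^sup>+y. u (y + (real q * r + of_int p)) * ennreal (exp (birkhoff r F q y)) \<partial>\<nu>) = (\<integral>\<^sup>+y. u y \<partial>\<nu>)"
proof -
  note [measurable] = borel_maps birkhoff_borel[OF F_borel]
  define k where "k x = u (\<phi> (x + of_int p))" for x
  have km: "k \<in> borel_measurable borel" unfolding k_def by measurable
  have "(\<integral>\<^sup>+y. u (y + (real q * r + of_int p)) * ennreal (exp (birkhoff r F q y)) \<partial>\<nu>)
      = (\<integral>\<^sup>+x. u (\<phi> x + (real q * r + of_int p)) * ennreal (exp (birkhoff r F q (\<phi> x))) \<partial>lborel)"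
    by (rule nn_integral_\<nu>) measurable
  also have "\<dots> = (\<integral>\<^sup>+x. k ((f ^^ q) x) * ennreal (exp (S q x)) \<partial>lborel)"
    by (simp add: k_def circle_lift_add_int[OF \<phi>] \<phi>_orbit add.assoc flip: S_\<psi>) (simp add: \<psi>\<phi>)
  also have "\<dots> = (\<integral>\<^sup>+x. k x \<partial>lborel)" using cov_S[of q] km unfolding change_of_variables_def by simp
  also have "\<dots> = (\<integral>\<^sup>+x. u (\<phi> x) \<partial>lborel)"
    unfolding k_def by (rule nn_integral_translate[of "\<lambda>x. u (\<phi> x)"]) measurable
  also have "\<dots> = (\<integral>\<^sup>+y. u y \<partial>\<nu>)" by (rule nn_integral_\<nu>[symmetric]) measurable
  finally show ?thesis .
qed

text \<open>The Radon-Nikodym density of \<nu>: equivalence of null sets makes it exist and be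
  positive, and comparing densities on both sides of the quasi-invariance gives the cocycle
  identity.\<close>

lemma density_exists:
  assumes eqv: "\<And>B. B \<in> sets borel \<Longrightarrow> emeasure lborel {x. \<phi> x \<in> B} = 0 \<longleftrightarrow> emeasure lborel B = 0"
  obtains g where "g \<in> borel_measurable borel" "\<And>y. 0 \<le> g y" "\<And>y. g (y + 1) = g y"
    "density lborel (\<lambda>y. ennreal (g y)) = \<nu>" "AE y in lborel. 0 < g y" "integrable unit_lborel g"
    "\<And>q p. AE y in lborel. g (y + (real q * r + of_int p)) = exp (birkhoff r F q y) * g y"
proof -
  note bm[measurable] = borel_maps
  have \<nu>e: "emeasure \<nu> B = emeasure lborel {x. \<phi> x \<in> B}" if "B \<in> sets borel" for B
    unfolding \<nu>_def using that by (subst emeasure_distr) (auto simp: vimage_def)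
  have s\<nu>: "sets \<nu> = sets lborel" by (simp add: \<nu>_def)
  have "absolutely_continuous lborel \<nu>"
    unfolding absolutely_continuous_def
  proof
    fix N :: "real set" assume "N \<in> null_sets lborel"
    then have N: "N \<in> sets borel" "emeasure lborel N = 0" by auto
    then show "N \<in> null_sets \<nu>" using eqv[OF N(1)] \<nu>e[OF N(1)] s\<nu> by (intro null_setsI) auto
  qed
  then obtain w where w[measurable]: "w \<in> borel_measurable borel" and dw: "density lborel w = \<nu>"
    using sigma_finite_measure.Radon_Nikodym[OF sigma_finite_lborel _ s\<nu>] by auto
  have nnw: "(\<integral>\<^sup>+y. u y \<partial>\<nu>) = (\<integral>\<^sup>+y. w y * u y \<partial>lborel)" if "u \<in> borel_measurable borel" for u
    unfolding dw[symmetric] using that by (intro nn_integral_density) auto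
  note [measurable] = birkhoff_borel[OF F_borel]
  have inv: "AE y in lborel. w (y + (real q * r + of_int p)) = w y * ennreal (exp (birkhoff r F q y))" for q p
  proof -
    define t where "t = real q * r + of_int p"
    have "density lborel (\<lambda>y. w (y + t)) = density lborel (\<lambda>y. w y * ennreal (exp (birkhoff r F q y)))"
    proof (rule measure_eqI)
      fix X assume "X \<in> sets (density lborel (\<lambda>y. w (y + t)))"
      then have X[measurable]: "X \<in> sets borel" by simp
      define u where "u y = (indicator X (y - t) :: ennreal)" for y
      have um[measurable]: "u \<in> borel_measurable borel" unfolding u_def by measurable
      have "emeasure (density lborel (\<lambda>y. w (y + t))) X = (\<integral>\<^sup>+y. w (y + t) * u (y + t) \<partial>lborel)"
        by (simp add: emeasure_density u_def)
      also have "\<dots> = (\<integral>\<^sup>+y. w y * u y \<partial>lborel)"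
        by (rule nn_integral_translate[of "\<lambda>y. w y * u y"]) measurable
      also have "\<dots> = (\<integral>\<^sup>+y. u y \<partial>\<nu>)" by (rule nnw[symmetric]) measurable
      also have "\<dots> = (\<integral>\<^sup>+y. u (y + t) * ennreal (exp (birkhoff r F q y)) \<partial>\<nu>)"
        unfolding t_def by (rule \<nu>_quasi_invariant[symmetric]) measurable
      also have "\<dots> = (\<integral>\<^sup>+y. w y * (u (y + t) * ennreal (exp (birkhoff r F q y))) \<partial>lborel)" by (rule nnw) measurable
      also have "\<dots> = emeasure (density lborel (\<lambda>y. w y * ennreal (exp (birkhoff r F q y)))) X"
        by (simp add: emeasure_density u_def mult_ac)
      finally show "emeasure (density lborel (\<lambda>y. w (y + t))) X = emeasure (density lborel (\<lambda>y. w y * ennreal (exp (birkhoff r F q y)))) X" .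
    qed simp
    then show ?thesis unfolding t_def
      by (subst (asm) sigma_finite_measure.density_unique_iff[OF sigma_finite_lborel]) measurable
  qed
  \<comment> \<open>Periodicity is the case q = 0 of the cocycle identity.\<close>
  have "AE y in lborel. w (y + of_int p) = w y" for p
    using inv[of 0 p] by (simp add: birkhoff_def)
  then have "AE y in lborel. \<forall>p. w (y + of_int p) = w y" by (subst AE_all_countable) blast
  then have wf: "AE y in lborel. w (frac y) = w y"
  proof eventually_elim
    fix y assume *: "\<forall>p. w (y + of_int p) = w y"
    show "w (frac y) = w y" using *[rule_format, of "- \<lfloor>y\<rfloor>"] by (simp add: frac_def)
  qed
  have "frac \<in> borel_measurable (borel :: real measure)" unfolding frac_def by measurable
  note [measurable] = this
  \<comment> \<open>The density is periodic and finite only almost everywhere; evaluation at the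
    fractional part and conversion to a real number make it so everywhere.\<close>
  define g where "g y = enn2real (w (frac y))" for y
  have gm[measurable]: "g \<in> borel_measurable borel" unfolding g_def by measurable
  have fin: "AE y in lborel. w y < \<infinity>"
  proof -
    have "AE y in lborel. w y * indicator {- real n..real n} y \<noteq> \<infinity>" for n
    proof (rule nn_integral_PInf_AE)
      have "(\<integral>\<^sup>+y. w y * indicator {- real n..real n} y \<partial>lborel) = (\<integral>\<^sup>+y. indicator {- real n..real n} y \<partial>\<nu>)"
        by (rule nnw[symmetric]) measurable
      also have "\<dots> = emeasure lborel {x. \<phi> x \<in> {- real n..real n}}" using s\<nu> \<nu>e by simp
      also have "{x. \<phi> x \<in> {- real n..real n}} = {\<psi> (- real n)..\<psi> (real n)}"
        using \<phi>_le[of "\<psi> (- real n)"] \<phi>_le[of _ "\<psi> (real n)"] by (auto simp: \<phi>\<psi>)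
      finally show "(\<integral>\<^sup>+y. w y * indicator {- real n..real n} y \<partial>lborel) \<noteq> \<infinity>" by (simp add: emeasure_lborel_Icc_eq)
    qed measurable
    then have "AE y in lborel. \<forall>n. w y * indicator {- real n..real n} y \<noteq> \<infinity>" by (subst AE_all_countable) blast
    then show ?thesis
    proof eventually_elim
      fix y assume *: "\<forall>n. w y * indicator {- real n..real n} y \<noteq> \<infinity>"
      obtain n :: nat where "\<bar>y\<bar> < n" using reals_Archimedean2 by blast
      then have "y \<in> {- real n..real n}" by auto
      then show "w y < \<infinity>" using *[rule_format, of n] by (simp add: less_top)
    qed
  qed
  have gw: "AE y in lborel. ennreal (g y) = w y"
    using wf fin by eventually_elim (simp add: g_def less_top)
  have "density lborel (\<lambda>y. ennreal (g y)) = density lborel w"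
    by (rule density_cong) (use gw in auto)
  then have dg: "density lborel (\<lambda>y. ennreal (g y)) = \<nu>" by (simp add: dw)
  have "AE y in lborel. w y \<noteq> 0"
  proof -
    have Z: "{y. w y = 0} \<in> sets borel" by measurable
    have "emeasure \<nu> {y. w y = 0} = (\<integral>\<^sup>+y. w y * indicator {y. w y = 0} y \<partial>lborel)"
      unfolding dw[symmetric] using Z by (simp add: emeasure_density)
    also have "\<dots> = (\<integral>\<^sup>+y. 0 \<partial>(lborel :: real measure))" by (intro nn_integral_cong) (auto simp: indicator_def)
    finally have "emeasure lborel {y. w y = 0} = 0" using eqv[OF Z] \<nu>e[OF Z] by simp
    then show ?thesis using Z by (subst AE_iff_measurable[of "{y. w y = 0}"]) auto
  qed
  then have gpos: "AE y in lborel. 0 < g y"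
    using gw
  proof eventually_elim
    fix y assume "w y \<noteq> 0" "ennreal (g y) = w y"
    then have "ennreal (g y) \<noteq> 0" by simp
    then show "0 < g y" by (simp add: ennreal_eq_0_iff not_le)
  qed
  have gq: "AE y in lborel. g (y + (real q * r + of_int p)) = exp (birkhoff r F q y) * g y" for q p
  proof -
    define t where "t = real q * r + of_int p"
    have "AE y in lborel. ennreal (g (y + t)) = w (y + t)"
    proof -
      have "{y. ennreal (g y) \<noteq> w y} \<in> sets borel" by measurable
      moreover have "emeasure lborel {y. ennreal (g y) \<noteq> w y} = 0"
        using gw calculation by (subst (asm) AE_iff_measurable[of "{y. ennreal (g y) \<noteq> w y}"]) auto
      ultimately have "emeasure lborel {y. y + t \<in> {y. ennreal (g y) \<noteq> w y}} = 0"
        using emeasure_lborel_translate[of "{y. ennreal (g y) \<noteq> w y}" t] by simp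
      moreover have "{y. y + t \<in> {y. ennreal (g y) \<noteq> w y}} \<in> sets borel" by measurable
      ultimately show ?thesis by (subst AE_iff_measurable[of "{y. y + t \<in> {y. ennreal (g y) \<noteq> w y}}"]) auto
    qed
    then show ?thesis
      using inv[of q p] gw unfolding t_def[symmetric]
    proof eventually_elim
      fix y assume a: "ennreal (g (y + t)) = w (y + t)" "w (y + t) = w y * ennreal (exp (birkhoff r F q y))" "ennreal (g y) = w y"
      then have "ennreal (g (y + t)) = ennreal (g y) * ennreal (exp (birkhoff r F q y))" by (simp only:)
      also have "\<dots> = ennreal (exp (birkhoff r F q y) * g y)"
        by (subst ennreal_mult[symmetric]) (simp_all add: g_def mult.commute)
      finally have "ennreal (g (y + t)) = ennreal (exp (birkhoff r F q y) * g y)" .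
      then show "g (y + t) = exp (birkhoff r F q y) * g y" by (subst (asm) ennreal_inj) (auto simp: g_def)
    qed
  qed
  have gint: "integrable unit_lborel g"
  proof (rule integrableI_nonneg)
    show "g \<in> borel_measurable unit_lborel" by (rule borel_unit[OF gm])
    have "(\<integral>\<^sup>+y. ennreal (g y) \<partial>unit_lborel) = (\<integral>\<^sup>+y. ennreal (g y) * indicator {0..<1} y \<partial>lborel)"
      by (rule nn_integral_unit_lborel)
    also have "\<dots> = emeasure \<nu> {0..<1}" unfolding dg[symmetric] by (simp add: emeasure_density)
    also have "\<dots> = emeasure lborel {x. \<phi> x \<in> {0..<1}}" by (rule \<nu>e) simp
    also have "\<dots> \<le> emeasure lborel {\<psi> 0..\<psi> 1}"
    proof (rule emeasure_mono)
      show "{x. \<phi> x \<in> {0..<1}} \<subseteq> {\<psi> 0..\<psi> 1}"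
        using \<phi>_le[of "\<psi> 0"] \<phi>_le[of _ "\<psi> 1"] by (auto simp: \<phi>\<psi> dest: less_imp_le)
    qed simp
    also have "\<dots> < \<infinity>" by (simp add: emeasure_lborel_Icc_eq)
    finally show "(\<integral>\<^sup>+y. ennreal (g y) \<partial>unit_lborel) < \<infinity>" .
  qed (simp add: g_def)
  show ?thesis
    by (rule that[OF gm _ _ dg gpos gint gq]) (simp_all add: g_def frac_1_eq)
qed

end

section \<open>Continuity of translations in the mean\<close>

lemma frac_translation_L1:
  assumes t: "0 \<le> t"
  shows "(\<integral>\<^sup>+y. ennreal \<bar>real_of_int \<lfloor>y + t - a\<rfloor> - of_int \<lfloor>y - a\<rfloor>\<bar> \<partial>unit_lborel) = ennreal t"
proof -
  interpret finite_measure unit_lborel by (rule finite_measure_unit)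
  have "frac \<in> borel_measurable (borel :: real measure)" unfolding frac_def by measurable
  note [measurable] = this
  have nn: "(\<integral>\<^sup>+y. ennreal (frac (y + s)) \<partial>unit_lborel) = (\<integral>\<^sup>+y. ennreal (frac y) \<partial>unit_lborel)" for s
    by (rule nn_integral_rotation[of "\<lambda>y. ennreal (frac y)"]) (auto simp: frac_1_eq)
  have le: "\<lfloor>y - a\<rfloor> \<le> \<lfloor>y + t - a\<rfloor>" for y using t by (intro floor_mono) simp
  \<comment> \<open>With floors written as argument minus fractional part, the difference is t plus
    a difference of two fractional parts with equal integrals. The identity stays additive, as
    subtraction of extended nonnegative numbers truncates.\<close>
  have split: "ennreal \<bar>real_of_int \<lfloor>y + t - a\<rfloor> - of_int \<lfloor>y - a\<rfloor>\<bar> + ennreal (frac (y + (t - a))) = ennreal t + ennreal (frac (y + - a))" for y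
  proof -
    have "\<bar>real_of_int \<lfloor>y + t - a\<rfloor> - of_int \<lfloor>y - a\<rfloor>\<bar> + frac (y + (t - a)) = t + frac (y + - a)"
      using le[of y] by (simp add: frac_def algebra_simps)
    then show ?thesis using t by (simp flip: ennreal_plus)
  qed
  have m1: "(\<lambda>y. ennreal \<bar>real_of_int \<lfloor>y + t - a\<rfloor> - of_int \<lfloor>y - a\<rfloor>\<bar>) \<in> borel_measurable unit_lborel"
    by (rule borel_unit') measurable
  have m2: "(\<lambda>y. ennreal (frac (y + s))) \<in> borel_measurable unit_lborel" for s
    by (rule borel_unit') measurable
  have m3: "(\<lambda>y. ennreal t) \<in> borel_measurable unit_lborel" by simp
  have "(\<integral>\<^sup>+y. ennreal \<bar>real_of_int \<lfloor>y + t - a\<rfloor> - of_int \<lfloor>y - a\<rfloor>\<bar> \<partial>unit_lborel) + (\<integral>\<^sup>+y. ennreal (frac (y + (t - a))) \<partial>unit_lborel)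
      = (\<integral>\<^sup>+y. ennreal t + ennreal (frac (y + - a)) \<partial>unit_lborel)"
    unfolding nn_integral_add[OF m1 m2, symmetric] by (simp only: split)
  also have "\<dots> = ennreal t + (\<integral>\<^sup>+y. ennreal (frac (y + - a)) \<partial>unit_lborel)"
    unfolding nn_integral_add[OF m3 m2] by (simp add: emeasure_unit_lborel)
  finally have "(\<integral>\<^sup>+y. ennreal \<bar>real_of_int \<lfloor>y + t - a\<rfloor> - of_int \<lfloor>y - a\<rfloor>\<bar> \<partial>unit_lborel) + (\<integral>\<^sup>+y. ennreal (frac y) \<partial>unit_lborel)
      = ennreal t + (\<integral>\<^sup>+y. ennreal (frac y) \<partial>unit_lborel)" by (simp only: nn)
  moreover have "(\<integral>\<^sup>+y. ennreal (frac y) \<partial>unit_lborel) < \<infinity>"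
  proof -
    have "(\<integral>\<^sup>+y. ennreal (frac y) \<partial>unit_lborel) \<le> (\<integral>\<^sup>+y. 1 \<partial>unit_lborel)"
      by (intro nn_integral_mono) (simp add: ennreal_le_1 frac_lt_1 less_imp_le)
    also have "\<dots> < \<infinity>" by (simp add: emeasure_unit_lborel)
    finally show ?thesis .
  qed
  ultimately show ?thesis by (auto simp: add.commute[of _ "\<integral>\<^sup>+y. ennreal (frac y) \<partial>unit_lborel"] ennreal_add_left_cancel)
qed

lemma floor_translation_L1:
  "(\<integral>\<^sup>+y. ennreal \<bar>real_of_int \<lfloor>y + t - a\<rfloor> - of_int \<lfloor>y - a\<rfloor>\<bar> \<partial>unit_lborel) \<le> ennreal \<bar>t\<bar>"
proof (cases "0 \<le> t")
  case True
  then show ?thesis using frac_translation_L1[OF True, of a] by simp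
next
  case False
  have e: "y + - t - (a - t) = y - a" "y - (a - t) = y + t - a" for y by simp_all
  have "(\<integral>\<^sup>+y. ennreal \<bar>real_of_int \<lfloor>y - a\<rfloor> - of_int \<lfloor>y + t - a\<rfloor>\<bar> \<partial>unit_lborel) = ennreal (- t)"
    using frac_translation_L1[of "- t" "a - t"] False unfolding e by simp
  then show ?thesis unfolding abs_minus_commute[of "of_int \<lfloor>_ + t - a\<rfloor>"] using False by simp
qed

text \<open>Translation by t moves a unit jump by |t| in the mean, so each new pair of jumps of
  height c adds 2 |c| to the constant.\<close>

lemma steps_translation:
  assumes "v \<in> steps"
  shows "\<exists>C\<ge>0. \<forall>t. (\<integral>\<^sup>+y. ennreal \<bar>v (y + t) - v y\<bar> \<partial>unit_lborel) \<le> ennreal (C * \<bar>t\<bar>)"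
  using assms
proof (induction rule: steps.induct)
  case zero
  then show ?case by (intro exI[of _ 0]) simp
next
  case (add v a b c)
  then obtain C where C: "C \<ge> 0" "\<And>t. (\<integral>\<^sup>+y. ennreal \<bar>v (y + t) - v y\<bar> \<partial>unit_lborel) \<le> ennreal (C * \<bar>t\<bar>)" by blast
  note [measurable] = steps_borel[OF add.hyps(1)]
  define d where "d a t y = ennreal \<bar>real_of_int \<lfloor>y + t - a\<rfloor> - of_int \<lfloor>y - a\<rfloor>\<bar>" for a t y :: real
  have dm: "d a t \<in> borel_measurable unit_lborel" for a t unfolding d_def by (rule borel_unit') measurable
  have vm: "(\<lambda>y. ennreal \<bar>v (y + t) - v y\<bar>) \<in> borel_measurable unit_lborel" for t by (rule borel_unit') measurable
  have "(\<integral>\<^sup>+y. ennreal \<bar>v (y + t) + c * (of_int \<lfloor>y + t - a\<rfloor> - of_int \<lfloor>y + t - b\<rfloor>) - (v y + c * (of_int \<lfloor>y - a\<rfloor> - of_int \<lfloor>y - b\<rfloor>))\<bar> \<partial>unit_lborel)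
      \<le> ennreal ((C + 2 * \<bar>c\<bar>) * \<bar>t\<bar>)" for t
  proof -
    have "(\<integral>\<^sup>+y. ennreal \<bar>v (y + t) + c * (of_int \<lfloor>y + t - a\<rfloor> - of_int \<lfloor>y + t - b\<rfloor>) - (v y + c * (of_int \<lfloor>y - a\<rfloor> - of_int \<lfloor>y - b\<rfloor>))\<bar> \<partial>unit_lborel)
        \<le> (\<integral>\<^sup>+y. ennreal \<bar>v (y + t) - v y\<bar> + (ennreal \<bar>c\<bar> * d a t y + ennreal \<bar>c\<bar> * d b t y) \<partial>unit_lborel)"
    proof (rule nn_integral_mono)
      fix y
      define A B where "A = real_of_int \<lfloor>y + t - a\<rfloor> - of_int \<lfloor>y - a\<rfloor>" and "B = real_of_int \<lfloor>y + t - b\<rfloor> - of_int \<lfloor>y - b\<rfloor>"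
      have eq: "v (y + t) + c * (of_int \<lfloor>y + t - a\<rfloor> - of_int \<lfloor>y + t - b\<rfloor>) - (v y + c * (of_int \<lfloor>y - a\<rfloor> - of_int \<lfloor>y - b\<rfloor>))
          = (v (y + t) - v y) + c * A + - (c * B)" by (simp add: A_def B_def algebra_simps)
      have "\<bar>v (y + t) + c * (of_int \<lfloor>y + t - a\<rfloor> - of_int \<lfloor>y + t - b\<rfloor>) - (v y + c * (of_int \<lfloor>y - a\<rfloor> - of_int \<lfloor>y - b\<rfloor>))\<bar>
          \<le> \<bar>v (y + t) - v y\<bar> + (\<bar>c\<bar> * \<bar>A\<bar> + \<bar>c\<bar> * \<bar>B\<bar>)"
        using abs_triangle_ineq[of "(v (y + t) - v y) + c * A" "- (c * B)"] abs_triangle_ineq[of "v (y + t) - v y" "c * A"]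
        unfolding eq abs_mult[symmetric] abs_minus_cancel by linarith
      then show "ennreal \<bar>v (y + t) + c * (of_int \<lfloor>y + t - a\<rfloor> - of_int \<lfloor>y + t - b\<rfloor>) - (v y + c * (of_int \<lfloor>y - a\<rfloor> - of_int \<lfloor>y - b\<rfloor>))\<bar>
          \<le> ennreal \<bar>v (y + t) - v y\<bar> + (ennreal \<bar>c\<bar> * d a t y + ennreal \<bar>c\<bar> * d b t y)"
        unfolding d_def A_def[symmetric] B_def[symmetric]
        by (simp add: ennreal_leI flip: ennreal_plus ennreal_mult)
    qed
    also have "\<dots> = (\<integral>\<^sup>+y. ennreal \<bar>v (y + t) - v y\<bar> \<partial>unit_lborel) + (ennreal \<bar>c\<bar> * (\<integral>\<^sup>+y. d a t y \<partial>unit_lborel) + ennreal \<bar>c\<bar> * (\<integral>\<^sup>+y. d b t y \<partial>unit_lborel))"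
      using dm vm by (simp add: nn_integral_add nn_integral_cmult)
    also have "\<dots> \<le> ennreal (C * \<bar>t\<bar>) + (ennreal \<bar>c\<bar> * ennreal \<bar>t\<bar> + ennreal \<bar>c\<bar> * ennreal \<bar>t\<bar>)"
      unfolding d_def by (intro add_mono mult_left_mono C floor_translation_L1) auto
    also have "\<dots> = ennreal ((C + 2 * \<bar>c\<bar>) * \<bar>t\<bar>)"
      using C(1) by (simp add: algebra_simps flip: ennreal_plus ennreal_mult)
    finally show ?thesis .
  qed
  then show ?case using C(1) by (intro exI[of _ "C + 2 * \<bar>c\<bar>"]) simp
qed

text \<open>For steps the dependence on t is Lipschitz; the approximation error e / 4 enters once
  before and once after the translation.\<close>

lemma translation_continuous_L1:
  assumes g: "g \<in> borel_measurable borel" "\<And>y. g (y + 1) = g y" "integrable unit_lborel g" and e: "0 < e"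
  obtains d where "0 < d" "\<And>t. \<bar>t\<bar> < d \<Longrightarrow> (\<integral>\<^sup>+y. ennreal \<bar>g (y + t) - g y\<bar> \<partial>unit_lborel) \<le> ennreal e"
proof -
  obtain v where v: "v \<in> steps" "(\<integral>y. \<bar>g y - v y\<bar> \<partial>unit_lborel) < e / 4"
    using integrable_step_approximable[OF g(3)] e unfolding step_approximable_def by (metis divide_pos_pos zero_less_numeral)
  obtain C where C: "C \<ge> 0" "\<And>t. (\<integral>\<^sup>+y. ennreal \<bar>v (y + t) - v y\<bar> \<partial>unit_lborel) \<le> ennreal (C * \<bar>t\<bar>)"
    using steps_translation[OF v(1)] by blast
  note [measurable] = g(1) steps_borel[OF v(1)]
  have gv: "(\<integral>\<^sup>+y. ennreal \<bar>g y - v y\<bar> \<partial>unit_lborel) \<le> ennreal (e / 4)"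
    using g(3) steps_integrable[OF v(1)] v(2) by (subst nn_integral_eq_integral) (auto simp: ennreal_leI)
  have gvt: "(\<integral>\<^sup>+y. ennreal \<bar>g (y + t) - v (y + t)\<bar> \<partial>unit_lborel) \<le> ennreal (e / 4)" for t
  proof -
    have "(\<integral>\<^sup>+y. ennreal \<bar>g (y + t) - v (y + t)\<bar> \<partial>unit_lborel) = (\<integral>\<^sup>+y. ennreal \<bar>g y - v y\<bar> \<partial>unit_lborel)"
      by (rule nn_integral_rotation[of "\<lambda>y. ennreal \<bar>g y - v y\<bar>"]) (measurable, simp add: g(2) steps_periodic[OF v(1)])
    then show ?thesis using gv by simp
  qed
  have "(\<integral>\<^sup>+y. ennreal \<bar>g (y + t) - g y\<bar> \<partial>unit_lborel) \<le> ennreal e" if t: "\<bar>t\<bar> < e / (4 * (C + 1))" for t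
  proof -
    have "(C + 1) * \<bar>t\<bar> < (C + 1) * (e / (4 * (C + 1)))" using C(1) by (intro mult_strict_left_mono t) auto
    moreover have "(C + 1) * (e / (4 * (C + 1))) = e / 4" using C(1) by (simp add: field_simps)
    moreover have "C * \<bar>t\<bar> \<le> (C + 1) * \<bar>t\<bar>" by (intro mult_right_mono) auto
    ultimately have Ct: "C * \<bar>t\<bar> \<le> e / 4" by linarith
    have "(\<integral>\<^sup>+y. ennreal \<bar>g (y + t) - g y\<bar> \<partial>unit_lborel)
        \<le> (\<integral>\<^sup>+y. ennreal \<bar>g (y + t) - v (y + t)\<bar> + (ennreal \<bar>v (y + t) - v y\<bar> + ennreal \<bar>g y - v y\<bar>) \<partial>unit_lborel)"
    proof (rule nn_integral_mono)
      fix y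
      have "\<bar>g (y + t) - g y\<bar> \<le> \<bar>g (y + t) - v (y + t)\<bar> + (\<bar>v (y + t) - v y\<bar> + \<bar>g y - v y\<bar>)" by linarith
      then show "ennreal \<bar>g (y + t) - g y\<bar> \<le> ennreal \<bar>g (y + t) - v (y + t)\<bar> + (ennreal \<bar>v (y + t) - v y\<bar> + ennreal \<bar>g y - v y\<bar>)"
        by (simp add: ennreal_leI flip: ennreal_plus)
    qed
    also have "\<dots> = (\<integral>\<^sup>+y. ennreal \<bar>g (y + t) - v (y + t)\<bar> \<partial>unit_lborel) + ((\<integral>\<^sup>+y. ennreal \<bar>v (y + t) - v y\<bar> \<partial>unit_lborel) + (\<integral>\<^sup>+y. ennreal \<bar>g y - v y\<bar> \<partial>unit_lborel))"
    proof -
      have m1: "(\<lambda>y. ennreal \<bar>g (y + t) - v (y + t)\<bar>) \<in> borel_measurable unit_lborel" by (rule borel_unit') measurable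
      have m2: "(\<lambda>y. ennreal \<bar>v (y + t) - v y\<bar>) \<in> borel_measurable unit_lborel" by (rule borel_unit') measurable
      have m3: "(\<lambda>y. ennreal \<bar>g y - v y\<bar>) \<in> borel_measurable unit_lborel" by (rule borel_unit') measurable
      show ?thesis
        using m2 m3 by (simp only: nn_integral_add[OF m1 borel_measurable_add[OF m2 m3]] nn_integral_add[OF m2 m3])
    qed
    also have "\<dots> \<le> ennreal (e / 4) + (ennreal (e / 4) + ennreal (e / 4))"
      by (intro add_mono gvt gv order_trans[OF C(2) ennreal_leI[OF Ct]])
    also have "\<dots> = ennreal (e / 4 + (e / 4 + e / 4))" using e by (simp flip: ennreal_plus)
    also have "\<dots> \<le> ennreal e" using e by (intro ennreal_leI) simp
    finally show ?thesis .
  qed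
  moreover have "0 < e / (4 * (C + 1))" using e C(1) by simp
  ultimately show ?thesis using that by blast
qed

section \<open>Singularity\<close>

text \<open>Negative s are the worse case, since 1 - exp (- \<delta>) \<le> \<delta> \<le> exp
  \<delta> - 1.\<close>

lemma abs_exp_minus_one_lower:
  fixes s \<delta> :: real
  assumes "0 < \<delta>" "\<delta> \<le> \<bar>s\<bar>"
  shows "1 - exp (- \<delta>) \<le> \<bar>exp s - 1\<bar>"
proof (cases "0 \<le> s")
  case True
  then have "exp \<delta> \<le> exp s" using assms by simp
  moreover have "1 + \<delta> \<le> exp \<delta>" "1 + - \<delta> \<le> exp (- \<delta>)" by (rule exp_ge_add_one_self)+
  ultimately show ?thesis by linarith
next
  case False
  then have "exp s \<le> exp (- \<delta>)" using assms by simp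
  then show ?thesis by linarith
qed

lemma AE_unit_lborel:
  assumes "AE y in lborel. P y" shows "AE y in unit_lborel. P y"
proof -
  have "AE y in lborel. y \<in> {0..<1} \<longrightarrow> P y" using assms by eventually_elim simp
  then show ?thesis unfolding unit_lborel_def by (subst AE_restrict_space_iff) auto
qed

text \<open>A density that is positive almost everywhere may still come close to 0; continuity of
  the measure from above gives it a lower bound \<tau> outside a set of measure e.\<close>

lemma sublevel_small:
  fixes g :: "real \<Rightarrow> real"
  assumes g: "g \<in> borel_measurable borel" "AE y in lborel. 0 < g y" and e: "0 < e"
  obtains \<tau> where "0 < \<tau>" "emeasure unit_lborel {y \<in> {0..<1}. g y < \<tau>} \<le> ennreal e"
proof -
  interpret finite_measure unit_lborel by (rule finite_measure_unit)
  define A where "A n = {y \<in> {0..<1}. g y < 1 / (real n + 1)}" for n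
  have gm: "g \<in> borel_measurable unit_lborel" using g(1) by (simp add: measurable_restrict_space1 cong: measurable_cong_sets)
  have Am: "A n \<in> sets unit_lborel" for n
  proof -
    have "{y \<in> space unit_lborel. g y < 1 / (real n + 1)} \<in> sets unit_lborel"
      using gm by (rule borel_measurable_less) simp
    then show ?thesis by (simp only: space_unit_lborel A_def)
  qed
  have "decseq A"
  proof (rule decseq_SucI)
    fix n
    have "1 / (real (Suc n) + 1) \<le> 1 / (real n + 1)" by (intro divide_left_mono) auto
    then show "A (Suc n) \<subseteq> A n" unfolding A_def by force
  qed
  then have lim: "(\<lambda>n. measure unit_lborel (A n)) \<longlonglongrightarrow> measure unit_lborel (\<Inter>n. A n)"
    using Am by (intro finite_Lim_measure_decseq) auto
  define B where "B = (\<Inter>n. A n)"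
  have "AE y in unit_lborel. y \<notin> B"
    using AE_unit_lborel[OF g(2)]
  proof eventually_elim
    fix y assume y: "0 < g y"
    obtain n :: nat where "1 / g y < n" using reals_Archimedean2 by blast
    then have "1 < g y * (real n + 1)" using y by (simp add: pos_divide_less_eq algebra_simps)
    then have "\<not> g y < 1 / (real n + 1)" by (simp add: field_simps)
    then show "y \<notin> B" unfolding A_def B_def by blast
  qed
  moreover have BM: "B \<in> sets unit_lborel" unfolding B_def using Am by (intro sets.countable_INT) auto
  moreover have "{y \<in> space unit_lborel. \<not> y \<notin> B} = B" using sets.sets_into_space[OF BM] by blast
  ultimately have "emeasure unit_lborel B = 0" by (simp only: AE_iff_measurable[OF BM])
  then have "measure unit_lborel (\<Inter>n. A n) = 0" by (simp add: measure_def B_def)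
  then have "\<forall>\<^sub>F n in sequentially. measure unit_lborel (A n) < e"
    using lim e by (intro order_tendstoD(2)) auto
  then obtain n where "measure unit_lborel (A n) < e" by (auto simp: eventually_sequentially)
  then have "emeasure unit_lborel (A n) \<le> ennreal e" by (simp add: emeasure_eq_measure ennreal_leI)
  then show ?thesis by (intro that[of "1 / (real n + 1)"]) (simp_all add: A_def)
qed

lemma variation_primitive:
  assumes R: "indefinite_integral R k" and per: "\<And>y. k (y + 1) = k y"
  obtains \<Theta> V where "mono \<Theta>" "\<And>y. \<Theta> (y + 1) = \<Theta> y + V" "\<And>x y. x \<le> y \<Longrightarrow> \<bar>R x - R y\<bar> \<le> \<Theta> y - \<Theta> x"
proof -
  have km: "k \<in> borel_measurable borel" using R by (simp add: indefinite_integral_def)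
  have ki: "set_integrable lborel {x..y} k" for x y
    using R by (cases "x \<le> y") (auto simp: indefinite_integral_def set_integrable_def)
  have ka: "set_integrable lborel {x..y} (\<lambda>t. \<bar>k t\<bar>)" for x y using ki[of x y] by (rule set_integrable_abs)
  have "(\<lambda>t. \<bar>k t\<bar>) \<in> borel_measurable borel" using km by measurable
  then obtain \<Theta> where \<Theta>: "indefinite_integral \<Theta> (\<lambda>t. \<bar>k t\<bar>)" using primitive_exists ka by metis
  have per': "\<Theta> (y + 1) = \<Theta> y + (\<Theta> 1 - \<Theta> 0)" for y
    using indefinite_integral_quasiperiodic[OF \<Theta>, of y] per by (simp add: algebra_simps)
  have inc: "\<bar>R x - R y\<bar> \<le> \<Theta> y - \<Theta> x" if "x \<le> y" for x y
  proof -
    have "\<bar>LINT t:{x..y}|lborel. k t\<bar> \<le> (LINT t:{x..y}|lborel. \<bar>k t\<bar>)"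
      using integral_abs_bound[of lborel "\<lambda>t. indicator {x..y} t *\<^sub>R k t"]
      by (simp add: set_lebesgue_integral_def abs_mult)
    then show ?thesis using R \<Theta> that by (simp add: indefinite_integral_def abs_minus_commute)
  qed
  have "mono \<Theta>"
  proof (rule monoI)
    fix x y :: real assume "x \<le> y" then show "\<Theta> x \<le> \<Theta> y" using inc[of x y] by linarith
  qed
  then show ?thesis using per' inc by (rule that)
qed

lemma indefinite_integral_borel:
  assumes R: "indefinite_integral R k" and per: "\<And>y. k (y + 1) = k y"
  shows "R \<in> borel_measurable borel"
proof -
  obtain \<Theta> V where \<Theta>: "mono \<Theta>" "\<And>x y. x \<le> y \<Longrightarrow> \<bar>R x - R y\<bar> \<le> \<Theta> y - \<Theta> x" using variation_primitive[OF assms] by metis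
  have "mono (\<lambda>x. \<Theta> x - R x)"
  proof (rule monoI)
    fix x y :: real assume "x \<le> y" then show "\<Theta> x - R x \<le> \<Theta> y - R y" using \<Theta>(2)[of x y] by linarith
  qed
  then have D: "(\<lambda>x. \<Theta> x - R x) \<in> borel_measurable borel" by (rule borel_measurable_mono)
  have "\<Theta> \<in> borel_measurable borel" using \<Theta>(1) by (rule borel_measurable_mono)
  from borel_measurable_diff[OF this D] show ?thesis by simp
qed

context circle_conjugacy
begin

text \<open>With t = q r - p the cocycle identity gives |g (y + t) - g y| = |exp (S_q F y) - 1| g y.
  Where |S_q F| \<ge> \<delta> and g \<ge> \<tau> this is at least \<eta> \<tau>, so Markov's
  inequality bounds the measure of that set by the distance of g from its translate.\<close>

lemma birkhoff_small_in_measure: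
  assumes g: "g \<in> borel_measurable borel" "\<And>y. 0 \<le> g y" "\<And>y. g (y + 1) = g y"
    "AE y in lborel. 0 < g y" "integrable unit_lborel g"
    "\<And>q p. AE y in lborel. g (y + (real q * r + of_int p)) = exp (birkhoff r F q y) * g y"
    and \<delta>: "0 < \<delta>" and e: "0 < e"
  obtains N where "\<And>q p. N \<le> q \<Longrightarrow> good_denom r q p \<Longrightarrow>
    emeasure unit_lborel {y \<in> {0..<1}. \<delta> \<le> \<bar>birkhoff r F q y\<bar>} \<le> ennreal e"
proof -
  obtain \<tau> where \<tau>: "0 < \<tau>" "emeasure unit_lborel {y \<in> {0..<1}. g y < \<tau>} \<le> ennreal (e / 2)"
    using sublevel_small[OF g(1,4) half_gt_zero[OF e]] by blast
  define \<eta> where "\<eta> = 1 - exp (- \<delta>)"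
  have \<eta>: "0 < \<eta>" using \<delta> by (simp add: \<eta>_def)
  have e': "0 < e / 2 * (\<eta> * \<tau>)" using e \<eta> \<tau>(1) by simp
  obtain d where d: "0 < d" "\<And>t. \<bar>t\<bar> < d \<Longrightarrow> (\<integral>\<^sup>+y. ennreal \<bar>g (y + t) - g y\<bar> \<partial>unit_lborel) \<le> ennreal (e / 2 * (\<eta> * \<tau>))"
    using translation_continuous_L1[OF g(1,3,5) e'] by blast
  obtain N :: nat where N: "1 / d < N" using reals_Archimedean2 by blast
  have "emeasure unit_lborel {y \<in> {0..<1}. \<delta> \<le> \<bar>birkhoff r F q y\<bar>} \<le> ennreal e"
    if q: "N \<le> q" "good_denom r q p" for q p
  proof -
    define t where "t = real q * r + of_int (- p)"
    have "q > 0" "\<bar>t\<bar> \<le> 1 / q" using q(2) by (auto simp: good_denom_def t_def)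
    moreover have "1 / real q < d"
    proof -
      have "1 / d < real q" using N q(1) by linarith
      then show ?thesis using d(1) \<open>q > 0\<close> by (simp add: field_simps)
    qed
    ultimately have I: "(\<integral>\<^sup>+y. ennreal \<bar>g (y + t) - g y\<bar> \<partial>unit_lborel) \<le> ennreal (e / 2 * (\<eta> * \<tau>))" by (intro d(2)) linarith
    note [measurable] = g(1) birkhoff_borel[OF F_borel]
    define X where "X = {y \<in> {0..<1}. \<delta> \<le> \<bar>birkhoff r F q y\<bar> \<and> \<tau> \<le> g y}"
    have cl: "{y \<in> {0..<1}. P y} \<in> sets unit_lborel" if "{y. P y} \<in> sets borel" for P :: "real \<Rightarrow> bool"
    proof -
      have "{y \<in> {0..<1}. P y} = {0..<1} \<inter> {y. P y}" by auto
      then show ?thesis using that by (simp only: sets_unit_lborel_iff) auto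
    qed
    have Xm: "X \<in> sets unit_lborel" unfolding X_def by (rule cl) measurable
    have Tm: "{y \<in> {0..<1}. g y < \<tau>} \<in> sets unit_lborel" by (rule cl) measurable
    have "ennreal (\<eta> * \<tau>) * emeasure unit_lborel X = (\<integral>\<^sup>+y. ennreal (\<eta> * \<tau>) * indicator X y \<partial>unit_lborel)"
      using Xm by (simp only: nn_integral_cmult_indicator)
    also have "\<dots> \<le> (\<integral>\<^sup>+y. ennreal \<bar>g (y + t) - g y\<bar> \<partial>unit_lborel)"
    proof (rule nn_integral_mono_AE)
      show "AE y in unit_lborel. ennreal (\<eta> * \<tau>) * indicator X y \<le> ennreal \<bar>g (y + t) - g y\<bar>"
        using AE_unit_lborel[OF g(6)[of q "- p"]]
      proof eventually_elim
        fix y assume "g (y + (real q * r + of_int (- p))) = exp (birkhoff r F q y) * g y"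
        then have eq: "g (y + t) - g y = (exp (birkhoff r F q y) - 1) * g y" by (simp add: t_def algebra_simps)
        show "ennreal (\<eta> * \<tau>) * indicator X y \<le> ennreal \<bar>g (y + t) - g y\<bar>"
        proof (cases "y \<in> X")
          case True
          then have "\<eta> \<le> \<bar>exp (birkhoff r F q y) - 1\<bar>" "\<tau> \<le> g y"
            using abs_exp_minus_one_lower[OF \<delta>, of "birkhoff r F q y"] by (auto simp: X_def \<eta>_def)
          then have "\<eta> * \<tau> \<le> \<bar>exp (birkhoff r F q y) - 1\<bar> * g y" using \<tau>(1) by (intro mult_mono) auto
          then show ?thesis using True g(2)[of y] unfolding eq by (simp add: abs_mult ennreal_leI)
        qed simp
      qed
    qed
    also note I
    finally have "ennreal (\<eta> * \<tau>) * emeasure unit_lborel X \<le> ennreal (\<eta> * \<tau>) * ennreal (e / 2)"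
      using \<eta> \<tau>(1) e by (simp add: ennreal_mult[symmetric] mult.commute)
    then have Xe: "emeasure unit_lborel X \<le> ennreal (e / 2)"
      using \<eta> \<tau>(1) by (subst (asm) ennreal_mult_le_mult_iff) (auto simp: ennreal_eq_0_iff not_le)
    have "emeasure unit_lborel {y \<in> {0..<1}. \<delta> \<le> \<bar>birkhoff r F q y\<bar>} \<le> emeasure unit_lborel (X \<union> {y \<in> {0..<1}. g y < \<tau>})"
      by (rule emeasure_mono) (use Xm Tm in \<open>auto simp: X_def simp del: sets_unit_lborel\<close>)
    also have "\<dots> \<le> emeasure unit_lborel X + emeasure unit_lborel {y \<in> {0..<1}. g y < \<tau>}"
      by (rule emeasure_subadditive[OF Xm Tm])
    also have "\<dots> \<le> ennreal (e / 2) + ennreal (e / 2)" by (intro add_mono Xe \<tau>(2))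
    also have "\<dots> = ennreal e" using e by (simp flip: ennreal_plus)
    finally show ?thesis .
  qed
  then show ?thesis by (rule that)
qed

text \<open>The density w turns integrals along \<phi> into integrals over y, so \<psi> acts as an
  absolutely continuous substitution with derivative w. This makes the oscillation result applicable
  to the conjugate of G.\<close>

lemma conjugated_primitive:
  assumes G: "indefinite_integral G k" and w: "w \<in> borel_measurable borel" "\<And>y. 0 \<le> w y"
    "density lborel (\<lambda>y. ennreal (w y)) = \<nu>"
  shows "indefinite_integral (\<lambda>y. G (\<psi> y)) (\<lambda>y. k (\<psi> y) * w y)"
proof -
  have km: "k \<in> borel_measurable borel" using G by (simp add: indefinite_integral_def)
  note [measurable] = borel_maps km w(1)
  have "set_integrable lborel {x..y} (\<lambda>t. k (\<psi> t) * w t) \<and> (LINT t:{x..y}|lborel. k (\<psi> t) * w t) = G (\<psi> y) - G (\<psi> x)"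
    if xy: "x \<le> y" for x y
  proof -
    have \<psi>xy: "\<psi> x \<le> \<psi> y" using xy by (simp add: \<psi>_le)
    define h where "h z = indicator {x..y} z * k (\<psi> z)" for z :: real
    have hm[measurable]: "h \<in> borel_measurable borel" unfolding h_def by measurable
    have h\<phi>: "h (\<phi> s) = indicator {\<psi> x..\<psi> y} s *\<^sub>R k s" for s
      using \<phi>_le[of "\<psi> x" s] \<phi>_le[of s "\<psi> y"] by (simp add: h_def \<psi>\<phi> \<phi>\<psi> indicator_def)
    have "integrable lborel (\<lambda>s. h (\<phi> s))" "(\<integral>s. h (\<phi> s) \<partial>lborel) = G (\<psi> y) - G (\<psi> x)"
      using G \<psi>xy unfolding h\<phi> by (auto simp: indefinite_integral_def set_integrable_def set_lebesgue_integral_def)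
    then have "integrable \<nu> h" "(\<integral>z. h z \<partial>\<nu>) = G (\<psi> y) - G (\<psi> x)"
      unfolding \<nu>_def by (simp_all add: integrable_distr_eq integral_distr)
    then have "integrable lborel (\<lambda>z. w z *\<^sub>R h z)" "(\<integral>z. w z *\<^sub>R h z \<partial>lborel) = G (\<psi> y) - G (\<psi> x)"
      unfolding w(3)[symmetric] using w(2) by (simp_all add: integrable_density integral_density)
    then show ?thesis
      by (simp add: set_integrable_def set_lebesgue_integral_def h_def mult_ac)
  qed
  moreover have "(\<lambda>y. k (\<psi> y) * w y) \<in> borel_measurable borel" by measurable
  ultimately show ?thesis by (simp add: indefinite_integral_def)
qed

lemma two_break_singular:
  assumes \<phi>0: "\<phi> 0 = 0" and L: "\<And>x. L x = G x - \<kappa> * (of_int \<lfloor>x - a\<rfloor> - of_int \<lfloor>x - c\<rfloor>)"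
    and G: "indefinite_integral G k" and per: "\<And>x. k (x + 1) = k x" "\<And>x. G (x + 1) = G x" and \<kappa>: "\<kappa> \<noteq> 0"
    and c0: "0 < c0" "c0 < 1" "\<And>m p :: int. m \<noteq> 0 \<Longrightarrow> c0 \<le> \<bar>real_of_int m * r - p\<bar> * \<bar>real_of_int m\<bar>"
    and no: "\<And>k m :: int. \<phi> a - \<phi> c \<noteq> of_int k * r + of_int m"
  shows "singular_measure \<mu>0"
proof (rule ccontr)
  assume ns: "\<not> singular_measure \<mu>0"
  obtain w where w: "w \<in> borel_measurable borel" "\<And>y. 0 \<le> w y" "\<And>y. w (y + 1) = w y"
    "density lborel (\<lambda>y. ennreal (w y)) = \<nu>" "AE y in lborel. 0 < w y" "integrable unit_lborel w"
    "\<And>q p. AE y in lborel. w (y + (real q * r + of_int p)) = exp (birkhoff r F q y) * w y"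
    by (rule density_exists[OF nonsingular_equivalent[OF \<phi>0 ns]]) (assumption, rule that, assumption, (assumption | simp only:)+)
  have \<psi>1: "\<psi> (y + 1) = \<psi> y + 1" for y using \<psi> by (simp add: circle_lift_def)
  define H where "H y = G (\<psi> y)" for y
  have osc: "osc_vanishes r H" unfolding H_def
    by (rule osc_vanishes_primitive[OF unb conjugated_primitive[OF G w(1,2,4)]]) (simp_all add: \<psi>1 per w(3))
  define \<zeta> where "\<zeta> = (\<lambda>y. real_of_int \<lfloor>y - \<phi> a\<rfloor> - of_int \<lfloor>y - \<phi> c\<rfloor>)"
  \<comment> \<open>\<phi> preserves order and integer translations, so the floors, and with them
    the jumps, carry over to the rotation coordinate.\<close>
  have fl: "\<lfloor>\<psi> y - b\<rfloor> = \<lfloor>y - \<phi> b\<rfloor>" for y b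
  proof -
    define n where "n = \<lfloor>y - \<phi> b\<rfloor>"
    have n: "\<phi> b + of_int n \<le> y" "y < \<phi> b + of_int (n + 1)" unfolding n_def of_int_add by linarith+
    have "\<phi> (b + of_int n) \<le> \<phi> (\<psi> y)" "\<phi> (\<psi> y) < \<phi> (b + of_int (n + 1))"
      using n by (simp_all only: circle_lift_add_int[OF \<phi>] \<phi>\<psi>)
    then have "b + of_int n \<le> \<psi> y" "\<psi> y < b + of_int (n + 1)" by (simp_all only: \<phi>_le \<phi>_less)
    then have "\<lfloor>\<psi> y - b\<rfloor> = n" by (simp add: floor_eq_iff)
    then show ?thesis by (simp add: n_def)
  qed
  have F: "F y = H y - \<kappa> * \<zeta> y" for y by (simp add: F_def L H_def \<zeta>_def fl)
  have bF: "birkhoff r F q y = birkhoff r H q y - \<kappa> * birkhoff r \<zeta> q y" for q y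
    by (simp add: birkhoff_def F sum_subtractf sum_distrib_left)
  have Fper: "F (y + 1) = F y" for y by (simp add: F_def \<psi>1 L_per)
  have bFper: "birkhoff r F q (y + 1) = birkhoff r F q y" for q y
  proof -
    have "F (y + 1 + s) = F (y + s)" for s using Fper[of "y + s"] by (simp add: add_ac)
    then show ?thesis by (simp add: birkhoff_def)
  qed
  have bint: "\<exists>n::int. birkhoff r \<zeta> q y - birkhoff r \<zeta> q y' = of_int n" for q y y'
  proof -
    define M where "M z = (\<Sum>j<q. \<lfloor>z + real j * r - \<phi> a\<rfloor> - \<lfloor>z + real j * r - \<phi> c\<rfloor>)" for z
    have "birkhoff r \<zeta> q z = of_int (M z)" for z
      unfolding M_def of_int_sum of_int_diff birkhoff_def \<zeta>_def ..
    then have "birkhoff r \<zeta> q y - birkhoff r \<zeta> q y' = of_int (M y - M y')" by (simp only: of_int_diff)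
    then show ?thesis by (rule exI)
  qed
  \<comment> \<open>Both coincidence lemmas ask for \<eta> < c0 / 4.\<close>
  define \<eta> where "\<eta> = c0 / 8"
  have \<eta>: "0 < \<eta>" "\<eta> < c0 / 4" "\<eta> < 1" using c0 by (auto simp: \<eta>_def)
  have \<kappa>8: "0 < \<bar>\<kappa>\<bar> / 8" using \<kappa> by simp
  have \<eta>2: "0 < \<eta>\<^sup>2 / 2" using \<eta> by simp
  obtain N1 where N1: "\<And>q p. N1 \<le> q \<Longrightarrow> good_denom r q p \<Longrightarrow>
      emeasure unit_lborel {y \<in> {0..<1}. \<bar>\<kappa>\<bar> / 8 \<le> \<bar>birkhoff r F q y\<bar>} \<le> ennreal (\<eta>\<^sup>2 / 2)"
    using birkhoff_small_in_measure[OF w(1,2,3,5,6,7) \<kappa>8 \<eta>2] by blast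
  obtain N2 where N2: "\<And>q p y y'. N2 \<le> q \<Longrightarrow> good_denom r q p \<Longrightarrow> \<bar>birkhoff r H q y - birkhoff r H q y'\<bar> \<le> \<bar>\<kappa>\<bar> / 8"
    using osc \<kappa>8 unfolding osc_vanishes_def by meson
  have sc: "\<exists>k m :: int. \<bar>real_of_int k\<bar> \<le> \<eta> * q \<and> \<bar>\<phi> a - \<phi> c - of_int k * r - of_int m\<bar> < \<eta> / q"
    if q: "max N1 N2 \<le> q" "good_denom r q p" for q p
  proof (rule coincidence_single_scale[OF q(2) c0(3) \<eta> \<zeta>_def])
    define U where "U = {y. \<bar>\<kappa>\<bar> / 8 \<le> \<bar>birkhoff r F q y\<bar>}"
    note [measurable] = birkhoff_borel[OF F_borel]
    show "U \<in> sets borel" unfolding U_def by measurable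
    show "y + 1 \<in> U \<longleftrightarrow> y \<in> U" for y by (simp add: U_def bFper)
    have "U \<inter> {0..<1} = {y \<in> {0..<1}. \<bar>\<kappa>\<bar> / 8 \<le> \<bar>birkhoff r F q y\<bar>}" by (auto simp: U_def)
    then show "emeasure unit_lborel (U \<inter> {0..<1}) \<le> ennreal (\<eta>\<^sup>2 / 2)" using N1[OF _ q(2)] q(1) by simp
    fix y y' assume y: "y \<notin> U" "y' \<notin> U"
    obtain n where n: "birkhoff r \<zeta> q y - birkhoff r \<zeta> q y' = of_int n" using bint by blast
    \<comment> \<open>One eighth of |\<kappa>| comes from H and one from each of the two values of
      F, so |\<kappa> n| < |\<kappa>| and the integer n vanishes.\<close>
    have "\<kappa> * of_int n = (birkhoff r H q y - birkhoff r H q y') - (birkhoff r F q y - birkhoff r F q y')"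
      unfolding n[symmetric] bF by (simp add: algebra_simps)
    moreover have "\<bar>birkhoff r H q y - birkhoff r H q y'\<bar> \<le> \<bar>\<kappa>\<bar> / 8" using q by (intro N2) auto
    moreover have "\<bar>birkhoff r F q y\<bar> < \<bar>\<kappa>\<bar> / 8" "\<bar>birkhoff r F q y'\<bar> < \<bar>\<kappa>\<bar> / 8" using y by (auto simp: U_def)
    ultimately have "\<bar>\<kappa> * of_int n\<bar> < \<bar>\<kappa>\<bar>" by linarith
    then have "\<bar>real_of_int n\<bar> < 1" using \<kappa> by (simp add: abs_mult)
    then have "n = 0" by linarith
    then show "birkhoff r \<zeta> q y = birkhoff r \<zeta> q y'" using n by simp
  qed
  have "\<exists>k m :: int. \<phi> a - \<phi> c = of_int k * r + of_int m"
    by (rule coincidence_all_scales[OF c0(1,3) \<eta>(1,2)]) (assumption, rule sc)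
  then show False using no by blast
qed

end

lemma circle_map_funpow:
  assumes f: "circle_lift f" and x: "x \<in> {0..<1}"
  shows "(circle_map f ^^ n) x = frac ((f ^^ n) x)"
proof (induction n)
  case 0
  then show ?case using x by (simp add: frac_eq)
next
  case (Suc n)
  define z where "z = (f ^^ n) x"
  have "f z = f (frac z) + of_int \<lfloor>z\<rfloor>" using circle_lift_add_int[OF f, of "frac z" "\<lfloor>z\<rfloor>"] by (simp add: frac_def)
  then have "frac (f (frac z)) = frac (f z)" by (simp add: frac_def)
  then show ?case using Suc by (simp add: circle_map_def z_def)
qed

lemma orbit_relation:
  assumes f: "circle_lift f" and x: "x \<in> {0..<1}" and y: "y \<in> {0..<1}" and e: "y = (f ^^ n) x + of_int m"
  shows "circle_orbit f x \<inter> circle_orbit f y \<noteq> {}"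
proof -
  have "(f ^^ n) x = y - of_int m" using e by simp
  then have "frac ((f ^^ n) x) = frac y" by (simp add: frac_def)
  also have "\<dots> = y" using y by (simp add: frac_eq)
  finally have "(circle_map f ^^ n) x = y" using circle_map_funpow[OF f x] by simp
  then have "y \<in> circle_orbit f x" unfolding circle_orbit_def by blast
  moreover have "(circle_map f ^^ 0) y \<in> circle_orbit f y" unfolding circle_orbit_def by blast
  ultimately show ?thesis by auto
qed

lemma two_breaks_ordered:
  assumes P: "class_P f" and bt: "bounded_type (rotation_number f)"
    and bp: "break_points f = {a, c}" and ac: "a < c"
    and orb: "circle_orbit f a \<inter> circle_orbit f c = {}" and jump: "jump_ratio f a * jump_ratio f c = 1"
    and AC: "\<And>I. connected I \<Longrightarrow> frac ` I \<inter> {a, c} = {} \<Longrightarrow> abs_continuous_on I (deriv f)"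
  shows "\<exists>\<mu>. invariant_prob f \<mu> \<and> singular_measure \<mu> \<and> (\<forall>\<mu>'. invariant_prob f \<mu>' \<longrightarrow> \<mu>' = \<mu>)"
proof -
  have f: "circle_lift f" using P by (simp add: class_P_def)
  have ac01: "a \<in> {0..<1}" "c \<in> {0..<1}" using bp by (auto simp: break_points_def)
  obtain r where r: "\<And>n x. \<bar>(f ^^ n) x - x - real n * r\<bar> \<le> 2" "rotation_number f = frac r"
    using circle_lift_translation_number[OF f] by metis
  have rQ: "r \<notin> \<rat>"
  proof
    assume "r \<in> \<rat>"
    then have "frac r \<in> \<rat>" by (simp add: frac_def)
    then show False using bt r(2) by (simp add: bounded_type_def)
  qed
  obtain c0 where c0: "0 < c0" "c0 < 1" "\<And>m p :: int. m \<noteq> 0 \<Longrightarrow> c0 \<le> \<bar>real_of_int m * r - p\<bar> * \<bar>real_of_int m\<bar>"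
    using bounded_type_lower_bound[of r] bt r(2) by metis
  have unb: "\<exists>q p. good_denom r q p \<and> n \<le> q" for n by (rule good_denom_unbounded[OF c0(1,3)])
  obtain \<phi>1 where \<phi>1: "rotation_semiconj f r \<phi>1" by (rule rotation_semiconj_exists[OF f r(1)])
  \<comment> \<open>Normalized at 0, so that the inverse will preserve the unit interval and \<phi>
    is itself the distribution function of the invariant measure.\<close>
  define \<phi> where "\<phi> x = \<phi>1 x - \<phi>1 0" for x
  have semi: "rotation_semiconj f r \<phi>" using \<phi>1 by (simp add: rotation_semiconj_def \<phi>_def mono_def)
  have \<phi>0: "\<phi> 0 = 0" by (simp add: \<phi>_def)
  obtain G k \<kappa> where G: "indefinite_integral G k" "\<And>x. k (x + 1) = k x" "\<And>x. G (x + 1) = G x" "\<kappa> \<noteq> 0"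
    and I: "\<And>x y. x \<le> y \<Longrightarrow> ((\<lambda>t. exp (G t - \<kappa> * (of_int \<lfloor>t - a\<rfloor> - of_int \<lfloor>t - c\<rfloor>))) has_integral (f y - f x)) {x..y}"
    by (rule two_break_structure[OF P bp ac jump AC]) (assumption, assumption, rule that, assumption, (assumption | simp only:)+)
  define L where "L x = G x - \<kappa> * (of_int \<lfloor>x - a\<rfloor> - of_int \<lfloor>x - c\<rfloor>)" for x
  have Gm[measurable]: "G \<in> borel_measurable borel" by (rule indefinite_integral_borel[OF G(1,2)])
  have Lm: "L \<in> borel_measurable borel" unfolding L_def by measurable
  have cov: "change_of_variables f L"
    using I by (intro change_of_variables_circle_lift[OF f Lm]) (simp add: L_def)
  obtain \<Theta> V where \<Theta>: "mono \<Theta>" "\<And>y. \<Theta> (y + 1) = \<Theta> y + V" "\<And>x y. x \<le> y \<Longrightarrow> \<bar>G x - G y\<bar> \<le> \<Theta> y - \<Theta> x"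
    using variation_primitive[OF G(1,2)] by metis
  \<comment> \<open>\<Theta> controls G, and the sum of the floors counts both jumps with weight
    |\<kappa>|, which adds 2 |\<kappa>| per period.\<close>
  define W where "W x = \<Theta> x + \<bar>\<kappa>\<bar> * (of_int \<lfloor>x - a\<rfloor> + of_int \<lfloor>x - c\<rfloor>)" for x
  have fl1: "\<lfloor>x + 1 - s\<rfloor> = \<lfloor>x - s\<rfloor> + 1" for x s :: real by (simp add: diff_add_eq[symmetric])
  have Wb: "\<bar>L u - L v\<bar> \<le> W v - W u" if uv: "u \<le> v" for u v
  proof -
    define x where "x = real_of_int \<lfloor>v - a\<rfloor> - of_int \<lfloor>u - a\<rfloor>"
    define y where "y = real_of_int \<lfloor>v - c\<rfloor> - of_int \<lfloor>u - c\<rfloor>"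
    have xy: "0 \<le> x" "0 \<le> y" unfolding x_def y_def using uv by (auto simp: floor_mono)
    have "L u - L v = (G u - G v) + \<kappa> * (x - y)" by (simp add: L_def x_def y_def algebra_simps)
    then have "\<bar>L u - L v\<bar> \<le> \<bar>G u - G v\<bar> + \<bar>\<kappa>\<bar> * \<bar>x - y\<bar>"
      using abs_triangle_ineq[of "G u - G v" "\<kappa> * (x - y)"] by (simp add: abs_mult)
    also have "\<dots> \<le> (\<Theta> v - \<Theta> u) + \<bar>\<kappa>\<bar> * (x + y)" using \<Theta>(3)[OF uv] xy by (intro add_mono mult_left_mono) auto
    also have "\<dots> = W v - W u" by (simp add: W_def x_def y_def algebra_simps)
    finally show ?thesis .
  qed
  have var: "variation_bound L W (V + 2 * \<bar>\<kappa>\<bar>)"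
    unfolding variation_bound_def
  proof (intro conjI allI impI)
    show "mono W"
    proof (rule monoI)
      fix u v :: real assume "u \<le> v" then show "W u \<le> W v" using Wb[of u v] by linarith
    qed
    show "W (y + 1) = W y + (V + 2 * \<bar>\<kappa>\<bar>)" for y
      unfolding W_def \<Theta>(2) fl1 of_int_add of_int_1 by (simp add: algebra_simps)
    show "L (y + 1) = L y" for y by (simp add: L_def G(3) fl1)
  qed (rule Wb)
  have sm: "strict_mono \<phi>" by (rule denjoy_injective[OF f semi rQ cov var unb])
  have \<phi>l: "circle_lift \<phi>"
    using sm semiconjugacy_continuous[OF rQ semi] semi by (simp add: circle_lift_def rotation_semiconj_def)
  have bij: "bij \<phi>" by (rule circle_lift_bij[OF \<phi>l])
  interpret circle_conjugacy f \<phi> "inv \<phi>" L W "V + 2 * \<bar>\<kappa>\<bar>" r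
  proof
    show "\<phi> (inv \<phi> y) = y" for y using bij by (simp add: bij_is_surj surj_f_inv_f)
    show "inv \<phi> (\<phi> x) = x" for x using bij by (simp add: bij_is_inj)
  qed (use f semi \<phi>l circle_lift_inv[OF \<phi>l] cov var unb in auto)
  have orb\<phi>: "b = (f ^^ n) b' + of_int m" if "\<phi> b = \<phi> b' + real n * r + of_int m" for b b' n m
  proof -
    have "\<phi> ((f ^^ n) b' + of_int m) = \<phi> b" using that by (simp add: circle_lift_add_int[OF \<phi>l] \<phi>_orbit)
    then show ?thesis using bij by (metis bij_is_inj injD)
  qed
  have "\<phi> a - \<phi> c \<noteq> of_int k * r + of_int m" for k m :: int
  proof
    assume e: "\<phi> a - \<phi> c = of_int k * r + of_int m"
    \<comment> \<open>The sign of k decides which of the two breaks is a forward image of the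
      other.\<close>
    show False
    proof (cases "k \<ge> 0")
      case True
      then have "a = (f ^^ nat k) c + of_int m" using e by (intro orb\<phi>) simp
      then show False using orbit_relation[OF f ac01(2,1)] orb by blast
    next
      case False
      then have "c = (f ^^ nat (- k)) a + of_int (- m)" using e by (intro orb\<phi>) (simp add: algebra_simps)
      then show False using orbit_relation[OF f ac01] orb by blast
    qed
  qed
  then have "singular_measure \<mu>0"
    by (intro two_break_singular[OF \<phi>0 L_def G(1,2,3,4) c0]) 
  moreover have "invariant_prob f \<mu>0" by (rule invariant_prob_exists[OF \<phi>0])
  moreover have "\<mu>' = \<mu>0" if "invariant_prob f \<mu>'" for \<mu>'
    by (rule invariant_prob_unique[OF f r(1) rQ semi \<phi>0 that invariant_prob_exists[OF \<phi>0]])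
  ultimately show ?thesis by blast
qed

theorem theorem1p10:
  fixes f :: "real \<Rightarrow> real" and a\<^sub>b c\<^sub>b :: real
  assumes "class_P f"
    and "rotation_number f \<notin> \<rat>"
    and "bounded_type (rotation_number f)"
    and "break_points f = {a\<^sub>b, c\<^sub>b}" and "a\<^sub>b \<noteq> c\<^sub>b"
    and "circle_orbit f a\<^sub>b \<inter> circle_orbit f c\<^sub>b = {}"
    and "jump_ratio f a\<^sub>b * jump_ratio f c\<^sub>b = 1"
    and "\<And>I. connected I \<Longrightarrow> frac ` I \<inter> {a\<^sub>b, c\<^sub>b} = {} \<Longrightarrow> abs_continuous_on I (deriv f)"
    and "deriv (deriv f) absolutely_integrable_on {0..1}"
  shows "(\<exists>!\<mu>. invariant_prob f \<mu>) \<and> (\<forall>\<mu>. invariant_prob f \<mu> \<longrightarrow> singular_measure \<mu>)"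
proof -
  \<comment> \<open>The hypotheses are symmetric in the two breaks; the ordered version cuts the
    circle into the arc from the smaller break to the larger and the arc onwards to the translate of
    the smaller.\<close>
  have "\<exists>\<mu>. invariant_prob f \<mu> \<and> singular_measure \<mu> \<and> (\<forall>\<mu>'. invariant_prob f \<mu>' \<longrightarrow> \<mu>' = \<mu>)"
  proof (cases "a\<^sub>b < c\<^sub>b")
    case True
    show ?thesis by (rule two_breaks_ordered[OF assms(1,3,4) True assms(6,7,8)])
  next
    case False
    then have lt: "c\<^sub>b < a\<^sub>b" using assms(5) by simp
    have bp: "break_points f = {c\<^sub>b, a\<^sub>b}" using assms(4) by blast
    have orb: "circle_orbit f c\<^sub>b \<inter> circle_orbit f a\<^sub>b = {}" using assms(6) by blast
    have jump: "jump_ratio f c\<^sub>b * jump_ratio f a\<^sub>b = 1" using assms(7) by (simp only: mult.commute)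
    have AC: "abs_continuous_on I (deriv f)" if "connected I" "frac ` I \<inter> {c\<^sub>b, a\<^sub>b} = {}" for I
      using that by (intro assms(8)) blast+
    show ?thesis by (rule two_breaks_ordered[OF assms(1,3) bp lt orb jump AC])
  qed
  then show ?thesis by metis
qed

end
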